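(* Let $R$ be a (non-random) unitary operator on the Cameron–Martin space $H$, let $(\Pi_\theta,\theta\in[0,2\pi])$ be its resolution of the identity, and let $T$ be the $\mu$-preserving transformation of the Wiener space given by $Tw=\sum_{i=1}^\infty\delta(Re_i)(w)\,e_i$, where $(e_i)_{i\ge 1}$ is a complete orthonormal basis of $H$. Then $T$ is ergodic if and only if the function $\theta\mapsto(\Pi_\theta h,k)_H$ is continuous on $[0,2\pi]$ for all $h,k\in H$. Moreover, if $T$ is ergodic, then it is also weak mixing.
   Context: $(C_0([0,1]),H,\mu)$ is the classical Wiener space: $\mu$ is the Wiener measure and $H$ is the Cameron–Martin space of absolutely continuous functions $h$ on $[0,1]$ with $h(0)=0$ and $h'\in L^2([0,1])$, with $(h,k)_H=\int_0^1h'(s)k'(s)\,ds$. For $h\in H$, $\delta h=\int_0^1h'(s)\,dw_s$ (Wiener integral). The series defining $Tw$ converges almost surely uniformly on $[0,1]$, its sum does not depend ($\mu$-a.s.) on the choice of the orthonormal basis, and $T$ preserves $\mu$. The resolution of the identity of $R$ (acting on the complexification of $H$, with scalar product extended sesquilinearly) is the family of orthogonal projections, nondecreasing and right-continuous in $\theta$, with $\Pi_0=0$, $\Pi_{2\pi}=I$, such that $R=\int_0^{2\pi}e^{i\theta}\,d_\theta\Pi_\theta$ (so the eigenvalue $1$ of $R$, if present, corresponds to a jump at $\theta=2\pi$). $T$ is ergodic if every measurable $F$ with $F\circ T=F$ $\mu$-a.s. is $\mu$-a.s. constant. $T$ is weak mixing if the induced operator $f\mapsto f\circ T$ on (complex)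 $L^2(\mu)$ has no eigenfunctions other than constants. *)

theory Defs
  imports "HOL-Probability.Probability"
begin

text \<open>
  Functions on $[0,1]$ are total functions on the reals that vanish outside $[0,1]$; in this way
  both the path space and the Cameron--Martin space are linear spaces under the pointwise
  operations, and equality of functions on $[0,1]$ is equality in HOL.
\<close>

section \<open>The classical Wiener space\<close>

definition C0_paths :: "(real \<Rightarrow> real) set" where
  "C0_paths = {w. continuous_on {0..1} w \<and> w 0 = 0 \<and> (\<forall>t. t \<notin> {0..1} \<longrightarrow> w t = 0)}"

text \<open>
  The sigma-algebra generated by the coordinate maps, which on this space is the Borel
  sigma-algebra of the uniform norm.
\<close>

definition path_space :: "(real \<Rightarrow> real) measure" where
  "path_space = restrict_space (\<Pi>\<^sub>M t\<in>UNIV. borel) C0_paths"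

text \<open>
  Second parameter of \<^const>\<open>normal_density\<close>: the standard deviation, not the variance.
\<close>

definition wiener_measure :: "(real \<Rightarrow> real) measure \<Rightarrow> bool" where
  "wiener_measure \<mu> \<longleftrightarrow>
     prob_space \<mu> \<and> sets \<mu> = sets path_space \<and>
     (\<forall>s t. 0 \<le> s \<and> s < t \<and> t \<le> 1 \<longrightarrow>
        distributed \<mu> lborel (\<lambda>w. w t - w s) (normal_density 0 (sqrt (t - s)))) \<and>
     (\<forall>(n::nat) (\<tau>::nat \<Rightarrow> real).
        (\<forall>i\<le>n. \<tau> i \<in> {0..1}) \<and> (\<forall>i<n. \<tau> i < \<tau> (Suc i)) \<longrightarrow>
        prob_space.indep_vars \<mu> (\<lambda>_. borel) (\<lambda>i w. w (\<tau> (Suc i)) - w (\<tau> i)) {..<n})"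


section \<open>The Cameron--Martin space and its complexification\<close>

definition absolutely_continuous_on :: "real set \<Rightarrow> (real \<Rightarrow> real) \<Rightarrow> bool" where
  "absolutely_continuous_on S h \<longleftrightarrow>
     (\<forall>\<epsilon>>0. \<exists>\<delta>>0. \<forall>(n::nat) a b.
        (\<forall>i<n. a i \<le> b i \<and> {a i..b i} \<subseteq> S) \<and>
        (\<forall>i<n. \<forall>j<n. i \<noteq> j \<longrightarrow> {a i<..<b i} \<inter> {a j<..<b j} = {}) \<and>
        (\<Sum>i<n. b i - a i) < \<delta> \<longrightarrow>
        (\<Sum>i<n. \<bar>h (b i) - h (a i)\<bar>) < \<epsilon>)"

text \<open>
  An absolutely continuous function is differentiable almost everywhere, and the arbitrary value
  of \<^const>\<open>deriv\<close> at the other points is irrelevant for the (complete) Lebesgue measure.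
\<close>

definition CM :: "(real \<Rightarrow> real) set" where
  "CM = {h. absolutely_continuous_on {0..1} h \<and> h 0 = 0 \<and> (\<forall>t. t \<notin> {0..1} \<longrightarrow> h t = 0) \<and>
            integrable (lebesgue_on {0..1}) (\<lambda>s. (deriv h s)\<^sup>2)}"

definition cm_inner :: "(real \<Rightarrow> real) \<Rightarrow> (real \<Rightarrow> real) \<Rightarrow> real" where
  "cm_inner h k = (LINT s|lebesgue_on {0..1}. deriv h s * deriv k s)"

definition cm_norm :: "(real \<Rightarrow> real) \<Rightarrow> real" where
  "cm_norm h = sqrt (cm_inner h h)"

definition orthonormal_basis_CM :: "(nat \<Rightarrow> real \<Rightarrow> real) \<Rightarrow> bool" where
  "orthonormal_basis_CM e \<longleftrightarrow>
     (\<forall>i. e i \<in> CM) \<and> (\<forall>i j. cm_inner (e i) (e j) = (if i = j then 1 else 0)) \<and>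
     (\<forall>h\<in>CM. (\<lambda>n. cm_norm (\<lambda>t. h t - (\<Sum>i<n. cm_inner h (e i) * e i t))) \<longlonglongrightarrow> 0)"

definition unitary_CM :: "((real \<Rightarrow> real) \<Rightarrow> (real \<Rightarrow> real)) \<Rightarrow> bool" where
  "unitary_CM R \<longleftrightarrow>
     R ` CM = CM \<and>
     (\<forall>h\<in>CM. \<forall>k\<in>CM. \<forall>a b. R (\<lambda>t. a * h t + b * k t) = (\<lambda>t. a * R h t + b * R k t)) \<and>
     (\<forall>h\<in>CM. \<forall>k\<in>CM. cm_inner (R h) (R k) = cm_inner h k)"

definition CM_complex :: "(real \<Rightarrow> complex) set" where
  "CM_complex = {f. (\<lambda>t. Re (f t)) \<in> CM \<and> (\<lambda>t. Im (f t)) \<in> CM}"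

text \<open>The sesquilinear extension of \<^const>\<open>cm_inner\<close>, antilinear in the second argument.\<close>

definition cm_cinner :: "(real \<Rightarrow> complex) \<Rightarrow> (real \<Rightarrow> complex) \<Rightarrow> complex" where
  "cm_cinner f g = Complex
     (cm_inner (\<lambda>t. Re (f t)) (\<lambda>t. Re (g t)) + cm_inner (\<lambda>t. Im (f t)) (\<lambda>t. Im (g t)))
     (cm_inner (\<lambda>t. Im (f t)) (\<lambda>t. Re (g t)) - cm_inner (\<lambda>t. Re (f t)) (\<lambda>t. Im (g t)))"

definition cm_cnorm :: "(real \<Rightarrow> complex) \<Rightarrow> real" where
  "cm_cnorm f = sqrt (Re (cm_cinner f f))"

definition complexify_op :: "((real \<Rightarrow> real) \<Rightarrow> (real \<Rightarrow> real)) \<Rightarrow> (real \<Rightarrow> complex) \<Rightarrow> (real \<Rightarrow> complex)" where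
  "complexify_op R f = (\<lambda>t. Complex (R (\<lambda>s. Re (f s)) t) (R (\<lambda>s. Im (f s)) t))"


section \<open>Resolution of the identity\<close>

definition orthogonal_projection_CM :: "((real \<Rightarrow> complex) \<Rightarrow> (real \<Rightarrow> complex)) \<Rightarrow> bool" where
  "orthogonal_projection_CM P \<longleftrightarrow>
     (\<forall>f\<in>CM_complex. P f \<in> CM_complex) \<and>
     (\<forall>f\<in>CM_complex. \<forall>g\<in>CM_complex. \<forall>a b.
        P (\<lambda>t. a * f t + b * g t) = (\<lambda>t. a * P f t + b * P g t)) \<and>
     (\<forall>f\<in>CM_complex. P (P f) = P f) \<and>
     (\<forall>f\<in>CM_complex. \<forall>g\<in>CM_complex. cm_cinner (P f) g = cm_cinner f (P g))"

text \<open>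
  \<open>U = \<integral>\<^sub>0\<^sup>2\<^sup>\<pi> e\<^sup>i\<^sup>\<theta> dE\<^sub>\<theta>\<close> as the limit in operator norm of Riemann--Stieltjes sums, as the
  mesh of the tagged partition tends to 0.
\<close>

definition is_spectral_integral ::
    "((real \<Rightarrow> complex) \<Rightarrow> (real \<Rightarrow> complex)) \<Rightarrow> (real \<Rightarrow> (real \<Rightarrow> complex) \<Rightarrow> (real \<Rightarrow> complex)) \<Rightarrow> bool" where
  "is_spectral_integral U E \<longleftrightarrow>
     (\<forall>\<epsilon>>0. \<exists>\<delta>>0. \<forall>(n::nat) (\<tau>::nat \<Rightarrow> real) (\<xi>::nat \<Rightarrow> real).
        \<tau> 0 = 0 \<and> \<tau> n = 2 * pi \<and>
        (\<forall>j<n. \<tau> j \<le> \<xi> j \<and> \<xi> j \<le> \<tau> (Suc j) \<and> \<tau> (Suc j) - \<tau> j < \<delta>) \<longrightarrow>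
        (\<forall>f\<in>CM_complex.
           cm_cnorm (\<lambda>t. U f t - (\<Sum>j<n. cis (\<xi> j) * (E (\<tau> (Suc j)) f t - E (\<tau> j) f t)))
             \<le> \<epsilon> * cm_cnorm f))"

definition resolution_of_identity ::
    "((real \<Rightarrow> real) \<Rightarrow> (real \<Rightarrow> real)) \<Rightarrow> (real \<Rightarrow> (real \<Rightarrow> complex) \<Rightarrow> (real \<Rightarrow> complex)) \<Rightarrow> bool" where
  "resolution_of_identity R E \<longleftrightarrow>
     (\<forall>\<theta>\<in>{0..2*pi}. orthogonal_projection_CM (E \<theta>)) \<and>
     (\<forall>\<theta>\<in>{0..2*pi}. \<forall>\<phi>\<in>{0..2*pi}. \<theta> \<le> \<phi> \<longrightarrow>
        (\<forall>f\<in>CM_complex. Re (cm_cinner (E \<theta> f) f) \<le> Re (cm_cinner (E \<phi> f) f))) \<and>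
     (\<forall>\<theta>\<in>{0..<2*pi}. \<forall>f\<in>CM_complex.
        ((\<lambda>\<phi>. cm_cnorm (\<lambda>t. E \<phi> f t - E \<theta> f t)) \<longlongrightarrow> 0) (at_right \<theta>)) \<and>
     (\<forall>f\<in>CM_complex. E 0 f = (\<lambda>t. 0)) \<and>
     (\<forall>f\<in>CM_complex. E (2 * pi) f = f) \<and>
     is_spectral_integral (complexify_op R) E"


section \<open>The Wiener integral\<close>

text \<open>
  A list of triples \<open>(a, s, t)\<close> represents the step function \<open>\<Sum> a 1\<^bsub>(s,t]\<^esub>\<close>, whose
  integral is \<open>\<Sum> a (w\<^sub>t - w\<^sub>s)\<close>.
\<close>

definition step_fun :: "(real \<times> real \<times> real) list \<Rightarrow> real \<Rightarrow> real" where
  "step_fun xs u = (\<Sum>(a, s, t)\<leftarrow>xs. a * indicator {s<..t} u)"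

definition step_integral :: "(real \<times> real \<times> real) list \<Rightarrow> (real \<Rightarrow> real) \<Rightarrow> real" where
  "step_integral xs w = (\<Sum>(a, s, t)\<leftarrow>xs. a * (w t - w s))"

text \<open>
  The Wiener integral is an element of \<open>L\<^sup>2(\<mu>)\<close>, so it is rendered as a relation: \<open>X\<close> is a version
  of \<open>\<integral>\<^sub>0\<^sup>1 f dw\<close> iff it is the \<open>L\<^sup>2(\<mu>)\<close>-limit of the integrals of step functions that converge to
  \<open>f\<close> in \<open>L\<^sup>2([0,1])\<close>.
\<close>

definition is_wiener_integral ::
    "(real \<Rightarrow> real) measure \<Rightarrow> (real \<Rightarrow> real) \<Rightarrow> ((real \<Rightarrow> real) \<Rightarrow> real) \<Rightarrow> bool" where
  "is_wiener_integral \<mu> f X \<longleftrightarrow>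
     X \<in> borel_measurable \<mu> \<and>
     (\<exists>\<phi>. (\<forall>n. \<forall>(a, s, t)\<in>set (\<phi> n). 0 \<le> s \<and> s \<le> t \<and> t \<le> 1) \<and>
        (\<lambda>n. \<integral>\<^sup>+u. ennreal ((step_fun (\<phi> n) u - f u)\<^sup>2) \<partial>lebesgue_on {0..1}) \<longlonglongrightarrow> 0 \<and>
        (\<lambda>n. \<integral>\<^sup>+w. ennreal ((step_integral (\<phi> n) w - X w)\<^sup>2) \<partial>\<mu>) \<longlonglongrightarrow> 0)"

definition is_delta ::
    "(real \<Rightarrow> real) measure \<Rightarrow> (real \<Rightarrow> real) \<Rightarrow> ((real \<Rightarrow> real) \<Rightarrow> real) \<Rightarrow> bool" where
  "is_delta \<mu> h X \<longleftrightarrow> is_wiener_integral \<mu> (deriv h) X"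


section \<open>Measure-preserving transformations\<close>

definition measure_preserving_map :: "'a measure \<Rightarrow> ('a \<Rightarrow> 'a) \<Rightarrow> bool" where
  "measure_preserving_map M T \<longleftrightarrow> T \<in> measurable M M \<and> distr M M T = M"

definition ergodic_map :: "'a measure \<Rightarrow> ('a \<Rightarrow> 'a) \<Rightarrow> bool" where
  "ergodic_map M T \<longleftrightarrow>
     (\<forall>F :: 'a \<Rightarrow> real. F \<in> borel_measurable M \<and> (AE w in M. F (T w) = F w) \<longrightarrow>
        (\<exists>c. AE w in M. F w = c))"

definition weak_mixing_map :: "'a measure \<Rightarrow> ('a \<Rightarrow> 'a) \<Rightarrow> bool" where
  "weak_mixing_map M T \<longleftrightarrow>
     (\<forall>(f :: 'a \<Rightarrow> complex) (c :: complex).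
        f \<in> borel_measurable M \<and> integrable M (\<lambda>w. (cmod (f w))\<^sup>2) \<and>
        (AE w in M. f (T w) = c * f w) \<longrightarrow>
        (\<exists>d. AE w in M. f w = d))"

text \<open>
  \<open>T w = \<Sum>\<^sub>i \<delta>(R e\<^sub>i)(w) e\<^sub>i\<close> for almost every \<open>w\<close>, the series converging uniformly on \<open>[0,1]\<close>.
\<close>

definition is_wiener_series ::
    "(real \<Rightarrow> real) measure \<Rightarrow> ((real \<Rightarrow> real) \<Rightarrow> (real \<Rightarrow> real)) \<Rightarrow> (nat \<Rightarrow> real \<Rightarrow> real) \<Rightarrow>
     ((real \<Rightarrow> real) \<Rightarrow> (real \<Rightarrow> real)) \<Rightarrow> bool" where
  "is_wiener_series \<mu> R e T \<longleftrightarrow>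
     (\<exists>D. (\<forall>i. is_delta \<mu> (R (e i)) (D i)) \<and>
        (AE w in \<mu>. uniform_limit {0..1} (\<lambda>n t. \<Sum>i<n. D i w * e i t) (T w) sequentially))"

end

theory Submission
  imports Defs
begin

text \<open>
  Since \<open>\<delta>(h) \<circ> T = \<delta>(R h)\<close>, the process \<open>Y\<^sub>n = \<delta>(h) \<circ> T\<^sup>n\<close> is a stationary Gaussian sequence whose covariance
  \<open>(R\<^sup>n h, R\<^sup>m h)\<close> is the Fourier transform of the spectral measure \<open>\<sigma>\<^sub>h = d(\<Pi>\<^sub>\<theta> h, h)\<close>, and continuity of
  \<open>\<theta> \<mapsto> (\<Pi>\<^sub>\<theta> h, k)\<close> for all \<open>h, k\<close> means that no \<open>\<sigma>\<^sub>h\<close> has an atom.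

  If there are no atoms, Wiener's lemma makes the covariances tend to 0 in mean square.  An eigenfunction
  of mean zero is then orthogonal to every \<open>exp (i \<delta>h)\<close>; these functions are total, so it vanishes, and an
  eigenfunction for an eigenvalue other than 1 has mean zero.

  If \<open>\<sigma>\<^sub>h\<close> has an atom at \<open>\<theta>\<close>, the means of \<open>e\<^sup>-\<^sup>i\<^sup>n\<^sup>\<theta> Y\<^sub>n\<close> converge in \<open>L\<^sup>2\<close> to some \<open>P + i Q \<noteq> 0\<close> with \<open>P, Q\<close>
  Gaussian, which \<open>T\<close> rotates by the angle \<open>\<theta>\<close>.  Hence \<open>P\<^sup>2 + Q\<^sup>2\<close> is invariant, and it is not constant because
  a non-degenerate Gaussian variable is unbounded.
\<close>

section \<open>Square-integrable functions\<close>

text \<open>Even the bilinearity of \<open>cm_inner\<close> rests on a.e. differentiability, since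
  \<open>CM\<close> is defined through \<open>deriv\<close>; hence Lebesgue's differentiation
  theorem and the fundamental theorem come first. Their yield is the reproducing identity
  \<open>cm_inner h (rkernel t) = h t\<close>: it makes the norm definite, and it recognises the
  value at \<open>t\<close> of the series for \<open>T\<close> as the Wiener integral of
  \<open>R (rkernel t)\<close>, from which the rule for composing with \<open>T\<close> spreads to
  all Wiener integrals. A Wiener integral is only determined almost surely, so it is handled as a
  closed relation \<open>wdelta\<close> between elements of \<open>CM\<close> and square-integrable
  variables. On the spectral side the hypothesis is an integral formula for \<open>R\<close> alone;
  its powers are reached through Riemann sums, which multiply because the slices of the resolution
  are mutually orthogonal. Exponentials serve as test functions because their covariances are
  explicit: \<open>\<kappa>\<^sup>2 * (exp r - 1)\<close> is at most a constant times
  \<open>\<bar>r\<bar>\<close>, where \<open>r\<close> is the covariance of the Gaussian variables,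
  so decay of \<open>r\<close> in mean suffices.\<close>

definition sq_int :: "'a measure \<Rightarrow> ('a \<Rightarrow> real) \<Rightarrow> bool" where
  "sq_int M f \<longleftrightarrow> f \<in> borel_measurable M \<and> integrable M (\<lambda>x. (f x)\<^sup>2)"

text \<open>Meaningful only beside \<open>sq_int\<close>, because the Bochner integral of a
  non-integrable square is 0. It is a seminorm on functions: norm zero yields equality almost
  everywhere only.\<close>

definition L2_norm :: "'a measure \<Rightarrow> ('a \<Rightarrow> real) \<Rightarrow> real" where
  "L2_norm M f = sqrt (\<integral>x. (f x)\<^sup>2 \<partial>M)"

lemma sq_int_measurable[measurable_dest]: "sq_int M f \<Longrightarrow> f \<in> borel_measurable M"
  by (simp add: sq_int_def)

lemma sq_int_prod_integrable:
  assumes "sq_int M f" "sq_int M g"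
  shows "integrable M (\<lambda>x. f x * g x)"
proof (rule Bochner_Integration.integrable_bound[where f="\<lambda>x. (f x)\<^sup>2 + (g x)\<^sup>2"])
  show "integrable M (\<lambda>x. (f x)\<^sup>2 + (g x)\<^sup>2)"
    using assms by (simp add: sq_int_def)
  show "(\<lambda>x. f x * g x) \<in> borel_measurable M"
    using assms by (auto simp: sq_int_def)
  have "\<bar>a * b\<bar> \<le> a\<^sup>2 + b\<^sup>2" for a b :: real
  proof -
    have "2 * (\<bar>a\<bar> * \<bar>b\<bar>) \<le> a\<^sup>2 + b\<^sup>2"
      using sum_squares_bound[of "\<bar>a\<bar>" "\<bar>b\<bar>"] by simp
    moreover have "0 \<le> \<bar>a\<bar> * \<bar>b\<bar>" by simp
    ultimately show ?thesis unfolding abs_mult by linarith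
  qed
  then show "AE x in M. norm (f x * g x) \<le> norm ((f x)\<^sup>2 + (g x)\<^sup>2)"
    by auto
qed

lemma sq_int_lincomb:
  assumes "sq_int M f" "sq_int M g"
  shows "sq_int M (\<lambda>x. a * f x + b * g x)"
proof -
  have "(\<lambda>x. (a * f x + b * g x)\<^sup>2)
      = (\<lambda>x. a\<^sup>2 * (f x)\<^sup>2 + b\<^sup>2 * (g x)\<^sup>2 + 2 * a * b * (f x * g x))"
    by (auto simp: power2_eq_square algebra_simps)
  then show ?thesis
    using assms sq_int_prod_integrable[OF assms] by (auto simp: sq_int_def)
qed

lemma sq_int_add: "sq_int M f \<Longrightarrow> sq_int M g \<Longrightarrow> sq_int M (\<lambda>x. f x + g x)"
  using sq_int_lincomb[of M f g 1 1] by simp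

lemma sq_int_diff: "sq_int M f \<Longrightarrow> sq_int M g \<Longrightarrow> sq_int M (\<lambda>x. f x - g x)"
  using sq_int_lincomb[of M f g 1 "-1"] by simp

lemma sq_int_cmult: "sq_int M f \<Longrightarrow> sq_int M (\<lambda>x. a * f x)"
  using sq_int_lincomb[of M f f a 0] by simp

lemma sq_int_zero: "sq_int M (\<lambda>x. 0)"
  by (simp add: sq_int_def)

lemma sq_int_sum: "(\<And>i. i \<in> A \<Longrightarrow> sq_int M (f i)) \<Longrightarrow> sq_int M (\<lambda>x. \<Sum>i\<in>A. f i x)"
  by (induction A rule: infinite_finite_induct) (auto intro!: sq_int_zero sq_int_add)

lemma sq_int_abs: "sq_int M f \<Longrightarrow> sq_int M (\<lambda>x. \<bar>f x\<bar>)"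
  by (auto simp: sq_int_def)

lemma sq_int_cong_AE:
  assumes "sq_int M f" "g \<in> borel_measurable M" "AE x in M. f x = g x"
  shows "sq_int M g"
proof -
  have "integrable M (\<lambda>x. (f x)\<^sup>2) \<longleftrightarrow> integrable M (\<lambda>x. (g x)\<^sup>2)"
    using assms by (intro integrable_cong_AE) (auto simp: sq_int_def)
  with assms show ?thesis by (simp add: sq_int_def)
qed

lemma L2_norm_nonneg[simp]: "0 \<le> L2_norm M f"
  by (simp add: L2_norm_def)

lemma L2_norm_sq: "(L2_norm M f)\<^sup>2 = (\<integral>x. (f x)\<^sup>2 \<partial>M)"
  by (simp add: L2_norm_def)

text \<open>The quadratic polynomial \<open>t \<mapsto> \<integral> (f - t g)\<^sup>2\<close> is
  nonnegative, so its discriminant is not positive.\<close>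

lemma L2_Cauchy_Schwarz:
  assumes f: "sq_int M f" and g: "sq_int M g"
  shows "\<bar>\<integral>x. f x * g x \<partial>M\<bar> \<le> L2_norm M f * L2_norm M g"
proof -
  define A where "A = (\<integral>x. (f x)\<^sup>2 \<partial>M)"
  define B where "B = (\<integral>x. f x * g x \<partial>M)"
  define C where "C = (\<integral>x. (g x)\<^sup>2 \<partial>M)"
  have quad: "0 \<le> A - 2 * t * B + t\<^sup>2 * C" for t
  proof -
    have "0 \<le> (\<integral>x. (f x - t * g x)\<^sup>2 \<partial>M)" by simp
    also have "(\<lambda>x. (f x - t * g x)\<^sup>2) = (\<lambda>x. (f x)\<^sup>2 - 2 * t * (f x * g x) + t\<^sup>2 * (g x)\<^sup>2)"
      by (auto simp: power2_eq_square algebra_simps)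
    also have "(\<integral>x. (f x)\<^sup>2 - 2 * t * (f x * g x) + t\<^sup>2 * (g x)\<^sup>2 \<partial>M) = A - 2 * t * B + t\<^sup>2 * C"
      using f g sq_int_prod_integrable[OF f g]
      by (simp add: sq_int_def A_def B_def C_def)
    finally show ?thesis .
  qed
  have C0: "0 \<le> C" by (simp add: C_def)
  have A0: "0 \<le> A" by (simp add: A_def)
  have "B\<^sup>2 \<le> A * C"
  proof (cases "C = 0")
    case True
    have "B = 0"
    proof (rule ccontr)
      assume "B \<noteq> 0"
      \<comment> \<open>With \<open>C = 0\<close> the polynomial is linear in \<open>t\<close>, and
        this \<open>t\<close> gives it the value -1.\<close>
      with quad[of "(A + 1) / (2 * B)"] True show False by simp
    qed
    with True show ?thesis by simp
  next
    case False
    with C0 have "0 < C" by simp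
    with quad[of "B / C"] show ?thesis
      by (simp add: field_simps power2_eq_square)
  qed
  then have "sqrt (B\<^sup>2) \<le> sqrt (A * C)" by (rule real_sqrt_le_mono)
  then show ?thesis
    by (simp add: real_sqrt_mult L2_norm_def A_def B_def C_def)
qed

lemma L2_norm_add:
  assumes f: "sq_int M f" and g: "sq_int M g"
  shows "L2_norm M (\<lambda>x. f x + g x) \<le> L2_norm M f + L2_norm M g"
proof (rule power2_le_imp_le)
  have "(L2_norm M (\<lambda>x. f x + g x))\<^sup>2
      = (\<integral>x. (f x)\<^sup>2 + (g x)\<^sup>2 + 2 * (f x * g x) \<partial>M)"
    by (simp add: L2_norm_sq power2_sum mult.assoc)
  also have "\<dots> = (L2_norm M f)\<^sup>2 + (L2_norm M g)\<^sup>2 + 2 * (\<integral>x. f x * g x \<partial>M)"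
    using f g sq_int_prod_integrable[OF f g] by (simp add: sq_int_def L2_norm_sq)
  also have "\<dots> \<le> (L2_norm M f + L2_norm M g)\<^sup>2"
    using L2_Cauchy_Schwarz[OF f g] by (simp add: power2_sum)
  finally show "(L2_norm M (\<lambda>x. f x + g x))\<^sup>2 \<le> (L2_norm M f + L2_norm M g)\<^sup>2" .
qed simp

lemma L2_norm_cmult: "L2_norm M (\<lambda>x. a * f x) = \<bar>a\<bar> * L2_norm M f"
  by (simp add: L2_norm_def power_mult_distrib real_sqrt_mult)

lemma L2_norm_zero[simp]: "L2_norm M (\<lambda>x. 0) = 0"
  by (simp add: L2_norm_def)

lemma L2_norm_minus_commute: "L2_norm M (\<lambda>x. f x - g x) = L2_norm M (\<lambda>x. g x - f x)"
  by (simp add: L2_norm_def power2_commute)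

lemma L2_norm_abs: "L2_norm M (\<lambda>x. \<bar>f x\<bar>) = L2_norm M f"
  by (simp add: L2_norm_def)

lemma L2_norm_cong_AE:
  assumes "AE x in M. f x = g x" "f \<in> borel_measurable M" "g \<in> borel_measurable M"
  shows "L2_norm M f = L2_norm M g"
proof -
  have "(\<integral>x. (f x)\<^sup>2 \<partial>M) = (\<integral>x. (g x)\<^sup>2 \<partial>M)"
    using assms by (intro integral_cong_AE) auto
  then show ?thesis by (simp add: L2_norm_def)
qed

lemma L2_norm_triangle:
  assumes "sq_int M f" "sq_int M g" "sq_int M h"
  shows "L2_norm M (\<lambda>x. f x - h x) \<le> L2_norm M (\<lambda>x. f x - g x) + L2_norm M (\<lambda>x. g x - h x)"
  using L2_norm_add[OF sq_int_diff[OF assms(1,2)] sq_int_diff[OF assms(2,3)]] by simp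

lemma L2_norm_diff_le:
  assumes f: "sq_int M f" and g: "sq_int M g"
  shows "\<bar>L2_norm M f - L2_norm M g\<bar> \<le> L2_norm M (\<lambda>x. f x - g x)"
  using L2_norm_triangle[OF f g sq_int_zero] L2_norm_triangle[OF g f sq_int_zero]
    L2_norm_minus_commute[of M f g] by (simp add: abs_le_iff)

lemma L2_norm_sum:
  assumes "\<And>i. i \<in> A \<Longrightarrow> sq_int M (f i)"
  shows "L2_norm M (\<lambda>x. \<Sum>i\<in>A. f i x) \<le> (\<Sum>i\<in>A. L2_norm M (f i))"
  using assms
proof (induction A rule: infinite_finite_induct)
  case (insert a A)
  then have "L2_norm M (\<lambda>x. f a x + (\<Sum>i\<in>A. f i x)) \<le> L2_norm M (f a) + L2_norm M (\<lambda>x. \<Sum>i\<in>A. f i x)"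
    by (intro L2_norm_add sq_int_sum) auto
  also have "\<dots> \<le> L2_norm M (f a) + (\<Sum>i\<in>A. L2_norm M (f i))"
    using insert by auto
  finally show ?case using insert by simp
qed auto

lemma nn_integral_sq_eq_L2_norm:
  assumes "sq_int M f"
  shows "(\<integral>\<^sup>+x. ennreal ((f x)\<^sup>2) \<partial>M) = ennreal ((L2_norm M f)\<^sup>2)"
  using assms by (simp add: L2_norm_sq sq_int_def nn_integral_eq_integral)

lemma sq_int_if_nn_integral_finite:
  assumes "f \<in> borel_measurable M" "(\<integral>\<^sup>+x. ennreal ((f x)\<^sup>2) \<partial>M) < \<infinity>"
  shows "sq_int M f"
  unfolding sq_int_def
  using assms by (auto intro!: integrableI_nonneg)

lemma L2_norm_le_if_nn_integral_le:
  assumes "f \<in> borel_measurable M" "(\<integral>\<^sup>+x. ennreal ((f x)\<^sup>2) \<partial>M) \<le> ennreal (c\<^sup>2)" "0 \<le> c"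
  shows "sq_int M f \<and> L2_norm M f \<le> c"
proof
  show f: "sq_int M f"
    using assms by (intro sq_int_if_nn_integral_finite) (auto intro: le_less_trans)
  have "ennreal ((L2_norm M f)\<^sup>2) \<le> ennreal (c\<^sup>2)"
    using assms nn_integral_sq_eq_L2_norm[OF f] by simp
  then have "(L2_norm M f)\<^sup>2 \<le> c\<^sup>2" by simp
  then show "L2_norm M f \<le> c" using assms(3) by (rule power2_le_imp_le)
qed

section \<open>Completeness of the space of square-integrable functions\<close>

definition L2_Cauchy :: "'a measure \<Rightarrow> (nat \<Rightarrow> 'a \<Rightarrow> real) \<Rightarrow> bool" where
  "L2_Cauchy M X \<longleftrightarrow> (\<forall>\<epsilon>>0. \<exists>N. \<forall>m\<ge>N. \<forall>n\<ge>N. L2_norm M (\<lambda>x. X m x - X n x) < \<epsilon>)"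

text \<open>Fatou: the norm of \<open>X m - Y\<close> is bounded by the lower limit of the norms of
  \<open>X m - X (r k)\<close>, which the Cauchy property makes small. Used with a fast subsequence
  for completeness, and with the identity to show that the series for \<open>T\<close> converges in
  mean square to its pointwise limit.\<close>

lemma L2_limit_of_AE_limit:
  fixes X :: "nat \<Rightarrow> 'a \<Rightarrow> real"
  assumes X: "\<And>n. sq_int M (X n)" and C: "L2_Cauchy M X"
    and r: "strict_mono r" and Y: "Y \<in> borel_measurable M"
    and ae: "AE x in M. (\<lambda>k. X (r k) x) \<longlonglongrightarrow> Y x"
  shows "sq_int M Y" and "(\<lambda>n. L2_norm M (\<lambda>x. X n x - Y x)) \<longlonglongrightarrow> 0"
proof -
  have bound: "sq_int M (\<lambda>x. X m x - Y x) \<and> L2_norm M (\<lambda>x. X m x - Y x) \<le> \<epsilon>"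
    if N: "\<forall>m\<ge>N. \<forall>n\<ge>N. L2_norm M (\<lambda>x. X m x - X n x) < \<epsilon>" and m: "m \<ge> N" for N m \<epsilon>
  proof (rule L2_norm_le_if_nn_integral_le)
    have e: "0 \<le> \<epsilon>"
      using N m L2_norm_nonneg[of M "\<lambda>x. X m x - X m x"] by (meson le_less_trans less_imp_le order_refl)
    then show "0 \<le> \<epsilon>" .
    show [measurable]: "(\<lambda>x. X m x - Y x) \<in> borel_measurable M"
      using X[of m] Y by (auto simp: sq_int_def)
    have [measurable]: "X n \<in> borel_measurable M" for n using X by (simp add: sq_int_def)
    have "AE x in M. ennreal ((X m x - Y x)\<^sup>2) = liminf (\<lambda>k. ennreal ((X m x - X (r k) x)\<^sup>2))"
      using ae
    proof (eventually_elim)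
      fix x assume "(\<lambda>k. X (r k) x) \<longlonglongrightarrow> Y x"
      then have "(\<lambda>k. ennreal ((X m x - X (r k) x)\<^sup>2)) \<longlonglongrightarrow> ennreal ((X m x - Y x)\<^sup>2)"
        by (intro tendsto_intros tendsto_ennrealI)
      then show "ennreal ((X m x - Y x)\<^sup>2) = liminf (\<lambda>k. ennreal ((X m x - X (r k) x)\<^sup>2))"
        using lim_imp_Liminf[OF sequentially_bot] by metis
    qed
    then have "(\<integral>\<^sup>+x. ennreal ((X m x - Y x)\<^sup>2) \<partial>M)
        = (\<integral>\<^sup>+x. liminf (\<lambda>k. ennreal ((X m x - X (r k) x)\<^sup>2)) \<partial>M)"
      by (rule nn_integral_cong_AE)
    also have "\<dots> \<le> liminf (\<lambda>k. \<integral>\<^sup>+x. ennreal ((X m x - X (r k) x)\<^sup>2) \<partial>M)"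
      by (rule nn_integral_liminf) simp
    also have "\<dots> \<le> limsup (\<lambda>k. \<integral>\<^sup>+x. ennreal ((X m x - X (r k) x)\<^sup>2) \<partial>M)"
      by (rule Liminf_le_Limsup) simp
    also have "\<dots> \<le> ennreal (\<epsilon>\<^sup>2)"
    proof (rule Limsup_bounded, rule eventually_sequentiallyI[of N])
      fix k assume "N \<le> k"
      then have "N \<le> r k" using seq_suble[OF r, of k] by linarith
      then have "L2_norm M (\<lambda>x. X m x - X (r k) x) \<le> \<epsilon>" using N m by (meson less_imp_le)
      then have "(L2_norm M (\<lambda>x. X m x - X (r k) x))\<^sup>2 \<le> \<epsilon>\<^sup>2" by (simp add: power_mono)
      then show "(\<integral>\<^sup>+x. ennreal ((X m x - X (r k) x)\<^sup>2) \<partial>M) \<le> ennreal (\<epsilon>\<^sup>2)"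
        by (simp add: nn_integral_sq_eq_L2_norm sq_int_diff X ennreal_leI)
    qed
    finally show "(\<integral>\<^sup>+x. ennreal ((X m x - Y x)\<^sup>2) \<partial>M) \<le> ennreal (\<epsilon>\<^sup>2)" .
  qed
  obtain N where "\<forall>m\<ge>N. \<forall>n\<ge>N. L2_norm M (\<lambda>x. X m x - X n x) < 1"
    using C unfolding L2_Cauchy_def by (meson zero_less_one)
  then have "sq_int M (\<lambda>x. X N x - Y x)" using bound[of N 1 N] by auto
  from sq_int_diff[OF X[of N] this] show "sq_int M Y" by simp
  show "(\<lambda>n. L2_norm M (\<lambda>x. X n x - Y x)) \<longlonglongrightarrow> 0"
  proof (rule LIMSEQ_I)
    fix e :: real assume "0 < e"
    then obtain N where "\<forall>m\<ge>N. \<forall>n\<ge>N. L2_norm M (\<lambda>x. X m x - X n x) < e / 2"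
      using C unfolding L2_Cauchy_def by (meson half_gt_zero)
    then have "\<forall>n\<ge>N. L2_norm M (\<lambda>x. X n x - Y x) \<le> e / 2" using bound by blast
    then show "\<exists>N. \<forall>n\<ge>N. norm (L2_norm M (\<lambda>x. X n x - Y x) - 0) < e"
      using \<open>0 < e\<close> by (intro exI[of _ N]) force
  qed
qed

text \<open>Riesz-Fischer: along a subsequence with geometrically small increments the sum of the
  absolute increments is finite almost everywhere, so the subsequence converges pointwise.\<close>

lemma L2_complete:
  fixes X :: "nat \<Rightarrow> 'a \<Rightarrow> real"
  assumes X: "\<And>n. sq_int M (X n)" and C: "L2_Cauchy M X"
  obtains Y where "sq_int M Y" "(\<lambda>n. L2_norm M (\<lambda>x. X n x - Y x)) \<longlonglongrightarrow> 0"
proof -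
  have [measurable]: "X n \<in> borel_measurable M" for n using X by (simp add: sq_int_def)
  have "\<forall>k. \<exists>N. \<forall>m\<ge>N. \<forall>n\<ge>N. L2_norm M (\<lambda>x. X m x - X n x) < (1/2)^k"
    using C by (simp add: L2_Cauchy_def)
  then obtain N where N: "\<And>k m n. m \<ge> N k \<Longrightarrow> n \<ge> N k \<Longrightarrow> L2_norm M (\<lambda>x. X m x - X n x) < (1/2)^k"
    by metis
  \<comment> \<open>Adding all earlier thresholds keeps \<open>r k\<close> above \<open>N k\<close>,
    and the summand \<open>k\<close> makes \<open>r\<close> strictly increasing.\<close>
  define r where "r k = k + (\<Sum>i\<le>k. N i)" for k
  have r: "strict_mono r"
    by (rule strict_monoI_Suc) (simp add: r_def)
  have rN: "r k \<ge> N k" for k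
    using member_le_sum[of k "{..k}" N] by (simp add: r_def)
  define g where "g k x = \<bar>X (r (Suc k)) x - X (r k) x\<bar>" for k x
  have [measurable]: "g k \<in> borel_measurable M" for k unfolding g_def by measurable
  have gs: "sq_int M (g k)" for k
    unfolding g_def by (intro sq_int_abs sq_int_diff X)
  have gn: "L2_norm M (g k) \<le> (1/2)^k" for k
    unfolding g_def L2_norm_abs
    using rN[of k] strict_monoD[OF r, of k "Suc k"]
    by (intro less_imp_le[OF N]) auto
  \<comment> \<open>Minkowski bounds the norm of every partial sum by the full geometric series,
    which is 2; a bound independent of \<open>n\<close> is what monotone convergence
    requires.\<close>
  have S: "(\<integral>\<^sup>+x. ennreal ((\<Sum>k<n. g k x)\<^sup>2) \<partial>M) \<le> 4" for n
  proof -
    have "L2_norm M (\<lambda>x. \<Sum>k<n. g k x) \<le> (\<Sum>k<n. (1/2)^k)"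
      using L2_norm_sum[of "{..<n}" M g] gs gn by (meson order_trans sum_mono)
    also have "\<dots> \<le> 2" by (simp add: sum_gp_strict)
    finally have "(L2_norm M (\<lambda>x. \<Sum>k<n. g k x))\<^sup>2 \<le> 2\<^sup>2" by (rule power_mono) simp
    then have "ennreal ((L2_norm M (\<lambda>x. \<Sum>k<n. g k x))\<^sup>2) \<le> ennreal 4" by (intro ennreal_leI) simp
    then show ?thesis
      using gs by (simp add: nn_integral_sq_eq_L2_norm sq_int_sum)
  qed
  have "(\<integral>\<^sup>+x. (SUP n. ennreal ((\<Sum>k<n. g k x)\<^sup>2)) \<partial>M) = (SUP n. \<integral>\<^sup>+x. ennreal ((\<Sum>k<n. g k x)\<^sup>2) \<partial>M)"
  proof (rule nn_integral_monotone_convergence_SUP)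
    show "incseq (\<lambda>n x. ennreal ((\<Sum>k<n. g k x)\<^sup>2))"
      by (auto intro!: incseq_SucI le_funI ennreal_leI power_mono sum_nonneg simp: g_def)
  qed simp
  also have "\<dots> \<le> 4" by (intro SUP_least S)
  finally have "(\<integral>\<^sup>+x. (SUP n. ennreal ((\<Sum>k<n. g k x)\<^sup>2)) \<partial>M) \<noteq> \<infinity>"
    by (auto simp: top_unique)
  then have "AE x in M. (SUP n. ennreal ((\<Sum>k<n. g k x)\<^sup>2)) \<noteq> \<infinity>"
    by (intro nn_integral_noteq_infinite) auto
  then have conv: "AE x in M. convergent (\<lambda>k. X (r k) x)"
  proof eventually_elim
    fix x assume fin: "(SUP n. ennreal ((\<Sum>k<n. g k x)\<^sup>2)) \<noteq> \<infinity>"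
    then obtain B where B: "(SUP n. ennreal ((\<Sum>k<n. g k x)\<^sup>2)) = ennreal B" "0 \<le> B"
      by (metis ennreal_cases infinity_ennreal_def)
    have "(\<Sum>k<n. g k x) \<le> sqrt B" for n
    proof -
      have "ennreal ((\<Sum>k<n. g k x)\<^sup>2) \<le> ennreal B" unfolding B(1)[symmetric] by (rule SUP_upper) simp
      then have "(\<Sum>k<n. g k x)\<^sup>2 \<le> B" using B(2) by simp
      then show ?thesis by (rule real_le_rsqrt)
    qed
    then have "summable (\<lambda>k. g k x)"
      by (intro summableI_nonneg_bounded[of _ "sqrt B"]) (auto simp: g_def)
    then have "summable (\<lambda>k. X (r (Suc k)) x - X (r k) x)"
      unfolding g_def by (rule summable_rabs_cancel)
    then have "convergent (\<lambda>n. \<Sum>k<n. X (r (Suc k)) x - X (r k) x)"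
      by (simp add: summable_iff_convergent)
    then have "convergent (\<lambda>n. X (r n) x - X (r 0) x)"
      unfolding sum_lessThan_telescope[of "\<lambda>k. X (r k) x"] .
    then show "convergent (\<lambda>k. X (r k) x)"
      using convergent_diff_const_right_iff[of "\<lambda>k. X (r k) x" "X (r 0) x"] by blast
  qed
  define Y where "Y x = lim (\<lambda>k. X (r k) x)" for x
  have "Y \<in> borel_measurable M" unfolding Y_def by measurable
  moreover have "AE x in M. (\<lambda>k. X (r k) x) \<longlonglongrightarrow> Y x"
    using conv by (auto simp: Y_def convergent_LIMSEQ_iff)
  ultimately show thesis
    using L2_limit_of_AE_limit[OF X C r] that by blast
qed

section \<open>Absolutely continuous functions\<close>

definition nonoverlapping_in :: "real \<Rightarrow> real \<Rightarrow> real set set \<Rightarrow> bool" where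
  "nonoverlapping_in a b F \<longleftrightarrow> finite F \<and> (\<forall>K\<in>F. \<exists>u v. u < v \<and> a \<le> u \<and> v \<le> b \<and> K = {u..v}) \<and>
     (\<forall>K\<in>F. \<forall>L\<in>F. K \<noteq> L \<longrightarrow> interior K \<inter> interior L = {})"

lemma nonoverlapping_in_interval:
  assumes "nonoverlapping_in a b F" "K \<in> F"
  obtains u v where "u < v" "a \<le> u" "v \<le> b" "K = {u..v}"
  using assms unfolding nonoverlapping_in_def by meson

lemma nonoverlapping_in_disjoint:
  "nonoverlapping_in a b F \<Longrightarrow> K \<in> F \<Longrightarrow> L \<in> F \<Longrightarrow> K \<noteq> L \<Longrightarrow> interior K \<inter> interior L = {}"
  by (simp add: nonoverlapping_in_def)

text \<open>The endpoints are read off the set, so that families of intervals can be plain sets, as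
  in \<open>division_of\<close>.\<close>

definition increment :: "(real \<Rightarrow> real) \<Rightarrow> real set \<Rightarrow> real" where
  "increment f K = f (Sup K) - f (Inf K)"

lemma increment_Icc[simp]: "u \<le> v \<Longrightarrow> increment f {u..v} = f v - f u"
  by (simp add: increment_def)

text \<open>Tagging every cell with its left endpoint turns the division into a tagged division, for
  which the telescoping identity is available.\<close>

lemma sum_increment_division:
  assumes "q division_of {a..b::real}" "a \<le> b"
  shows "(\<Sum>K\<in>q. increment f K) = f b - f a"
proof -
  have inf: "Inf K \<in> K" if K: "K \<in> q" for K
  proof -
    obtain u v where "K = cbox u v" "K \<noteq> {}" using division_ofD(3,4)[OF assms(1) K] by blast
    then show ?thesis by auto
  qed
  define p where "p = (\<lambda>K. (Inf K, K)) ` q"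
  have "p tagged_division_of {a..b}"
    unfolding tagged_division_of
  proof (intro conjI allI impI)
    show "finite p" using division_ofD(1)[OF assms(1)] by (simp add: p_def)
  next
    have "\<Union>{K. \<exists>x. (x, K) \<in> p} = \<Union>q" by (auto simp: p_def)
    then show "\<Union>{K. \<exists>x. (x, K) \<in> p} = {a..b}" using division_ofD(6)[OF assms(1)] by simp
  next
    fix x K assume "(x, K) \<in> p"
    then have K: "K \<in> q" "x = Inf K" by (auto simp: p_def)
    show "x \<in> K" using inf K by simp
    show "K \<subseteq> {a..b}" "\<exists>a b. K = cbox a b"
      using division_ofD(2,4)[OF assms(1) K(1)] by simp_all
  next
    fix x K y L assume "(x, K) \<in> p \<and> (y, L) \<in> p \<and> (x, K) \<noteq> (y, L)"
    then have "K \<in> q" "L \<in> q" "K \<noteq> L" by (auto simp: p_def)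
    then show "interior K \<inter> interior L = {}"
      using division_ofD(5)[OF assms(1)] by simp
  qed
  from additive_tagged_division_1[OF assms(2) this, of f]
  show ?thesis
    unfolding p_def by (subst (asm) sum.reindex) (auto simp: inj_on_def increment_def)
qed

text \<open>Filling the gaps makes signed increments telescope. With the identity as
  \<open>f\<close> this bounds total lengths, with a general \<open>f\<close> it feeds the
  refinement argument; the finite remainder of endpoints is negligible.\<close>

lemma nonoverlapping_in_extend:
  assumes F: "nonoverlapping_in a b F" and ab: "a < b"
  obtains q where "nonoverlapping_in a b q" "F \<subseteq> q"
    "\<And>f. (\<Sum>K\<in>q. increment f K) = f b - f a"
    "finite ({a..b} - (\<Union>K\<in>q. interior K))"
proof -
  have "F division_of \<Union>F"
  proof (rule division_ofI)
    show "finite F" using F by (simp add: nonoverlapping_in_def)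
    fix K assume "K \<in> F"
    then obtain u v where uv: "u < v" "K = {u..v}"
      using nonoverlapping_in_interval[OF F] by metis
    then show "K \<noteq> {}" by simp
    show "\<exists>a b. K = cbox a b" using uv(2) by (intro exI[of _ u] exI[of _ v]) simp
    show "K \<subseteq> \<Union>F" using \<open>K \<in> F\<close> by blast
  next
    fix K L assume "K \<in> F" "L \<in> F" "K \<noteq> L"
    then show "interior K \<inter> interior L = {}" using nonoverlapping_in_disjoint[OF F] by simp
  qed simp
  moreover have "\<Union>F \<subseteq> cbox a b"
  proof (rule Union_least)
    fix K assume "K \<in> F"
    then obtain u v where "u < v" "a \<le> u" "v \<le> b" "K = {u..v}"
      using nonoverlapping_in_interval[OF F] by metis
    then show "K \<subseteq> cbox a b" by simp
  qed
  ultimately obtain q where q: "F \<subseteq> q" "q division_of {a..b}"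
    using partial_division_extend_interval by (metis box_real(2))
  note d = division_ofD[OF q(2)]
  have ival: "\<exists>u v. K = {u..v} \<and> u \<le> v" if K: "K \<in> q" for K
  proof -
    obtain u v where "K = {u..v}" using d(4)[OF K] unfolding box_real by blast
    with d(3)[OF K] show ?thesis by (intro exI[of _ u] exI[of _ v]) simp
  qed
  define q' where "q' = {K \<in> q. interior K \<noteq> {}}"
  have int: "interior K \<noteq> {}" if "K \<in> F" for K
    using nonoverlapping_in_interval[OF F that] by (metis box_ne_empty(2) dense_le empty_iff greaterThanLessThan_iff interior_atLeastAtMost_real dense)
  show thesis
  proof
    show "nonoverlapping_in a b q'"
      unfolding nonoverlapping_in_def
    proof (intro conjI ballI impI)
      show "finite q'" using d(1) by (simp add: q'_def)
      fix K assume "K \<in> q'"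
      then have K: "K \<in> q" "interior K \<noteq> {}" by (auto simp: q'_def)
      from ival[OF K(1)] obtain u v where uv: "K = {u..v}" "u \<le> v" by blast
      moreover have "u < v" using K(2) uv by auto
      moreover have "a \<le> u" "v \<le> b" using d(2)[OF K(1)] uv by auto
      ultimately show "\<exists>u v. u < v \<and> a \<le> u \<and> v \<le> b \<and> K = {u..v}" by blast
    next
      fix K L assume "K \<in> q'" "L \<in> q'" "K \<noteq> L"
      then show "interior K \<inter> interior L = {}" using d(5) by (auto simp: q'_def)
    qed
    show "F \<subseteq> q'" using q(1) int by (auto simp: q'_def)
    show "(\<Sum>K\<in>q'. increment f K) = f b - f a" for f
    proof -
      have "increment f K = 0" if "K \<in> q - q'" for K
      proof -
        from that ival[of K] obtain u v where "K = {u..v}" "u \<le> v" "interior K = {}"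
          by (auto simp: q'_def)
        then have "K = {u}" by auto
        then show ?thesis by (simp add: increment_def)
      qed
      then have "(\<Sum>K\<in>q'. increment f K) = (\<Sum>K\<in>q. increment f K)"
        using d(1) by (intro sum.mono_neutral_left) (auto simp: q'_def)
      then show ?thesis using sum_increment_division[OF q(2)] ab by simp
    qed
    have "{a..b} - (\<Union>K\<in>q'. interior K) \<subseteq> (\<Union>K\<in>q. {Inf K, Sup K})"
    proof
      fix x assume x: "x \<in> {a..b} - (\<Union>K\<in>q'. interior K)"
      then obtain K where K: "K \<in> q" "x \<in> K" using d(6) by blast
      from ival[OF K(1)] obtain u v where uv: "K = {u..v}" "u \<le> v" by blast
      have "x \<notin> interior K"
        using x K(1) by (cases "interior K = {}") (auto simp: q'_def)
      then have "x = u \<or> x = v" using uv K(2) by auto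
      then show "x \<in> (\<Union>K\<in>q. {Inf K, Sup K})" using uv K(1) by force
    qed
    moreover have "finite (\<Union>K\<in>q. {Inf K, Sup K})" using d(1) by auto
    ultimately show "finite ({a..b} - (\<Union>K\<in>q'. interior K))"
      by (rule finite_subset)
  qed
qed

text \<open>If a cell rises while the pieces cut out of it fall, the rest of the cell must rise by
  the increment of the cell plus the total fall. Rest and pieces together then exceed the variation
  of the cell by twice the variation of the pieces; the case of a falling cell is symmetric.\<close>

lemma nonoverlapping_refine:
  assumes d: "nonoverlapping_in a b d" and F: "nonoverlapping_in a b F"
    and sub: "\<And>K. K \<in> F \<Longrightarrow> \<exists>J\<in>d. K \<subseteq> J \<and>
      (if 0 \<le> increment f J then increment f K \<le> 0 else 0 \<le> increment f K)"
  obtains d' where "nonoverlapping_in a b d'"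
    "(\<Sum>K\<in>d. \<bar>increment f K\<bar>) + 2 * (\<Sum>K\<in>F. \<bar>increment f K\<bar>) \<le> (\<Sum>K\<in>d'. \<bar>increment f K\<bar>)"
proof -
  obtain Jof where Jof: "\<And>K. K \<in> F \<Longrightarrow> Jof K \<in> d" "\<And>K. K \<in> F \<Longrightarrow> K \<subseteq> Jof K"
    "\<And>K. K \<in> F \<Longrightarrow> if 0 \<le> increment f (Jof K) then increment f K \<le> 0 else 0 \<le> increment f K"
    using sub by metis
  have dE: "\<exists>u v. u < v \<and> a \<le> u \<and> v \<le> b \<and> J = {u..v}" if "J \<in> d" for J
    using nonoverlapping_in_interval[OF d that] by metis
  have FE: "\<exists>u v. u < v \<and> a \<le> u \<and> v \<le> b \<and> J = {u..v}" if "J \<in> F" for J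
    using nonoverlapping_in_interval[OF F that] by metis
  have fin: "finite d" "finite F" using d F by (auto simp: nonoverlapping_in_def)
  define G where "G J = {K \<in> F. Jof K = J}" for J
  have "\<forall>J\<in>d. \<exists>q. nonoverlapping_in (Inf J) (Sup J) q \<and> G J \<subseteq> q \<and>
      (\<Sum>K\<in>q. increment f K) = increment f J"
  proof
    fix J assume J: "J \<in> d"
    then obtain u v where uv: "u < v" "J = {u..v}" using dE by blast
    have "nonoverlapping_in u v (G J)"
      unfolding nonoverlapping_in_def
    proof (intro conjI ballI impI)
      show "finite (G J)" using fin by (simp add: G_def)
      fix K assume K: "K \<in> G J"
      then obtain s t where st: "s < t" "K = {s..t}" using FE[of K] by (auto simp: G_def)
      moreover have "K \<subseteq> J" using K Jof by (auto simp: G_def)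
      ultimately have "u \<le> s" "t \<le> v" using uv by auto
      with st show "\<exists>s t. s < t \<and> u \<le> s \<and> t \<le> v \<and> K = {s..t}" by blast
    next
      fix K L assume "K \<in> G J" "L \<in> G J" "K \<noteq> L"
      then show "interior K \<inter> interior L = {}"
        using nonoverlapping_in_disjoint[OF F] by (simp add: G_def)
    qed
    from nonoverlapping_in_extend[OF this uv(1)] obtain q where
      "nonoverlapping_in u v q" "G J \<subseteq> q" "\<And>f. (\<Sum>K\<in>q. increment f K) = f v - f u"
      by metis
    then show "\<exists>q. nonoverlapping_in (Inf J) (Sup J) q \<and> G J \<subseteq> q \<and>
      (\<Sum>K\<in>q. increment f K) = increment f J"
      using uv by (intro exI[of _ q]) auto
  qed
  then obtain q where q: "\<And>J. J \<in> d \<Longrightarrow> nonoverlapping_in (Inf J) (Sup J) (q J)"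
    "\<And>J. J \<in> d \<Longrightarrow> G J \<subseteq> q J" "\<And>J. J \<in> d \<Longrightarrow> (\<Sum>K\<in>q J. increment f K) = increment f J"
    by metis
  have qE: "\<exists>u v. u < v \<and> a \<le> u \<and> v \<le> b \<and> K = {u..v} \<and> K \<subseteq> J" if JK: "J \<in> d" "K \<in> q J" for J K
  proof -
    obtain s t where st: "s < t" "a \<le> s" "t \<le> b" "J = {s..t}" using dE[OF JK(1)] by blast
    obtain u v where uv: "u < v" "Inf J \<le> u" "v \<le> Sup J" "K = {u..v}"
      using nonoverlapping_in_interval[OF q(1)[OF JK(1)] JK(2)] by metis
    have "s \<le> u" "v \<le> t" using uv(2,3) st(1) unfolding st(4) by simp_all
    then show ?thesis
      using st uv by (intro exI[of _ u] exI[of _ v]) simp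
  qed
  have qfin: "finite (q J)" if "J \<in> d" for J using q(1)[OF that] by (simp add: nonoverlapping_in_def)
  have disj: "interior K \<inter> interior L = {}"
    if "J \<in> d" "J' \<in> d" "J \<noteq> J'" "K \<in> q J" "L \<in> q J'" for J J' K L
  proof -
    have "interior K \<subseteq> interior J" "interior L \<subseteq> interior J'"
      using qE that by (meson interior_mono)+
    moreover have "interior J \<inter> interior J' = {}" using nonoverlapping_in_disjoint[OF d] that by simp
    ultimately show ?thesis by blast
  qed
  show thesis
  proof
    show "nonoverlapping_in a b (\<Union>J\<in>d. q J)"
      unfolding nonoverlapping_in_def
    proof (intro conjI ballI impI)
      show "finite (\<Union>J\<in>d. q J)" using fin qfin by auto
      fix K assume "K \<in> (\<Union>J\<in>d. q J)"
      then show "\<exists>u v. u < v \<and> a \<le> u \<and> v \<le> b \<and> K = {u..v}" using qE by blast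
    next
      fix K L assume "K \<in> (\<Union>J\<in>d. q J)" "L \<in> (\<Union>J\<in>d. q J)" and ne: "K \<noteq> L"
      then obtain J J' where J: "J \<in> d" "K \<in> q J" "J' \<in> d" "L \<in> q J'" by blast
      show "interior K \<inter> interior L = {}"
      proof (cases "J = J'")
        case True
        then show ?thesis using nonoverlapping_in_disjoint[OF q(1)[OF J(1)]] J ne by simp
      qed (use disj J in blast)
    qed
    \<comment> \<open>Cells of distinct members of \<open>d\<close> have disjoint interiors, and a
      common cell would be nondegenerate.\<close>
    have "q J \<inter> q J' = {}" if JJ: "J \<in> d" "J' \<in> d" "J \<noteq> J'" for J J'
    proof (rule ccontr)
      assume "q J \<inter> q J' \<noteq> {}"
      then obtain K where K: "K \<in> q J" "K \<in> q J'" by blast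
      then have "interior K = {}" using disj JJ by blast
      with qE[OF JJ(1) K(1)] show False by auto
    qed
    then have sumU: "(\<Sum>K\<in>(\<Union>J\<in>d. q J). g K) = (\<Sum>J\<in>d. \<Sum>K\<in>q J. g K)" for g :: "real set \<Rightarrow> real"
      using fin qfin by (intro sum.UNION_disjoint) auto
    have sumF: "(\<Sum>K\<in>F. g K) = (\<Sum>J\<in>d. \<Sum>K\<in>G J. g K)" for g :: "real set \<Rightarrow> real"
      unfolding G_def using fin Jof(1) by (intro sum.group[symmetric]) auto
    have one: "\<bar>increment f J\<bar> + 2 * (\<Sum>K\<in>G J. \<bar>increment f K\<bar>) \<le> (\<Sum>K\<in>q J. \<bar>increment f K\<bar>)"
      if J: "J \<in> d" for J
    proof -
      define s where "s = (\<Sum>K\<in>G J. increment f K)"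
      have G: "if 0 \<le> increment f J then increment f K \<le> 0 else 0 \<le> increment f K"
        if "K \<in> G J" for K
        using that Jof by (auto simp: G_def)
      \<comment> \<open>The pieces carry the sign opposite to that of the cell, so no cancellation
        occurs; \<open>increment f J - s\<close> is what remains for the other cells of
        \<open>q J\<close>.\<close>
      have abs: "\<bar>increment f J - s\<bar> = \<bar>increment f J\<bar> + (\<Sum>K\<in>G J. \<bar>increment f K\<bar>)"
      proof (cases "0 \<le> increment f J")
        case True
        then have "(\<Sum>K\<in>G J. \<bar>increment f K\<bar>) = - s" "s \<le> 0"
          using G unfolding s_def sum_negf[symmetric]
          by (auto intro!: sum.cong sum_nonpos)
        with True show ?thesis by simp
      next
        case False
        then have "(\<Sum>K\<in>G J. \<bar>increment f K\<bar>) = s" "0 \<le> s"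
          using G unfolding s_def by (auto intro!: sum.cong sum_nonneg)
        with False show ?thesis by simp
      qed
      have "(\<Sum>K\<in>q J. increment f K) = s + (\<Sum>K\<in>q J - G J. increment f K)"
        unfolding s_def using qfin[OF J] q(2)[OF J] by (metis add.commute sum.subset_diff)
      then have "increment f J - s = (\<Sum>K\<in>q J - G J. increment f K)"
        using q(3)[OF J] by simp
      then have "\<bar>increment f J - s\<bar> \<le> (\<Sum>K\<in>q J - G J. \<bar>increment f K\<bar>)"
        using sum_abs by metis
      moreover have "(\<Sum>K\<in>q J. \<bar>increment f K\<bar>)
          = (\<Sum>K\<in>q J - G J. \<bar>increment f K\<bar>) + (\<Sum>K\<in>G J. \<bar>increment f K\<bar>)"
        using qfin[OF J] q(2)[OF J] by (metis sum.subset_diff)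
      ultimately show ?thesis using abs by linarith
    qed
    show "(\<Sum>K\<in>d. \<bar>increment f K\<bar>) + 2 * (\<Sum>K\<in>F. \<bar>increment f K\<bar>)
        \<le> (\<Sum>K\<in>(\<Union>J\<in>d. q J). \<bar>increment f K\<bar>)"
      unfolding sumU sumF sum_distrib_left sum.distrib[symmetric]
      using one by (intro sum_mono) (simp add: sum_distrib_left)
  qed
qed

text \<open>Vitali's theorem selects countably many disjoint admissible intervals that cover
  \<open>A\<close> up to a negligible set, and a bound valid for finite subfamilies passes to the
  countable union. The predicate \<open>P\<close> decides which intervals are admissible, so an
  application only has to estimate finite families.\<close>

lemma Vitali_outer_bound:
  fixes A :: "real set"
  assumes P: "\<And>u v. P u v \<Longrightarrow> u < v \<and> a \<le> u \<and> v \<le> b"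
    and cov: "\<And>x d. x \<in> A \<Longrightarrow> 0 < d \<Longrightarrow> \<exists>u v. P u v \<and> u \<le> x \<and> x \<le> v \<and> x - d < u \<and> v < x + d"
    and bound: "\<And>F. nonoverlapping_in a b F \<Longrightarrow> (\<And>K. K \<in> F \<Longrightarrow> \<exists>u v. P u v \<and> K = {u..v}) \<Longrightarrow>
      (\<Sum>K\<in>F. measure lebesgue K) \<le> M"
  shows "\<exists>T. A \<subseteq> T \<and> T \<in> lmeasurable \<and> measure lebesgue T \<le> M"
proof -
  \<comment> \<open>Intervals are coded by centre and radius, because the covering theorem speaks of
    balls.\<close>
  define KK where "KK = {(c, r). P (c - r) (c + r)}"
  have r0: "0 < snd i" if "i \<in> KK" for i
    using that P by (force simp: KK_def)
  have "\<exists>i. i \<in> KK \<and> x \<in> cball (fst i) (snd i) \<and> snd i < d" if "x \<in> A" "0 < d" for x d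
  proof -
    obtain u v where uv: "P u v" "u \<le> x" "x \<le> v" "x - d < u" "v < x + d"
      using cov[OF \<open>x \<in> A\<close> \<open>0 < d\<close>] by blast
    have eq: "(u + v) / 2 - (v - u) / 2 = u" "(u + v) / 2 + (v - u) / 2 = v"
      by (simp_all add: field_simps)
    have "x \<in> cball ((u + v) / 2) ((v - u) / 2)"
      unfolding cball_eq_atLeastAtMost eq using uv by simp
    moreover have "(v - u) / 2 < d" using uv(4,5) by (simp add: field_simps)
    moreover have "((u + v) / 2, (v - u) / 2) \<in> KK"
      unfolding KK_def by (simp only: mem_Collect_eq prod.case eq uv)
    ultimately show ?thesis by (metis fst_conv snd_conv)
  qed
  from Vitali_covering_theorem_cballs[of KK snd A fst, OF r0 this]
  obtain C where C: "countable C" "C \<subseteq> KK"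
    "pairwise (\<lambda>i j. disjnt (cball (fst i) (snd i)) (cball (fst j) (snd j))) C"
    "negligible (A - (\<Union>i\<in>C. cball (fst i) (snd i)))"
    by blast
  define B where "B i = cball (fst i) (snd i)" for i :: "real \<times> real"
  have Bm: "B i \<in> lmeasurable" for i unfolding B_def by (rule lmeasurable_cball)
  have fin: "measure lebesgue (\<Union>i\<in>I. B i) \<le> M" if I: "I \<subseteq> C" "finite I" for I
  proof -
    have ival: "\<exists>u v. P u v \<and> B i = {u..v}" if "i \<in> I" for i
      using that I C(2) by (force simp: KK_def B_def cball_eq_atLeastAtMost)
    have dis: "interior K \<inter> interior L = {}" if KL: "K \<in> B ` I" "L \<in> B ` I" "K \<noteq> L" for K L
    proof -
      have "K \<inter> L = {}"
      proof -
        obtain i j where ij: "i \<in> I" "j \<in> I" "K = B i" "L = B j" using KL by blast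
        then have "i \<noteq> j" using KL by blast
        then show ?thesis
          using ij I(1) C(3) unfolding pairwise_def disjnt_def B_def by blast
      qed
      then show ?thesis using interior_subset by blast
    qed
    have "nonoverlapping_in a b (B ` I)"
      unfolding nonoverlapping_in_def
    proof (intro conjI ballI impI)
      show "finite (B ` I)" using I by simp
      show "\<exists>u v. u < v \<and> a \<le> u \<and> v \<le> b \<and> K = {u..v}" if "K \<in> B ` I" for K
        using that ival P by blast
    qed (use dis in auto)
    then have le: "(\<Sum>K\<in>B ` I. measure lebesgue K) \<le> M"
      using ival by (intro bound) auto
    have "measure lebesgue (\<Union>(B ` I)) \<le> (\<Sum>K\<in>B ` I. measure lebesgue K)"
      using I Bm measure_UNION_le[of "B ` I" "\<lambda>K. K" lebesgue] by (force dest: fmeasurableD)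
    with le show ?thesis by simp
  qed
  have UC: "(\<Union>i\<in>C. B i) \<in> lmeasurable" "measure lebesgue (\<Union>i\<in>C. B i) \<le> M"
    using fmeasurable_UN_bound[OF C(1) Bm fin] measure_UN_bound[OF C(1) Bm fin] by auto
  define N where "N = A - (\<Union>i\<in>C. B i)"
  have N: "negligible N" using C(4) by (simp add: N_def B_def)
  show ?thesis
  proof (intro exI conjI)
    show "A \<subseteq> (\<Union>i\<in>C. B i) \<union> N" by (auto simp: N_def)
    show "(\<Union>i\<in>C. B i) \<union> N \<in> lmeasurable"
      using UC(1) N negligible_imp_measurable by blast
    have "measure lebesgue ((\<Union>i\<in>C. B i) \<union> N) \<le> measure lebesgue (\<Union>i\<in>C. B i) + measure lebesgue N"
      using UC(1) N by (intro measure_Un_le) (auto simp: negligible_imp_sets fmeasurableD)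
    then show "measure lebesgue ((\<Union>i\<in>C. B i) \<union> N) \<le> M"
      using UC(2) N by (simp add: negligible_imp_measure0)
  qed
qed

text \<open>A form of "the upper derivative at \<open>x\<close> is at least \<open>r\<close>" with
  difference quotients over arbitrarily short intervals that contain \<open>x\<close>, rather than
  start there. These intervals are at the same time the Vitali cover.\<close>

definition steep_at :: "(real \<Rightarrow> real) \<Rightarrow> real \<Rightarrow> real \<Rightarrow> bool" where
  "steep_at f r x \<longleftrightarrow> (\<forall>d>0. \<exists>u v. u < v \<and> u \<le> x \<and> x \<le> v \<and> x - d < u \<and> v < x + d \<and>
     r * (v - u) < f v - f u)"

definition variation_le :: "real \<Rightarrow> real \<Rightarrow> (real \<Rightarrow> real) \<Rightarrow> real \<Rightarrow> bool" where
  "variation_le a b f B \<longleftrightarrow> (\<forall>F. nonoverlapping_in a b F \<longrightarrow> (\<Sum>K\<in>F. \<bar>increment f K\<bar>) \<le> B)"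

text \<open>
  Take a division whose variation is almost maximal.  On each cell, cover the points that are steep in both
  directions by small intervals whose increment has the sign opposite to that of the cell: inserting these
  intervals raises the variation by at least \<open>2 r\<close> times their total length, which must therefore be small.
\<close>

lemma negligible_steep_both:
  assumes ab: "a < b" and V: "variation_le a b f B" and r: "0 < r"
  shows "negligible {x \<in> {a<..<b}. steep_at f r x \<and> steep_at (\<lambda>x. - f x) r x}" (is "negligible ?A")
proof -
  have "\<exists>T. ?A \<subseteq> T \<and> T \<in> lmeasurable \<and> measure lebesgue T \<le> e" if e: "0 < e" for e
  proof -
    define S where "S = {\<Sum>K\<in>F. \<bar>increment f K\<bar> |F. nonoverlapping_in a b F}"
    have "nonoverlapping_in a b {}" by (simp add: nonoverlapping_in_def)
    then have Sne: "S \<noteq> {}" by (auto simp: S_def)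
    have Sb: "bdd_above S" using V by (auto simp: S_def variation_le_def intro!: bdd_aboveI[of _ B])
    \<comment> \<open>The gap is chosen so that inserted intervals, which raise the variation by at
      least \<open>2 * r\<close> times their length, can have total length at most
      \<open>e\<close>.\<close>
    have "Sup S - 2 * r * e < Sup S" using r e by simp
    then obtain F0 where F0: "nonoverlapping_in a b F0" "Sup S - 2 * r * e < (\<Sum>K\<in>F0. \<bar>increment f K\<bar>)"
      unfolding less_cSup_iff[OF Sne Sb] by (auto simp: S_def)
    obtain q where q: "nonoverlapping_in a b q" "F0 \<subseteq> q" "finite ({a..b} - (\<Union>K\<in>q. interior K))"
      using nonoverlapping_in_extend[OF F0(1) ab] by metis
    have "finite q" using q(1) by (simp add: nonoverlapping_in_def)
    then have qv: "Sup S - 2 * r * e < (\<Sum>K\<in>q. \<bar>increment f K\<bar>)"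
      using F0(2) sum_mono2[OF _ q(2), of "\<lambda>K. \<bar>increment f K\<bar>"] by fastforce
    \<comment> \<open>Each admissible interval lies in a single cell of \<open>q\<close> and runs
      against it; this is the hypothesis of \<open>nonoverlapping_refine\<close>.\<close>
    define P where "P u v \<longleftrightarrow> u < v \<and> a \<le> u \<and> v \<le> b \<and> (\<exists>J\<in>q. {u..v} \<subseteq> J \<and>
        (if 0 \<le> increment f J then f v - f u \<le> 0 else 0 \<le> f v - f u)) \<and> r * (v - u) < \<bar>f v - f u\<bar>" for u v
    have "\<exists>T. ?A \<inter> (\<Union>K\<in>q. interior K) \<subseteq> T \<and> T \<in> lmeasurable \<and> measure lebesgue T \<le> e"
    proof (rule Vitali_outer_bound[of P a b])
      show "u < v \<and> a \<le> u \<and> v \<le> b" if "P u v" for u v using that by (simp add: P_def)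
      show "\<exists>u v. P u v \<and> u \<le> x \<and> x \<le> v \<and> x - d < u \<and> v < x + d"
        if x: "x \<in> ?A \<inter> (\<Union>K\<in>q. interior K)" and d: "0 < d" for x d
      proof -
        obtain J where J: "J \<in> q" "x \<in> interior J" using x by blast
        then obtain e where e: "0 < e" "{x - e<..<x + e} \<subseteq> J"
          by (auto simp: mem_interior ball_eq_greaterThanLessThan)
        have sub: "{u..v} \<subseteq> J" if "x - min d e < u" "v < x + min d e" for u v
        proof -
          have "{u..v} \<subseteq> {x - e<..<x + e}" using that by auto
          with e(2) show ?thesis by blast
        qed
        obtain s t where "J = {s..t}" "a \<le> s" "t \<le> b"
          using nonoverlapping_in_interval[OF q(1) J(1)] by metis
        then have Jab: "J \<subseteq> {a..b}" by auto
        have m: "0 < min d e" using d e by simp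
        show ?thesis
        proof (cases "0 \<le> increment f J")
          case True
          have "steep_at (\<lambda>x. - f x) r x" using x by simp
          then obtain u v where uv: "u < v" "u \<le> x" "x \<le> v" "x - min d e < u" "v < x + min d e" "r * (v - u) < - f v - - f u"
            using m unfolding steep_at_def by blast
          have "0 < r * (v - u)" using r uv by simp
          moreover have "{u..v} \<subseteq> J" using sub[OF uv(4,5)] .
          moreover have "a \<le> u" "v \<le> b"
            using subset_trans[OF sub[OF uv(4,5)] Jab] uv(1) by auto
          ultimately have "P u v" using uv True J(1) unfolding P_def by auto
          then show ?thesis using uv by (intro exI[of _ u] exI[of _ v]) auto
        next
          case False
          have "steep_at f r x" using x by simp
          then obtain u v where uv: "u < v" "u \<le> x" "x \<le> v" "x - min d e < u" "v < x + min d e" "r * (v - u) < f v - f u"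
            using m unfolding steep_at_def by blast
          have "0 < r * (v - u)" using r uv by simp
          moreover have "{u..v} \<subseteq> J" using sub[OF uv(4,5)] .
          moreover have "a \<le> u" "v \<le> b"
            using subset_trans[OF sub[OF uv(4,5)] Jab] uv(1) by auto
          ultimately have "P u v" using uv False J(1) unfolding P_def by (auto intro!: bexI[of _ J])
          then show ?thesis using uv by (intro exI[of _ u] exI[of _ v]) auto
        qed
      qed
      show "(\<Sum>K\<in>F. measure lebesgue K) \<le> e"
        if F: "nonoverlapping_in a b F" and FP: "\<And>K. K \<in> F \<Longrightarrow> \<exists>u v. P u v \<and> K = {u..v}" for F
      proof -
        have "\<exists>J\<in>q. K \<subseteq> J \<and> (if 0 \<le> increment f J then increment f K \<le> 0 else 0 \<le> increment f K)"
          if K: "K \<in> F" for K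
          using FP[OF K] by (auto simp: P_def)
        then obtain d' where d': "nonoverlapping_in a b d'"
          "(\<Sum>K\<in>q. \<bar>increment f K\<bar>) + 2 * (\<Sum>K\<in>F. \<bar>increment f K\<bar>) \<le> (\<Sum>K\<in>d'. \<bar>increment f K\<bar>)"
          using nonoverlapping_refine[OF q(1) F] by blast
        have "(\<Sum>K\<in>d'. \<bar>increment f K\<bar>) \<le> Sup S"
          using d'(1) by (intro cSup_upper Sb) (auto simp: S_def)
        then have "(\<Sum>K\<in>F. \<bar>increment f K\<bar>) \<le> r * e" using d'(2) qv by linarith
        moreover have "(\<Sum>K\<in>F. r * measure lebesgue K) \<le> (\<Sum>K\<in>F. \<bar>increment f K\<bar>)"
        proof (rule sum_mono)
          fix K assume "K \<in> F"
          with FP obtain u v where "P u v" "K = {u..v}" by blast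
          then show "r * measure lebesgue K \<le> \<bar>increment f K\<bar>" by (auto simp: P_def)
        qed
        ultimately have "r * (\<Sum>K\<in>F. measure lebesgue K) \<le> r * e" by (simp add: sum_distrib_left)
        then show ?thesis using r by simp
      qed
    qed
    then obtain T where T: "?A \<inter> (\<Union>K\<in>q. interior K) \<subseteq> T" "T \<in> lmeasurable" "measure lebesgue T \<le> e"
      by blast
    define N where "N = {a..b} - (\<Union>K\<in>q. interior K)"
    have N: "negligible N" using q(3) by (simp add: N_def negligible_finite)
    have "measure lebesgue (T \<union> N) \<le> measure lebesgue T + measure lebesgue N"
      using T N by (intro measure_Un_le) (auto simp: negligible_imp_sets fmeasurableD)
    then have "measure lebesgue (T \<union> N) \<le> e" using T(3) N by (simp add: negligible_imp_measure0)
    moreover have "?A \<subseteq> T \<union> N" using T(1) by (auto simp: N_def)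
    moreover have "T \<union> N \<in> lmeasurable" using T(2) N negligible_imp_measurable by blast
    ultimately show ?thesis by blast
  qed
  then show ?thesis by (simp add: negligible_outer_le)
qed

text \<open>Intervals of slope above \<open>r\<close> with total length \<open>L\<close> have
  variation at least \<open>r * L\<close>, so \<open>L\<close> is at most \<open>B / r\<close>, and
  \<open>r\<close> is arbitrary.\<close>

lemma negligible_steep_all:
  assumes ab: "a < b" and V: "variation_le a b f B"
  shows "negligible {x \<in> {a<..<b}. \<forall>r. steep_at f r x}" (is "negligible ?A")
proof -
  have "nonoverlapping_in a b {}" by (simp add: nonoverlapping_in_def)
  with V have "(\<Sum>K\<in>{}. \<bar>increment f K\<bar>) \<le> B" unfolding variation_le_def by blast
  then have B0: "0 \<le> B" by simp
  have "\<exists>T. ?A \<subseteq> T \<and> T \<in> lmeasurable \<and> measure lebesgue T \<le> e" if e: "0 < e" for e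
  proof -
    \<comment> \<open>Gives \<open>B \<le> r * e\<close>; the summand 1 keeps \<open>r\<close>
      positive when \<open>B\<close> is 0.\<close>
    define r where "r = (B + 1) / e"
    have r: "0 < r" using B0 e by (simp add: r_def)
    define P where "P u v \<longleftrightarrow> u < v \<and> a \<le> u \<and> v \<le> b \<and> r * (v - u) < f v - f u" for u v
    show ?thesis
    proof (rule Vitali_outer_bound[of P a b])
      show "u < v \<and> a \<le> u \<and> v \<le> b" if "P u v" for u v using that by (simp add: P_def)
      show "\<exists>u v. P u v \<and> u \<le> x \<and> x \<le> v \<and> x - d < u \<and> v < x + d"
        if x: "x \<in> ?A" and d: "0 < d" for x d
      proof -
        define e where "e = min d (min (x - a) (b - x))"
        have e: "0 < e" using x d by (auto simp: e_def)
        have "steep_at f r x" using x by simp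
        then obtain u v where "u < v" "u \<le> x" "x \<le> v" "x - e < u" "v < x + e" "r * (v - u) < f v - f u"
          using e unfolding steep_at_def by blast
        then show ?thesis unfolding P_def e_def by (intro exI[of _ u] exI[of _ v]) auto
      qed
      show "(\<Sum>K\<in>F. measure lebesgue K) \<le> e"
        if F: "nonoverlapping_in a b F" and FP: "\<And>K. K \<in> F \<Longrightarrow> \<exists>u v. P u v \<and> K = {u..v}" for F
      proof -
        have "(\<Sum>K\<in>F. r * measure lebesgue K) \<le> (\<Sum>K\<in>F. \<bar>increment f K\<bar>)"
        proof (rule sum_mono)
          fix K assume "K \<in> F"
          with FP obtain u v where "P u v" "K = {u..v}" by blast
          then show "r * measure lebesgue K \<le> \<bar>increment f K\<bar>" by (auto simp: P_def)
        qed
        also have "\<dots> \<le> B" using V F by (simp add: variation_le_def)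
        also have "B \<le> r * e" using e by (simp add: r_def)
        finally have "r * (\<Sum>K\<in>F. measure lebesgue K) \<le> r * e" by (simp add: sum_distrib_left)
        then show ?thesis using r by simp
      qed
    qed
  qed
  then show ?thesis by (simp add: negligible_outer_le)
qed

lemma variation_le_uminus: "variation_le a b f B \<Longrightarrow> variation_le a b (\<lambda>x. - f x) B"
proof -
  have "\<bar>increment (\<lambda>x. - f x) K\<bar> = \<bar>increment f K\<bar>" for K by (simp add: increment_def abs_minus_commute)
  then show "variation_le a b f B \<Longrightarrow> variation_le a b (\<lambda>x. - f x) B" by (simp add: variation_le_def)
qed

text \<open>Subtracting a linear function centres a pair of slopes \<open>p < q\<close> at 0, where
  \<open>negligible_steep_both\<close> applies.\<close>

lemma variation_le_diff_linear:
  assumes "a < b" "variation_le a b f B"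
  shows "variation_le a b (\<lambda>x. f x - m * x) (B + \<bar>m\<bar> * (b - a))"
  unfolding variation_le_def
proof (intro allI impI)
  fix F assume F: "nonoverlapping_in a b F"
  then obtain q where q: "nonoverlapping_in a b q" "F \<subseteq> q" "(\<Sum>K\<in>q. increment (\<lambda>x. x) K) = b - a"
    using nonoverlapping_in_extend[OF F assms(1)] by metis
  have pos: "0 \<le> increment (\<lambda>x. x) K" if "K \<in> q" for K
    using nonoverlapping_in_interval[OF q(1) that] by (metis diff_ge_0_iff_ge increment_Icc less_imp_le)
  have "finite q" using q(1) by (simp add: nonoverlapping_in_def)
  then have len: "(\<Sum>K\<in>F. increment (\<lambda>x. x) K) \<le> b - a"
    unfolding q(3)[symmetric] using q(2) pos by (intro sum_mono2) auto
  have "(\<Sum>K\<in>F. \<bar>increment (\<lambda>x. f x - m * x) K\<bar>) \<le> (\<Sum>K\<in>F. \<bar>increment f K\<bar> + \<bar>m\<bar> * increment (\<lambda>x. x) K)"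
  proof (rule sum_mono)
    fix K assume "K \<in> F"
    then have p: "0 \<le> increment (\<lambda>x. x) K" using pos q(2) by blast
    have "increment (\<lambda>x. f x - m * x) K = increment f K - m * increment (\<lambda>x. x) K"
      by (simp add: increment_def algebra_simps)
    also have "\<bar>\<dots>\<bar> \<le> \<bar>increment f K\<bar> + \<bar>m * increment (\<lambda>x. x) K\<bar>" by (rule abs_triangle_ineq4)
    finally show "\<bar>increment (\<lambda>x. f x - m * x) K\<bar> \<le> \<bar>increment f K\<bar> + \<bar>m\<bar> * increment (\<lambda>x. x) K"
      using p by (simp add: abs_mult)
  qed
  also have "\<dots> \<le> B + \<bar>m\<bar> * (b - a)"
    using assms(2) F len
    by (simp add: sum.distrib sum_distrib_left[symmetric] variation_le_def add_mono mult_left_mono)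
  finally show "(\<Sum>K\<in>F. \<bar>increment (\<lambda>x. f x - m * x) K\<bar>) \<le> B + \<bar>m\<bar> * (b - a)" .
qed

lemma steep_at_mono: "steep_at f r x \<Longrightarrow> s \<le> r \<Longrightarrow> steep_at f s x"
  unfolding steep_at_def
  by (meson diff_gt_0_iff_gt le_less_trans less_imp_le mult_right_mono)

text \<open>The derivative is the infimum of the slopes at which \<open>f\<close> is not steep. The
  first two hypotheses make it finite, and the third forbids a gap between upper and lower
  derivative. Rational slopes keep the exceptional sets countable in number.\<close>

lemma differentiable_if_not_steep:
  assumes up: "\<not> (\<forall>r. steep_at f r x)" and dn: "\<not> (\<forall>r. steep_at (\<lambda>x. - f x) r x)"
    and mid: "\<And>p q. p \<in> \<rat> \<Longrightarrow> q \<in> \<rat> \<Longrightarrow> p < q \<Longrightarrow> \<not> (steep_at f q x \<and> steep_at (\<lambda>x. - f x) (- p) x)"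
  shows "f differentiable (at x)"
proof -
  define U where "U = {r. \<not> steep_at f r x}"
  have Une: "U \<noteq> {}" using up by (auto simp: U_def)
  obtain r0 where r0: "\<not> steep_at (\<lambda>x. - f x) r0 x" using dn by blast
  \<comment> \<open>Otherwise one short interval to the right of \<open>x\<close> would satisfy two
    contradictory slope bounds.\<close>
  have Ubd: "- r0 \<le> r" if "r \<in> U" for r
  proof (rule ccontr)
    assume "\<not> - r0 \<le> r"
    have "\<not> steep_at f r x" using that by (simp add: U_def)
    then obtain d1 where d1: "0 < d1" "\<And>u v. u < v \<Longrightarrow> u \<le> x \<Longrightarrow> x \<le> v \<Longrightarrow> x - d1 < u \<Longrightarrow> v < x + d1 \<Longrightarrow> f v - f u \<le> r * (v - u)"
      unfolding steep_at_def by (meson not_less)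
    obtain d2 where d2: "0 < d2" "\<And>u v. u < v \<Longrightarrow> u \<le> x \<Longrightarrow> x \<le> v \<Longrightarrow> x - d2 < u \<Longrightarrow> v < x + d2 \<Longrightarrow> - f v - - f u \<le> r0 * (v - u)"
      using r0 unfolding steep_at_def by (meson not_less)
    define v where "v = x + min d1 d2 / 2"
    have v: "x < v" "v < x + d1" "v < x + d2" using d1 d2 by (auto simp: v_def)
    have "f v - f x \<le> r * (v - x)" "- f v - - f x \<le> r0 * (v - x)"
      using d1(2)[of x v] d2(2)[of x v] v d1(1) d2(1) by auto
    then have "0 \<le> (r + r0) * (v - x)" by (simp add: algebra_simps)
    with v(1) \<open>\<not> - r0 \<le> r\<close> show False by (simp add: zero_le_mult_iff)
  qed
  have bdd: "bdd_below U" using Ubd by (rule bdd_belowI)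
  define D where "D = Inf U"
  have above: "\<not> steep_at f r x" if "D < r" for r
    using that cInf_less_iff[OF Une bdd, of r] steep_at_mono[of f r x] by (auto simp: D_def U_def)
  have stp: "steep_at f r x" if "r < D" for r
    using that cInf_lower[OF _ bdd, of r] by (auto simp: D_def U_def)
  \<comment> \<open>A lower derivative under \<open>D\<close> would leave room for two rationals
    between it and \<open>D\<close>, against \<open>mid\<close>.\<close>
  have below: "\<not> steep_at (\<lambda>x. - f x) (- r) x" if r: "r < D" for r
  proof
    assume s: "steep_at (\<lambda>x. - f x) (- r) x"
    obtain p where p: "p \<in> \<rat>" "r < p" "p < D" using Rats_dense_in_real[OF r] by blast
    obtain q where q: "q \<in> \<rat>" "p < q" "q < D" using Rats_dense_in_real[OF p(3)] by blast
    have "steep_at (\<lambda>x. - f x) (- p) x" using steep_at_mono[OF s] p by simp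
    with mid[OF p(1) q(1,2)] stp[OF q(3)] show False by simp
  qed
  have "(f has_real_derivative D) (at x)"
    unfolding has_field_derivative_iff LIM_eq
  proof (intro allI impI)
    fix e :: real assume e: "0 < e"
    have "\<not> steep_at f (D + e/2) x" using above[of "D + e/2"] e by simp
    then obtain d1 where d1: "0 < d1" "\<And>u v. u < v \<Longrightarrow> u \<le> x \<Longrightarrow> x \<le> v \<Longrightarrow> x - d1 < u \<Longrightarrow> v < x + d1 \<Longrightarrow> f v - f u \<le> (D + e/2) * (v - u)"
      unfolding steep_at_def by (meson not_less)
    have "\<not> steep_at (\<lambda>x. - f x) (- (D - e/2)) x" using below[of "D - e/2"] e by simp
    then obtain d2 where d2: "0 < d2" "\<And>u v. u < v \<Longrightarrow> u \<le> x \<Longrightarrow> x \<le> v \<Longrightarrow> x - d2 < u \<Longrightarrow> v < x + d2 \<Longrightarrow> - f v - - f u \<le> - (D - e/2) * (v - u)"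
      unfolding steep_at_def by (meson not_less)
    have "norm ((f y - f x) / (y - x) - D) < e" if y: "y \<noteq> x" "norm (y - x) < min d1 d2" for y
    proof (cases "x < y")
      case True
      have "f y - f x \<le> (D + e/2) * (y - x)" "- f y - - f x \<le> - (D - e/2) * (y - x)"
        using d1(2)[of x y] d2(2)[of x y] d1(1) d2(1) y True by auto
      then have "f y - f x \<le> (D + e/2) * (y - x)" "(D - e/2) * (y - x) \<le> f y - f x"
        unfolding mult_minus_left by linarith+
      then have "(f y - f x) / (y - x) \<le> D + e/2" "D - e/2 \<le> (f y - f x) / (y - x)"
        using True by (simp_all only: pos_divide_le_eq pos_le_divide_eq diff_gt_0_iff_gt)
      then show ?thesis using e unfolding real_norm_def abs_less_iff by linarith
    next
      case False
      then have lt: "y < x" using y by simp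
      have "f x - f y \<le> (D + e/2) * (x - y)" "- f x - - f y \<le> - (D - e/2) * (x - y)"
        using d1(2)[of y x] d2(2)[of y x] d1(1) d2(1) y lt by auto
      then have "f x - f y \<le> (D + e/2) * (x - y)" "(D - e/2) * (x - y) \<le> f x - f y"
        unfolding mult_minus_left by linarith+
      then have "(f x - f y) / (x - y) \<le> D + e/2" "D - e/2 \<le> (f x - f y) / (x - y)"
        using lt by (simp_all only: pos_divide_le_eq pos_le_divide_eq diff_gt_0_iff_gt)
      moreover have "(f y - f x) / (y - x) = (f x - f y) / (x - y)"
        by (metis minus_diff_eq minus_divide_divide)
      ultimately show ?thesis using e unfolding real_norm_def abs_less_iff by linarith
    qed
    then show "\<exists>s>0. \<forall>y. y \<noteq> x \<and> norm (y - x) < s \<longrightarrow> norm ((f y - f x) / (y - x) - D) < e"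
      using d1(1) d2(1) by (intro exI[of _ "min d1 d2"]) auto
  qed
  then show ?thesis using real_differentiable_def by blast
qed

text \<open>At a point of non-differentiability, \<open>f\<close> or its negative is steep to every
  order, or two rational slopes separate the upper from the lower derivative: a countable union of
  negligible sets.\<close>

theorem variation_le_imp_differentiable_ae:
  assumes ab: "a < b" and V: "variation_le a b f B"
  shows "negligible {x \<in> {a<..<b}. \<not> f differentiable (at x)}"
proof (rule negligible_subset)
  define A where "A p q = {x \<in> {a<..<b}. p < q \<and> steep_at f q x \<and> steep_at (\<lambda>x. - f x) (- p) x}" for p q
  have A: "negligible (A p q)" for p q
  proof (cases "p < q")
    case True
    \<comment> \<open>Subtracting the midpoint slope \<open>m\<close> turns the bounds
      \<open>q\<close> for \<open>f\<close> and \<open>- p\<close> for its negative into the same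
      positive number \<open>r\<close>, half the gap.\<close>
    define m where "m = (p + q) / 2"
    define r where "r = (q - p) / 2"
    have r: "0 < r" using True by (simp add: r_def)
    have rq: "r = q - m" and rp: "r = m - p" by (simp_all add: r_def m_def field_simps)
    have "steep_at (\<lambda>x. f x - m * x) r x" if "steep_at f q x" for x
      using that unfolding steep_at_def rq by (simp add: algebra_simps)
    moreover have "steep_at (\<lambda>x. - (f x - m * x)) r x" if "steep_at (\<lambda>x. - f x) (- p) x" for x
      using that unfolding steep_at_def rp by (simp add: algebra_simps)
    ultimately have "A p q \<subseteq> {x \<in> {a<..<b}. steep_at (\<lambda>x. f x - m * x) r x \<and> steep_at (\<lambda>x. - (f x - m * x)) r x}"
      by (auto simp: A_def)
    then show ?thesis
      using negligible_steep_both[OF ab variation_le_diff_linear[OF ab V, of m] r]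
      by (rule negligible_subset[rotated])
  qed (simp add: A_def)
  have "negligible (\<Union>p\<in>\<rat>. \<Union>q\<in>\<rat>. A p q)"
    using A countable_rat by (intro negligible_countable_Union) (auto intro!: negligible_countable_Union)
  then show "negligible ((\<Union>p\<in>\<rat>. \<Union>q\<in>\<rat>. A p q) \<union> {x \<in> {a<..<b}. \<forall>r. steep_at f r x}
      \<union> {x \<in> {a<..<b}. \<forall>r. steep_at (\<lambda>x. - f x) r x})"
    using negligible_steep_all[OF ab V] negligible_steep_all[OF ab variation_le_uminus[OF V]]
    by (intro negligible_Un)
  show "{x \<in> {a<..<b}. \<not> f differentiable (at x)} \<subseteq> (\<Union>p\<in>\<rat>. \<Union>q\<in>\<rat>. A p q)
      \<union> {x \<in> {a<..<b}. \<forall>r. steep_at f r x} \<union> {x \<in> {a<..<b}. \<forall>r. steep_at (\<lambda>x. - f x) r x}"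
    using differentiable_if_not_steep unfolding A_def by blast
qed

section \<open>Absolutely continuous functions: differentiability and the fundamental
  theorem\<close>

lemma absolutely_continuous_on_finite:
  assumes h: "absolutely_continuous_on S h" and "0 < \<epsilon>"
  obtains \<delta> where "0 < \<delta>"
    "\<And>I (u :: 'i \<Rightarrow> real) v. finite I \<Longrightarrow> (\<And>i. i \<in> I \<Longrightarrow> u i \<le> v i \<and> {u i..v i} \<subseteq> S) \<Longrightarrow>
      disjoint_family_on (\<lambda>i. {u i<..<v i}) I \<Longrightarrow> (\<Sum>i\<in>I. v i - u i) < \<delta> \<Longrightarrow>
      (\<Sum>i\<in>I. \<bar>h (v i) - h (u i)\<bar>) < \<epsilon>"
proof -
  from h[unfolded absolutely_continuous_on_def, THEN spec, THEN mp, OF \<open>0 < \<epsilon>\<close>]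
  obtain \<delta> where \<delta>: "0 < \<delta>" and D: "\<forall>(n::nat) a b. (\<forall>i<n. a i \<le> b i \<and> {a i..b i} \<subseteq> S) \<and>
        (\<forall>i<n. \<forall>j<n. i \<noteq> j \<longrightarrow> {a i<..<b i} \<inter> {a j<..<b j} = {}) \<and>
        (\<Sum>i<n. b i - a i) < \<delta> \<longrightarrow> (\<Sum>i<n. \<bar>h (b i) - h (a i)\<bar>) < \<epsilon>"
    by (elim exE conjE)
  show thesis
  proof
    show "0 < \<delta>" by (rule \<delta>)
    fix I :: "'i set" and u v :: "'i \<Rightarrow> real"
    assume I: "finite I" "\<And>i. i \<in> I \<Longrightarrow> u i \<le> v i \<and> {u i..v i} \<subseteq> S"
      "disjoint_family_on (\<lambda>i. {u i<..<v i}) I" "(\<Sum>i\<in>I. v i - u i) < \<delta>"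
    \<comment> \<open>The order of the intervals is immaterial, so any enumeration serves; cells of
      a division can then index themselves.\<close>
    obtain f where f: "bij_betw f {..<card I} I"
      using ex_bij_betw_nat_finite[OF I(1)] by (auto simp: atLeast0LessThan)
    have sum: "(\<Sum>i<card I. g (f i)) = (\<Sum>i\<in>I. g i)" for g :: "'i \<Rightarrow> real"
      using sum.reindex_bij_betw[OF f] .
    have mem: "f i \<in> I" if "i < card I" for i using f that by (auto simp: bij_betw_def)
    have "\<forall>i<card I. \<forall>j<card I. i \<noteq> j \<longrightarrow> {u (f i)<..<v (f i)} \<inter> {u (f j)<..<v (f j)} = {}"
    proof (intro allI impI)
      fix i j assume ij: "i < card I" "j < card I" "i \<noteq> j"
      then have "f i \<noteq> f j" using f by (auto simp: bij_betw_def inj_on_def)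
      then show "{u (f i)<..<v (f i)} \<inter> {u (f j)<..<v (f j)} = {}"
        using I(3) mem ij unfolding disjoint_family_on_def by blast
    qed
    moreover have "\<forall>i<card I. u (f i) \<le> v (f i) \<and> {u (f i)..v (f i)} \<subseteq> S"
      using I(2) mem by simp
    moreover have "(\<Sum>i<card I. v (f i) - u (f i)) < \<delta>"
      using I(4) sum[of "\<lambda>i. v i - u i"] by simp
    ultimately have "(\<Sum>i<card I. \<bar>h (v (f i)) - h (u (f i))\<bar>) < \<epsilon>"
      using D[THEN spec, of "card I", THEN spec, of "\<lambda>i. u (f i)", THEN spec, of "\<lambda>i. v (f i)"] by simp
    then show "(\<Sum>i\<in>I. \<bar>h (v i) - h (u i)\<bar>) < \<epsilon>"
      using sum[of "\<lambda>i. \<bar>h (v i) - h (u i)\<bar>"] by simp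
  qed
qed

lemma absolutely_continuous_on_subset:
  assumes "absolutely_continuous_on S h" "T \<subseteq> S"
  shows "absolutely_continuous_on T h"
  unfolding absolutely_continuous_on_def
proof (intro allI impI)
  fix \<epsilon> :: real assume "0 < \<epsilon>"
  from assms(1)[unfolded absolutely_continuous_on_def, THEN spec, THEN mp, OF this]
  obtain \<delta> where \<delta>: "0 < \<delta>" and D: "\<forall>(n::nat) a b. (\<forall>i<n. a i \<le> b i \<and> {a i..b i} \<subseteq> S) \<and>
        (\<forall>i<n. \<forall>j<n. i \<noteq> j \<longrightarrow> {a i<..<b i} \<inter> {a j<..<b j} = {}) \<and>
        (\<Sum>i<n. b i - a i) < \<delta> \<longrightarrow> (\<Sum>i<n. \<bar>h (b i) - h (a i)\<bar>) < \<epsilon>"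
    by (elim exE conjE)
  show "\<exists>\<delta>>0. \<forall>(n::nat) a b. (\<forall>i<n. a i \<le> b i \<and> {a i..b i} \<subseteq> T) \<and>
        (\<forall>i<n. \<forall>j<n. i \<noteq> j \<longrightarrow> {a i<..<b i} \<inter> {a j<..<b j} = {}) \<and>
        (\<Sum>i<n. b i - a i) < \<delta> \<longrightarrow> (\<Sum>i<n. \<bar>h (b i) - h (a i)\<bar>) < \<epsilon>"
  proof (intro exI[of _ \<delta>] conjI allI impI \<delta>)
    fix n :: nat and a b :: "nat \<Rightarrow> real"
    assume A: "(\<forall>i<n. a i \<le> b i \<and> {a i..b i} \<subseteq> T) \<and>
        (\<forall>i<n. \<forall>j<n. i \<noteq> j \<longrightarrow> {a i<..<b i} \<inter> {a j<..<b j} = {}) \<and>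
        (\<Sum>i<n. b i - a i) < \<delta>"
    then have "\<forall>i<n. a i \<le> b i \<and> {a i..b i} \<subseteq> S" using assms(2) subset_trans by metis
    with A D[THEN spec, of n, THEN spec, of a, THEN spec, of b]
    show "(\<Sum>i<n. \<bar>h (b i) - h (a i)\<bar>) < \<epsilon>" by simp
  qed
qed

text \<open>On an interval shorter than the \<delta> that belongs to \<epsilon> = 1 the variation is
  at most 1, so the unit interval splits into finitely many cells on which the theorem on bounded
  variation applies.\<close>

lemma absolutely_continuous_on_imp_differentiable_ae:
  assumes h: "absolutely_continuous_on {0..1} h"
  shows "negligible {x \<in> {0..1}. \<not> h differentiable (at x)}"
proof -
  obtain \<delta> where \<delta>: "0 < \<delta>" and D: "\<And>I (u :: real set \<Rightarrow> real) v. finite I \<Longrightarrow> (\<And>i. i \<in> I \<Longrightarrow> u i \<le> v i \<and> {u i..v i} \<subseteq> {0..1}) \<Longrightarrow>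
      disjoint_family_on (\<lambda>i. {u i<..<v i}) I \<Longrightarrow> (\<Sum>i\<in>I. v i - u i) < \<delta> \<Longrightarrow>
      (\<Sum>i\<in>I. \<bar>h (v i) - h (u i)\<bar>) < 1"
    using absolutely_continuous_on_finite[OF h zero_less_one, where 'i="real set"] by blast
  obtain N :: nat where N: "0 < N" "1 / real N < \<delta>"
    using \<delta> by (metis nat_approx_posE of_nat_0_less_iff zero_less_Suc)
  have cell: "variation_le s t h 1" if st: "0 \<le> s" "s < t" "t \<le> 1" "t - s < \<delta>" for s t
    unfolding variation_le_def
  proof (intro allI impI)
    fix F assume F: "nonoverlapping_in s t F"
    have E: "\<exists>u v. u < v \<and> s \<le> u \<and> v \<le> t \<and> K = {u..v}" if "K \<in> F" for K
      using nonoverlapping_in_interval[OF F that] by metis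
    obtain q where q: "nonoverlapping_in s t q" "F \<subseteq> q" "(\<Sum>K\<in>q. increment (\<lambda>x. x) K) = t - s"
      using nonoverlapping_in_extend[OF F st(2)] by metis
    have pos: "0 \<le> increment (\<lambda>x. x) K" if "K \<in> q" for K
      using nonoverlapping_in_interval[OF q(1) that] by (metis diff_ge_0_iff_ge increment_Icc less_imp_le)
    have "finite q" using q(1) by (simp add: nonoverlapping_in_def)
    then have len: "(\<Sum>K\<in>F. increment (\<lambda>x. x) K) \<le> t - s"
      unfolding q(3)[symmetric] using q(2) pos by (intro sum_mono2) auto
    have "(\<Sum>K\<in>F. \<bar>h (Sup K) - h (Inf K)\<bar>) < 1"
    proof (rule D)
      show "finite F" using F by (simp add: nonoverlapping_in_def)
      show "Inf K \<le> Sup K \<and> {Inf K..Sup K} \<subseteq> {0..1}" if "K \<in> F" for K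
        using E[OF that] st by auto
      show "disjoint_family_on (\<lambda>K. {Inf K<..<Sup K}) F"
        unfolding disjoint_family_on_def
      proof (intro ballI impI)
        fix K L assume KL: "K \<in> F" "L \<in> F" "K \<noteq> L"
        then have "interior K \<inter> interior L = {}" by (rule nonoverlapping_in_disjoint[OF F])
        moreover obtain u v where "u < v" "K = {u..v}" using E[OF KL(1)] by blast
        moreover obtain u' v' where "u' < v'" "L = {u'..v'}" using E[OF KL(2)] by blast
        ultimately show "{Inf K<..<Sup K} \<inter> {Inf L<..<Sup L} = {}" by simp
      qed
      show "(\<Sum>K\<in>F. Sup K - Inf K) < \<delta>" using len st(4) by (simp add: increment_def)
    qed
    then show "(\<Sum>K\<in>F. \<bar>increment h K\<bar>) \<le> 1" by (simp add: increment_def)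
  qed
  define Bad where "Bad i = {x \<in> {real i / N<..<real (Suc i) / N}. \<not> h differentiable (at x)}" for i
  have Bad: "negligible (Bad i)" if "i < N" for i
    unfolding Bad_def
  proof (rule variation_le_imp_differentiable_ae)
    show "real i / N < real (Suc i) / N" using N by (simp add: divide_strict_right_mono)
    show "variation_le (real i / N) (real (Suc i) / N) h 1"
      using N that by (intro cell) (auto simp: field_simps)
  qed
  \<comment> \<open>The cells are open, so the grid points are added as a finite set.\<close>
  have "{x \<in> {0..1}. \<not> h differentiable (at x)} \<subseteq> (\<Union>i\<in>{..<N}. Bad i) \<union> (\<lambda>i. real i / N) ` {..N}"
  proof
    fix x assume x: "x \<in> {x \<in> {0..1}. \<not> h differentiable (at x)}"
    define i where "i = nat \<lfloor>x * N\<rfloor>"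
    have xN: "0 \<le> x * N" "x * N \<le> N" using x by (auto simp: mult_left_le_one_le)
    have i: "real i \<le> x * N" "x * N < real (Suc i)"
      using xN(1) unfolding i_def by linarith+
    have "i \<le> N" using i xN by linarith
    show "x \<in> (\<Union>i\<in>{..<N}. Bad i) \<union> (\<lambda>i. real i / N) ` {..N}"
    proof (cases "real i = x * N")
      case True
      then have "x = real i / N" using N by simp
      with \<open>i \<le> N\<close> show ?thesis by blast
    next
      case False
      then have "real i < x * N" using i by simp
      then have "i < N" using xN by linarith
      moreover have "x \<in> Bad i"
        using \<open>real i < x * N\<close> i(2) N x unfolding Bad_def by (simp add: field_simps)
      ultimately show ?thesis by blast
    qed
  qed
  moreover have "negligible ((\<Union>i\<in>{..<N}. Bad i) \<union> (\<lambda>i. real i / N) ` {..N})"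
    using Bad by (intro negligible_Un negligible_Union) auto
  ultimately show ?thesis by (rule negligible_subset[rotated])
qed

text \<open>A Henstock-Kurzweil argument with two kinds of tags. At a tag outside \<open>N\<close>
  the gauge comes from the derivative, as in the classical theorem. The cells tagged in
  \<open>N\<close> lie in an open set of measure below \<delta>, and absolute continuity makes the
  sum of their increments small.\<close>

lemma absolutely_continuous_on_FTC:
  assumes ab: "a \<le> b" and h: "absolutely_continuous_on {a..b} h" and N: "negligible N"
    and diff: "\<And>x. x \<in> {a..b} - N \<Longrightarrow> h differentiable (at x)"
  shows "(deriv h has_integral (h b - h a)) {a..b}"
proof (cases "a = b")
  case False
  with ab have ab: "a < b" by simp
  \<comment> \<open>With the value 0 on \<open>N\<close>, a cell tagged there contributes nothing
    but its increment to the error.\<close>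
  define g where "g x = (if x \<in> N then 0 else deriv h x)" for x
  have "(g has_integral (h b - h a)) {a..b}"
    unfolding has_integral_factor_content_real
  proof (intro allI impI)
    fix e :: real assume e: "0 < e"
    \<comment> \<open>Half of the permitted error \<open>e * (b - a)\<close> for the tags in
      \<open>N\<close>; the other half is spent on the remaining tags.\<close>
    define e2 where "e2 = e * (b - a) / 2"
    have "0 < e2" using e ab by (simp add: e2_def)
    then obtain \<delta> where \<delta>: "0 < \<delta>" and D: "\<And>I (u :: real \<times> real set \<Rightarrow> real) v. finite I \<Longrightarrow> (\<And>i. i \<in> I \<Longrightarrow> u i \<le> v i \<and> {u i..v i} \<subseteq> {a..b}) \<Longrightarrow>
        disjoint_family_on (\<lambda>i. {u i<..<v i}) I \<Longrightarrow> (\<Sum>i\<in>I. v i - u i) < \<delta> \<Longrightarrow>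
        (\<Sum>i\<in>I. \<bar>h (v i) - h (u i)\<bar>) < e2"
      using absolutely_continuous_on_finite[OF h, where 'i="real \<times> real set"] by blast
    obtain W where W: "open W" "N \<subseteq> W" "W - N \<in> lmeasurable" "emeasure lebesgue (W - N) < ennreal \<delta>"
      using sets_lebesgue_outer_open[OF negligible_imp_sets[OF N] \<delta>] by blast
    have WN: "W = (W - N) \<union> N" using W(2) by blast
    have Wm: "W \<in> lmeasurable" using W(3) N negligible_imp_measurable by (subst WN) blast
    have "measure lebesgue (W - N) < \<delta>"
      using W(3,4) \<delta> by (metis emeasure_eq_measure2 ennreal_less_iff measure_nonneg)
    moreover have "measure lebesgue ((W - N) \<union> N) \<le> measure lebesgue (W - N) + measure lebesgue N"
      using W(3) N by (intro measure_Un_le) (auto simp: negligible_imp_sets fmeasurableD)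
    ultimately have Wmeas: "measure lebesgue W < \<delta>"
      using N WN by (simp add: negligible_imp_measure0)
    have "\<forall>x\<in>{a..b} - N. \<exists>s. 0 < s \<and> (\<forall>y. \<bar>y - x\<bar> < s \<longrightarrow> \<bar>h y - h x - g x * (y - x)\<bar> \<le> e / 2 * \<bar>y - x\<bar>)"
    proof
      fix x assume x: "x \<in> {a..b} - N"
      have "(h has_real_derivative g x) (at x)"
        using diff[OF x] x by (simp add: g_def DERIV_deriv_iff_real_differentiable)
      then have "\<forall>e>0. \<exists>s>0. \<forall>y. norm (y - x) < s \<longrightarrow> norm (h y - h x - g x * (y - x)) \<le> e * norm (y - x)"
        unfolding has_field_derivative_def has_derivative_at_alt by blast
      from this[rule_format, of "e / 2"] e
      show "\<exists>s. 0 < s \<and> (\<forall>y. \<bar>y - x\<bar> < s \<longrightarrow> \<bar>h y - h x - g x * (y - x)\<bar> \<le> e / 2 * \<bar>y - x\<bar>)"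
        by (simp only: real_norm_def half_gt_zero)
    qed
    from bchoice[OF this] obtain s where s: "\<And>x. x \<in> {a..b} - N \<Longrightarrow> 0 < s x"
      "\<And>x y. x \<in> {a..b} - N \<Longrightarrow> \<bar>y - x\<bar> < s x \<Longrightarrow> \<bar>h y - h x - g x * (y - x)\<bar> \<le> e / 2 * \<bar>y - x\<bar>"
      by blast
    \<comment> \<open>The first branch confines all cells tagged in \<open>N\<close> to the small
      open set \<open>W\<close>.\<close>
    define \<gamma> where "\<gamma> x = (if x \<in> N then W else if x \<in> {a..b} then ball x (s x) else UNIV)" for x
    have gauge: "gauge \<gamma>"
      unfolding gauge_def
    proof
      fix x show "x \<in> \<gamma> x \<and> open (\<gamma> x)"
        using W(1,2) s(1)[of x] by (cases "x \<in> N"; cases "x \<in> {a..b}") (auto simp: \<gamma>_def)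
    qed
    have main: "norm ((\<Sum>(x, K)\<in>p. measure lborel K *\<^sub>R g x) - (h b - h a)) \<le> e * measure lborel {a..b}"
      if p: "p tagged_division_of {a..b}" and fine: "\<gamma> fine p" for p
    proof -
      note d = tagged_division_ofD[OF p]
      have ival: "\<exists>u v. K = {u..v} \<and> u \<le> x \<and> x \<le> v" if xK: "(x, K) \<in> p" for x K
      proof -
        obtain u v where uv: "K = {u..v}" using d(4)[OF xK] unfolding box_real by blast
        with d(2)[OF xK] show ?thesis by (intro exI[of _ u] exI[of _ v]) simp
      qed
      define pN where "pN = {i \<in> p. fst i \<in> N}"
      define err where "err i = measure lborel (snd i) * g (fst i) - increment h (snd i)" for i
      have fin: "finite p" "finite pN" using d(1) by (auto simp: pN_def)
      have "(\<Sum>(x, K)\<in>p. measure lborel K *\<^sub>R g x) - (h b - h a) = (\<Sum>i\<in>p. err i)"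
        using additive_tagged_division_1[OF less_imp_le[OF ab] p, of h]
        by (simp add: err_def sum_subtractf increment_def case_prod_unfold)
      also have "\<dots> = (\<Sum>i\<in>p - pN. err i) + (\<Sum>i\<in>pN. err i)"
        using fin by (intro sum.subset_diff) (auto simp: pN_def)
      finally have split: "(\<Sum>(x, K)\<in>p. measure lborel K *\<^sub>R g x) - (h b - h a) = \<dots>" .
      have "\<bar>\<Sum>i\<in>p - pN. err i\<bar> \<le> (\<Sum>i\<in>p - pN. e / 2 * measure lborel (snd i))"
      proof (rule order_trans[OF sum_abs sum_mono])
        fix i assume i: "i \<in> p - pN"
        obtain x K where xK: "i = (x, K)" by (cases i)
        then have xKp: "(x, K) \<in> p" and xN: "x \<notin> N" using i by (auto simp: pN_def)
        obtain u v where uv: "K = {u..v}" "u \<le> x" "x \<le> v" using ival[OF xKp] by blast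
        have K: "Inf K = u" "Sup K = v" "measure lborel K = v - u" using uv by simp_all
        have xab: "x \<in> {a..b} - N" using d(2,3)[OF xKp] xN by blast
        then have "\<gamma> x = ball x (s x)" using xN by (simp add: \<gamma>_def)
        then have "{u..v} \<subseteq> ball x (s x)" using fineD[OF fine xKp] uv(1) by simp
        moreover have "u \<in> {u..v}" "v \<in> {u..v}" using uv by simp_all
        ultimately have "u \<in> ball x (s x)" "v \<in> ball x (s x)" by blast+
        then have "\<bar>u - x\<bar> < s x" "\<bar>v - x\<bar> < s x" by (simp_all add: dist_real_def abs_minus_commute)
        from s(2)[OF xab this(1)] s(2)[OF xab this(2)]
        have b1: "\<bar>h u - h x - g x * (u - x)\<bar> \<le> e / 2 * (x - u)"
          and b2: "\<bar>h v - h x - g x * (v - x)\<bar> \<le> e / 2 * (v - x)" using uv(2,3) by simp_all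
        \<comment> \<open>The tag may lie inside its cell, so the error is a difference of two
          first-order errors at \<open>x\<close>, whose bounds add up to the length of the
          cell.\<close>
        have "err i = (h u - h x - g x * (u - x)) - (h v - h x - g x * (v - x))"
          by (simp add: err_def xK K increment_def algebra_simps)
        also have "\<bar>\<dots>\<bar> \<le> e / 2 * (x - u) + e / 2 * (v - x)"
          using b1 b2 by linarith
        also have "\<dots> = e / 2 * (v - u)" by (simp add: field_simps)
        finally show "\<bar>err i\<bar> \<le> e / 2 * measure lborel (snd i)" by (simp add: xK K)
      qed
      also have "\<dots> \<le> (\<Sum>i\<in>p. e / 2 * measure lborel (snd i))"
      proof (rule sum_mono2)
        show "finite p" by (rule fin)
        show "p - pN \<subseteq> p" by blast
        show "0 \<le> e / 2 * measure lborel (snd i)" for i :: "real \<times> real set" using e by simp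
      qed
      also have "\<dots> = e / 2 * (\<Sum>i\<in>p. measure lborel (snd i))"
        by (simp only: sum_distrib_left)
      also have "(\<Sum>i\<in>p. measure lborel (snd i)) = b - a"
        using additive_content_tagged_division[of p a b] p ab
        by (simp add: case_prod_unfold)
      finally have good: "\<bar>\<Sum>i\<in>p - pN. err i\<bar> \<le> e / 2 * (b - a)" .
      have dis: "disjoint_family_on (\<lambda>i. {Inf (snd i)<..<Sup (snd i)}) pN"
        unfolding disjoint_family_on_def
      proof (intro ballI impI)
        fix i j assume ij: "i \<in> pN" "j \<in> pN" "i \<noteq> j"
        obtain x K y L where xy: "i = (x, K)" "j = (y, L)" by (cases i, cases j)
        have "interior K \<inter> interior L = {}" using d(5)[of x K y L] ij xy by (auto simp: pN_def)
        moreover have "{Inf K<..<Sup K} \<subseteq> interior K" if "(x, K) \<in> p" for x K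
          using ival[OF that] by fastforce
        then have "{Inf K<..<Sup K} \<subseteq> interior K" "{Inf L<..<Sup L} \<subseteq> interior L"
          using ij xy by (auto simp: pN_def)
        ultimately have "{Inf K<..<Sup K} \<inter> {Inf L<..<Sup L} = {}" by blast
        then show "{Inf (snd i)<..<Sup (snd i)} \<inter> {Inf (snd j)<..<Sup (snd j)} = {}"
          by (simp only: xy snd_conv)
      qed
      have len: "(\<Sum>i\<in>pN. Sup (snd i) - Inf (snd i)) < \<delta>"
      proof -
        have le: "Inf (snd i) \<le> Sup (snd i)" if "i \<in> pN" for i
        proof -
          obtain x K where xK: "i = (x, K)" by (cases i)
          with that have "(x, K) \<in> p" by (simp add: pN_def)
          from ival[OF this] show ?thesis by (auto simp: xK)
        qed
        have "(\<Sum>i\<in>pN. Sup (snd i) - Inf (snd i)) = (\<Sum>i\<in>pN. measure lebesgue {Inf (snd i)<..<Sup (snd i)})"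
          using le by (intro sum.cong) auto
        also have "\<dots> = measure lebesgue (\<Union>i\<in>pN. {Inf (snd i)<..<Sup (snd i)})"
        proof (rule measure_finite_Union[symmetric, OF fin(2) _ dis])
          show "(\<lambda>i. {Inf (snd i)<..<Sup (snd i)}) ` pN \<subseteq> sets lebesgue" by auto
          show "emeasure lebesgue {Inf (snd i)<..<Sup (snd i)} \<noteq> \<infinity>" for i :: "real \<times> real set"
            using fmeasurableD2[OF lmeasurable_box[of "Inf (snd i)" "Sup (snd i)"]] by simp
        qed
        also have "\<dots> \<le> measure lebesgue W"
        proof (rule measure_mono_fmeasurable[OF _ _ Wm])
          show "(\<Union>i\<in>pN. {Inf (snd i)<..<Sup (snd i)}) \<in> sets lebesgue"
            using fin by (intro sets.finite_UN) auto
          show "(\<Union>i\<in>pN. {Inf (snd i)<..<Sup (snd i)}) \<subseteq> W"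
          proof (rule UN_least)
            fix i assume i: "i \<in> pN"
            obtain x K where xK: "i = (x, K)" by (cases i)
            then have xKp: "(x, K) \<in> p" "x \<in> N" using i by (simp_all add: pN_def)
            then have "K \<subseteq> W" using fineD[OF fine xKp(1)] by (simp add: \<gamma>_def)
            moreover have "{Inf K<..<Sup K} \<subseteq> K" using ival[OF xKp(1)] by fastforce
            ultimately show "{Inf (snd i)<..<Sup (snd i)} \<subseteq> W" by (simp add: xK)
          qed
        qed
        finally show ?thesis using Wmeas by simp
      qed
      have "(\<Sum>i\<in>pN. \<bar>h (Sup (snd i)) - h (Inf (snd i))\<bar>) < e2"
      proof (rule D[OF fin(2) _ dis len])
        fix i assume i: "i \<in> pN"
        obtain x K where xK: "i = (x, K)" by (cases i)
        then have xKp: "(x, K) \<in> p" using i by (simp add: pN_def)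
        show "Inf (snd i) \<le> Sup (snd i) \<and> {Inf (snd i)..Sup (snd i)} \<subseteq> {a..b}"
          using ival[OF xKp] d(3)[OF xKp] xK by fastforce
      qed
      moreover have "\<bar>\<Sum>i\<in>pN. err i\<bar> \<le> (\<Sum>i\<in>pN. \<bar>h (Sup (snd i)) - h (Inf (snd i))\<bar>)"
      proof (rule order_trans[OF sum_abs sum_mono])
        fix i assume "i \<in> pN"
        then have "g (fst i) = 0" by (simp add: pN_def g_def)
        then show "\<bar>err i\<bar> \<le> \<bar>h (Sup (snd i)) - h (Inf (snd i))\<bar>"
          by (simp add: err_def increment_def)
      qed
      ultimately have "\<bar>\<Sum>i\<in>pN. err i\<bar> \<le> e2" by linarith
      with good have "\<bar>(\<Sum>i\<in>p - pN. err i) + (\<Sum>i\<in>pN. err i)\<bar> \<le> e * (b - a)"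
        unfolding e2_def by linarith
      then show ?thesis unfolding split using ab by simp
    qed
    show "\<exists>d. gauge d \<and> (\<forall>p. p tagged_division_of {a..b} \<and> d fine p \<longrightarrow>
      norm ((\<Sum>(x, K)\<in>p. measure lborel K *\<^sub>R g x) - (h b - h a)) \<le> e * measure lborel {a..b})"
    proof (intro exI[of _ \<gamma>] conjI allI impI)
      show "gauge \<gamma>" by (rule gauge)
      fix p assume "p tagged_division_of {a..b} \<and> \<gamma> fine p"
      then show "norm ((\<Sum>(x, K)\<in>p. measure lborel K *\<^sub>R g x) - (h b - h a)) \<le> e * measure lborel {a..b}"
        by (intro main) simp_all
    qed
  qed
  then show ?thesis
    by (rule has_integral_spike[OF N, rotated]) (simp add: g_def)
qed (simp add: has_integral_refl)

section \<open>The Cameron--Martin space\<close>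

abbreviation leb01 :: "real measure" where "leb01 \<equiv> lebesgue_on {0..1}"

lemma CM_D:
  assumes "h \<in> CM"
  shows "absolutely_continuous_on {0..1} h" "h 0 = 0" "t \<notin> {0..1} \<Longrightarrow> h t = 0"
    "integrable leb01 (\<lambda>s. (deriv h s)\<^sup>2)"
  using assms unfolding CM_def mem_Collect_eq by simp_all

lemma AE_leb01_iff: "(AE x in leb01. P x) \<longleftrightarrow> (AE x in lebesgue. x \<in> {0..1} \<longrightarrow> P x)"
  by (simp add: AE_restrict_space_iff)

lemma AE_leb01_negligible:
  assumes "negligible {x \<in> {0..1}. \<not> P x}"
  shows "AE x in leb01. P x"
  unfolding AE_leb01_iff
  by (rule AE_I'[of "{x \<in> {0..1}. \<not> P x}"]) (use assms in \<open>auto simp: negligible_iff_null_sets\<close>)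

lemma AE_leb01_finite:
  assumes "finite {x \<in> {0..1}. \<not> P x}"
  shows "AE x in leb01. P x"
  using assms by (intro AE_leb01_negligible negligible_finite)

lemma CM_differentiable_ae: "h \<in> CM \<Longrightarrow> AE x in leb01. h differentiable (at x)"
  by (intro AE_leb01_negligible absolutely_continuous_on_imp_differentiable_ae CM_D(1))

lemma absolutely_continuous_on_imp_continuous_on:
  assumes "absolutely_continuous_on {a..b} h"
  shows "continuous_on {a..b} h"
  unfolding continuous_on_iff
proof (intro ballI allI impI)
  fix x e :: real assume x: "x \<in> {a..b}" and "0 < e"
  obtain \<delta> where \<delta>: "0 < \<delta>" and D: "\<And>I (u :: nat \<Rightarrow> real) v. finite I \<Longrightarrow> (\<And>i. i \<in> I \<Longrightarrow> u i \<le> v i \<and> {u i..v i} \<subseteq> {a..b}) \<Longrightarrow>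
      disjoint_family_on (\<lambda>i. {u i<..<v i}) I \<Longrightarrow> (\<Sum>i\<in>I. v i - u i) < \<delta> \<Longrightarrow>
      (\<Sum>i\<in>I. \<bar>h (v i) - h (u i)\<bar>) < e"
    using absolutely_continuous_on_finite[OF assms \<open>0 < e\<close>, where 'i=nat] by blast
  show "\<exists>d>0. \<forall>x'\<in>{a..b}. dist x' x < d \<longrightarrow> dist (h x') (h x) < e"
  proof (intro exI[of _ \<delta>] conjI ballI impI \<delta>)
    fix y assume y: "y \<in> {a..b}" "dist y x < \<delta>"
    have "(\<Sum>i\<in>{0::nat}. \<bar>h (max x y) - h (min x y)\<bar>) < e"
      using x y by (intro D) (auto simp: disjoint_family_on_def dist_real_def)
    then show "dist (h y) (h x) < e"
      by (cases "x \<le> y") (auto simp: dist_real_def max_def min_def abs_minus_commute)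
  qed
qed

lemma CM_borel_measurable: 
  assumes h: "h \<in> CM"
  shows "h \<in> borel_measurable borel"
proof -
  have "(\<lambda>x. indicator {0..1} x *\<^sub>R h x) \<in> borel_measurable borel"
    using CM_D(1)[OF h] by (intro borel_measurable_continuous_on_indicator absolutely_continuous_on_imp_continuous_on) auto
  moreover have "(\<lambda>x. indicator {0..1} x *\<^sub>R h x) = h"
    using CM_D(3)[OF h] by (auto simp: indicator_def fun_eq_iff)
  ultimately show ?thesis by simp
qed

text \<open>\<open>deriv\<close> has arbitrary values at exceptional points, so measurability is
  obtained from a limit of difference quotients that agrees with it a.e., together with completeness
  of Lebesgue measure.\<close>

lemma CM_deriv_measurable:
  assumes h: "h \<in> CM"
  shows "deriv h \<in> borel_measurable leb01"
proof -
  define q where "q n x = (h (x + inverse (real (Suc n))) - h x) / inverse (real (Suc n))" for n x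
  have [measurable]: "h \<in> borel_measurable borel" by (rule CM_borel_measurable[OF h])
  have q: "q n \<in> borel_measurable lebesgue" for n
    unfolding q_def by (intro measurable_completion) measurable
  define g where "g x = lim (\<lambda>n. q n x)" for x
  have g: "g \<in> borel_measurable lebesgue"
    unfolding g_def using q by (rule borel_measurable_lim_metric)
  have lim: "g x = deriv h x" if "h differentiable (at x)" for x
  proof -
    have "(h has_real_derivative deriv h x) (at x)"
      using that by (simp add: DERIV_deriv_iff_real_differentiable)
    then have "((\<lambda>k. (h (x + k) - h x) / k) \<longlongrightarrow> deriv h x) (at 0)" by (simp add: DERIV_def)
    moreover have "filterlim (\<lambda>n. inverse (real (Suc n))) (at 0) sequentially"
      by (intro filterlim_atI LIMSEQ_inverse_real_of_nat) (auto simp del: of_nat_Suc)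
    ultimately have "(\<lambda>n. q n x) \<longlonglongrightarrow> deriv h x"
      unfolding q_def by (rule filterlim_compose)
    then show ?thesis unfolding g_def by (rule limI)
  qed
  have "(\<lambda>x. if x \<in> {0..1} then deriv h x else g x) \<in> borel_measurable lebesgue"
  proof (rule borel_measurable_AE[OF g])
    show "AE x in lebesgue. g x = (if x \<in> {0..1} then deriv h x else g x)"
      using CM_differentiable_ae[OF h] unfolding AE_leb01_iff
      by eventually_elim (simp add: lim)
  qed
  then have "(\<lambda>x. if x \<in> {0..1} then deriv h x else g x) \<in> borel_measurable leb01"
    by (rule measurable_restrict_space1)
  then show ?thesis
    by (subst measurable_cong[where g="\<lambda>x. if x \<in> {0..1} then deriv h x else g x"]) (auto simp: space_restrict_space)
qed

lemma CM_sq_int: "h \<in> CM \<Longrightarrow> sq_int leb01 (deriv h)"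
  by (simp add: sq_int_def CM_deriv_measurable CM_D)

lemma absolutely_continuous_on_lincomb:
  assumes h: "absolutely_continuous_on S h" and k: "absolutely_continuous_on S k"
  shows "absolutely_continuous_on S (\<lambda>t. a * h t + b * k t)"
  unfolding absolutely_continuous_on_def
proof (intro allI impI)
  fix \<epsilon> :: real assume e: "0 < \<epsilon>"
  \<comment> \<open>The summand 1 in the denominator covers a vanishing coefficient.\<close>
  define e1 where "e1 = \<epsilon> / (2 * (\<bar>a\<bar> + 1))"
  define e2 where "e2 = \<epsilon> / (2 * (\<bar>b\<bar> + 1))"
  have e1: "0 < e1" and e2: "0 < e2" using e by (simp_all add: e1_def e2_def)
  have ae: "\<bar>a\<bar> * e1 < \<epsilon> / 2" "\<bar>b\<bar> * e2 < \<epsilon> / 2"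
    using e by (simp_all add: e1_def e2_def field_simps)
  from h[unfolded absolutely_continuous_on_def, THEN spec, THEN mp, OF e1]
  obtain d1 where d1: "0 < d1" and D1: "\<forall>(n::nat) a b. (\<forall>i<n. a i \<le> b i \<and> {a i..b i} \<subseteq> S) \<and>
        (\<forall>i<n. \<forall>j<n. i \<noteq> j \<longrightarrow> {a i<..<b i} \<inter> {a j<..<b j} = {}) \<and>
        (\<Sum>i<n. b i - a i) < d1 \<longrightarrow> (\<Sum>i<n. \<bar>h (b i) - h (a i)\<bar>) < e1"
    by (elim exE conjE)
  from k[unfolded absolutely_continuous_on_def, THEN spec, THEN mp, OF e2]
  obtain d2 where d2: "0 < d2" and D2: "\<forall>(n::nat) a b. (\<forall>i<n. a i \<le> b i \<and> {a i..b i} \<subseteq> S) \<and>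
        (\<forall>i<n. \<forall>j<n. i \<noteq> j \<longrightarrow> {a i<..<b i} \<inter> {a j<..<b j} = {}) \<and>
        (\<Sum>i<n. b i - a i) < d2 \<longrightarrow> (\<Sum>i<n. \<bar>k (b i) - k (a i)\<bar>) < e2"
    by (elim exE conjE)
  show "\<exists>\<delta>>0. \<forall>(n::nat) u v. (\<forall>i<n. u i \<le> v i \<and> {u i..v i} \<subseteq> S) \<and>
        (\<forall>i<n. \<forall>j<n. i \<noteq> j \<longrightarrow> {u i<..<v i} \<inter> {u j<..<v j} = {}) \<and>
        (\<Sum>i<n. v i - u i) < \<delta> \<longrightarrow>
        (\<Sum>i<n. \<bar>(a * h (v i) + b * k (v i)) - (a * h (u i) + b * k (u i))\<bar>) < \<epsilon>"
  proof (intro exI[of _ "min d1 d2"] conjI allI impI)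
    show "0 < min d1 d2" using d1 d2 by simp
    fix n :: nat and u v :: "nat \<Rightarrow> real"
    assume A: "(\<forall>i<n. u i \<le> v i \<and> {u i..v i} \<subseteq> S) \<and>
        (\<forall>i<n. \<forall>j<n. i \<noteq> j \<longrightarrow> {u i<..<v i} \<inter> {u j<..<v j} = {}) \<and>
        (\<Sum>i<n. v i - u i) < min d1 d2"
    have H: "(\<Sum>i<n. \<bar>h (v i) - h (u i)\<bar>) < e1"
      using A D1[THEN spec, of n, THEN spec, of u, THEN spec, of v] by simp
    have K: "(\<Sum>i<n. \<bar>k (v i) - k (u i)\<bar>) < e2"
      using A D2[THEN spec, of n, THEN spec, of u, THEN spec, of v] by simp
    have "(\<Sum>i<n. \<bar>(a * h (v i) + b * k (v i)) - (a * h (u i) + b * k (u i))\<bar>)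
        \<le> (\<Sum>i<n. \<bar>a\<bar> * \<bar>h (v i) - h (u i)\<bar> + \<bar>b\<bar> * \<bar>k (v i) - k (u i)\<bar>)"
    proof (rule sum_mono)
      fix i
      have "(a * h (v i) + b * k (v i)) - (a * h (u i) + b * k (u i)) = a * (h (v i) - h (u i)) + b * (k (v i) - k (u i))"
        by (simp add: algebra_simps)
      then show "\<bar>(a * h (v i) + b * k (v i)) - (a * h (u i) + b * k (u i))\<bar>
          \<le> \<bar>a\<bar> * \<bar>h (v i) - h (u i)\<bar> + \<bar>b\<bar> * \<bar>k (v i) - k (u i)\<bar>"
        using abs_triangle_ineq[of "a * (h (v i) - h (u i))" "b * (k (v i) - k (u i))"] by (simp add: abs_mult)
    qed
    also have "\<dots> = \<bar>a\<bar> * (\<Sum>i<n. \<bar>h (v i) - h (u i)\<bar>) + \<bar>b\<bar> * (\<Sum>i<n. \<bar>k (v i) - k (u i)\<bar>)"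
      by (simp add: sum.distrib sum_distrib_left)
    also have "\<dots> \<le> \<bar>a\<bar> * e1 + \<bar>b\<bar> * e2"
      using H K by (intro add_mono mult_left_mono) auto
    also have "\<dots> < \<epsilon>" using ae by linarith
    finally show "(\<Sum>i<n. \<bar>(a * h (v i) + b * k (v i)) - (a * h (u i) + b * k (u i))\<bar>) < \<epsilon>" .
  qed
qed

lemma deriv_lincomb_at:
  fixes h k :: "real \<Rightarrow> real"
  assumes "h differentiable (at x)" "k differentiable (at x)"
  shows "deriv (\<lambda>t. a * h t + b * k t) x = a * deriv h x + b * deriv k x"
proof -
  have "(h has_real_derivative deriv h x) (at x)" "(k has_real_derivative deriv k x) (at x)"
    using assms by (simp_all add: DERIV_deriv_iff_real_differentiable)
  then have "((\<lambda>t. a * h t + b * k t) has_real_derivative a * deriv h x + b * deriv k x) (at x)"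
    by (auto intro!: derivative_eq_intros)
  then show ?thesis by (rule DERIV_imp_deriv)
qed

lemma CM_deriv_lincomb:
  assumes "h \<in> CM" "k \<in> CM"
  shows "AE x in leb01. deriv (\<lambda>t. a * h t + b * k t) x = a * deriv h x + b * deriv k x"
  using CM_differentiable_ae[OF assms(1)] CM_differentiable_ae[OF assms(2)]
  by eventually_elim (rule deriv_lincomb_at)

text \<open>Completeness of Lebesgue measure carries measurability across a null set, whatever
  \<open>deriv\<close> does there.\<close>

lemma deriv_measurable_if_AE_eq:
  assumes "f \<in> borel_measurable leb01" "AE x in leb01. deriv h x = f x"
  shows "deriv h \<in> borel_measurable leb01"
proof -
  define F where "F x = (if x \<in> {0..1} then f x else 0)" for x
  have F: "F \<in> borel_measurable lebesgue"
    using assms(1) unfolding F_def by (intro borel_measurable_if_I) simp_all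
  have "(\<lambda>x. if x \<in> {0..1} then deriv h x else 0) \<in> borel_measurable lebesgue"
  proof (rule borel_measurable_AE[OF F])
    show "AE x in lebesgue. F x = (if x \<in> {0..1} then deriv h x else 0)"
      using assms(2) unfolding AE_leb01_iff F_def by eventually_elim simp
  qed
  then have "(\<lambda>x. if x \<in> {0..1} then deriv h x else 0) \<in> borel_measurable leb01"
    by (rule measurable_restrict_space1)
  then show ?thesis
    by (subst measurable_cong[where g="\<lambda>x. if x \<in> {0..1} then deriv h x else 0"]) (auto simp: space_restrict_space)
qed

lemma CM_lincomb:
  assumes h: "h \<in> CM" and k: "k \<in> CM"
  shows "(\<lambda>t. a * h t + b * k t) \<in> CM"
  unfolding CM_def
proof (intro CollectI conjI allI impI)
  show "absolutely_continuous_on {0..1} (\<lambda>t. a * h t + b * k t)"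
    by (intro absolutely_continuous_on_lincomb CM_D h k)
  show "a * h 0 + b * k 0 = 0" by (simp add: CM_D h k)
  show "a * h t + b * k t = 0" if "t \<notin> {0..1}" for t by (simp add: CM_D(3)[OF _ that] h k)
  let ?f = "\<lambda>x. a * deriv h x + b * deriv k x"
  have f: "sq_int leb01 ?f" by (intro sq_int_lincomb CM_sq_int h k)
  have m: "deriv (\<lambda>t. a * h t + b * k t) \<in> borel_measurable leb01"
    using f CM_deriv_lincomb[OF h k] by (intro deriv_measurable_if_AE_eq[of ?f]) (auto simp: sq_int_def)
  have "sq_int leb01 (deriv (\<lambda>t. a * h t + b * k t))"
    using CM_deriv_lincomb[OF h k, of a b] by (intro sq_int_cong_AE[OF f m]) (auto elim!: eventually_mono)
  then show "integrable leb01 (\<lambda>s. (deriv (\<lambda>t. a * h t + b * k t) s)\<^sup>2)" by (simp add: sq_int_def)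
qed

lemma CM_zero: "(\<lambda>t. 0) \<in> CM"
  unfolding CM_def absolutely_continuous_on_def by (auto intro: exI[of _ 1])

lemma CM_add: "h \<in> CM \<Longrightarrow> k \<in> CM \<Longrightarrow> (\<lambda>t. h t + k t) \<in> CM"
  using CM_lincomb[of h k 1 1] by simp

lemma CM_diff: "h \<in> CM \<Longrightarrow> k \<in> CM \<Longrightarrow> (\<lambda>t. h t - k t) \<in> CM"
  using CM_lincomb[of h k 1 "-1"] by simp

lemma CM_cmult: "h \<in> CM \<Longrightarrow> (\<lambda>t. a * h t) \<in> CM"
  using CM_lincomb[of h h a 0] by simp

lemma CM_sum: "(\<And>i. i \<in> I \<Longrightarrow> f i \<in> CM) \<Longrightarrow> (\<lambda>t. \<Sum>i\<in>I. f i t) \<in> CM"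
  by (induction I rule: infinite_finite_induct) (auto intro: CM_zero CM_add)

lemma cm_norm_eq: "cm_norm h = L2_norm leb01 (deriv h)"
  by (simp add: cm_norm_def cm_inner_def L2_norm_def power2_eq_square)

lemma cm_inner_commute: "cm_inner h k = cm_inner k h"
  by (simp add: cm_inner_def mult.commute)

lemma cm_norm_nonneg[simp]: "0 \<le> cm_norm h"
  by (simp add: cm_norm_eq)

lemma cm_norm_sq: "(cm_norm h)\<^sup>2 = cm_inner h h"
  unfolding cm_norm_eq L2_norm_sq cm_inner_def by (simp add: power2_eq_square)

lemma cm_inner_nonneg[simp]: "0 \<le> cm_inner h h"
  by (simp flip: cm_norm_sq)

lemma cm_inner_lincomb_left:
  assumes h: "h \<in> CM" and k: "k \<in> CM" and l: "l \<in> CM"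
  shows "cm_inner (\<lambda>t. a * h t + b * k t) l = a * cm_inner h l + b * cm_inner k l"
proof -
  have "cm_inner (\<lambda>t. a * h t + b * k t) l
      = (\<integral>x. a * (deriv h x * deriv l x) + b * (deriv k x * deriv l x) \<partial>leb01)"
    unfolding cm_inner_def
  proof (rule integral_cong_AE)
    show "AE x in leb01. deriv (\<lambda>t. a * h t + b * k t) x * deriv l x
        = a * (deriv h x * deriv l x) + b * (deriv k x * deriv l x)"
      using CM_deriv_lincomb[OF h k, of a b] by eventually_elim (simp add: algebra_simps)
    show "(\<lambda>x. deriv (\<lambda>t. a * h t + b * k t) x * deriv l x) \<in> borel_measurable leb01"
      by (intro borel_measurable_times CM_deriv_measurable CM_lincomb h k l)
    show "(\<lambda>x. a * (deriv h x * deriv l x) + b * (deriv k x * deriv l x)) \<in> borel_measurable leb01"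
      using CM_deriv_measurable[OF h] CM_deriv_measurable[OF k] CM_deriv_measurable[OF l]
      by (intro borel_measurable_add borel_measurable_times borel_measurable_const)
  qed
  also have "\<dots> = a * cm_inner h l + b * cm_inner k l"
    using sq_int_prod_integrable[OF CM_sq_int[OF h] CM_sq_int[OF l]]
      sq_int_prod_integrable[OF CM_sq_int[OF k] CM_sq_int[OF l]]
    by (simp add: cm_inner_def)
  finally show ?thesis .
qed

lemma cm_inner_lincomb_right:
  assumes "h \<in> CM" "k \<in> CM" "l \<in> CM"
  shows "cm_inner l (\<lambda>t. a * h t + b * k t) = a * cm_inner l h + b * cm_inner l k"
  using cm_inner_lincomb_left[OF assms] by (simp add: cm_inner_commute)

lemma cm_inner_add_left: "h \<in> CM \<Longrightarrow> k \<in> CM \<Longrightarrow> l \<in> CM \<Longrightarrow>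
  cm_inner (\<lambda>t. h t + k t) l = cm_inner h l + cm_inner k l"
  using cm_inner_lincomb_left[of h k l 1 1] by simp

lemma cm_inner_diff_left: "h \<in> CM \<Longrightarrow> k \<in> CM \<Longrightarrow> l \<in> CM \<Longrightarrow>
  cm_inner (\<lambda>t. h t - k t) l = cm_inner h l - cm_inner k l"
  using cm_inner_lincomb_left[of h k l 1 "-1"] by simp

lemma cm_inner_add_right: "h \<in> CM \<Longrightarrow> k \<in> CM \<Longrightarrow> l \<in> CM \<Longrightarrow>
  cm_inner l (\<lambda>t. h t + k t) = cm_inner l h + cm_inner l k"
  using cm_inner_lincomb_right[of h k l 1 1] by simp

lemma cm_inner_diff_right: "h \<in> CM \<Longrightarrow> k \<in> CM \<Longrightarrow> l \<in> CM \<Longrightarrow>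
  cm_inner l (\<lambda>t. h t - k t) = cm_inner l h - cm_inner l k"
  using cm_inner_lincomb_right[of h k l 1 "-1"] by simp

lemma cm_inner_cmult_left: "h \<in> CM \<Longrightarrow> l \<in> CM \<Longrightarrow> cm_inner (\<lambda>t. a * h t) l = a * cm_inner h l"
  using cm_inner_lincomb_left[of h h l a 0] by simp

lemma cm_inner_cmult_right: "h \<in> CM \<Longrightarrow> l \<in> CM \<Longrightarrow> cm_inner l (\<lambda>t. a * h t) = a * cm_inner l h"
  using cm_inner_lincomb_right[of h h l a 0] by simp

lemma cm_inner_zero_left[simp]: "cm_inner (\<lambda>t. 0) l = 0"
  by (simp add: cm_inner_def)

lemma cm_Cauchy_Schwarz: "h \<in> CM \<Longrightarrow> k \<in> CM \<Longrightarrow> \<bar>cm_inner h k\<bar> \<le> cm_norm h * cm_norm k"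
  unfolding cm_norm_eq cm_inner_def by (intro L2_Cauchy_Schwarz CM_sq_int)

lemma cm_norm_add:
  assumes h: "h \<in> CM" and k: "k \<in> CM"
  shows "cm_norm (\<lambda>t. h t + k t) \<le> cm_norm h + cm_norm k"
proof (rule power2_le_imp_le)
  have "(cm_norm (\<lambda>t. h t + k t))\<^sup>2 = cm_inner h h + 2 * cm_inner h k + cm_inner k k"
    unfolding cm_norm_sq using h k
    by (simp add: cm_inner_add_left cm_inner_add_right CM_add cm_inner_commute[of k h])
  also have "\<dots> \<le> (cm_norm h + cm_norm k)\<^sup>2"
    using cm_Cauchy_Schwarz[OF h k] by (simp add: power2_sum cm_norm_sq)
  finally show "(cm_norm (\<lambda>t. h t + k t))\<^sup>2 \<le> (cm_norm h + cm_norm k)\<^sup>2" .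
qed simp

lemma cm_norm_cmult: "h \<in> CM \<Longrightarrow> cm_norm (\<lambda>t. a * h t) = \<bar>a\<bar> * cm_norm h"
  by (simp add: cm_norm_def cm_inner_cmult_left cm_inner_cmult_right CM_cmult real_sqrt_mult flip: mult.assoc)

lemma cm_norm_minus_commute:
  assumes "h \<in> CM" "k \<in> CM"
  shows "cm_norm (\<lambda>t. h t - k t) = cm_norm (\<lambda>t. k t - h t)"
  using cm_norm_cmult[OF CM_diff[OF assms], of "-1"] by simp

lemma cm_norm_triangle:
  assumes "f \<in> CM" "g \<in> CM" "h \<in> CM"
  shows "cm_norm (\<lambda>t. f t - h t) \<le> cm_norm (\<lambda>t. f t - g t) + cm_norm (\<lambda>t. g t - h t)"
  using cm_norm_add[OF CM_diff[OF assms(1,2)] CM_diff[OF assms(2,3)]] by simp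

lemma cm_norm_diff_le:
  assumes f: "f \<in> CM" and g: "g \<in> CM"
  shows "\<bar>cm_norm f - cm_norm g\<bar> \<le> cm_norm (\<lambda>t. f t - g t)"
  using cm_norm_triangle[OF f g CM_zero] cm_norm_triangle[OF g f CM_zero]
    cm_norm_minus_commute[OF f g] by (simp add: abs_le_iff)

text \<open>The reproducing kernel of the Cameron-Martin space, which is the covariance of Brownian
  motion. The cutoff respects the convention that functions vanish outside the unit
  interval.\<close>

definition rkernel :: "real \<Rightarrow> real \<Rightarrow> real" where
  "rkernel t s = (if s \<in> {0..1} then min s t else 0)"

lemma deriv_rkernel:
  assumes t: "t \<in> {0..1}"
  shows "AE s in leb01. deriv (rkernel t) s = indicator {..t} s"
proof (rule AE_leb01_finite, rule finite_subset)
  \<comment> \<open>The exceptions are the kink at \<open>t\<close> and the two ends, where the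
    cutoff disturbs the two-sided derivative.\<close>
  show "{s \<in> {0..1}. deriv (rkernel t) s \<noteq> indicator {..t} s} \<subseteq> {0, 1, t}"
  proof (rule subsetI, rule ccontr)
    fix s assume s: "s \<in> {s \<in> {0..1}. deriv (rkernel t) s \<noteq> indicator {..t} s}" "s \<notin> {0, 1, t}"
    then have s01: "0 < s" "s < 1" "s \<noteq> t" by auto
    show False
    proof (cases "s < t")
      case True
      have "((\<lambda>x. x) has_real_derivative 1) (at s)" by (rule DERIV_ident)
      then have "(rkernel t has_real_derivative 1) (at s)"
        by (rule has_field_derivative_transform_within_open[where S="{0<..<t}"])
          (use True s01 t in \<open>auto simp: rkernel_def\<close>)
      then have "deriv (rkernel t) s = 1" by (rule DERIV_imp_deriv)
      with s True show False by simp
    next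
      case False
      have "((\<lambda>x. t) has_real_derivative 0) (at s)" by (rule DERIV_const)
      then have "(rkernel t has_real_derivative 0) (at s)"
        by (rule has_field_derivative_transform_within_open[where S="{t<..<1}"])
          (use False s01 t in \<open>auto simp: rkernel_def\<close>)
      then have "deriv (rkernel t) s = 0" by (rule DERIV_imp_deriv)
      with s False s01 show False by simp
    qed
  qed
qed simp

lemma absolutely_continuous_on_min:
  assumes t: "t \<in> {0..1}"
  shows "absolutely_continuous_on {0..1} (rkernel t)"
  unfolding absolutely_continuous_on_def
proof (intro allI impI)
  fix \<epsilon> :: real assume e: "0 < \<epsilon>"
  show "\<exists>\<delta>>0. \<forall>(n::nat) u v. (\<forall>i<n. u i \<le> v i \<and> {u i..v i} \<subseteq> {0..1}) \<and>
        (\<forall>i<n. \<forall>j<n. i \<noteq> j \<longrightarrow> {u i<..<v i} \<inter> {u j<..<v j} = {}) \<and>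
        (\<Sum>i<n. v i - u i) < \<delta> \<longrightarrow> (\<Sum>i<n. \<bar>rkernel t (v i) - rkernel t (u i)\<bar>) < \<epsilon>"
  proof (intro exI[of _ \<epsilon>] conjI allI impI e)
    fix n :: nat and u v :: "nat \<Rightarrow> real"
    assume A: "(\<forall>i<n. u i \<le> v i \<and> {u i..v i} \<subseteq> {0..1}) \<and>
        (\<forall>i<n. \<forall>j<n. i \<noteq> j \<longrightarrow> {u i<..<v i} \<inter> {u j<..<v j} = {}) \<and>
        (\<Sum>i<n. v i - u i) < \<epsilon>"
    have "(\<Sum>i<n. \<bar>rkernel t (v i) - rkernel t (u i)\<bar>) \<le> (\<Sum>i<n. v i - u i)"
    proof (rule sum_mono)
      fix i assume "i \<in> {..<n}"
      then have uv: "u i \<le> v i" "{u i..v i} \<subseteq> {0..1}" using A by simp_all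
      then have "0 \<le> u i" "v i \<le> 1" by simp_all
      with uv(1) show "\<bar>rkernel t (v i) - rkernel t (u i)\<bar> \<le> v i - u i"
        by (simp add: rkernel_def min_def)
    qed
    with A show "(\<Sum>i<n. \<bar>rkernel t (v i) - rkernel t (u i)\<bar>) < \<epsilon>" by linarith
  qed
qed

lemma indicator_sq_int: "S \<in> sets lebesgue \<Longrightarrow> sq_int leb01 (indicator S :: real \<Rightarrow> real)"
proof -
  assume S: "S \<in> sets lebesgue"
  have m: "(indicator S :: real \<Rightarrow> real) \<in> borel_measurable leb01"
    using S by (intro measurable_restrict_space1 borel_measurable_indicator)
  have fin: "finite_measure leb01"
    by (rule finite_measureI) (simp add: space_restrict_space emeasure_restrict_space)
  have "integrable leb01 (\<lambda>x. (indicator S x :: real)\<^sup>2)"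
  proof (rule finite_measure.integrable_const_bound[OF fin, of _ 1])
    show "(\<lambda>x. (indicator S x :: real)\<^sup>2) \<in> borel_measurable leb01"
      using m by (rule borel_measurable_power)
  qed (simp add: indicator_def)
  with m show ?thesis by (simp add: sq_int_def)
qed

lemma rkernel_CM:
  assumes t: "t \<in> {0..1}"
  shows "rkernel t \<in> CM"
  unfolding CM_def
proof (intro CollectI conjI allI impI)
  show "absolutely_continuous_on {0..1} (rkernel t)" by (rule absolutely_continuous_on_min[OF t])
  show "rkernel t 0 = 0" using t by (simp add: rkernel_def)
  show "rkernel t s = 0" if "s \<notin> {0..1}" for s unfolding rkernel_def using that by (rule if_not_P)
  have i: "sq_int leb01 (indicator {..t} :: real \<Rightarrow> real)" by (intro indicator_sq_int) simp
  have m: "deriv (rkernel t) \<in> borel_measurable leb01"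
    using i deriv_rkernel[OF t] by (intro deriv_measurable_if_AE_eq[of "indicator {..t}"]) (auto simp: sq_int_def)
  have "sq_int leb01 (deriv (rkernel t))"
    using deriv_rkernel[OF t] by (intro sq_int_cong_AE[OF i m]) (auto elim!: eventually_mono)
  then show "integrable leb01 (\<lambda>s. (deriv (rkernel t) s)\<^sup>2)" by (simp add: sq_int_def)
qed

text \<open>The derivative of the kernel is the indicator of the points up to \<open>t\<close>, so
  the inner product integrates \<open>deriv h\<close> from 0 to \<open>t\<close> and the fundamental
  theorem returns the value of \<open>h\<close>. Pointwise evaluation thereby becomes an inner
  product.\<close>

lemma cm_inner_rkernel:
  assumes h: "h \<in> CM" and t: "t \<in> {0..1}"
  shows "cm_inner h (rkernel t) = h t"
proof -
  have "negligible {x \<in> {0..1}. \<not> h differentiable (at x)}"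
    by (intro absolutely_continuous_on_imp_differentiable_ae CM_D(1) h)
  moreover have "absolutely_continuous_on {0..t} h"
    using t by (intro absolutely_continuous_on_subset[OF CM_D(1)[OF h]]) auto
  ultimately have "(deriv h has_integral (h t - h 0)) {0..t}"
    using t by (intro absolutely_continuous_on_FTC[where N="{x \<in> {0..1}. \<not> h differentiable (at x)}"]) auto
  then have hi: "((\<lambda>x. if x \<in> {0..t} then deriv h x else 0) has_integral h t) {0..1}"
    using t CM_D(2)[OF h] by (subst has_integral_restrict) auto
  have ind: "sq_int leb01 (indicator {..t} :: real \<Rightarrow> real)" by (intro indicator_sq_int) simp
  have int: "integrable leb01 (\<lambda>x. deriv h x * indicator {..t} x)"
    by (intro sq_int_prod_integrable CM_sq_int h ind)
  have "cm_inner h (rkernel t) = (LINT x|leb01. deriv h x * indicator {..t} x)"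
    unfolding cm_inner_def
  proof (rule integral_cong_AE)
    show "AE x in leb01. deriv h x * deriv (rkernel t) x = deriv h x * indicator {..t} x"
      using deriv_rkernel[OF t] by eventually_elim simp
    show "(\<lambda>x. deriv h x * deriv (rkernel t) x) \<in> borel_measurable leb01"
      by (intro borel_measurable_times CM_deriv_measurable rkernel_CM h t)
    show "(\<lambda>x. deriv h x * indicator {..t} x) \<in> borel_measurable leb01"
      using int by (rule borel_measurable_integrable)
  qed
  also have "\<dots> = integral {0..1} (\<lambda>x. deriv h x * indicator {..t} x)"
    using int by (intro lebesgue_integral_eq_integral) auto
  also have "\<dots> = integral {0..1} (\<lambda>x. if x \<in> {0..t} then deriv h x else 0)"
    by (rule Henstock_Kurzweil_Integration.integral_cong) (auto simp: indicator_def)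
  also have "\<dots> = h t" using hi by (rule integral_unique)
  finally show ?thesis .
qed

text \<open>Evaluation at \<open>t\<close> is bounded by the norm, by Cauchy-Schwarz against
  \<open>rkernel t\<close>.\<close>

lemma cm_norm_eq_0:
  assumes h: "h \<in> CM" and z: "cm_norm h = 0"
  shows "h = (\<lambda>t. 0)"
proof
  fix t show "h t = 0"
  proof (cases "t \<in> {0..1}")
    case True
    then have "\<bar>h t\<bar> \<le> 0"
      using cm_Cauchy_Schwarz[OF h rkernel_CM[OF True]] z by (simp add: cm_inner_rkernel[OF h True])
    then show ?thesis by simp
  qed (rule CM_D(3)[OF h])
qed

section \<open>Step functions as elements of the Cameron-Martin space\<close>

definition step_valid :: "(real \<times> real \<times> real) list \<Rightarrow> bool" where
  "step_valid xs \<longleftrightarrow> (\<forall>(a, s, t)\<in>set xs. 0 \<le> s \<and> s \<le> t \<and> t \<le> 1)"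

text \<open>The element of \<open>CM\<close> whose derivative is \<open>step_fun xs\<close> a.e.;
  approximation of \<open>deriv h\<close> by step functions becomes approximation of
  \<open>h\<close> in \<open>cm_norm\<close>.\<close>

definition step_primitive :: "(real \<times> real \<times> real) list \<Rightarrow> real \<Rightarrow> real" where
  "step_primitive xs u = (\<Sum>(a, s, t)\<leftarrow>xs. a * (rkernel t u - rkernel s u))"

lemma step_valid_Cons: "step_valid ((a, s, t) # xs) \<longleftrightarrow> 0 \<le> s \<and> s \<le> t \<and> t \<le> 1 \<and> step_valid xs"
  by (auto simp: step_valid_def)

lemma step_valid_append: "step_valid (xs @ ys) \<longleftrightarrow> step_valid xs \<and> step_valid ys"
  by (simp add: step_valid_def ball_Un)

lemma step_primitive_Nil: "step_primitive [] = (\<lambda>u. 0)"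
  by (simp add: step_primitive_def fun_eq_iff)

lemma step_primitive_Cons:
  "step_primitive ((a, s, t) # xs) = (\<lambda>u. a * (rkernel t u - rkernel s u) + step_primitive xs u)"
  by (simp add: step_primitive_def fun_eq_iff)

lemma step_primitive_append:
  "step_primitive (xs @ ys) = (\<lambda>u. step_primitive xs u + step_primitive ys u)"
  by (simp add: step_primitive_def fun_eq_iff)

lemma step_integral_append:
  "step_integral (xs @ ys) = (\<lambda>u. step_integral xs u + step_integral ys u)"
  by (simp add: step_integral_def fun_eq_iff)

lemma step_primitive_scale:
  "step_primitive (map (\<lambda>(b, s, t). (a * b, s, t)) xs) = (\<lambda>u. a * step_primitive xs u)"
proof (induction xs)
  case (Cons x xs)
  obtain b s t where "x = (b, s, t)" by (cases x)
  with Cons show ?case by (simp add: step_primitive_Cons fun_eq_iff algebra_simps)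
qed (simp add: step_primitive_def fun_eq_iff)

lemma step_integral_scale:
  "step_integral (map (\<lambda>(b, s, t). (a * b, s, t)) xs) = (\<lambda>u. a * step_integral xs u)"
proof (induction xs)
  case (Cons x xs)
  obtain b s t where "x = (b, s, t)" by (cases x)
  with Cons show ?case by (simp add: step_integral_def fun_eq_iff algebra_simps)
qed (simp add: step_integral_def fun_eq_iff)

lemma step_valid_scale: "step_valid xs \<Longrightarrow> step_valid (map (\<lambda>(b, s, t). (a * b, s, t)) xs)"
  by (auto simp: step_valid_def)

lemma step_primitive_CM: "step_valid xs \<Longrightarrow> step_primitive xs \<in> CM"
proof (induction xs)
  case (Cons x xs)
  obtain a s t where x: "x = (a, s, t)" by (cases x)
  have "(\<lambda>u. a * (rkernel t u - rkernel s u)) \<in> CM"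
    using Cons.prems by (intro CM_cmult CM_diff rkernel_CM) (auto simp: x step_valid_Cons)
  with Cons show ?case by (auto simp: x step_primitive_Cons step_valid_Cons intro: CM_add)
qed (simp add: step_primitive_Nil CM_zero)

lemma deriv_step_primitive: "step_valid xs \<Longrightarrow> AE u in leb01. deriv (step_primitive xs) u = step_fun xs u"
proof (induction xs)
  case (Cons x xs)
  obtain a s t where x: "x = (a, s, t)" by (cases x)
  have st: "s \<in> {0..1}" "t \<in> {0..1}" "s \<le> t" and v: "step_valid xs" using Cons.prems by (auto simp: x step_valid_Cons)
  have k: "rkernel s \<in> CM" "rkernel t \<in> CM" using st by (simp_all add: rkernel_CM)
  have d: "(\<lambda>u. rkernel t u - rkernel s u) \<in> CM" using k by (intro CM_diff)
  have "AE u in leb01. deriv (\<lambda>u. 1 * rkernel t u + (- 1) * rkernel s u) u = 1 * deriv (rkernel t) u + (- 1) * deriv (rkernel s) u"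
    by (intro CM_deriv_lincomb k)
  moreover have "AE u in leb01. deriv (\<lambda>u. a * (rkernel t u - rkernel s u) + 1 * step_primitive xs u) u
      = a * deriv (\<lambda>u. rkernel t u - rkernel s u) u + 1 * deriv (step_primitive xs) u"
    by (intro CM_deriv_lincomb d step_primitive_CM v)
  ultimately show ?case
    using Cons.IH[OF v] deriv_rkernel[OF st(1)] deriv_rkernel[OF st(2)]
  proof eventually_elim
    case (elim u)
    have "indicator {..t} u - indicator {..s} u = (indicator {s<..t} u :: real)"
      using st(3) by (auto simp: indicator_def)
    with elim show ?case by (simp add: x step_primitive_Cons step_fun_def)
  qed
qed (simp add: step_primitive_Nil step_fun_def deriv_const)

section \<open>The complexified Cameron-Martin space\<close>

lemma CM_complex_lincomb:
  assumes "f \<in> CM_complex" "g \<in> CM_complex"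
  shows "(\<lambda>t. a * f t + b * g t) \<in> CM_complex"
proof -
  have c: "(\<lambda>t. Re (f t)) \<in> CM" "(\<lambda>t. Im (f t)) \<in> CM" "(\<lambda>t. Re (g t)) \<in> CM" "(\<lambda>t. Im (g t)) \<in> CM"
    using assms by (simp_all add: CM_complex_def)
  have "(\<lambda>t. (Re a * Re (f t) + (- Im a) * Im (f t)) + (Re b * Re (g t) + (- Im b) * Im (g t))) \<in> CM"
    by (intro CM_add CM_lincomb c)
  moreover have "(\<lambda>t. (Re a * Im (f t) + Im a * Re (f t)) + (Re b * Im (g t) + Im b * Re (g t))) \<in> CM"
    by (intro CM_add CM_lincomb c)
  ultimately show ?thesis by (simp add: CM_complex_def algebra_simps)
qed

lemma CM_complex_D:
  assumes "f \<in> CM_complex"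
  shows "(\<lambda>t. Re (f t)) \<in> CM" "(\<lambda>t. Im (f t)) \<in> CM"
  using assms by (simp_all add: CM_complex_def)

lemma CM_complex_add: "f \<in> CM_complex \<Longrightarrow> g \<in> CM_complex \<Longrightarrow> (\<lambda>t. f t + g t) \<in> CM_complex"
  using CM_complex_lincomb[of f g 1 1] by simp

lemma CM_complex_diff: "f \<in> CM_complex \<Longrightarrow> g \<in> CM_complex \<Longrightarrow> (\<lambda>t. f t - g t) \<in> CM_complex"
  using CM_complex_lincomb[of f g 1 "-1"] by simp

lemma CM_complex_cmult: "f \<in> CM_complex \<Longrightarrow> (\<lambda>t. a * f t) \<in> CM_complex"
  using CM_complex_lincomb[of f f a 0] by simp

lemma CM_complex_zero: "(\<lambda>t. 0) \<in> CM_complex"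
  by (simp add: CM_complex_def CM_zero)

lemma CM_complex_of_real: "h \<in> CM \<Longrightarrow> (\<lambda>t. complex_of_real (h t)) \<in> CM_complex"
  by (simp add: CM_complex_def CM_zero)

lemma CM_complex_sum: "(\<And>i. i \<in> I \<Longrightarrow> f i \<in> CM_complex) \<Longrightarrow> (\<lambda>t. \<Sum>i\<in>I. f i t) \<in> CM_complex"
  by (induction I rule: infinite_finite_induct) (auto intro: CM_complex_zero CM_complex_add)

lemma cm_cinner_add_left:
  assumes "f \<in> CM_complex" "g \<in> CM_complex" "k \<in> CM_complex"
  shows "cm_cinner (\<lambda>t. f t + g t) k = cm_cinner f k + cm_cinner g k"
  using CM_complex_D[OF assms(1)] CM_complex_D[OF assms(2)] CM_complex_D[OF assms(3)]
  by (simp add: cm_cinner_def cm_inner_add_left complex_eq_iff)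

lemma cm_cinner_cmult_left:
  assumes "f \<in> CM_complex" "k \<in> CM_complex"
  shows "cm_cinner (\<lambda>t. a * f t) k = a * cm_cinner f k"
proof -
  note f = CM_complex_D[OF assms(1)] and k = CM_complex_D[OF assms(2)]
  have 1: "cm_inner (\<lambda>t. Re a * Re (f t) - Im a * Im (f t)) l = Re a * cm_inner (\<lambda>t. Re (f t)) l - Im a * cm_inner (\<lambda>t. Im (f t)) l"
    if "l \<in> CM" for l
    using cm_inner_lincomb_left[OF f that, of "Re a" "- Im a"] by simp
  have 2: "cm_inner (\<lambda>t. Re a * Im (f t) + Im a * Re (f t)) l = Re a * cm_inner (\<lambda>t. Im (f t)) l + Im a * cm_inner (\<lambda>t. Re (f t)) l"
    if "l \<in> CM" for l
    using cm_inner_lincomb_left[OF f(2,1) that, of "Re a" "Im a"] by simp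
  show ?thesis
    by (simp add: cm_cinner_def complex_eq_iff 1[OF k(1)] 1[OF k(2)] 2[OF k(1)] 2[OF k(2)] distrib_left right_diff_distrib)
qed

lemma cm_cinner_commute: "cm_cinner g f = cnj (cm_cinner f g)"
  by (simp add: cm_cinner_def complex_eq_iff cm_inner_commute)

lemma cm_cinner_diff_left:
  assumes "f \<in> CM_complex" "g \<in> CM_complex" "k \<in> CM_complex"
  shows "cm_cinner (\<lambda>t. f t - g t) k = cm_cinner f k - cm_cinner g k"
  using cm_cinner_add_left[OF assms(1) CM_complex_cmult[OF assms(2), of "-1"] assms(3)]
    cm_cinner_cmult_left[OF assms(2,3), of "-1"] by simp

lemma cm_cinner_diff_right:
  assumes "f \<in> CM_complex" "g \<in> CM_complex" "k \<in> CM_complex"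
  shows "cm_cinner k (\<lambda>t. f t - g t) = cm_cinner k f - cm_cinner k g"
  using cm_cinner_diff_left[OF assms] by (metis cm_cinner_commute complex_cnj_diff)

lemma cm_cinner_zero_left[simp]: "cm_cinner (\<lambda>t. 0) k = 0"
  by (simp add: cm_cinner_def complex_eq_iff)

lemma cm_cinner_sum_left:
  assumes "\<And>i. i \<in> I \<Longrightarrow> f i \<in> CM_complex" "k \<in> CM_complex"
  shows "cm_cinner (\<lambda>t. \<Sum>i\<in>I. f i t) k = (\<Sum>i\<in>I. cm_cinner (f i) k)"
  using assms
proof (induction I rule: infinite_finite_induct)
  case (insert i I)
  then have "cm_cinner (\<lambda>t. f i t + (\<Sum>i\<in>I. f i t)) k = cm_cinner (f i) k + cm_cinner (\<lambda>t. \<Sum>i\<in>I. f i t) k"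
    by (intro cm_cinner_add_left CM_complex_sum) auto
  with insert show ?case by simp
qed auto

lemma cm_cnorm_sq: "(cm_cnorm f)\<^sup>2 = (cm_norm (\<lambda>t. Re (f t)))\<^sup>2 + (cm_norm (\<lambda>t. Im (f t)))\<^sup>2"
  by (simp add: cm_cnorm_def cm_cinner_def cm_norm_sq)

lemma cm_cnorm_nonneg[simp]: "0 \<le> cm_cnorm f"
  by (simp add: cm_cnorm_def cm_cinner_def)

lemma cm_cinner_self: "cm_cinner f f = complex_of_real ((cm_cnorm f)\<^sup>2)"
  by (simp add: complex_eq_iff cm_cnorm_def cm_cinner_def cm_inner_commute)

lemma cm_cnorm_of_real[simp]: "cm_cnorm (\<lambda>t. complex_of_real (h t)) = cm_norm h"
  by (simp add: cm_cnorm_def cm_cinner_def cm_norm_def)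

lemma cm_cinner_of_real[simp]:
  "cm_cinner (\<lambda>t. complex_of_real (h t)) (\<lambda>t. complex_of_real (k t)) = complex_of_real (cm_inner h k)"
  by (simp add: cm_cinner_def complex_eq_iff cm_inner_commute[of _ "\<lambda>t. 0"])

lemma Re_cm_cinner_le:
  assumes "f \<in> CM_complex" "g \<in> CM_complex"
  shows "Re (cm_cinner f g) \<le> cm_cnorm f * cm_cnorm g"
proof -
  note f = CM_complex_D[OF assms(1)] and g = CM_complex_D[OF assms(2)]
  define a b c d where "a = cm_norm (\<lambda>t. Re (f t))" and "b = cm_norm (\<lambda>t. Im (f t))"
    and "c = cm_norm (\<lambda>t. Re (g t))" and "d = cm_norm (\<lambda>t. Im (g t))"
  have "Re (cm_cinner f g) \<le> a * c + b * d"
    using cm_Cauchy_Schwarz[OF f(1) g(1)] cm_Cauchy_Schwarz[OF f(2) g(2)]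
    by (simp add: cm_cinner_def a_def b_def c_def d_def)
  also have "a * c + b * d \<le> cm_cnorm f * cm_cnorm g"
  proof (rule power2_le_imp_le)
    have "(a * c + b * d)\<^sup>2 + (a * d - b * c)\<^sup>2 = (a\<^sup>2 + b\<^sup>2) * (c\<^sup>2 + d\<^sup>2)"
      by (simp add: power2_eq_square algebra_simps)
    then have "(a * c + b * d)\<^sup>2 \<le> (a\<^sup>2 + b\<^sup>2) * (c\<^sup>2 + d\<^sup>2)"
      by (smt (verit) zero_le_power2)
    then show "(a * c + b * d)\<^sup>2 \<le> (cm_cnorm f * cm_cnorm g)\<^sup>2"
      by (simp add: power_mult_distrib cm_cnorm_sq a_def b_def c_def d_def)
  qed simp
  finally show ?thesis .
qed

lemma cm_cnorm_cmult:
  assumes "f \<in> CM_complex"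
  shows "cm_cnorm (\<lambda>t. a * f t) = cmod a * cm_cnorm f"
proof -
  have "cm_cinner (\<lambda>t. a * f t) (\<lambda>t. a * f t) = a * cnj (a * cm_cinner f f)"
    using assms by (simp add: cm_cinner_cmult_left CM_complex_cmult cm_cinner_commute[of f "\<lambda>t. a * f t"])
  also have "\<dots> = complex_of_real ((cmod a)\<^sup>2 * (cm_cnorm f)\<^sup>2)"
    by (simp only: cm_cinner_self complex_cnj_mult complex_cnj_complex_of_real mult.assoc[symmetric] complex_norm_square of_real_mult)
  finally have "(cm_cnorm (\<lambda>t. a * f t))\<^sup>2 = (cmod a * cm_cnorm f)\<^sup>2"
    unfolding cm_cinner_self of_real_eq_iff by (simp add: power_mult_distrib)
  then show ?thesis by (simp add: power2_eq_iff_nonneg)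
qed

lemma cm_cinner_Cauchy_Schwarz:
  assumes f: "f \<in> CM_complex" and g: "g \<in> CM_complex"
  shows "cmod (cm_cinner f g) \<le> cm_cnorm f * cm_cnorm g"
proof (cases "cm_cinner f g = 0")
  case False
  \<comment> \<open>A unimodular factor turns the inner product into its modulus, which reduces the
    claim to the bound for real parts.\<close>
  define z where "z = cnj (sgn (cm_cinner f g))"
  have z: "cmod z = 1" using False by (simp add: z_def norm_sgn)
  have "z * cm_cinner f g = complex_of_real (cmod (cm_cinner f g))"
    using False by (simp add: z_def sgn_eq complex_norm_square power2_eq_square field_simps)
      (metis complex_norm_square mult.commute of_real_mult power2_eq_square)
  then have "cmod (cm_cinner f g) = Re (cm_cinner (\<lambda>t. z * f t) g)"
    by (simp add: cm_cinner_cmult_left f g)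
  also have "\<dots> \<le> cm_cnorm (\<lambda>t. z * f t) * cm_cnorm g"
    by (intro Re_cm_cinner_le CM_complex_cmult f g)
  finally show ?thesis by (simp add: cm_cnorm_cmult f z)
qed simp

lemma cm_cnorm_add:
  assumes f: "f \<in> CM_complex" and g: "g \<in> CM_complex"
  shows "cm_cnorm (\<lambda>t. f t + g t) \<le> cm_cnorm f + cm_cnorm g"
proof (rule power2_le_imp_le)
  have fg: "(\<lambda>t. f t + g t) \<in> CM_complex" by (intro CM_complex_add f g)
  have "cm_cinner (\<lambda>t. f t + g t) (\<lambda>t. f t + g t)
      = cm_cinner f (\<lambda>t. f t + g t) + cm_cinner g (\<lambda>t. f t + g t)"
    by (intro cm_cinner_add_left f g fg)
  also have "\<dots> = cnj (cm_cinner f f + cm_cinner g f) + cnj (cm_cinner f g + cm_cinner g g)"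
    by (simp only: cm_cinner_commute[of _ "\<lambda>t. f t + g t"] cm_cinner_add_left[OF f g f] cm_cinner_add_left[OF f g g])
  finally have "(cm_cnorm (\<lambda>t. f t + g t))\<^sup>2 = Re (cnj (cm_cinner f f + cm_cinner g f) + cnj (cm_cinner f g + cm_cinner g g))"
    by (metis Re_complex_of_real cm_cinner_self)
  also have "\<dots> = (cm_cnorm f)\<^sup>2 + (cm_cnorm g)\<^sup>2 + 2 * Re (cm_cinner f g)"
    by (simp add: cm_cinner_self cm_cinner_commute[of g f])
  also have "\<dots> \<le> (cm_cnorm f + cm_cnorm g)\<^sup>2"
    using Re_cm_cinner_le[OF f g] by (simp add: power2_sum)
  finally show "(cm_cnorm (\<lambda>t. f t + g t))\<^sup>2 \<le> (cm_cnorm f + cm_cnorm g)\<^sup>2" .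
qed simp

lemma cm_cnorm_triangle:
  assumes "f \<in> CM_complex" "g \<in> CM_complex" "h \<in> CM_complex"
  shows "cm_cnorm (\<lambda>t. f t - h t) \<le> cm_cnorm (\<lambda>t. f t - g t) + cm_cnorm (\<lambda>t. g t - h t)"
  using cm_cnorm_add[OF CM_complex_diff[OF assms(1,2)] CM_complex_diff[OF assms(2,3)]] by simp

lemma cm_cnorm_eq_0:
  assumes f: "f \<in> CM_complex" and z: "cm_cnorm f = 0"
  shows "f = (\<lambda>t. 0)"
proof -
  have "(cm_norm (\<lambda>t. Re (f t)))\<^sup>2 + (cm_norm (\<lambda>t. Im (f t)))\<^sup>2 = 0"
    using z cm_cnorm_sq[of f] by simp
  then have "cm_norm (\<lambda>t. Re (f t)) = 0" "cm_norm (\<lambda>t. Im (f t)) = 0"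
    by (simp_all add: add_nonneg_eq_0_iff)
  then have "(\<lambda>t. Re (f t)) = (\<lambda>t. 0)" "(\<lambda>t. Im (f t)) = (\<lambda>t. 0)"
    using cm_norm_eq_0 CM_complex_D[OF f] by blast+
  then show ?thesis by (simp add: fun_eq_iff complex_eq_iff)
qed

section \<open>Wiener integrals\<close>

text \<open>The sorted endpoints form a grid whose cells make up every interval of the list; the
  increments over the cells are the independent variables provided by the Wiener measure.
  Quantifying over \<open>g\<close> inside lets the same coefficients serve for paths, for kernels
  and for the primitive itself.\<close>

lemma step_common_partition:
  assumes "step_valid xs"
  obtains n and \<tau> c :: "nat \<Rightarrow> real"
  where "\<And>i. i \<le> n \<Longrightarrow> \<tau> i \<in> {0..1}" "\<And>i. i < n \<Longrightarrow> \<tau> i < \<tau> (Suc i)"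
    "\<And>g :: real \<Rightarrow> real. (\<Sum>(a, s, t)\<leftarrow>xs. a * (g t - g s)) = (\<Sum>i<n. c i * (g (\<tau> (Suc i)) - g (\<tau> i)))"
proof -
  \<comment> \<open>Adjoining 0 and 1 keeps the grid nonempty for the empty list.\<close>
  define S where "S = {0, 1} \<union> (\<lambda>(a, s, t). s) ` set xs \<union> (\<lambda>(a, s, t). t) ` set xs"
  have fin: "finite S" by (simp add: S_def)
  have S01: "S \<subseteq> {0..1}" using assms by (fastforce simp: S_def step_valid_def)
  define ys where "ys = sorted_list_of_set S"
  have ys: "set ys = S" "sorted_wrt (<) ys"
    using fin by (simp_all add: ys_def)
  define \<tau> where "\<tau> i = ys ! i" for i
  define n where "n = length ys - 1"
  have "ys \<noteq> []" using ys(1) by (auto simp: S_def)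
  then have len: "length ys = Suc n" by (simp add: n_def)
  have less: "\<tau> i < \<tau> j" if "i < j" "j \<le> n" for i j
    unfolding \<tau>_def using sorted_wrt_nth_less[OF ys(2), of i j] that len by simp
  then have le_iff: "\<tau> i \<le> \<tau> j \<longleftrightarrow> i \<le> j" if "i \<le> n" "j \<le> n" for i j
    using that by (metis leD leI less_imp_le nat_less_le)
  have mem: "\<exists>p\<le>n. s = \<tau> p" if "s \<in> S" for s
    using that unfolding ys(1)[symmetric] in_set_conv_nth len \<tau>_def by (auto simp: less_Suc_eq_le)
  \<comment> \<open>The value of the step function on cell \<open>i\<close>: the sum of the
    coefficients of all intervals that contain the cell.\<close>
  define c where "c i = (\<Sum>(a, s, t)\<leftarrow>xs. a * (if s \<le> \<tau> i \<and> \<tau> (Suc i) \<le> t then 1 else 0))" for i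
  have one: "g t - g s = (\<Sum>i<n. (if s \<le> \<tau> i \<and> \<tau> (Suc i) \<le> t then 1 else 0) * (g (\<tau> (Suc i)) - g (\<tau> i)))"
    if st: "s \<in> S" "t \<in> S" "s \<le> t" for s t and g :: "real \<Rightarrow> real"
  proof -
    obtain p q where pq: "p \<le> n" "s = \<tau> p" "q \<le> n" "t = \<tau> q" using mem[OF st(1)] mem[OF st(2)] by blast
    have "p \<le> q" using st(3) pq le_iff by simp
    have eq: "(s \<le> \<tau> i \<and> \<tau> (Suc i) \<le> t) \<longleftrightarrow> i \<in> {p..<q}" if "i < n" for i
      using that pq le_iff[of p i] le_iff[of "Suc i" q] by auto
    have "(\<Sum>i<n. (if s \<le> \<tau> i \<and> \<tau> (Suc i) \<le> t then 1 else 0) * (g (\<tau> (Suc i)) - g (\<tau> i)))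
        = (\<Sum>i<n. if i \<in> {p..<q} then g (\<tau> (Suc i)) - g (\<tau> i) else 0)"
      using eq by (intro sum.cong) auto
    also have "\<dots> = (\<Sum>i\<in>{..<n} \<inter> {p..<q}. g (\<tau> (Suc i)) - g (\<tau> i))"
      by (simp only: sum.inter_restrict finite_lessThan)
    also have "{..<n} \<inter> {p..<q} = {p..<q}" using pq by auto
    also have "(\<Sum>i\<in>{p..<q}. g (\<tau> (Suc i)) - g (\<tau> i)) = g t - g s"
      using sum_Suc_diff'[OF \<open>p \<le> q\<close>, of "\<lambda>i. g (\<tau> i)"] pq by simp
    finally show ?thesis by simp
  qed
  have "(\<Sum>(a, s, t)\<leftarrow>zs. a * (g t - g s))
      = (\<Sum>i<n. (\<Sum>(a, s, t)\<leftarrow>zs. a * (if s \<le> \<tau> i \<and> \<tau> (Suc i) \<le> t then 1 else 0)) * (g (\<tau> (Suc i)) - g (\<tau> i)))"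
    if "set zs \<subseteq> set xs" for zs and g :: "real \<Rightarrow> real"
    using that
  proof (induction zs)
    case (Cons z zs)
    obtain a s t where z: "z = (a, s, t)" by (cases z)
    have mem: "(a, s, t) \<in> set xs" using Cons.prems z by simp
    then have "s \<in> S" "t \<in> S" unfolding S_def by force+
    moreover have "s \<le> t" using assms mem by (auto simp: step_valid_def)
    ultimately have g: "g t - g s = (\<Sum>i<n. (if s \<le> \<tau> i \<and> \<tau> (Suc i) \<le> t then 1 else 0) * (g (\<tau> (Suc i)) - g (\<tau> i)))"
      by (rule one)
    have "(\<Sum>(a, s, t)\<leftarrow>z # zs. a * (g t - g s)) = a * (g t - g s) + (\<Sum>(a, s, t)\<leftarrow>zs. a * (g t - g s))"
      by (simp add: z)
    also have "\<dots> = (\<Sum>i<n. a * ((if s \<le> \<tau> i \<and> \<tau> (Suc i) \<le> t then 1 else 0) * (g (\<tau> (Suc i)) - g (\<tau> i)))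
        + (\<Sum>(a, s, t)\<leftarrow>zs. a * (if s \<le> \<tau> i \<and> \<tau> (Suc i) \<le> t then 1 else 0)) * (g (\<tau> (Suc i)) - g (\<tau> i)))"
      using Cons by (subst g) (simp only: sum_distrib_left sum.distrib set_subset_Cons list.set insert_subset)
    also have "\<dots> = (\<Sum>i<n. (\<Sum>(a, s, t)\<leftarrow>z # zs. a * (if s \<le> \<tau> i \<and> \<tau> (Suc i) \<le> t then 1 else 0)) * (g (\<tau> (Suc i)) - g (\<tau> i)))"
      by (intro sum.cong refl) (simp only: z list.map sum_list.Cons prod.case distrib_right mult.assoc)
    finally show ?case .
  qed simp
  from this[OF order_refl] show thesis
    using that[of n \<tau> c] less S01 ys(1) len unfolding c_def \<tau>_def
    by (metis le_imp_less_Suc lessI less_or_eq_imp_le nth_mem subsetD Suc_leI)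
qed

text \<open>By the reproducing property, the inner product with a step primitive is a combination of
  increments. Applied to the primitive itself this leaves its increments over the cells, each equal
  to \<open>c i\<close> times the length of the cell.\<close>

lemma step_primitive_norm:
  fixes \<tau> c :: "nat \<Rightarrow> real"
  assumes xs: "step_valid xs"
    and \<tau>: "\<And>i. i \<le> n \<Longrightarrow> \<tau> i \<in> {0..1}" "\<And>i. i < n \<Longrightarrow> \<tau> i < \<tau> (Suc i)"
    and g: "\<And>g :: real \<Rightarrow> real. (\<Sum>(a, s, t)\<leftarrow>xs. a * (g t - g s)) = (\<Sum>i<n. c i * (g (\<tau> (Suc i)) - g (\<tau> i)))"
  shows "(cm_norm (step_primitive xs))\<^sup>2 = (\<Sum>i<n. (c i)\<^sup>2 * (\<tau> (Suc i) - \<tau> i))"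
proof -
  define K where "K = step_primitive xs"
  have K: "K \<in> CM" using xs by (simp add: K_def step_primitive_CM)
  have inner: "cm_inner h (step_primitive zs) = (\<Sum>(a, s, t)\<leftarrow>zs. a * (h t - h s))"
    if "step_valid zs" "h \<in> CM" for zs h
    using that(1)
  proof (induction zs)
    case Nil
    then show ?case by (simp add: step_primitive_Nil cm_inner_commute[of h])
  next
    case (Cons z zs)
    obtain a s t where z: "z = (a, s, t)" by (cases z)
    have st: "s \<in> {0..1}" "t \<in> {0..1}" and v: "step_valid zs" using Cons.prems by (auto simp: z step_valid_Cons)
    have k: "(\<lambda>u. rkernel t u - rkernel s u) \<in> CM" by (intro CM_diff rkernel_CM st)
    have "cm_inner h (step_primitive (z # zs)) = a * cm_inner h (\<lambda>u. rkernel t u - rkernel s u) + 1 * cm_inner h (step_primitive zs)"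
      using cm_inner_lincomb_right[OF k step_primitive_CM[OF v] that(2), of a 1] by (simp add: z step_primitive_Cons)
    also have "cm_inner h (\<lambda>u. rkernel t u - rkernel s u) = h t - h s"
      by (simp only: cm_inner_diff_right[OF rkernel_CM[OF st(2)] rkernel_CM[OF st(1)] that(2)]
          cm_inner_rkernel[OF that(2) st(1)] cm_inner_rkernel[OF that(2) st(2)])
    finally show ?case using Cons.IH[OF v] by (simp add: z)
  qed
  have Ku: "K u = (\<Sum>j<n. c j * (rkernel (\<tau> (Suc j)) u - rkernel (\<tau> j) u))" for u
    unfolding K_def step_primitive_def using g[of "\<lambda>t. rkernel t u"] .
  have mono: "\<tau> i \<le> \<tau> j" if "i \<le> j" "j \<le> n" for i j
    using that
  proof (induction j rule: dec_induct)
    case (step j)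
    then show ?case using \<tau>(2)[of j] by simp
  qed simp
  have diff: "K (\<tau> (Suc i)) - K (\<tau> i) = c i * (\<tau> (Suc i) - \<tau> i)" if i: "i < n" for i
  proof -
    have rk: "rkernel (\<tau> j) (\<tau> k) = min (\<tau> k) (\<tau> j)" if "j \<le> n" "k \<le> n" for j k
      using \<tau>(1)[OF that(2)] by (simp add: rkernel_def)
    have "K (\<tau> (Suc i)) - K (\<tau> i) = (\<Sum>j<n. c j * (rkernel (\<tau> (Suc j)) (\<tau> (Suc i)) - rkernel (\<tau> j) (\<tau> (Suc i)))
         - c j * (rkernel (\<tau> (Suc j)) (\<tau> i) - rkernel (\<tau> j) (\<tau> i)))"
      by (simp only: Ku sum_subtractf)
    also have "\<dots> = (\<Sum>j<n. if j = i then c i * (\<tau> (Suc i) - \<tau> i) else 0)"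
    proof (rule sum.cong[OF refl])
      fix j assume "j \<in> {..<n}"
      then have j: "j < n" by simp
      show "c j * (rkernel (\<tau> (Suc j)) (\<tau> (Suc i)) - rkernel (\<tau> j) (\<tau> (Suc i)))
         - c j * (rkernel (\<tau> (Suc j)) (\<tau> i) - rkernel (\<tau> j) (\<tau> i)) = (if j = i then c i * (\<tau> (Suc i) - \<tau> i) else 0)"
      proof -
        have r: "rkernel (\<tau> (Suc j)) (\<tau> (Suc i)) = min (\<tau> (Suc i)) (\<tau> (Suc j))"
          "rkernel (\<tau> j) (\<tau> (Suc i)) = min (\<tau> (Suc i)) (\<tau> j)"
          "rkernel (\<tau> (Suc j)) (\<tau> i) = min (\<tau> i) (\<tau> (Suc j))" "rkernel (\<tau> j) (\<tau> i) = min (\<tau> i) (\<tau> j)"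
          using i j by (simp_all add: rk)
        \<comment> \<open>Over cell \<open>i\<close>, the two kernels with index \<open>j\<close>
          are both constant if \<open>j < i\<close> and both the identity if \<open>j > i\<close>,
          so only \<open>j = i\<close> contributes.\<close>
        consider "j < i" | "j = i" | "i < j" by linarith
        then show ?thesis
        proof cases
          case 1
          then have "\<tau> j \<le> \<tau> i" "\<tau> (Suc j) \<le> \<tau> i" "\<tau> i \<le> \<tau> (Suc i)" using i mono by auto
          then show ?thesis unfolding r using 1 by (simp add: min_def)
        next
          case 2
          have "\<tau> i < \<tau> (Suc i)" using i \<tau> by simp
          then show ?thesis unfolding r using 2 by (simp add: min_def)
        next
          case 3
          then have "\<tau> (Suc i) \<le> \<tau> j" "\<tau> j \<le> \<tau> (Suc j)" "\<tau> i \<le> \<tau> (Suc i)" using i j mono by auto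
          then show ?thesis unfolding r using 3 by (simp add: min_def)
        qed
      qed
    qed
    also have "\<dots> = c i * (\<tau> (Suc i) - \<tau> i)" using i by (simp add: sum.delta)
    finally show ?thesis .
  qed
  have "(cm_norm K)\<^sup>2 = cm_inner K K" by (rule cm_norm_sq)
  also have "\<dots> = (\<Sum>(a, s, t)\<leftarrow>xs. a * (K t - K s))" using inner[OF xs K] by (simp add: K_def)
  also have "\<dots> = (\<Sum>i<n. c i * (K (\<tau> (Suc i)) - K (\<tau> i)))" by (rule g)
  also have "\<dots> = (\<Sum>i<n. (c i)\<^sup>2 * (\<tau> (Suc i) - \<tau> i))"
    using diff by (intro sum.cong) (auto simp: power2_eq_square)
  finally show ?thesis by (simp add: K_def)
qed

lemma (in prob_space) normal_distributed_L2_char: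
  assumes D: "distributed M lborel X (normal_density 0 \<sigma>)" and \<sigma>: "0 < \<sigma>"
  shows "sq_int M X" "L2_norm M X = \<sigma>"
    "(\<integral>w. iexp (X w) \<partial>M) = exp (- (\<sigma>\<^sup>2) / 2)"
proof -
  have [measurable]: "X \<in> borel_measurable M" using distributed_measurable[OF D] by simp
  have mom: "has_bochner_integral lborel (\<lambda>x. normal_density 0 \<sigma> x * (x - 0) ^ (2 * 1)) (fact (2 * 1) / ((2 / \<sigma>\<^sup>2) ^ 1 * fact 1))"
    by (rule normal_moment_even[OF \<sigma>])
  have i: "integrable lborel (\<lambda>x. normal_density 0 \<sigma> x *\<^sub>R (x\<^sup>2))"
    using mom by (simp add: has_bochner_integral_iff)
  have "integrable M (\<lambda>w. (X w)\<^sup>2)"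
    using i distributed_integrable[OF D, of "\<lambda>x. x\<^sup>2"] by simp
  then show sq: "sq_int M X" by (simp add: sq_int_def)
  have "(\<integral>w. (X w)\<^sup>2 \<partial>M) = (\<integral>x. normal_density 0 \<sigma> x * x\<^sup>2 \<partial>lborel)"
    using distributed_integral[OF D, of "\<lambda>x. x\<^sup>2"] by simp
  also have "\<dots> = \<sigma>\<^sup>2" using mom \<sigma> by (simp add: has_bochner_integral_iff fact_numeral)
  finally show "L2_norm M X = \<sigma>" using \<sigma> by (simp add: L2_norm_def)
  \<comment> \<open>Rescaled to unit variance, so that the characteristic function of the standard
    normal law can be evaluated at \<sigma>.\<close>
  have "distributed M lborel (\<lambda>x. 0 + (1 / \<sigma>) * X x) (normal_density (0 + (1 / \<sigma>) * 0) (\<bar>1 / \<sigma>\<bar> * \<sigma>))"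
    using \<sigma> by (intro normal_density_affine[OF D]) auto
  then have Y: "distributed M lborel (\<lambda>x. X x / \<sigma>) std_normal_density" using \<sigma> by simp
  have "distr M borel (\<lambda>x. X x / \<sigma>) = distr M lborel (\<lambda>x. X x / \<sigma>)" by (rule distr_cong) auto
  also have "\<dots> = std_normal_distribution" using Y by (rule distributed_distr_eq_density)
  finally have dd: "distr M borel (\<lambda>x. X x / \<sigma>) = std_normal_distribution" .
  have "char (distr M borel (\<lambda>x. X x / \<sigma>)) \<sigma> = (\<integral>w. iexp (\<sigma> * (X w / \<sigma>)) \<partial>M)"
    unfolding char_def by (subst integral_distr) auto
  then show "(\<integral>w. iexp (X w) \<partial>M) = exp (- (\<sigma>\<^sup>2) / 2)"
    unfolding dd char_std_normal_distribution using \<sigma> by simp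
qed

locale wiener_space = prob_space \<mu> for \<mu> :: "(real \<Rightarrow> real) measure" +
  assumes wiener: "wiener_measure \<mu>"
begin

lemma sets_mu: "sets \<mu> = sets path_space"
  using wiener by (simp add: wiener_measure_def)

lemma coordinate_measurable[measurable]: "(\<lambda>w. w t) \<in> borel_measurable \<mu>"
proof -
  have "(\<lambda>w. w t) \<in> borel_measurable path_space"
    unfolding path_space_def by (intro measurable_restrict_space1 measurable_component_singleton) simp
  then show ?thesis using measurable_cong_sets[OF sets_mu refl] by blast
qed

lemma step_integral_measurable[measurable]: "step_integral xs \<in> borel_measurable \<mu>"
proof (induction xs)
  case (Cons x xs)
  obtain a s t where x: "x = (a, s, t)" by (cases x)
  have "step_integral (x # xs) = (\<lambda>w. a * (w t - w s) + step_integral xs w)"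
    by (simp add: step_integral_def x fun_eq_iff)
  then show ?case using Cons by simp
qed (simp add: step_integral_def)

text \<open>A sum of independent centred Gaussian increments whose variances add up to the squared
  norm. The disjunction is forced by norm zero, where the variable is constant and has no
  density.\<close>

lemma step_integral_distributed:
  assumes xs: "step_valid xs"
  shows "(cm_norm (step_primitive xs) = 0 \<and> step_integral xs = (\<lambda>w. 0)) \<or>
    (0 < cm_norm (step_primitive xs) \<and>
      distributed \<mu> lborel (step_integral xs) (normal_density 0 (cm_norm (step_primitive xs))))"
proof -
  obtain n and \<tau> c :: "nat \<Rightarrow> real" where \<tau>: "\<And>i. i \<le> n \<Longrightarrow> \<tau> i \<in> {0..1}" "\<And>i. i < n \<Longrightarrow> \<tau> i < \<tau> (Suc i)"
    and g: "\<And>g :: real \<Rightarrow> real. (\<Sum>(a, s, t)\<leftarrow>xs. a * (g t - g s)) = (\<Sum>i<n. c i * (g (\<tau> (Suc i)) - g (\<tau> i)))"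
    using step_common_partition[OF xs] by blast
  have norm: "(cm_norm (step_primitive xs))\<^sup>2 = (\<Sum>i<n. (c i)\<^sup>2 * (\<tau> (Suc i) - \<tau> i))"
    using xs \<tau> g by (rule step_primitive_norm)
  \<comment> \<open>Cells with coefficient 0 are removed, because every summand must have positive
    variance.\<close>
  define I where "I = {i. i < n \<and> c i \<noteq> 0}"
  define X where "X i w = c i * (w (\<tau> (Suc i)) - w (\<tau> i))" for i and w :: "real \<Rightarrow> real"
  define s where "s i = \<bar>c i\<bar> * sqrt (\<tau> (Suc i) - \<tau> i)" for i
  have fin: "finite I" by (simp add: I_def)
  have SI: "step_integral xs = (\<lambda>w. \<Sum>i\<in>I. X i w)"
  proof
    fix w
    have "step_integral xs w = (\<Sum>i<n. X i w)" unfolding step_integral_def X_def by (rule g)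
    also have "\<dots> = (\<Sum>i\<in>I. X i w)" by (intro sum.mono_neutral_right) (auto simp: I_def X_def)
    finally show "step_integral xs w = (\<Sum>i\<in>I. X i w)" .
  qed
  have "(cm_norm (step_primitive xs))\<^sup>2 = (\<Sum>i\<in>I. (c i)\<^sup>2 * (\<tau> (Suc i) - \<tau> i))"
    unfolding norm by (intro sum.mono_neutral_right) (auto simp: I_def)
  also have "\<dots> = (\<Sum>i\<in>I. (s i)\<^sup>2)"
    using \<tau>(2) by (intro sum.cong) (auto simp: s_def power_mult_distrib I_def less_imp_le)
  finally have norm2: "(cm_norm (step_primitive xs))\<^sup>2 = (\<Sum>i\<in>I. (s i)\<^sup>2)" .
  have sp: "0 < s i" if "i \<in> I" for i using that \<tau>(2) by (simp add: s_def I_def)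
  show ?thesis
  proof (cases "I = {}")
    case True
    then show ?thesis using SI norm2 by simp
  next
    case False
    have iv: "indep_vars (\<lambda>_. borel) (\<lambda>i w. w (\<tau> (Suc i)) - w (\<tau> i)) {..<n}"
      using wiener \<tau> unfolding wiener_measure_def by simp
    have "indep_vars (\<lambda>_. borel) (\<lambda>i w. w (\<tau> (Suc i)) - w (\<tau> i)) I"
      by (rule indep_vars_subset[OF iv]) (auto simp: I_def)
    then have ind: "indep_vars (\<lambda>_. borel) X I"
      unfolding X_def by (rule indep_vars_compose2[where Y="\<lambda>i x. c i * x"]) simp
    have dist: "distributed \<mu> lborel (X i) (normal_density 0 (s i))" if i: "i \<in> I" for i
    proof -
      have "i < n" "c i \<noteq> 0" using i by (simp_all add: I_def)
      then have "0 \<le> \<tau> i" "\<tau> i < \<tau> (Suc i)" "\<tau> (Suc i) \<le> 1" using \<tau>(1)[of i] \<tau>(1)[of "Suc i"] \<tau>(2) by auto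
      then have "distributed \<mu> lborel (\<lambda>w. w (\<tau> (Suc i)) - w (\<tau> i)) (normal_density 0 (sqrt (\<tau> (Suc i) - \<tau> i)))"
        using wiener unfolding wiener_measure_def by simp
      from normal_density_affine[OF this, of "c i" 0] \<open>c i \<noteq> 0\<close> \<open>\<tau> i < \<tau> (Suc i)\<close>
      show ?thesis by (simp add: X_def[abs_def] s_def)
    qed
    have "distributed \<mu> lborel (\<lambda>w. \<Sum>i\<in>I. X i w) (normal_density (\<Sum>i\<in>I. 0) (sqrt (\<Sum>i\<in>I. (s i)\<^sup>2)))"
      using fin False ind sp dist by (rule sum_indep_normal)
    moreover have "sqrt (\<Sum>i\<in>I. (s i)\<^sup>2) = cm_norm (step_primitive xs)"
      unfolding norm2[symmetric] by simp
    moreover have "0 < (\<Sum>i\<in>I. (s i)\<^sup>2)"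
    proof (rule sum_pos[OF fin False])
      fix i assume "i \<in> I"
      from sp[OF this] show "0 < (s i)\<^sup>2" by simp
    qed
    then have "0 < cm_norm (step_primitive xs)"
      unfolding norm2[symmetric] by (simp add: less_le)
    ultimately show ?thesis using SI by simp
  qed
qed

lemma step_integral_L2:
  assumes "step_valid xs"
  shows "sq_int \<mu> (step_integral xs)" "L2_norm \<mu> (step_integral xs) = cm_norm (step_primitive xs)"
    "(\<integral>w. iexp (step_integral xs w) \<partial>\<mu>) = exp (- ((cm_norm (step_primitive xs))\<^sup>2) / 2)"
proof -
  from step_integral_distributed[OF assms]
  have "sq_int \<mu> (step_integral xs) \<and> L2_norm \<mu> (step_integral xs) = cm_norm (step_primitive xs) \<and>
    (\<integral>w. iexp (step_integral xs w) \<partial>\<mu>) = exp (- ((cm_norm (step_primitive xs))\<^sup>2) / 2)"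
  proof
    assume "cm_norm (step_primitive xs) = 0 \<and> step_integral xs = (\<lambda>w. 0)"
    then show ?thesis by (simp add: sq_int_zero prob_space)
  next
    assume A: "0 < cm_norm (step_primitive xs) \<and>
      distributed \<mu> lborel (step_integral xs) (normal_density 0 (cm_norm (step_primitive xs)))"
    from normal_distributed_L2_char[OF A[THEN conjunct2] A[THEN conjunct1]] show ?thesis by simp
  qed
  then show "sq_int \<mu> (step_integral xs)" "L2_norm \<mu> (step_integral xs) = cm_norm (step_primitive xs)"
    "(\<integral>w. iexp (step_integral xs w) \<partial>\<mu>) = exp (- ((cm_norm (step_primitive xs))\<^sup>2) / 2)" by simp_all
qed

end

section \<open>The Wiener integral as a closed linear relation\<close>

context wiener_space
begin

lemma L1_le_L2:
  assumes "sq_int \<mu> X"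
  shows "(\<integral>w. \<bar>X w\<bar> \<partial>\<mu>) \<le> L2_norm \<mu> X" "integrable \<mu> X"
proof -
  have one: "sq_int \<mu> (\<lambda>w. 1)" by (simp add: sq_int_def)
  have "\<bar>\<integral>w. \<bar>X w\<bar> * 1 \<partial>\<mu>\<bar> \<le> L2_norm \<mu> (\<lambda>w. \<bar>X w\<bar>) * L2_norm \<mu> (\<lambda>w. 1)"
    by (intro L2_Cauchy_Schwarz sq_int_abs assms one)
  moreover have "L2_norm \<mu> (\<lambda>w. 1) = 1" by (simp add: L2_norm_def prob_space)
  ultimately show "(\<integral>w. \<bar>X w\<bar> \<partial>\<mu>) \<le> L2_norm \<mu> X" by (simp add: L2_norm_abs)
  show "integrable \<mu> X" using sq_int_prod_integrable[OF assms one] by simp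
qed

text \<open>The function \<open>x \<mapsto> exp (i x)\<close> is 1-Lipschitz. Through this bound
  characteristic functions survive mean-square limits.\<close>

lemma iexp_integral_diff_le:
  assumes X: "sq_int \<mu> X" and Y: "sq_int \<mu> Y"
  shows "cmod ((\<integral>w. iexp (X w) \<partial>\<mu>) - (\<integral>w. iexp (Y w) \<partial>\<mu>)) \<le> L2_norm \<mu> (\<lambda>w. X w - Y w)"
proof -
  have iX: "integrable \<mu> (\<lambda>w. iexp (X w))" and iY: "integrable \<mu> (\<lambda>w. iexp (Y w))"
    using X Y by (auto simp: sq_int_def intro!: integrable_iexp)
  have "cmod (iexp x - iexp y) \<le> \<bar>x - y\<bar>" for x y :: real
  proof -
    have "cmod (iexp x - iexp y) = cmod (iexp y * (iexp (x - y) - 1))"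
      by (simp add: right_diff_distrib exp_add[symmetric] distrib_left[symmetric])
    also have "\<dots> = cmod (iexp (x - y) - 1)" by (simp add: norm_mult)
    also have "\<dots> \<le> \<bar>x - y\<bar>" using iexp_approx1[of "x - y" 0] by simp
    finally show ?thesis .
  qed
  note le = this
  have "cmod (\<integral>w. iexp (X w) - iexp (Y w) \<partial>\<mu>) \<le> (\<integral>w. \<bar>X w - Y w\<bar> \<partial>\<mu>)"
  proof (rule order_trans[OF integral_norm_bound])
    show "(\<integral>w. cmod (iexp (X w) - iexp (Y w)) \<partial>\<mu>) \<le> (\<integral>w. \<bar>X w - Y w\<bar> \<partial>\<mu>)"
    proof (rule integral_mono)
      show "integrable \<mu> (\<lambda>w. cmod (iexp (X w) - iexp (Y w)))" using iX iY by simp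
      show "integrable \<mu> (\<lambda>w. \<bar>X w - Y w\<bar>)" using L1_le_L2(2)[OF sq_int_diff[OF X Y]] by simp
    qed (rule le)
  qed
  also have "\<dots> \<le> L2_norm \<mu> (\<lambda>w. X w - Y w)" by (rule L1_le_L2(1)[OF sq_int_diff[OF X Y]])
  finally show ?thesis using iX iY by simp
qed

text \<open>The closure, in the product of \<open>CM\<close> and the square-integrable variables, of
  the graph sending a step primitive to its step integral. One list has to approximate both
  components at once; this is what makes the isometry and the Gaussian law pass to all related
  pairs.\<close>

definition wdelta :: "(real \<Rightarrow> real) \<Rightarrow> ((real \<Rightarrow> real) \<Rightarrow> real) \<Rightarrow> bool" where
  "wdelta h X \<longleftrightarrow> h \<in> CM \<and> sq_int \<mu> X \<and> (\<forall>\<epsilon>>0. \<exists>xs. step_valid xs \<and>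
     cm_norm (\<lambda>t. step_primitive xs t - h t) < \<epsilon> \<and> L2_norm \<mu> (\<lambda>w. step_integral xs w - X w) < \<epsilon>)"

lemma wdelta_CM: "wdelta h X \<Longrightarrow> h \<in> CM"
  by (simp add: wdelta_def)

lemma wdelta_sq_int: "wdelta h X \<Longrightarrow> sq_int \<mu> X"
  by (simp add: wdelta_def)

lemma wdelta_approx:
  assumes "wdelta h X" "0 < \<epsilon>"
  obtains xs where "step_valid xs" "cm_norm (\<lambda>t. step_primitive xs t - h t) < \<epsilon>"
    "L2_norm \<mu> (\<lambda>w. step_integral xs w - X w) < \<epsilon>"
  using assms unfolding wdelta_def by metis

lemma wdelta_step: "step_valid xs \<Longrightarrow> wdelta (step_primitive xs) (step_integral xs)"
  unfolding wdelta_def using step_primitive_CM step_integral_L2(1)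
  by (auto intro!: exI[of _ xs] simp: cm_norm_def)

text \<open>Closedness of the relation. Every later extension, from step functions to the series for
  \<open>T\<close> and to composition with \<open>T\<close>, goes through it.\<close>

lemma wdelta_limit:
  assumes X: "\<And>n. wdelta (h n) (X n)" and h: "h' \<in> CM" and Y: "sq_int \<mu> Y"
    and lh: "(\<lambda>n. cm_norm (\<lambda>t. h n t - h' t)) \<longlonglongrightarrow> 0"
    and lX: "(\<lambda>n. L2_norm \<mu> (\<lambda>w. X n w - Y w)) \<longlonglongrightarrow> 0"
  shows "wdelta h' Y"
  unfolding wdelta_def
proof (intro conjI allI impI h Y)
  fix \<epsilon> :: real assume "0 < \<epsilon>"
  then have e: "0 < \<epsilon> / 2" by simp
  have "\<forall>\<^sub>F n in sequentially. cm_norm (\<lambda>t. h n t - h' t) < \<epsilon> / 2 \<and> L2_norm \<mu> (\<lambda>w. X n w - Y w) < \<epsilon> / 2"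
    using order_tendstoD(2)[OF lh e] order_tendstoD(2)[OF lX e] by (rule eventually_conj)
  then obtain n where n: "cm_norm (\<lambda>t. h n t - h' t) < \<epsilon> / 2" "L2_norm \<mu> (\<lambda>w. X n w - Y w) < \<epsilon> / 2"
    using eventually_happens'[OF sequentially_bot] by blast
  obtain xs where xs: "step_valid xs" "cm_norm (\<lambda>t. step_primitive xs t - h n t) < \<epsilon> / 2"
    "L2_norm \<mu> (\<lambda>w. step_integral xs w - X n w) < \<epsilon> / 2"
    by (rule wdelta_approx[OF X[of n] e])
  have "cm_norm (\<lambda>t. step_primitive xs t - h' t) < \<epsilon>"
    using cm_norm_triangle[OF step_primitive_CM[OF xs(1)] wdelta_CM[OF X[of n]] h] xs(2) n(1) by linarith
  moreover have "L2_norm \<mu> (\<lambda>w. step_integral xs w - Y w) < \<epsilon>"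
    using L2_norm_triangle[OF step_integral_L2(1)[OF xs(1)] wdelta_sq_int[OF X[of n]] Y] xs(3) n(2) by linarith
  ultimately show "\<exists>xs. step_valid xs \<and> cm_norm (\<lambda>t. step_primitive xs t - h' t) < \<epsilon> \<and>
      L2_norm \<mu> (\<lambda>w. step_integral xs w - Y w) < \<epsilon>" using xs(1) by blast
qed

lemma wdelta_seq:
  assumes X: "wdelta h X"
  obtains \<phi> where "\<And>n. step_valid (\<phi> n)"
    "(\<lambda>n. cm_norm (\<lambda>t. step_primitive (\<phi> n) t - h t)) \<longlonglongrightarrow> 0"
    "(\<lambda>n. L2_norm \<mu> (\<lambda>w. step_integral (\<phi> n) w - X w)) \<longlonglongrightarrow> 0"
proof -
  have "\<forall>n. \<exists>xs. step_valid xs \<and> cm_norm (\<lambda>t. step_primitive xs t - h t) < inverse (real (Suc n)) \<and>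
      L2_norm \<mu> (\<lambda>w. step_integral xs w - X w) < inverse (real (Suc n))"
    using X unfolding wdelta_def by simp
  from choice[OF this] obtain \<phi> where \<phi>: "\<And>n. step_valid (\<phi> n)"
    "\<And>n. cm_norm (\<lambda>t. step_primitive (\<phi> n) t - h t) < inverse (real (Suc n))"
    "\<And>n. L2_norm \<mu> (\<lambda>w. step_integral (\<phi> n) w - X w) < inverse (real (Suc n))"
    by auto
  have "(\<lambda>n. cm_norm (\<lambda>t. step_primitive (\<phi> n) t - h t)) \<longlonglongrightarrow> 0"
    by (rule tendsto_sandwich[OF _ _ tendsto_const LIMSEQ_inverse_real_of_nat])
      (auto intro!: always_eventually less_imp_le[OF \<phi>(2)] simp del: of_nat_Suc)
  moreover have "(\<lambda>n. L2_norm \<mu> (\<lambda>w. step_integral (\<phi> n) w - X w)) \<longlonglongrightarrow> 0"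
    by (rule tendsto_sandwich[OF _ _ tendsto_const LIMSEQ_inverse_real_of_nat])
      (auto intro!: always_eventually less_imp_le[OF \<phi>(3)] simp del: of_nat_Suc)
  ultimately show thesis using that \<phi>(1) by blast
qed

lemma wdelta_add:
  assumes X: "wdelta h X" and Y: "wdelta k Y"
  shows "wdelta (\<lambda>t. h t + k t) (\<lambda>w. X w + Y w)"
  unfolding wdelta_def
proof (intro conjI allI impI)
  note h = wdelta_CM[OF X] and k = wdelta_CM[OF Y] and sX = wdelta_sq_int[OF X] and sY = wdelta_sq_int[OF Y]
  show "(\<lambda>t. h t + k t) \<in> CM" "sq_int \<mu> (\<lambda>w. X w + Y w)"
    using h k sX sY by (simp_all add: CM_add sq_int_add)
  fix \<epsilon> :: real assume "0 < \<epsilon>"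
  then have e: "0 < \<epsilon> / 2" by simp
  obtain xs where xs: "step_valid xs" "cm_norm (\<lambda>t. step_primitive xs t - h t) < \<epsilon> / 2"
    "L2_norm \<mu> (\<lambda>w. step_integral xs w - X w) < \<epsilon> / 2" by (rule wdelta_approx[OF X e])
  obtain ys where ys: "step_valid ys" "cm_norm (\<lambda>t. step_primitive ys t - k t) < \<epsilon> / 2"
    "L2_norm \<mu> (\<lambda>w. step_integral ys w - Y w) < \<epsilon> / 2" by (rule wdelta_approx[OF Y e])
  have "cm_norm (\<lambda>t. (step_primitive xs t - h t) + (step_primitive ys t - k t)) < \<epsilon>"
    using cm_norm_add[OF CM_diff[OF step_primitive_CM[OF xs(1)] h] CM_diff[OF step_primitive_CM[OF ys(1)] k]]
      xs(2) ys(2) by linarith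
  moreover have "L2_norm \<mu> (\<lambda>w. (step_integral xs w - X w) + (step_integral ys w - Y w)) < \<epsilon>"
    using L2_norm_add[OF sq_int_diff[OF step_integral_L2(1)[OF xs(1)] sX] sq_int_diff[OF step_integral_L2(1)[OF ys(1)] sY]]
      xs(3) ys(3) by linarith
  ultimately show "\<exists>xs. step_valid xs \<and> cm_norm (\<lambda>t. step_primitive xs t - (h t + k t)) < \<epsilon> \<and>
      L2_norm \<mu> (\<lambda>w. step_integral xs w - (X w + Y w)) < \<epsilon>"
    using xs(1) ys(1)
    by (intro exI[of _ "xs @ ys"]) (simp add: step_valid_append step_primitive_append step_integral_append algebra_simps)
qed

text \<open>An approximating sequence is scaled as a whole, which avoids dividing a tolerance by a
  coefficient that may be 0.\<close>

lemma wdelta_cmult: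
  assumes X: "wdelta h X"
  shows "wdelta (\<lambda>t. a * h t) (\<lambda>w. a * X w)"
proof -
  note h = wdelta_CM[OF X] and sX = wdelta_sq_int[OF X]
  obtain \<phi> where \<phi>: "\<And>n. step_valid (\<phi> n)"
    "(\<lambda>n. cm_norm (\<lambda>t. step_primitive (\<phi> n) t - h t)) \<longlonglongrightarrow> 0"
    "(\<lambda>n. L2_norm \<mu> (\<lambda>w. step_integral (\<phi> n) w - X w)) \<longlonglongrightarrow> 0"
    by (rule wdelta_seq[OF X]) (rule that)
  define \<psi> where "\<psi> n = map (\<lambda>(b, s, t). (a * b, s, t)) (\<phi> n)" for n
  have prim: "step_primitive (\<psi> n) = (\<lambda>u. a * step_primitive (\<phi> n) u)"
    and int: "step_integral (\<psi> n) = (\<lambda>u. a * step_integral (\<phi> n) u)" for n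
    unfolding \<psi>_def by (rule step_primitive_scale, rule step_integral_scale)
  show ?thesis
  proof (rule wdelta_limit[where h="\<lambda>n. step_primitive (\<psi> n)" and X="\<lambda>n. step_integral (\<psi> n)"])
    show "wdelta (step_primitive (\<psi> n)) (step_integral (\<psi> n))" for n
      unfolding \<psi>_def by (intro wdelta_step step_valid_scale \<phi>(1))
    show "(\<lambda>t. a * h t) \<in> CM" "sq_int \<mu> (\<lambda>w. a * X w)" using h sX by (simp_all add: CM_cmult sq_int_cmult)
    have "cm_norm (\<lambda>t. step_primitive (\<psi> n) t - a * h t) = \<bar>a\<bar> * cm_norm (\<lambda>t. step_primitive (\<phi> n) t - h t)" for n
      using cm_norm_cmult[OF CM_diff[OF step_primitive_CM[OF \<phi>(1)] h], of a n]
      by (simp add: prim right_diff_distrib)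
    then show "(\<lambda>n. cm_norm (\<lambda>t. step_primitive (\<psi> n) t - a * h t)) \<longlonglongrightarrow> 0"
      using tendsto_mult_right_zero[OF \<phi>(2), of "\<bar>a\<bar>"] by simp
    have "L2_norm \<mu> (\<lambda>w. step_integral (\<psi> n) w - a * X w) = \<bar>a\<bar> * L2_norm \<mu> (\<lambda>w. step_integral (\<phi> n) w - X w)" for n
      using L2_norm_cmult[of \<mu> a "\<lambda>w. step_integral (\<phi> n) w - X w"]
      by (simp add: int right_diff_distrib)
    then show "(\<lambda>n. L2_norm \<mu> (\<lambda>w. step_integral (\<psi> n) w - a * X w)) \<longlonglongrightarrow> 0"
      using tendsto_mult_right_zero[OF \<phi>(3), of "\<bar>a\<bar>"] by simp
  qed
qed

lemma wdelta_diff: "wdelta h X \<Longrightarrow> wdelta k Y \<Longrightarrow> wdelta (\<lambda>t. h t - k t) (\<lambda>w. X w - Y w)"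
  using wdelta_add[OF _ wdelta_cmult[of k Y "-1"], of h X] by simp

lemma wdelta_zero: "wdelta (\<lambda>t. 0) (\<lambda>w. 0)"
  using wdelta_step[of "[]"] by (simp add: step_valid_def step_primitive_Nil step_integral_def[abs_def])

lemma wdelta_sum: "(\<And>i. i \<in> I \<Longrightarrow> wdelta (h i) (X i)) \<Longrightarrow> wdelta (\<lambda>t. \<Sum>i\<in>I. h i t) (\<lambda>w. \<Sum>i\<in>I. X i w)"
  by (induction I rule: infinite_finite_induct) (auto intro: wdelta_zero wdelta_add)

text \<open>The Wiener isometry: exact on step functions, and both norms are continuous along the
  approximation.\<close>

lemma wdelta_norm:
  assumes X: "wdelta h X"
  shows "L2_norm \<mu> X = cm_norm h"
proof -
  obtain \<phi> where \<phi>: "\<And>n. step_valid (\<phi> n)"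
    "(\<lambda>n. cm_norm (\<lambda>t. step_primitive (\<phi> n) t - h t)) \<longlonglongrightarrow> 0"
    "(\<lambda>n. L2_norm \<mu> (\<lambda>w. step_integral (\<phi> n) w - X w)) \<longlonglongrightarrow> 0"
    by (rule wdelta_seq[OF X]) (rule that)
  have "(\<lambda>n. cm_norm (step_primitive (\<phi> n))) \<longlonglongrightarrow> cm_norm h"
    by (rule Lim_transform_bound[THEN LIM_zero_cancel, OF _ \<phi>(2)])
      (auto intro!: always_eventually cm_norm_diff_le step_primitive_CM \<phi>(1) wdelta_CM[OF X])
  moreover have "(\<lambda>n. L2_norm \<mu> (step_integral (\<phi> n))) \<longlonglongrightarrow> L2_norm \<mu> X"
    by (rule Lim_transform_bound[THEN LIM_zero_cancel, OF _ \<phi>(3)])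
      (auto intro!: always_eventually L2_norm_diff_le step_integral_L2 \<phi>(1) wdelta_sq_int[OF X])
  ultimately show ?thesis
    unfolding step_integral_L2(2)[OF \<phi>(1)] by (rule LIMSEQ_unique[rotated])
qed

lemma wdelta_char:
  assumes X: "wdelta h X"
  shows "(\<integral>w. iexp (X w) \<partial>\<mu>) = exp (- ((cm_norm h)\<^sup>2) / 2)"
proof -
  obtain \<phi> where \<phi>: "\<And>n. step_valid (\<phi> n)"
    "(\<lambda>n. cm_norm (\<lambda>t. step_primitive (\<phi> n) t - h t)) \<longlonglongrightarrow> 0"
    "(\<lambda>n. L2_norm \<mu> (\<lambda>w. step_integral (\<phi> n) w - X w)) \<longlonglongrightarrow> 0"
    by (rule wdelta_seq[OF X]) (rule that)
  have "(\<lambda>n. cm_norm (step_primitive (\<phi> n))) \<longlonglongrightarrow> cm_norm h"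
    by (rule Lim_transform_bound[THEN LIM_zero_cancel, OF _ \<phi>(2)])
      (auto intro!: always_eventually cm_norm_diff_le step_primitive_CM \<phi>(1) wdelta_CM[OF X])
  then have "(\<lambda>n. complex_of_real (exp (- ((cm_norm (step_primitive (\<phi> n)))\<^sup>2) / 2)))
      \<longlonglongrightarrow> complex_of_real (exp (- ((cm_norm h)\<^sup>2) / 2))"
    by (intro tendsto_intros) auto
  moreover have "(\<lambda>n. \<integral>w. iexp (step_integral (\<phi> n) w) \<partial>\<mu>) \<longlonglongrightarrow> (\<integral>w. iexp (X w) \<partial>\<mu>)"
    by (rule Lim_transform_bound[THEN LIM_zero_cancel, OF _ \<phi>(3)])
      (auto intro!: always_eventually iexp_integral_diff_le step_integral_L2 \<phi>(1) wdelta_sq_int[OF X])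
  ultimately show ?thesis
    unfolding step_integral_L2(3)[OF \<phi>(1)] by (rule LIMSEQ_unique[rotated])
qed

lemma wdelta_inner:
  assumes X: "wdelta h X" and Y: "wdelta k Y"
  shows "(\<integral>w. X w * Y w \<partial>\<mu>) = cm_inner h k"
proof -
  note h = wdelta_CM[OF X] and k = wdelta_CM[OF Y] and sX = wdelta_sq_int[OF X] and sY = wdelta_sq_int[OF Y]
  have "(L2_norm \<mu> (\<lambda>w. X w + Y w))\<^sup>2 = (\<integral>w. (X w)\<^sup>2 + (Y w)\<^sup>2 + 2 * (X w * Y w) \<partial>\<mu>)"
    by (simp add: L2_norm_sq power2_sum mult.assoc)
  also have "\<dots> = (L2_norm \<mu> X)\<^sup>2 + (L2_norm \<mu> Y)\<^sup>2 + 2 * (\<integral>w. X w * Y w \<partial>\<mu>)"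
    using sX sY sq_int_prod_integrable[OF sX sY] by (simp add: sq_int_def L2_norm_sq)
  finally have "(cm_norm (\<lambda>t. h t + k t))\<^sup>2 = (cm_norm h)\<^sup>2 + (cm_norm k)\<^sup>2 + 2 * (\<integral>w. X w * Y w \<partial>\<mu>)"
    by (simp only: wdelta_norm[OF wdelta_add[OF X Y]] wdelta_norm[OF X] wdelta_norm[OF Y])
  moreover have "(cm_norm (\<lambda>t. h t + k t))\<^sup>2 = (cm_norm h)\<^sup>2 + (cm_norm k)\<^sup>2 + 2 * cm_inner h k"
    unfolding cm_norm_sq using h k
    by (simp add: cm_inner_add_left cm_inner_add_right CM_add cm_inner_commute[of k h])
  ultimately show ?thesis by linarith
qed

text \<open>The a.e. derivative of a step primitive translates the convergence of step functions
  into convergence in \<open>CM\<close>; the remaining point is that \<open>X\<close>, so far only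
  measurable, is square-integrable.\<close>

lemma wdelta_of_is_delta:
  assumes D: "is_delta \<mu> h X" and h: "h \<in> CM"
  shows "wdelta h X"
proof -
  from D[unfolded is_delta_def is_wiener_integral_def]
  obtain \<phi> where X: "X \<in> borel_measurable \<mu>"
    and V: "\<forall>n. \<forall>(a, s, t)\<in>set (\<phi> n). 0 \<le> s \<and> s \<le> t \<and> t \<le> 1"
    and l1: "(\<lambda>n. \<integral>\<^sup>+u. ennreal ((step_fun (\<phi> n) u - deriv h u)\<^sup>2) \<partial>leb01) \<longlonglongrightarrow> 0"
    and l2: "(\<lambda>n. \<integral>\<^sup>+w. ennreal ((step_integral (\<phi> n) w - X w)\<^sup>2) \<partial>\<mu>) \<longlonglongrightarrow> 0"
    by (elim conjE exE)
  have v: "step_valid (\<phi> n)" for n using V unfolding step_valid_def by (rule spec)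
  have K: "step_primitive (\<phi> n) \<in> CM" for n using v by (rule step_primitive_CM)
  have Kh: "(\<lambda>t. step_primitive (\<phi> n) t - h t) \<in> CM" for n using K h by (rule CM_diff)
  have e1: "(\<integral>\<^sup>+u. ennreal ((step_fun (\<phi> n) u - deriv h u)\<^sup>2) \<partial>leb01)
      = ennreal ((cm_norm (\<lambda>t. step_primitive (\<phi> n) t - h t))\<^sup>2)" for n
  proof -
    have "AE u in leb01. deriv (\<lambda>t. 1 * step_primitive (\<phi> n) t + (-1) * h t) u = 1 * deriv (step_primitive (\<phi> n)) u + (-1) * deriv h u"
      by (rule CM_deriv_lincomb[OF K h])
    then have "AE u in leb01. ennreal ((step_fun (\<phi> n) u - deriv h u)\<^sup>2) = ennreal ((deriv (\<lambda>t. step_primitive (\<phi> n) t - h t) u)\<^sup>2)"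
      using deriv_step_primitive[OF v[of n]] by eventually_elim simp
    then have "(\<integral>\<^sup>+u. ennreal ((step_fun (\<phi> n) u - deriv h u)\<^sup>2) \<partial>leb01)
        = (\<integral>\<^sup>+u. ennreal ((deriv (\<lambda>t. step_primitive (\<phi> n) t - h t) u)\<^sup>2) \<partial>leb01)"
      by (rule nn_integral_cong_AE)
    also have "\<dots> = ennreal ((cm_norm (\<lambda>t. step_primitive (\<phi> n) t - h t))\<^sup>2)"
      unfolding cm_norm_eq by (rule nn_integral_sq_eq_L2_norm[OF CM_sq_int[OF Kh]])
    finally show ?thesis .
  qed
  have m: "(\<lambda>w. step_integral (\<phi> n) w - X w) \<in> borel_measurable \<mu>" for n
    using X step_integral_measurable by (rule borel_measurable_diff[rotated])
  have small: "\<exists>n. cm_norm (\<lambda>t. step_primitive (\<phi> n) t - h t) < \<epsilon> \<and>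
      (\<integral>\<^sup>+w. ennreal ((step_integral (\<phi> n) w - X w)\<^sup>2) \<partial>\<mu>) < ennreal (\<epsilon>\<^sup>2)" if e: "0 < \<epsilon>" for \<epsilon> :: real
  proof -
    have e2: "0 < ennreal (\<epsilon>\<^sup>2)" using e by simp
    have "\<forall>\<^sub>F n in sequentially. (\<integral>\<^sup>+u. ennreal ((step_fun (\<phi> n) u - deriv h u)\<^sup>2) \<partial>leb01) < ennreal (\<epsilon>\<^sup>2) \<and>
        (\<integral>\<^sup>+w. ennreal ((step_integral (\<phi> n) w - X w)\<^sup>2) \<partial>\<mu>) < ennreal (\<epsilon>\<^sup>2)"
      using order_tendstoD(2)[OF l1 e2] order_tendstoD(2)[OF l2 e2] by (rule eventually_conj)
    then obtain n where n: "(\<integral>\<^sup>+u. ennreal ((step_fun (\<phi> n) u - deriv h u)\<^sup>2) \<partial>leb01) < ennreal (\<epsilon>\<^sup>2)"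
        "(\<integral>\<^sup>+w. ennreal ((step_integral (\<phi> n) w - X w)\<^sup>2) \<partial>\<mu>) < ennreal (\<epsilon>\<^sup>2)"
      using eventually_happens'[OF sequentially_bot] by blast
    have "(cm_norm (\<lambda>t. step_primitive (\<phi> n) t - h t))\<^sup>2 < \<epsilon>\<^sup>2"
      using n(1) e unfolding e1 by (simp add: ennreal_less_iff)
    then have "cm_norm (\<lambda>t. step_primitive (\<phi> n) t - h t) < \<epsilon>"
      by (rule power2_less_imp_less) (use e in simp)
    then show ?thesis using n(2) by blast
  qed
  \<comment> \<open>A single step integral at finite distance from \<open>X\<close> makes
    \<open>X\<close> a difference of square-integrable functions.\<close>
  obtain n where "(\<integral>\<^sup>+w. ennreal ((step_integral (\<phi> n) w - X w)\<^sup>2) \<partial>\<mu>) < ennreal (1\<^sup>2)"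
    using small[OF zero_less_one] by blast
  from less_trans[OF this ennreal_less_top]
  have "sq_int \<mu> (\<lambda>w. step_integral (\<phi> n) w - X w)"
    by (intro sq_int_if_nn_integral_finite m) simp
  from sq_int_diff[OF step_integral_L2(1)[OF v[of n]] this] have sX: "sq_int \<mu> X" by simp
  show ?thesis
    unfolding wdelta_def
  proof (intro conjI allI impI h sX)
    fix \<epsilon> :: real assume e: "0 < \<epsilon>"
    from small[OF this] obtain n where n: "cm_norm (\<lambda>t. step_primitive (\<phi> n) t - h t) < \<epsilon>"
      "(\<integral>\<^sup>+w. ennreal ((step_integral (\<phi> n) w - X w)\<^sup>2) \<partial>\<mu>) < ennreal (\<epsilon>\<^sup>2)" by blast
    have s: "sq_int \<mu> (\<lambda>w. step_integral (\<phi> n) w - X w)" by (intro sq_int_diff step_integral_L2 v sX)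
    have "(L2_norm \<mu> (\<lambda>w. step_integral (\<phi> n) w - X w))\<^sup>2 < \<epsilon>\<^sup>2"
      using n(2) e unfolding nn_integral_sq_eq_L2_norm[OF s] by (simp add: ennreal_less_iff)
    then have "L2_norm \<mu> (\<lambda>w. step_integral (\<phi> n) w - X w) < \<epsilon>"
      by (rule power2_less_imp_less) (use e in simp)
    then show "\<exists>xs. step_valid xs \<and> cm_norm (\<lambda>t. step_primitive xs t - h t) < \<epsilon> \<and>
        L2_norm \<mu> (\<lambda>w. step_integral xs w - X w) < \<epsilon>" using n(1) v by blast
  qed
qed

end

section \<open>Rotations of the Wiener space\<close>

lemma unitary_CM_D:
  assumes "unitary_CM R"
  shows "h \<in> CM \<Longrightarrow> R h \<in> CM"
    "h \<in> CM \<Longrightarrow> \<exists>k\<in>CM. R k = h"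
    "h \<in> CM \<Longrightarrow> k \<in> CM \<Longrightarrow> R (\<lambda>t. a * h t + b * k t) = (\<lambda>t. a * R h t + b * R k t)"
    "h \<in> CM \<Longrightarrow> k \<in> CM \<Longrightarrow> cm_inner (R h) (R k) = cm_inner h k"
proof -
  have im: "R ` CM = CM" using assms unfolding unitary_CM_def by (elim conjE)
  show "R h \<in> CM" if "h \<in> CM" using im that by (metis imageI)
  show "\<exists>k\<in>CM. R k = h" if "h \<in> CM" using im that by (metis imageE)
  show "R (\<lambda>t. a * h t + b * k t) = (\<lambda>t. a * R h t + b * R k t)" if "h \<in> CM" "k \<in> CM"
    using assms that unfolding unitary_CM_def by simp
  show "cm_inner (R h) (R k) = cm_inner h k" if "h \<in> CM" "k \<in> CM"
    using assms that unfolding unitary_CM_def by simp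
qed

lemma unitary_CM_linear:
  assumes U: "unitary_CM R"
  shows "R (\<lambda>t. 0) = (\<lambda>t. 0)"
    "h \<in> CM \<Longrightarrow> R (\<lambda>t. a * h t) = (\<lambda>t. a * R h t)"
    "h \<in> CM \<Longrightarrow> k \<in> CM \<Longrightarrow> R (\<lambda>t. h t + k t) = (\<lambda>t. R h t + R k t)"
    "h \<in> CM \<Longrightarrow> k \<in> CM \<Longrightarrow> R (\<lambda>t. h t - k t) = (\<lambda>t. R h t - R k t)"
  using unitary_CM_D(3)[OF U CM_zero CM_zero, of 0 0] unitary_CM_D(3)[OF U, of h h a 0]
    unitary_CM_D(3)[OF U, of h k 1 1] unitary_CM_D(3)[OF U, of h k 1 "-1"] by simp_all

lemma unitary_CM_sum:
  assumes U: "unitary_CM R" and "\<And>i. i \<in> I \<Longrightarrow> f i \<in> CM"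
  shows "R (\<lambda>t. \<Sum>i\<in>I. f i t) = (\<lambda>t. \<Sum>i\<in>I. R (f i) t)"
  using assms(2)
proof (induction I rule: infinite_finite_induct)
  case (insert i I)
  have "R (\<lambda>t. f i t + (\<Sum>i\<in>I. f i t)) = (\<lambda>t. R (f i) t + R (\<lambda>t. \<Sum>i\<in>I. f i t) t)"
    using insert.prems by (intro unitary_CM_linear(3)[OF U] CM_sum) auto
  then show ?case using insert by simp
qed (simp_all add: unitary_CM_linear(1)[OF U])

lemma unitary_CM_norm: "unitary_CM R \<Longrightarrow> h \<in> CM \<Longrightarrow> cm_norm (R h) = cm_norm h"
  by (simp add: cm_norm_def unitary_CM_D(4))

lemma unitary_CM_norm_diff:
  assumes "unitary_CM R" "h \<in> CM" "k \<in> CM"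
  shows "cm_norm (\<lambda>t. R h t - R k t) = cm_norm (\<lambda>t. h t - k t)"
  using unitary_CM_norm[OF assms(1) CM_diff[OF assms(2,3)]] unitary_CM_linear(4)[OF assms] by simp

lemma unitary_CM_funpow:
  assumes U: "unitary_CM R" and h: "h \<in> CM"
  shows "(R ^^ n) h \<in> CM"
  by (induction n) (simp_all add: h unitary_CM_D(1)[OF U])

lemma unitary_CM_funpow_inner:
  assumes U: "unitary_CM R" and h: "h \<in> CM" and k: "k \<in> CM"
  shows "cm_inner ((R ^^ n) h) ((R ^^ n) k) = cm_inner h k"
  by (induction n) (simp_all add: unitary_CM_D(4)[OF U] unitary_CM_funpow[OF U] h k)

lemma unitary_CM_funpow_norm:
  assumes U: "unitary_CM R" and h: "h \<in> CM"
  shows "cm_norm ((R ^^ n) h) = cm_norm h"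
  by (simp add: cm_norm_def unitary_CM_funpow_inner[OF U h h])

lemma measure_preserving_integral:
  fixes f :: "'a \<Rightarrow> 'b::{banach, second_countable_topology}"
  assumes T: "measure_preserving_map M T" and f: "f \<in> borel_measurable M"
  shows "(\<lambda>x. f (T x)) \<in> borel_measurable M" "(\<integral>x. f (T x) \<partial>M) = (\<integral>x. f x \<partial>M)"
    "integrable M (\<lambda>x. f (T x)) \<longleftrightarrow> integrable M f"
proof -
  have m: "T \<in> measurable M M" and d: "distr M M T = M" using T by (simp_all add: measure_preserving_map_def)
  show "(\<lambda>x. f (T x)) \<in> borel_measurable M" using m f by (rule measurable_compose)
  show "(\<integral>x. f (T x) \<partial>M) = (\<integral>x. f x \<partial>M)" using integral_distr[OF m f] d by simp
  show "integrable M (\<lambda>x. f (T x)) \<longleftrightarrow> integrable M f" using integrable_distr_eq[OF m f] d by simp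
qed

lemma measure_preserving_AE:
  assumes T: "measure_preserving_map M T" and P: "AE x in M. P x"
  shows "AE x in M. P (T x)"
proof -
  have m: "T \<in> measurable M M" and d: "distr M M T = M" using T by (simp_all add: measure_preserving_map_def)
  have "AE x in distr M M T. P x" unfolding d by (rule P)
  then show ?thesis using m by (rule AE_distrD[rotated])
qed

lemma measure_preserving_L2:
  assumes T: "measure_preserving_map M T" and f: "sq_int M f"
  shows "sq_int M (\<lambda>x. f (T x))" "L2_norm M (\<lambda>x. f (T x)) = L2_norm M f"
proof -
  have m: "f \<in> borel_measurable M" and m2: "(\<lambda>x. (f x)\<^sup>2) \<in> borel_measurable M" using f by (auto simp: sq_int_def)
  show "sq_int M (\<lambda>x. f (T x))"
    using measure_preserving_integral(1)[OF T m] measure_preserving_integral(3)[OF T m2] f by (simp add: sq_int_def)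
  show "L2_norm M (\<lambda>x. f (T x)) = L2_norm M f"
    using measure_preserving_integral(2)[OF T m2] by (simp add: L2_norm_def)
qed

locale wiener_rotation = wiener_space \<mu> for \<mu> +
  fixes R :: "(real \<Rightarrow> real) \<Rightarrow> (real \<Rightarrow> real)" and e :: "nat \<Rightarrow> real \<Rightarrow> real"
    and T :: "(real \<Rightarrow> real) \<Rightarrow> (real \<Rightarrow> real)" and D :: "nat \<Rightarrow> (real \<Rightarrow> real) \<Rightarrow> real"
  assumes R: "unitary_CM R" and e: "orthonormal_basis_CM e" and T: "measure_preserving_map \<mu> T"
    and D: "\<And>i. is_delta \<mu> (R (e i)) (D i)"
    and series: "AE w in \<mu>. uniform_limit {0..1} (\<lambda>n t. \<Sum>i<n. D i w * e i t) (T w) sequentially"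
begin

lemma e_CM: "e i \<in> CM"
  using e unfolding orthonormal_basis_CM_def by simp

lemma wdelta_D: "wdelta (R (e i)) (D i)"
  by (intro wdelta_of_is_delta D unitary_CM_D(1)[OF R] e_CM)

definition proj :: "nat \<Rightarrow> (real \<Rightarrow> real) \<Rightarrow> real \<Rightarrow> real" where
  "proj n h t = (\<Sum>i<n. cm_inner h (e i) * e i t)"

lemma proj_CM: "proj n h \<in> CM"
  unfolding proj_def[abs_def] by (intro CM_sum CM_cmult e_CM)

lemma proj_tendsto:
  assumes "h \<in> CM"
  shows "(\<lambda>n. cm_norm (\<lambda>t. proj n h t - h t)) \<longlonglongrightarrow> 0"
proof -
  have "(\<lambda>n. cm_norm (\<lambda>t. h t - proj n h t)) \<longlonglongrightarrow> 0"
    using e assms unfolding orthonormal_basis_CM_def proj_def by simp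
  then show ?thesis by (simp add: cm_norm_minus_commute[OF proj_CM assms])
qed

lemma wdelta_proj: "wdelta (R (proj n h)) (\<lambda>w. \<Sum>i<n. cm_inner h (e i) * D i w)"
proof -
  have "R (proj n h) = (\<lambda>t. \<Sum>i<n. R (\<lambda>t. cm_inner h (e i) * e i t) t)"
    unfolding proj_def[abs_def] by (intro unitary_CM_sum[OF R] CM_cmult e_CM)
  also have "\<dots> = (\<lambda>t. \<Sum>i<n. cm_inner h (e i) * R (e i) t)"
    by (simp add: unitary_CM_linear(2)[OF R e_CM])
  finally show ?thesis by (simp add: wdelta_sum wdelta_cmult wdelta_D)
qed

text \<open>The Wiener isometry and the isometry of \<open>R\<close> reduce this to convergence of
  the expansion of \<open>h\<close> in the basis.\<close>

lemma wdelta_proj_Cauchy: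
  assumes h: "h \<in> CM"
  shows "L2_Cauchy \<mu> (\<lambda>n w. \<Sum>i<n. cm_inner h (e i) * D i w)"
  unfolding L2_Cauchy_def
proof (intro allI impI)
  fix \<epsilon> :: real assume "0 < \<epsilon>"
  then have e2: "0 < \<epsilon> / 2" by simp
  from order_tendstoD(2)[OF proj_tendsto[OF h] e2]
  obtain N where N: "\<forall>n\<ge>N. cm_norm (\<lambda>t. proj n h t - h t) < \<epsilon> / 2"
    unfolding eventually_sequentially by (elim exE)
  show "\<exists>N. \<forall>m\<ge>N. \<forall>n\<ge>N. L2_norm \<mu> (\<lambda>w. (\<Sum>i<m. cm_inner h (e i) * D i w) - (\<Sum>i<n. cm_inner h (e i) * D i w)) < \<epsilon>"
  proof (intro exI[of _ N] allI impI)
    fix m n assume mn: "m \<ge> N" "n \<ge> N"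
    have "L2_norm \<mu> (\<lambda>w. (\<Sum>i<m. cm_inner h (e i) * D i w) - (\<Sum>i<n. cm_inner h (e i) * D i w))
        = cm_norm (\<lambda>t. R (proj m h) t - R (proj n h) t)"
      by (rule wdelta_norm[OF wdelta_diff[OF wdelta_proj wdelta_proj]])
    also have "\<dots> = cm_norm (\<lambda>t. proj m h t - proj n h t)"
      by (rule unitary_CM_norm_diff[OF R proj_CM proj_CM])
    also have "\<dots> \<le> cm_norm (\<lambda>t. proj m h t - h t) + cm_norm (\<lambda>t. h t - proj n h t)"
      by (rule cm_norm_triangle[OF proj_CM h proj_CM])
    also have "\<dots> < \<epsilon>" using N[rule_format, OF mn(1)] N[rule_format, OF mn(2)] by (simp add: cm_norm_minus_commute[OF h proj_CM])
    finally show "L2_norm \<mu> (\<lambda>w. (\<Sum>i<m. cm_inner h (e i) * D i w) - (\<Sum>i<n. cm_inner h (e i) * D i w)) < \<epsilon>" .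
  qed
qed

lemma R_proj_tendsto:
  assumes h: "h \<in> CM"
  shows "(\<lambda>n. cm_norm (\<lambda>t. R (proj n h) t - R h t)) \<longlonglongrightarrow> 0"
  using proj_tendsto[OF h] by (simp add: unitary_CM_norm_diff[OF R proj_CM h])

text \<open>The series for \<open>T\<close> supplies the variables: surjectivity gives
  \<open>h = R k\<close>, and the \<open>D i\<close> summed with the coefficients of
  \<open>k\<close> converge in mean square.\<close>

lemma wdelta_exists:
  assumes h: "h \<in> CM"
  obtains X where "wdelta h X"
proof -
  obtain k where k: "k \<in> CM" "R k = h" using unitary_CM_D(2)[OF R h] by (rule bexE)
  obtain Y where Y: "sq_int \<mu> Y"
    "(\<lambda>n. L2_norm \<mu> (\<lambda>w. (\<Sum>i<n. cm_inner k (e i) * D i w) - Y w)) \<longlonglongrightarrow> 0"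
    using L2_complete[OF wdelta_sq_int[OF wdelta_proj] wdelta_proj_Cauchy[OF k(1)]] by blast
  have "wdelta (R k) Y"
    by (rule wdelta_limit[OF wdelta_proj unitary_CM_D(1)[OF R k(1)] Y(1) R_proj_tendsto[OF k(1)] Y(2)])
  then show thesis using that k(2) by simp
qed

lemma T_coordinate_measurable: "(\<lambda>w. T w t) \<in> borel_measurable \<mu>"
  using measure_preserving_integral(1)[OF T coordinate_measurable] .

text \<open>By the reproducing property \<open>e i t\<close> is the coefficient of
  \<open>rkernel t\<close> along \<open>e i\<close>, so the partial sums of the series at
  \<open>t\<close> are Wiener integrals of \<open>R (proj n (rkernel t))\<close>. Their mean-square
  limit agrees with their almost sure limit \<open>T w t\<close>.\<close>

lemma wdelta_T_coordinate:
  assumes t: "t \<in> {0..1}"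
  shows "wdelta (R (rkernel t)) (\<lambda>w. T w t)"
proof -
  have k: "rkernel t \<in> CM" by (rule rkernel_CM[OF t])
  have "AE w in \<mu>. (\<lambda>n. \<Sum>i<n. cm_inner (rkernel t) (e i) * D i w) \<longlonglongrightarrow> T w t"
    using series
  proof eventually_elim
    case (elim w)
    from tendsto_uniform_limitI[OF elim t] show ?case
      by (simp add: cm_inner_commute[of "rkernel t"] cm_inner_rkernel[OF e_CM t] mult.commute)
  qed
  then have ae: "AE w in \<mu>. (\<lambda>n. \<Sum>i<id n. cm_inner (rkernel t) (e i) * D i w) \<longlonglongrightarrow> T w t" by simp
  have id: "strict_mono (id :: nat \<Rightarrow> nat)" by (simp add: strict_mono_def)
  note L = L2_limit_of_AE_limit[OF wdelta_sq_int[OF wdelta_proj] wdelta_proj_Cauchy[OF k] id T_coordinate_measurable ae]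
  show ?thesis
    by (rule wdelta_limit[OF wdelta_proj unitary_CM_D(1)[OF R k] L(1) R_proj_tendsto[OF k] L(2)])
qed

lemma wdelta_T_step: "step_valid xs \<Longrightarrow> wdelta (R (step_primitive xs)) (\<lambda>w. step_integral xs (T w))"
proof (induction xs)
  case Nil
  show ?case using wdelta_zero by (simp add: step_primitive_Nil step_integral_def unitary_CM_linear(1)[OF R])
next
  case (Cons x xs)
  obtain a s t where x: "x = (a, s, t)" by (cases x)
  have st: "s \<in> {0..1}" "t \<in> {0..1}" and v: "step_valid xs" using Cons.prems by (auto simp: x step_valid_Cons)
  note ks = rkernel_CM[OF st(1)] and kt = rkernel_CM[OF st(2)]
  have "wdelta (\<lambda>u. a * (R (rkernel t) u - R (rkernel s) u) + R (step_primitive xs) u)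
      (\<lambda>w. a * (T w t - T w s) + step_integral xs (T w))"
    by (intro wdelta_add wdelta_cmult wdelta_diff wdelta_T_coordinate st Cons.IH v)
  moreover have "R (step_primitive (x # xs)) = (\<lambda>u. a * (R (rkernel t) u - R (rkernel s) u) + R (step_primitive xs) u)"
    unfolding x step_primitive_Cons
    by (simp only: unitary_CM_linear(3)[OF R CM_cmult[OF CM_diff[OF kt ks]] step_primitive_CM[OF v]]
        unitary_CM_linear(2)[OF R CM_diff[OF kt ks]] unitary_CM_linear(4)[OF R kt ks])
  ultimately show ?case by (simp add: x step_integral_def)
qed

text \<open>The rule \<delta>(h) o T = \<delta>(R h). It holds for coordinates, hence for step
  integrals by linearity, and passes to the closure because composition with \<open>T\<close>
  preserves mean-square norms and \<open>R\<close> is an isometry.\<close>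

lemma wdelta_compose_T:
  assumes X: "wdelta h X"
  shows "wdelta (R h) (\<lambda>w. X (T w))"
proof -
  note h = wdelta_CM[OF X] and sX = wdelta_sq_int[OF X]
  obtain \<phi> where \<phi>: "\<And>n. step_valid (\<phi> n)"
    "(\<lambda>n. cm_norm (\<lambda>t. step_primitive (\<phi> n) t - h t)) \<longlonglongrightarrow> 0"
    "(\<lambda>n. L2_norm \<mu> (\<lambda>w. step_integral (\<phi> n) w - X w)) \<longlonglongrightarrow> 0"
    by (rule wdelta_seq[OF X]) (rule that)
  show ?thesis
  proof (rule wdelta_limit[where h="\<lambda>n. R (step_primitive (\<phi> n))" and X="\<lambda>n w. step_integral (\<phi> n) (T w)"])
    show "wdelta (R (step_primitive (\<phi> n))) (\<lambda>w. step_integral (\<phi> n) (T w))" for n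
      by (rule wdelta_T_step[OF \<phi>(1)])
    show "R h \<in> CM" by (rule unitary_CM_D(1)[OF R h])
    show "sq_int \<mu> (\<lambda>w. X (T w))" by (rule measure_preserving_L2(1)[OF T sX])
    show "(\<lambda>n. cm_norm (\<lambda>t. R (step_primitive (\<phi> n)) t - R h t)) \<longlonglongrightarrow> 0"
      using \<phi>(2) by (simp add: unitary_CM_norm_diff[OF R step_primitive_CM[OF \<phi>(1)] h])
    have "L2_norm \<mu> (\<lambda>w. step_integral (\<phi> n) (T w) - X (T w)) = L2_norm \<mu> (\<lambda>w. step_integral (\<phi> n) w - X w)" for n
      by (rule measure_preserving_L2(2)[OF T sq_int_diff[OF step_integral_L2(1)[OF \<phi>(1)] sX]])
    then show "(\<lambda>n. L2_norm \<mu> (\<lambda>w. step_integral (\<phi> n) (T w) - X (T w))) \<longlonglongrightarrow> 0"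
      using \<phi>(3) by simp
  qed
qed

lemma wdelta_compose_T_funpow:
  assumes X: "wdelta h X"
  shows "wdelta ((R ^^ n) h) (\<lambda>w. X ((T ^^ n) w))"
proof (induction n)
  case (Suc n)
  from wdelta_compose_T[OF Suc] show ?case by (simp add: funpow_swap1)
qed (simp add: X)

end

section \<open>Spectral measures of a unitary operator\<close>

lemma norm_cis_diff_le: "cmod (cis a - cis b) \<le> \<bar>a - b\<bar>"
proof -
  have "cmod (cis a - cis b) = cmod (cis b * (cis (a - b) - 1))"
    by (simp add: right_diff_distrib cis_mult)
  also have "\<dots> = cmod (iexp (a - b) - 1)" by (simp add: norm_mult cis_conv_exp)
  also have "\<dots> \<le> \<bar>a - b\<bar>" using iexp_approx1[of "a - b" 0] by simp
  finally show ?thesis .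
qed

lemma orthogonal_projection_CM_D:
  assumes P: "orthogonal_projection_CM P"
  shows "f \<in> CM_complex \<Longrightarrow> P f \<in> CM_complex"
    "f \<in> CM_complex \<Longrightarrow> g \<in> CM_complex \<Longrightarrow> P (\<lambda>t. a * f t + b * g t) = (\<lambda>t. a * P f t + b * P g t)"
    "f \<in> CM_complex \<Longrightarrow> P (P f) = P f"
    "f \<in> CM_complex \<Longrightarrow> g \<in> CM_complex \<Longrightarrow> cm_cinner (P f) g = cm_cinner f (P g)"
proof -
  note P' = P[unfolded orthogonal_projection_CM_def]
  note 1 = P'[THEN conjunct1]
  note 2 = P'[THEN conjunct2, THEN conjunct1]
  note 3 = P'[THEN conjunct2, THEN conjunct2, THEN conjunct1]
  note 4 = P'[THEN conjunct2, THEN conjunct2, THEN conjunct2]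
  show "f \<in> CM_complex \<Longrightarrow> P f \<in> CM_complex" using 1 by (rule bspec)
  show "f \<in> CM_complex \<Longrightarrow> g \<in> CM_complex \<Longrightarrow> P (\<lambda>t. a * f t + b * g t) = (\<lambda>t. a * P f t + b * P g t)"
    by (rule 2[rule_format])
  show "f \<in> CM_complex \<Longrightarrow> P (P f) = P f" using 3 by (rule bspec)
  show "f \<in> CM_complex \<Longrightarrow> g \<in> CM_complex \<Longrightarrow> cm_cinner (P f) g = cm_cinner f (P g)"
    by (rule 4[rule_format])
qed

locale spectral_resolution =
  fixes R :: "(real \<Rightarrow> real) \<Rightarrow> (real \<Rightarrow> real)" and E :: "real \<Rightarrow> (real \<Rightarrow> complex) \<Rightarrow> (real \<Rightarrow> complex)"
  assumes R: "unitary_CM R" and RE: "resolution_of_identity R E"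
begin

lemma E_projection: "\<theta> \<in> {0..2*pi} \<Longrightarrow> orthogonal_projection_CM (E \<theta>)"
  using RE unfolding resolution_of_identity_def by (elim conjE) (erule bspec)

lemma E_monotone: "\<theta> \<in> {0..2*pi} \<Longrightarrow> \<phi> \<in> {0..2*pi} \<Longrightarrow> \<theta> \<le> \<phi> \<Longrightarrow> f \<in> CM_complex \<Longrightarrow>
    Re (cm_cinner (E \<theta> f) f) \<le> Re (cm_cinner (E \<phi> f) f)"
  using RE unfolding resolution_of_identity_def by (elim conjE) simp

lemma E_right: "\<theta> \<in> {0..<2*pi} \<Longrightarrow> f \<in> CM_complex \<Longrightarrow>
    ((\<lambda>\<phi>. cm_cnorm (\<lambda>t. E \<phi> f t - E \<theta> f t)) \<longlongrightarrow> 0) (at_right \<theta>)"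
  using RE unfolding resolution_of_identity_def by (elim conjE) simp

lemma E_0: "f \<in> CM_complex \<Longrightarrow> E 0 f = (\<lambda>t. 0)"
  using RE unfolding resolution_of_identity_def by (elim conjE) simp

lemma E_2pi: "f \<in> CM_complex \<Longrightarrow> E (2 * pi) f = f"
  using RE unfolding resolution_of_identity_def by (elim conjE) simp

lemma E_spectral: "is_spectral_integral (complexify_op R) E"
  using RE unfolding resolution_of_identity_def by (elim conjE)

lemmas E_CM = orthogonal_projection_CM_D(1)[OF E_projection]
lemmas E_lincomb = orthogonal_projection_CM_D(2)[OF E_projection]
lemmas E_idem = orthogonal_projection_CM_D(3)[OF E_projection]
lemmas E_sym = orthogonal_projection_CM_D(4)[OF E_projection]

lemma E_diff: "\<theta> \<in> {0..2*pi} \<Longrightarrow> f \<in> CM_complex \<Longrightarrow> g \<in> CM_complex \<Longrightarrow>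
    E \<theta> (\<lambda>t. f t - g t) = (\<lambda>t. E \<theta> f t - E \<theta> g t)"
  using E_lincomb[of \<theta> f g 1 "-1"] by simp

lemma E_zero: "\<theta> \<in> {0..2*pi} \<Longrightarrow> E \<theta> (\<lambda>t. 0) = (\<lambda>t. 0)"
  using E_lincomb[OF _ CM_complex_zero CM_complex_zero, of \<theta> 0 0] by simp

lemma E_sum:
  assumes "\<theta> \<in> {0..2*pi}" "\<And>i. i \<in> I \<Longrightarrow> f i \<in> CM_complex"
  shows "E \<theta> (\<lambda>t. \<Sum>i\<in>I. c i * f i t) = (\<lambda>t. \<Sum>i\<in>I. c i * E \<theta> (f i) t)"
  using assms(2)
proof (induction I rule: infinite_finite_induct)
  case (insert i I)
  have "(\<lambda>t. \<Sum>i\<in>I. c i * f i t) \<in> CM_complex"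
    using insert.prems by (intro CM_complex_sum CM_complex_cmult) auto
  then have "E \<theta> (\<lambda>t. c i * f i t + 1 * (\<Sum>i\<in>I. c i * f i t)) = (\<lambda>t. c i * E \<theta> (f i) t + 1 * E \<theta> (\<lambda>t. \<Sum>i\<in>I. c i * f i t) t)"
    using insert.prems by (intro E_lincomb assms(1)) auto
  then show ?case using insert by simp
qed (simp_all add: E_zero[OF assms(1)])

lemma E_cinner_self:
  assumes "\<theta> \<in> {0..2*pi}" "f \<in> CM_complex"
  shows "cm_cinner (E \<theta> f) f = complex_of_real ((cm_cnorm (E \<theta> f))\<^sup>2)"
  using E_sym[OF assms(1) E_CM[OF assms] assms(2)] by (simp add: E_idem[OF assms] cm_cinner_self)

text \<open>Monotone quadratic forms mean nested ranges: on \<open>f - E \<phi> f\<close> the form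
  of \<open>E \<phi>\<close> is 0, which forces that of \<open>E \<theta>\<close> to be 0. The
  second identity is the adjoint of the first.\<close>

lemma E_E_le:
  assumes t: "\<theta> \<in> {0..2*pi}" and p: "\<phi> \<in> {0..2*pi}" and le: "\<theta> \<le> \<phi>" and f: "f \<in> CM_complex"
  shows "E \<theta> (E \<phi> f) = E \<theta> f" "E \<phi> (E \<theta> f) = E \<theta> f"
proof -
  have 1: "E \<theta> (E \<phi> f) = E \<theta> f" if f: "f \<in> CM_complex" for f
  proof -
    define g where "g = (\<lambda>t. f t - E \<phi> f t)"
    have g: "g \<in> CM_complex" unfolding g_def by (intro CM_complex_diff f E_CM p)
    have "E \<phi> g = (\<lambda>t. 0)"
      unfolding g_def by (simp add: E_diff[OF p f E_CM[OF p f]] E_idem[OF p f])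
    then have "(cm_cnorm (E \<theta> g))\<^sup>2 \<le> 0"
      using E_monotone[OF t p le g] E_cinner_self[OF t g] by simp
    then have "cm_cnorm (E \<theta> g) = 0" by simp
    then have "E \<theta> g = (\<lambda>t. 0)" by (rule cm_cnorm_eq_0[OF E_CM[OF t g]])
    then show ?thesis
      unfolding g_def by (simp add: E_diff[OF t f E_CM[OF p f]] fun_eq_iff)
  qed
  show "E \<theta> (E \<phi> f) = E \<theta> f" by (rule 1[OF f])
  define u where "u = (\<lambda>t. E \<phi> (E \<theta> f) t - E \<theta> f t)"
  have u: "u \<in> CM_complex" unfolding u_def by (intro CM_complex_diff E_CM t p f)
  have "cm_cinner u u = cm_cinner (E \<phi> (E \<theta> f)) u - cm_cinner (E \<theta> f) u"
    by (subst u_def) (intro cm_cinner_diff_left E_CM t p f u)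
  also have "cm_cinner (E \<phi> (E \<theta> f)) u = cm_cinner (E \<theta> f) u"
    by (simp only: E_sym[OF p E_CM[OF t f] u] E_sym[OF t f E_CM[OF p u]] 1[OF u] E_sym[OF t f u])
  finally have "cm_cnorm u = 0" by (simp add: cm_cinner_self)
  then have "u = (\<lambda>t. 0)" by (rule cm_cnorm_eq_0[OF u])
  then show "E \<phi> (E \<theta> f) = E \<theta> f" by (simp add: u_def fun_eq_iff)
qed

lemma E_E:
  assumes "\<theta> \<in> {0..2*pi}" "\<phi> \<in> {0..2*pi}" "f \<in> CM_complex"
  shows "E \<theta> (E \<phi> f) = E (min \<theta> \<phi>) f"
  using E_E_le[OF assms(1,2) _ assms(3)] E_E_le[OF assms(2,1) _ assms(3)] by (simp add: min_def)

text \<open>Pythagoras for nested ranges: \<open>E \<phi> f\<close> is the orthogonal sum of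
  \<open>E \<theta> f\<close> and the increment. This makes the squared norms an increasing function
  of the angle.\<close>

lemma E_increment_norm:
  assumes t: "\<theta> \<in> {0..2*pi}" and p: "\<phi> \<in> {0..2*pi}" and le: "\<theta> \<le> \<phi>" and f: "f \<in> CM_complex"
  shows "(cm_cnorm (\<lambda>t. E \<phi> f t - E \<theta> f t))\<^sup>2 = (cm_cnorm (E \<phi> f))\<^sup>2 - (cm_cnorm (E \<theta> f))\<^sup>2"
proof -
  define u where "u = (\<lambda>t. E \<phi> f t - E \<theta> f t)"
  note Ef = E_CM[OF t f] E_CM[OF p f]
  have u: "u \<in> CM_complex" unfolding u_def by (intro CM_complex_diff Ef)
  have pt: "cm_cinner (E \<phi> f) (E \<theta> f) = complex_of_real ((cm_cnorm (E \<theta> f))\<^sup>2)"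
    using E_sym[OF t Ef(2) f] by (simp add: E_E_le[OF t p le f] E_cinner_self[OF t f])
  have tp: "cm_cinner (E \<theta> f) (E \<phi> f) = complex_of_real ((cm_cnorm (E \<theta> f))\<^sup>2)"
    using pt by (subst cm_cinner_commute) simp
  have "cm_cinner u u = cm_cinner (E \<phi> f) u - cm_cinner (E \<theta> f) u"
    by (subst u_def) (intro cm_cinner_diff_left Ef u)
  also have "cm_cinner (E \<phi> f) u = cm_cinner (E \<phi> f) (E \<phi> f) - cm_cinner (E \<phi> f) (E \<theta> f)"
    unfolding u_def by (intro cm_cinner_diff_right Ef)
  also have "cm_cinner (E \<theta> f) u = cm_cinner (E \<theta> f) (E \<phi> f) - cm_cinner (E \<theta> f) (E \<theta> f)"
    unfolding u_def by (intro cm_cinner_diff_right Ef)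
  finally have "complex_of_real ((cm_cnorm u)\<^sup>2) = complex_of_real ((cm_cnorm (E \<phi> f))\<^sup>2 - (cm_cnorm (E \<theta> f))\<^sup>2)"
    by (simp add: pt tp cm_cinner_self)
  then show ?thesis unfolding of_real_eq_iff u_def .
qed

lemma complexify_op_D:
  assumes f: "f \<in> CM_complex"
  shows "complexify_op R f \<in> CM_complex" "cm_cnorm (complexify_op R f) = cm_cnorm f"
    "g \<in> CM_complex \<Longrightarrow> complexify_op R (\<lambda>t. f t - g t) = (\<lambda>t. complexify_op R f t - complexify_op R g t)"
proof -
  note c = CM_complex_D[OF f]
  show "complexify_op R f \<in> CM_complex"
    by (simp add: complexify_op_def CM_complex_def unitary_CM_D(1)[OF R c(1)] unitary_CM_D(1)[OF R c(2)])
  have "(cm_cnorm (complexify_op R f))\<^sup>2 = (cm_cnorm f)\<^sup>2"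
    by (simp add: cm_cnorm_sq complexify_op_def unitary_CM_norm[OF R c(1)] unitary_CM_norm[OF R c(2)])
  then show "cm_cnorm (complexify_op R f) = cm_cnorm f" by (simp add: power2_eq_iff_nonneg)
  assume g: "g \<in> CM_complex"
  note d = CM_complex_D[OF g]
  show "complexify_op R (\<lambda>t. f t - g t) = (\<lambda>t. complexify_op R f t - complexify_op R g t)"
    by (simp add: complexify_op_def unitary_CM_linear(4)[OF R c(1) d(1)] unitary_CM_linear(4)[OF R c(2) d(2)] fun_eq_iff complex_eq_iff)
qed

lemma complexify_op_funpow_of_real:
  "h \<in> CM \<Longrightarrow> (complexify_op R ^^ n) (\<lambda>t. complex_of_real (h t)) = (\<lambda>t. complex_of_real ((R ^^ n) h t))"
  by (induction n) (simp_all add: complexify_op_def unitary_CM_linear(1)[OF R] fun_eq_iff complex_eq_iff)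

section \<open>Riemann sums for the powers of the operator\<close>

definition grid :: "nat \<Rightarrow> nat \<Rightarrow> real" where
  "grid M l = 2 * pi * real l / real (Suc M)"

lemma grid_range: "l \<le> Suc M \<Longrightarrow> grid M l \<in> {0..2*pi}"
  by (simp add: grid_def field_simps del: of_nat_Suc)

lemma grid_0: "grid M 0 = 0" and grid_last: "grid M (Suc M) = 2 * pi"
  by (simp_all add: grid_def del: of_nat_Suc)

lemma grid_Suc_diff: "grid M (Suc l) - grid M l = 2 * pi / real (Suc M)"
proof -
  have "2 * pi * real (Suc l) - 2 * pi * real l = 2 * pi" by (simp add: algebra_simps)
  then show ?thesis unfolding grid_def diff_divide_distrib[symmetric] by (rule arg_cong)
qed

lemma grid_mono: "l \<le> m \<Longrightarrow> grid M l \<le> grid M m"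
  by (simp add: grid_def divide_right_mono mult_left_mono del: of_nat_Suc)

lemma min_grid: "min (grid M l) (grid M m) = grid M (min l m)"
  using grid_mono[of l m M] grid_mono[of m l M] by (cases "l \<le> m") (auto simp: min_def)

definition slice :: "nat \<Rightarrow> nat \<Rightarrow> (real \<Rightarrow> complex) \<Rightarrow> real \<Rightarrow> complex" where
  "slice M l f t = E (grid M (Suc l)) f t - E (grid M l) f t"

text \<open>The left-endpoint Riemann sum of \<open>e\<^sup>i\<^sup>n\<^sup>\<theta>\<close> against
  the resolution, on \<open>Suc M\<close> equal cells: the approximation of
  \<open>R\<^sup>n f\<close>.\<close>

definition rsum :: "nat \<Rightarrow> nat \<Rightarrow> (real \<Rightarrow> complex) \<Rightarrow> real \<Rightarrow> complex" where
  "rsum n M f t = (\<Sum>l<Suc M. cis (real n * grid M l) * slice M l f t)"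

lemma slice_CM: "l < Suc M \<Longrightarrow> f \<in> CM_complex \<Longrightarrow> slice M l f \<in> CM_complex"
  unfolding slice_def[abs_def] by (intro CM_complex_diff E_CM grid_range) auto

lemma rsum_CM: "f \<in> CM_complex \<Longrightarrow> rsum n M f \<in> CM_complex"
  unfolding rsum_def[abs_def] by (intro CM_complex_sum CM_complex_cmult slice_CM) auto

text \<open>Slices over disjoint cells are mutually orthogonal projections, so products of Riemann
  sums have no cross terms.\<close>

lemma slice_slice:
  assumes l: "l < Suc M" and m: "m < Suc M" and f: "f \<in> CM_complex"
  shows "slice M l (slice M m f) = (if l = m then slice M m f else (\<lambda>t. 0))"
proof -
  have E: "E (grid M a) (slice M m f) = (\<lambda>t. E (grid M (min a (Suc m))) f t - E (grid M (min a m)) f t)"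
    if "a \<le> Suc M" for a
  proof -
    have "E (grid M a) (\<lambda>t. E (grid M (Suc m)) f t - E (grid M m) f t)
        = (\<lambda>t. E (grid M a) (E (grid M (Suc m)) f) t - E (grid M a) (E (grid M m) f) t)"
      using m by (intro E_diff grid_range that E_CM f) auto
    moreover have "E (grid M a) (E (grid M b) f) = E (grid M (min a b)) f" if "b \<le> Suc M" for b
      using E_E[OF grid_range[OF \<open>a \<le> Suc M\<close>] grid_range[OF that] f] by (simp only: min_grid)
    ultimately show ?thesis using m by (simp add: slice_def[abs_def])
  qed
  have "slice M l (slice M m f) = (\<lambda>t. (E (grid M (min (Suc l) (Suc m))) f t - E (grid M (min (Suc l) m)) f t)
      - (E (grid M (min l (Suc m))) f t - E (grid M (min l m)) f t))"
    using E[of l] E[of "Suc l"] l by (simp add: slice_def[of M l, abs_def])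
  also have "\<dots> = (if l = m then slice M m f else (\<lambda>t. 0))"
  proof -
    consider "l < m" | "l = m" | "m < l" by linarith
    then show ?thesis
    proof cases
      case 1
      then have "min (Suc l) (Suc m) = Suc l" "min (Suc l) m = Suc l" "min l (Suc m) = l" "min l m = l" by auto
      then show ?thesis using 1 by simp
    next
      case 2
      then show ?thesis by (simp add: slice_def fun_eq_iff)
    next
      case 3
      then have "min (Suc l) (Suc m) = Suc m" "min (Suc l) m = m" "min l (Suc m) = Suc m" "min l m = m" by auto
      then show ?thesis using 3 by simp
    qed
  qed
  finally show ?thesis .
qed

text \<open>Multiplicativity: the Riemann sum for \<open>R\<close> applied to the one for
  \<open>R\<^sup>n\<close> is the one for \<open>R\<^sup>n\<^sup>+\<^sup>1\<close>, with the same
  grid and tags.\<close>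

lemma rsum_Suc:
  assumes f: "f \<in> CM_complex"
  shows "(\<lambda>t. \<Sum>l<Suc M. cis (grid M l) * slice M l (rsum n M f) t) = rsum (Suc n) M f"
proof
  fix t
  have "slice M l (rsum n M f) t = cis (real n * grid M l) * slice M l f t" if l: "l < Suc M" for l
  proof -
    have EE: "E (grid M a) (rsum n M f) = (\<lambda>t. \<Sum>m<Suc M. cis (real n * grid M m) * E (grid M a) (slice M m f) t)"
      if "a \<le> Suc M" for a
      unfolding rsum_def[abs_def] by (intro E_sum grid_range that slice_CM f) auto
    have "slice M l (rsum n M f) t = (\<Sum>m<Suc M. cis (real n * grid M m) * slice M l (slice M m f) t)"
      using l by (simp only: slice_def[of M l "rsum n M f"] EE[of l] EE[of "Suc l"] Suc_le_eq less_imp_le sum_subtractf[symmetric]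
          right_diff_distrib[symmetric] slice_def[of M l "slice M m f" for m])
    also have "\<dots> = (\<Sum>m<Suc M. if m = l then cis (real n * grid M l) * slice M l f t else 0)"
      using l by (intro sum.cong refl) (auto simp: slice_slice f)
    also have "\<dots> = cis (real n * grid M l) * slice M l f t" using l by simp
    finally show ?thesis .
  qed
  then have "(\<Sum>l<Suc M. cis (grid M l) * slice M l (rsum n M f) t)
      = (\<Sum>l<Suc M. cis (grid M l) * (cis (real n * grid M l) * slice M l f t))"
    by (intro sum.cong refl) auto
  also have "\<dots> = rsum (Suc n) M f t"
    unfolding rsum_def by (intro sum.cong refl) (simp add: mult.assoc[symmetric] cis_mult distrib_right)
  finally show "(\<Sum>l<Suc M. cis (grid M l) * slice M l (rsum n M f) t) = rsum (Suc n) M f t" .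
qed

lemma rsum_0: "f \<in> CM_complex \<Longrightarrow> rsum 0 M f = f"
proof
  fix t assume f: "f \<in> CM_complex"
  have "rsum 0 M f t = (\<Sum>l<Suc M. E (grid M (Suc l)) f t - E (grid M l) f t)"
    by (simp add: rsum_def slice_def)
  also have "\<dots> = f t"
    by (simp only: sum_lessThan_telescope[of "\<lambda>l. E (grid M l) f t"] grid_0 grid_last E_0[OF f] E_2pi[OF f] diff_zero)
  finally show "rsum 0 M f t = f t" .
qed

lemma spectral_grid:
  assumes "0 < \<epsilon>"
  shows "\<exists>N. \<forall>M\<ge>N. \<forall>f\<in>CM_complex.
    cm_cnorm (\<lambda>t. complexify_op R f t - (\<Sum>l<Suc M. cis (grid M l) * slice M l f t)) \<le> \<epsilon> * cm_cnorm f"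
proof -
  from E_spectral[unfolded is_spectral_integral_def, rule_format, OF assms]
  obtain \<delta> where \<delta>: "\<delta> > 0" and S: "\<forall>(n::nat) (\<tau>::nat \<Rightarrow> real) (\<xi>::nat \<Rightarrow> real).
        \<tau> 0 = 0 \<and> \<tau> n = 2 * pi \<and>
        (\<forall>j<n. \<tau> j \<le> \<xi> j \<and> \<xi> j \<le> \<tau> (Suc j) \<and> \<tau> (Suc j) - \<tau> j < \<delta>) \<longrightarrow>
        (\<forall>f\<in>CM_complex.
           cm_cnorm (\<lambda>t. complexify_op R f t - (\<Sum>j<n. cis (\<xi> j) * (E (\<tau> (Suc j)) f t - E (\<tau> j) f t)))
             \<le> \<epsilon> * cm_cnorm f)"
    by (elim exE conjE)
  obtain N :: nat where N: "2 * pi / \<delta> < real N" using reals_Archimedean2 by blast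
  show ?thesis
  proof (intro exI[of _ N] allI impI)
    fix M assume "N \<le> M"
    then have "2 * pi / \<delta> < real (Suc M)" using N by simp
    then have "2 * pi / real (Suc M) < \<delta>" using \<delta> by (simp add: field_simps del: of_nat_Suc)
    then have A: "grid M 0 = 0 \<and> grid M (Suc M) = 2 * pi \<and>
        (\<forall>j<Suc M. grid M j \<le> grid M j \<and> grid M j \<le> grid M (Suc j) \<and> grid M (Suc j) - grid M j < \<delta>)"
      by (simp only: grid_0 grid_last grid_Suc_diff grid_mono order_refl le_SucI simp_thms)
    show "\<forall>f\<in>CM_complex. cm_cnorm (\<lambda>t. complexify_op R f t - (\<Sum>l<Suc M. cis (grid M l) * slice M l f t)) \<le> \<epsilon> * cm_cnorm f"
      using S[THEN spec, of "Suc M", THEN spec, of "grid M", THEN spec, of "grid M", THEN mp, OF A]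
      unfolding slice_def .
  qed
qed

lemma complexify_op_funpow_CM: "f \<in> CM_complex \<Longrightarrow> (complexify_op R ^^ n) f \<in> CM_complex"
  by (induction n) (simp_all add: complexify_op_D)

lemma complexify_op_funpow_norm: "f \<in> CM_complex \<Longrightarrow> cm_cnorm ((complexify_op R ^^ n) f) = cm_cnorm f"
  by (induction n) (simp_all add: complexify_op_D complexify_op_funpow_CM)

text \<open>The spectral formula is given for the first power only. In the step, the error splits
  into the old error moved by the isometry, and the error of the Riemann sum for \<open>R\<close> at
  the vector \<open>rsum n M f\<close>; the operator-norm form of the formula controls the latter
  although this vector varies with \<open>M\<close>.\<close>

lemma rsum_tendsto:
  assumes f: "f \<in> CM_complex"
  shows "(\<lambda>M. cm_cnorm (\<lambda>t. (complexify_op R ^^ n) f t - rsum n M f t)) \<longlonglongrightarrow> 0"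
proof (induction n)
  case 0
  have "cm_cnorm (\<lambda>t. 0) = 0" by (simp add: cm_cnorm_def)
  then show ?case by (simp add: rsum_0[OF f])
next
  case (Suc n)
  define U where "U = complexify_op R"
  define a where "a M = cm_cnorm (\<lambda>t. (U ^^ n) f t - rsum n M f t)" for M
  have a0: "a \<longlonglongrightarrow> 0" using Suc unfolding a_def U_def .
  have Un: "(U ^^ n) f \<in> CM_complex" unfolding U_def by (rule complexify_op_funpow_CM[OF f])
  note rs = rsum_CM[OF f]
  show ?case
  proof (rule LIMSEQ_I)
    fix r :: real assume r: "0 < r"
    \<comment> \<open>Eventually \<open>rsum n M f\<close> has norm at most
      \<open>1 + cm_cnorm f\<close>, so the second error is at most \<open>r / 2\<close>.\<close>
    define \<epsilon> where "\<epsilon> = r / (2 * (cm_cnorm f + 1))"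
    have c: "0 < cm_cnorm f + 1" using cm_cnorm_nonneg[of f] by linarith
    have \<epsilon>: "0 < \<epsilon>" unfolding \<epsilon>_def using r c by simp
    have \<epsilon>r: "\<epsilon> * (1 + cm_cnorm f) = r / 2" unfolding \<epsilon>_def using c by (simp add: field_simps)
    from spectral_grid[OF \<epsilon>] obtain N1 where N1: "\<forall>M\<ge>N1. \<forall>f\<in>CM_complex.
      cm_cnorm (\<lambda>t. U f t - (\<Sum>l<Suc M. cis (grid M l) * slice M l f t)) \<le> \<epsilon> * cm_cnorm f"
      unfolding U_def by (elim exE)
    have "0 < min 1 (r / 2)" using r by simp
    from order_tendstoD(2)[OF a0 this] obtain N2 where N2: "\<forall>M\<ge>N2. a M < min 1 (r / 2)"
      unfolding eventually_sequentially by (elim exE)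
    show "\<exists>N. \<forall>M\<ge>N. norm (cm_cnorm (\<lambda>t. (complexify_op R ^^ Suc n) f t - rsum (Suc n) M f t) - 0) < r"
    proof (intro exI[of _ "max N1 N2"] allI impI)
      fix M assume "max N1 N2 \<le> M"
      then have M: "N1 \<le> M" "N2 \<le> M" by simp_all
      have UU: "cm_cnorm (\<lambda>t. U ((U ^^ n) f) t - U (rsum n M f) t) = a M"
      proof -
        have "(\<lambda>t. U ((U ^^ n) f) t - U (rsum n M f) t) = U (\<lambda>t. (U ^^ n) f t - rsum n M f t)"
          unfolding U_def by (rule complexify_op_D(3)[OF Un[unfolded U_def] rs, symmetric])
        then show ?thesis
          unfolding a_def U_def by (simp only: complexify_op_D(2)[OF CM_complex_diff[OF Un[unfolded U_def] rs]])
      qed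
      have Us: "cm_cnorm (\<lambda>t. U (rsum n M f) t - rsum (Suc n) M f t) \<le> \<epsilon> * cm_cnorm (rsum n M f)"
        using N1[rule_format, OF M(1) rs[of n M]] unfolding rsum_Suc[OF f, THEN fun_cong] .
      have "cm_cnorm (rsum n M f) \<le> cm_cnorm (\<lambda>t. (rsum n M f t - (U ^^ n) f t) + (U ^^ n) f t)" by simp
      also have "\<dots> \<le> cm_cnorm (\<lambda>t. rsum n M f t - (U ^^ n) f t) + cm_cnorm ((U ^^ n) f)"
        by (intro cm_cnorm_add CM_complex_diff rs Un)
      also have "cm_cnorm (\<lambda>t. rsum n M f t - (U ^^ n) f t) = a M"
        unfolding a_def using cm_cnorm_cmult[OF CM_complex_diff[OF Un rs], of "-1" n M] by simp
      also have "cm_cnorm ((U ^^ n) f) = cm_cnorm f" unfolding U_def by (rule complexify_op_funpow_norm[OF f])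
      finally have "cm_cnorm (rsum n M f) \<le> 1 + cm_cnorm f" using N2[rule_format, OF M(2)] by simp
      then have "\<epsilon> * cm_cnorm (rsum n M f) \<le> r / 2" unfolding \<epsilon>r[symmetric] using \<epsilon> by (intro mult_left_mono) auto
      moreover have "cm_cnorm (\<lambda>t. U ((U ^^ n) f) t - rsum (Suc n) M f t)
          \<le> cm_cnorm (\<lambda>t. U ((U ^^ n) f) t - U (rsum n M f) t) + cm_cnorm (\<lambda>t. U (rsum n M f) t - rsum (Suc n) M f t)"
        unfolding U_def by (intro cm_cnorm_triangle complexify_op_D(1) rs complexify_op_funpow_CM f)
      ultimately have "cm_cnorm (\<lambda>t. U ((U ^^ n) f) t - rsum (Suc n) M f t) < r"
        using UU Us N2[rule_format, OF M(2)] by simp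
      then show "norm (cm_cnorm (\<lambda>t. (complexify_op R ^^ Suc n) f t - rsum (Suc n) M f t) - 0) < r"
        by (simp add: U_def)
    qed
  qed
qed

end

lemma cis_measurable: "(\<lambda>x. cis (c * x)) \<in> borel_measurable borel"
  by (intro borel_measurable_continuous_onI) (auto simp: cis_conv_exp intro!: continuous_intros)

section \<open>Spectral measures as Stieltjes measures\<close>

context spectral_resolution
begin

text \<open>The function \<open>\<theta> \<mapsto> (\<Pi>\<^sub>\<theta> h, h)\<close>, extended by
  constants outside the interval of angles to a distribution function on the whole line.\<close>

definition mass :: "(real \<Rightarrow> real) \<Rightarrow> real \<Rightarrow> real" where
  "mass h x = (cm_cnorm (E (max 0 (min x (2 * pi))) (\<lambda>t. complex_of_real (h t))))\<^sup>2"

lemma mass_eq: "x \<in> {0..2*pi} \<Longrightarrow> mass h x = (cm_cnorm (E x (\<lambda>t. complex_of_real (h t))))\<^sup>2"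
  by (simp add: mass_def)

lemma mass_low:
  assumes h: "h \<in> CM" and "x \<le> 0"
  shows "mass h x = 0"
proof -
  have "cm_cnorm (\<lambda>t. 0) = 0" by (simp add: cm_cnorm_def)
  moreover have "max 0 (min x (2 * pi)) = 0" using assms(2) by simp
  ultimately show ?thesis by (simp only: mass_def E_0[OF CM_complex_of_real[OF h]]) simp
qed

lemma mass_high:
  assumes h: "h \<in> CM" and "2 * pi \<le> x"
  shows "mass h x = (cm_norm h)\<^sup>2"
proof -
  have "max 0 (min x (2 * pi)) = 2 * pi" using assms(2) by simp
  then show ?thesis by (simp only: mass_def E_2pi[OF CM_complex_of_real[OF h]] cm_cnorm_of_real)
qed

lemma mass_increment:
  assumes h: "h \<in> CM" and "x \<in> {0..2*pi}" "y \<in> {0..2*pi}" "x \<le> y"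
  shows "(cm_cnorm (\<lambda>t. E y (\<lambda>t. complex_of_real (h t)) t - E x (\<lambda>t. complex_of_real (h t)) t))\<^sup>2 = mass h y - mass h x"
  using E_increment_norm[OF assms(2-4) CM_complex_of_real[OF h]] assms(2,3) by (simp only: mass_eq)

lemma mass_mono:
  assumes h: "h \<in> CM" and "x \<le> y"
  shows "mass h x \<le> mass h y"
proof -
  have r: "max 0 (min z (2 * pi)) \<in> {0..2*pi}" for z by simp
  have "max 0 (min x (2 * pi)) \<le> max 0 (min y (2 * pi))" using assms(2) by simp
  from mass_increment[OF h r r this] have "0 \<le> mass h (max 0 (min y (2 * pi))) - mass h (max 0 (min x (2 * pi)))"
    by (metis zero_le_power2)
  then show ?thesis by (simp add: mass_def)
qed

lemma mass_right_continuous: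
  assumes h: "h \<in> CM"
  shows "continuous (at_right a) (mass h)"
  unfolding continuous_within
proof -
  let ?f = "\<lambda>t. complex_of_real (h t)"
  consider "a < 0" | "0 \<le> a" "a < 2 * pi" | "2 * pi \<le> a" by linarith
  then show "(mass h \<longlongrightarrow> mass h a) (at_right a)"
  proof cases
    case 1
    have "eventually (\<lambda>x. x \<in> {a<..<0}) (at_right a)" by (rule eventually_at_right_real[OF 1])
    then have "eventually (\<lambda>x. mass h x = mass h a) (at_right a)"
      by eventually_elim (use 1 in \<open>simp add: mass_low[OF h]\<close>)
    then show ?thesis by (rule tendsto_eventually)
  next
    case 2
    have ev: "eventually (\<lambda>x. x \<in> {a<..<2 * pi}) (at_right a)" by (rule eventually_at_right_real[OF 2(2)])
    have "((\<lambda>x. cm_cnorm (\<lambda>t. E x ?f t - E a ?f t)) \<longlongrightarrow> 0) (at_right a)"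
      using 2 by (intro E_right CM_complex_of_real h) simp
    \<comment> \<open>To the right of \<open>a\<close>, the difference of \<open>mass\<close> is the
      squared norm of the increment of the projections, so strong right-continuity carries
      over.\<close>
    then have "((\<lambda>x. mass h a + (cm_cnorm (\<lambda>t. E x ?f t - E a ?f t))\<^sup>2) \<longlongrightarrow> mass h a + 0\<^sup>2) (at_right a)"
      by (intro tendsto_intros)
    moreover have "eventually (\<lambda>x. mass h a + (cm_cnorm (\<lambda>t. E x ?f t - E a ?f t))\<^sup>2 = mass h x) (at_right a)"
      using ev by eventually_elim (use 2 in \<open>simp add: mass_increment[OF h]\<close>)
    ultimately show ?thesis by (simp add: tendsto_cong)
  next
    case 3
    have "eventually (\<lambda>x. x \<in> {a<..<a + 1}) (at_right a)" by (rule eventually_at_right_real) simp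
    then have "eventually (\<lambda>x. mass h x = mass h a) (at_right a)"
      by eventually_elim (use 3 in \<open>simp add: mass_high[OF h]\<close>)
    then show ?thesis by (rule tendsto_eventually)
  qed
qed

definition spectral_measure :: "(real \<Rightarrow> real) \<Rightarrow> real measure" where
  "spectral_measure h = interval_measure (mass h)"

context
  fixes h assumes h: "h \<in> CM"
begin

lemma mass_at_bot: "(mass h \<longlongrightarrow> 0) at_bot"
  by (rule tendsto_eventually) (use mass_low[OF h] in \<open>auto simp: eventually_at_bot_linorder intro: exI[of _ 0]\<close>)

lemma mass_at_top: "(mass h \<longlongrightarrow> (cm_norm h)\<^sup>2) at_top"
  by (rule tendsto_eventually) (use mass_high[OF h] in \<open>auto simp: eventually_at_top_linorder intro: exI[of _ "2 * pi"]\<close>)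

lemma spectral_measure_finite: "finite_borel_measure (spectral_measure h)"
  unfolding spectral_measure_def
  by (rule finite_borel_measure_interval_measure[OF mass_mono[OF h] mass_right_continuous[OF h] mass_at_bot mass_at_top])
    simp_all

lemma spectral_measure_cdf: "cdf (spectral_measure h) = mass h"
  unfolding spectral_measure_def
  by (rule cdf_interval_measure[OF mass_mono[OF h] mass_right_continuous[OF h] mass_at_bot])

lemma spectral_measure_UNIV: "emeasure (spectral_measure h) UNIV = ennreal ((cm_norm h)\<^sup>2)"
  unfolding spectral_measure_def
  by (rule interval_measure_UNIV[OF mass_mono[OF h] mass_right_continuous[OF h] mass_at_bot mass_at_top]) simp_all

lemma spectral_measure_sets[simp, measurable_cong]: "sets (spectral_measure h) = sets borel"
  by (simp add: spectral_measure_def)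

lemma spectral_measure_space[simp]: "space (spectral_measure h) = UNIV"
  by (simp add: spectral_measure_def)

lemma spectral_measure_Ioc:
  assumes "a \<le> b"
  shows "emeasure (spectral_measure h) {a<..b} = ennreal (mass h b - mass h a)"
  unfolding spectral_measure_def
  by (rule emeasure_interval_measure_Ioc[OF assms mass_mono[OF h] mass_right_continuous[OF h]])

text \<open>The point 0 is excluded and \<open>2 * pi\<close> included, so an eigenvalue 1 is an
  atom at \<open>2 * pi\<close> and \<open>cis\<close> is injective on the support.\<close>

lemma spectral_measure_AE: "AE x in spectral_measure h. 0 < x \<and> x \<le> 2 * pi"
proof -
  interpret S: finite_borel_measure "spectral_measure h" by (rule spectral_measure_finite)
  have "emeasure (spectral_measure h) (UNIV - {0<..2 * pi}) = emeasure (spectral_measure h) UNIV - emeasure (spectral_measure h) {0<..2 * pi}"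
    by (rule emeasure_Diff) (simp_all add: S.emeasure_finite)
  also have "\<dots> = 0"
    using mass_low[OF h, of 0] mass_high[OF h, of "2 * pi"] by (simp add: spectral_measure_UNIV spectral_measure_Ioc)
  finally have "UNIV - {0<..2 * pi} \<in> null_sets (spectral_measure h)" by (intro null_setsI) simp_all
  then show ?thesis by (rule AE_I') auto
qed

text \<open>Two evaluations of the limit of one sequence: the integral of the step function
  \<open>g M\<close> is the inner product of \<open>rsum n M\<close> with \<open>h\<close>, which
  converges by \<open>rsum_tendsto\<close>, while \<open>g M\<close> converges uniformly on the
  support to \<open>cis (n x)\<close>.\<close>

lemma spectral_measure_moment:
  "complex_of_real (cm_inner ((R ^^ n) h) h) = (\<integral>x. cis (real n * x) \<partial>spectral_measure h)"
proof -
  interpret S: finite_borel_measure "spectral_measure h" by (rule spectral_measure_finite)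
  let ?f = "\<lambda>t. complex_of_real (h t)"
  have f: "?f \<in> CM_complex" by (rule CM_complex_of_real[OF h])
  define J where "J M l = {grid M l<..grid M (Suc l)}" for M l
  define g where "g M x = (\<Sum>l<Suc M. cis (real n * grid M l) * complex_of_real (indicator (J M l) x))" for M x
  have Jm: "J M l \<in> sets (spectral_measure h)" for M l by (simp add: J_def)
  have mJ: "measure (spectral_measure h) (J M l) = mass h (grid M (Suc l)) - mass h (grid M l)" for M l
    unfolding J_def measure_def using grid_mono[of l "Suc l" M] mass_mono[OF h, of "grid M l" "grid M (Suc l)"]
    by (simp add: spectral_measure_Ioc)
  have Ji: "integrable (spectral_measure h) (\<lambda>x. complex_of_real (indicator (J M l) x))" for M l
    using Jm by (intro integrable_of_real integrable_real_indicator) (simp_all add: S.emeasure_eq_measure)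
  have gi: "integrable (spectral_measure h) (g M)" for M
    unfolding g_def[abs_def] by (intro Bochner_Integration.integrable_sum integrable_mult_right Ji)
  have ci: "integrable (spectral_measure h) (\<lambda>x. cis (real n * x))"
  proof (rule S.integrable_const_bound[of _ 1])
    show "(\<lambda>x. cis (real n * x)) \<in> borel_measurable (spectral_measure h)"
      by (subst measurable_cong_sets[OF spectral_measure_sets refl]) (rule cis_measurable)
  qed simp
  have gint: "(\<integral>x. g M x \<partial>spectral_measure h) = cm_cinner (rsum n M ?f) ?f" for M
  proof -
    have "(\<integral>x. g M x \<partial>spectral_measure h) = (\<Sum>l<Suc M. cis (real n * grid M l) * (\<integral>x. complex_of_real (indicator (J M l) x) \<partial>spectral_measure h))"
      unfolding g_def
      by (subst Bochner_Integration.integral_sum) (intro integrable_mult_right Ji, simp add: Ji)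
    also have "\<dots> = (\<Sum>l<Suc M. cis (real n * grid M l) * complex_of_real (mass h (grid M (Suc l)) - mass h (grid M l)))"
      using Jm by (intro sum.cong refl) (simp add: mJ)
    also have "\<dots> = (\<Sum>l<Suc M. cis (real n * grid M l) * cm_cinner (slice M l ?f) ?f)"
    proof (intro sum.cong refl arg_cong2[where f=times])
      fix l assume "l \<in> {..<Suc M}"
      then have l: "grid M l \<in> {0..2*pi}" "grid M (Suc l) \<in> {0..2*pi}"
        using grid_range[of l M] grid_range[of "Suc l" M] by simp_all
      have "cm_cinner (slice M l ?f) ?f = cm_cinner (E (grid M (Suc l)) ?f) ?f - cm_cinner (E (grid M l) ?f) ?f"
        unfolding slice_def[abs_def] by (intro cm_cinner_diff_left E_CM l f)
      then show "complex_of_real (mass h (grid M (Suc l)) - mass h (grid M l)) = cm_cinner (slice M l ?f) ?f"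
        by (simp only: E_cinner_self[OF l(1) f] E_cinner_self[OF l(2) f] mass_eq[OF l(1)] mass_eq[OF l(2)] of_real_diff)
    qed
    also have "\<dots> = (\<Sum>l<Suc M. cm_cinner (\<lambda>t. cis (real n * grid M l) * slice M l ?f t) ?f)"
      by (intro sum.cong refl cm_cinner_cmult_left[symmetric] slice_CM f) auto
    also have "\<dots> = cm_cinner (rsum n M ?f) ?f"
      unfolding rsum_def[abs_def] by (intro cm_cinner_sum_left[symmetric] CM_complex_cmult slice_CM f) auto
    finally show ?thesis .
  qed
  have "(\<lambda>M. cm_cinner (rsum n M ?f) ?f) \<longlonglongrightarrow> cm_cinner ((complexify_op R ^^ n) ?f) ?f"
  proof (rule Lim_transform_bound[THEN LIM_zero_cancel])
    show "(\<lambda>M. cm_cnorm (\<lambda>t. (complexify_op R ^^ n) ?f t - rsum n M ?f t) * cm_cnorm ?f) \<longlonglongrightarrow> 0"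
      by (rule tendsto_mult_left_zero[OF rsum_tendsto[OF f]])
    have "cmod (cm_cinner (rsum n M ?f) ?f - cm_cinner ((complexify_op R ^^ n) ?f) ?f)
        \<le> cm_cnorm (\<lambda>t. (complexify_op R ^^ n) ?f t - rsum n M ?f t) * cm_cnorm ?f" for M
    proof -
      have "cm_cinner ((complexify_op R ^^ n) ?f) ?f - cm_cinner (rsum n M ?f) ?f
          = cm_cinner (\<lambda>t. (complexify_op R ^^ n) ?f t - rsum n M ?f t) ?f"
        by (intro cm_cinner_diff_left[symmetric] complexify_op_funpow_CM rsum_CM f)
      then show ?thesis
        using cm_cinner_Cauchy_Schwarz[OF CM_complex_diff[OF complexify_op_funpow_CM[OF f, of n] rsum_CM[OF f, of n M]] f]
        by (simp only: norm_minus_commute)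
    qed
    then show "\<forall>\<^sub>F M in sequentially. cmod (cm_cinner (rsum n M ?f) ?f - cm_cinner ((complexify_op R ^^ n) ?f) ?f)
        \<le> norm (cm_cnorm (\<lambda>t. (complexify_op R ^^ n) ?f t - rsum n M ?f t) * cm_cnorm ?f)"
      by (intro always_eventually allI) (simp add: abs_mult)
  qed
  moreover have "cm_cinner ((complexify_op R ^^ n) ?f) ?f = complex_of_real (cm_inner ((R ^^ n) h) h)"
    by (simp only: complexify_op_funpow_of_real[OF h] cm_cinner_of_real)
  ultimately have lim1: "(\<lambda>M. \<integral>x. g M x \<partial>spectral_measure h) \<longlonglongrightarrow> complex_of_real (cm_inner ((R ^^ n) h) h)"
    by (simp only: gint)
  have cell: "\<exists>l<k. x \<in> J M l" if "0 < x" "x \<le> grid M k" for x k M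
    using that(2)
  proof (induction k)
    case 0
    with that(1) show ?case by (simp add: grid_0)
  next
    case (Suc k)
    show ?case
    proof (cases "x \<le> grid M k")
      case True
      with Suc.IH show ?thesis by (metis less_SucI)
    next
      case False
      with Suc.prems have "x \<in> J M k" by (simp add: J_def)
      then show ?thesis by blast
    qed
  qed
  \<comment> \<open>On a cell \<open>g M\<close> is frozen at the left endpoint, so the error is at
    most \<open>n\<close> times the mesh.\<close>
  have pt: "cmod (g M x - cis (real n * x)) \<le> real n * (2 * pi / real (Suc M))" if x: "0 < x" "x \<le> 2 * pi" for M x
  proof -
    have "x \<le> grid M (Suc M)" using x by (simp only: grid_last)
    from cell[OF x(1) this] obtain l where l: "l < Suc M" "x \<in> J M l" by blast
    have "g M x = (\<Sum>k<Suc M. if k = l then cis (real n * grid M l) else 0)"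
      unfolding g_def
    proof (rule sum.cong[OF refl])
      fix k assume "k \<in> {..<Suc M}"
      have "x \<notin> J M k" if "k \<noteq> l"
      proof (cases "k < l")
        case True
        then have "grid M (Suc k) \<le> grid M l" by (intro grid_mono) simp
        with l(2) show ?thesis by (simp add: J_def)
      next
        case False
        then have "grid M (Suc l) \<le> grid M k" using that by (intro grid_mono) simp
        with l(2) show ?thesis by (simp add: J_def)
      qed
      then show "cis (real n * grid M k) * complex_of_real (indicator (J M k) x) = (if k = l then cis (real n * grid M l) else 0)"
        using l(2) by simp
    qed
    then have "g M x = cis (real n * grid M l)" using l(1) by simp
    then have "cmod (g M x - cis (real n * x)) \<le> \<bar>real n * grid M l - real n * x\<bar>"
      using norm_cis_diff_le by simp
    also have "\<dots> = real n * \<bar>grid M l - x\<bar>" by (simp add: abs_mult right_diff_distrib[symmetric])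
    also have "\<bar>grid M l - x\<bar> \<le> grid M (Suc l) - grid M l" using l(2) by (simp add: J_def)
    finally show ?thesis by (simp add: grid_Suc_diff mult_left_mono)
  qed
  have "(\<lambda>M. \<integral>x. g M x \<partial>spectral_measure h) \<longlonglongrightarrow> (\<integral>x. cis (real n * x) \<partial>spectral_measure h)"
  proof (rule Lim_transform_bound[THEN LIM_zero_cancel])
    have "(\<lambda>M. (real n * (2 * pi) * measure (spectral_measure h) UNIV) * inverse (real (Suc M))) \<longlonglongrightarrow> 0"
      by (rule tendsto_mult_right_zero[OF LIMSEQ_inverse_real_of_nat])
    then show "(\<lambda>M. real n * (2 * pi / real (Suc M)) * measure (spectral_measure h) UNIV) \<longlonglongrightarrow> 0"
      by (simp add: field_simps del: of_nat_Suc)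
    have "cmod ((\<integral>x. g M x \<partial>spectral_measure h) - (\<integral>x. cis (real n * x) \<partial>spectral_measure h))
        \<le> real n * (2 * pi / real (Suc M)) * measure (spectral_measure h) UNIV" for M
    proof -
      have "cmod (\<integral>x. g M x - cis (real n * x) \<partial>spectral_measure h) \<le> (\<integral>x. cmod (g M x - cis (real n * x)) \<partial>spectral_measure h)"
        by (rule integral_norm_bound)
      also have "\<dots> \<le> (\<integral>x. real n * (2 * pi / real (Suc M)) \<partial>spectral_measure h)"
      proof (rule integral_mono_AE)
        show "integrable (spectral_measure h) (\<lambda>x. cmod (g M x - cis (real n * x)))" using gi ci by simp
        show "AE x in spectral_measure h. cmod (g M x - cis (real n * x)) \<le> real n * (2 * pi / real (Suc M))"
          using spectral_measure_AE by eventually_elim (rule pt, simp_all)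
      qed simp
      also have "\<dots> = real n * (2 * pi / real (Suc M)) * measure (spectral_measure h) UNIV"
        by (simp only: lebesgue_integral_const spectral_measure_space real_scaleR_def mult.commute)
      finally show ?thesis unfolding Bochner_Integration.integral_diff[OF gi ci] .
    qed
    from order_trans[OF this abs_ge_self] show "\<forall>\<^sub>F M in sequentially. cmod ((\<integral>x. g M x \<partial>spectral_measure h) - (\<integral>x. cis (real n * x) \<partial>spectral_measure h))
        \<le> norm (real n * (2 * pi / real (Suc M)) * measure (spectral_measure h) UNIV)"
      unfolding real_norm_def by (intro always_eventually allI)
  qed
  with lim1 show ?thesis by (rule LIMSEQ_unique)
qed

text \<open>On the diagonal the continuous function is \<open>mass h\<close>, and an atom is a jump
  of the distribution function.\<close>

lemma atomless_if_continuous: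
  assumes c: "continuous_on {0..2*pi}
      (\<lambda>\<theta>. cm_cinner (E \<theta> (\<lambda>t. complex_of_real (h t))) (\<lambda>t. complex_of_real (h t)))"
  shows "measure (spectral_measure h) {x} = 0"
proof -
  interpret S: finite_borel_measure "spectral_measure h" by (rule spectral_measure_finite)
  let ?f = "\<lambda>t. complex_of_real (h t)"
  have f: "?f \<in> CM_complex" by (rule CM_complex_of_real[OF h])
  have "continuous_on UNIV (\<lambda>x. Re (cm_cinner (E (max 0 (min x (2 * pi))) ?f) ?f))"
    by (intro continuous_on_Re continuous_on_compose2[OF c]) (auto intro!: continuous_intros)
  moreover have "Re (cm_cinner (E (max 0 (min x (2 * pi))) ?f) ?f) = mass h x" for x
    using E_cinner_self[OF _ f, of "max 0 (min x (2 * pi))"] by (simp add: mass_def)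
  ultimately have "continuous_on UNIV (mass h)" by simp
  then have "isCont (mass h) x" by (simp add: continuous_on_eq_continuous_at)
  then show ?thesis using S.isCont_cdf[of x] by (simp add: spectral_measure_cdf)
qed

text \<open>The squared norm of the increment of \<open>E\<close> at \<open>h\<close> is the
  increment of \<open>mass h\<close>; Cauchy-Schwarz then gives continuity against every
  \<open>k\<close>. The absolute value under the root treats both sides of \<open>x\<close>
  together.\<close>

lemma continuous_if_atomless:
  assumes a: "\<And>x. measure (spectral_measure h) {x} = 0" and k: "k \<in> CM"
  shows "continuous_on {0..2*pi}
      (\<lambda>\<theta>. cm_cinner (E \<theta> (\<lambda>t. complex_of_real (h t))) (\<lambda>t. complex_of_real (k t)))"
  unfolding continuous_on_def
proof
  interpret S: finite_borel_measure "spectral_measure h" by (rule spectral_measure_finite)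
  let ?f = "\<lambda>t. complex_of_real (h t)" and ?g = "\<lambda>t. complex_of_real (k t)"
  have f: "?f \<in> CM_complex" and g: "?g \<in> CM_complex" by (simp_all add: CM_complex_of_real h k)
  fix x :: real assume x: "x \<in> {0..2*pi}"
  have "isCont (mass h) x" using S.isCont_cdf[of x] a by (simp add: spectral_measure_cdf)
  then have "(mass h \<longlongrightarrow> mass h x) (at x within {0..2*pi})"
    unfolding isCont_def by (rule tendsto_within_subset) simp
  then have "((\<lambda>y. sqrt \<bar>mass h y - mass h x\<bar> * cm_cnorm ?g) \<longlongrightarrow> sqrt \<bar>mass h x - mass h x\<bar> * cm_cnorm ?g) (at x within {0..2*pi})"
    by (intro tendsto_intros)
  then have lim: "((\<lambda>y. sqrt \<bar>mass h y - mass h x\<bar> * cm_cnorm ?g) \<longlongrightarrow> 0) (at x within {0..2*pi})" by simp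
  show "((\<lambda>\<theta>. cm_cinner (E \<theta> ?f) ?g) \<longlongrightarrow> cm_cinner (E x ?f) ?g) (at x within {0..2*pi})"
  proof (rule Lim_transform_bound[THEN LIM_zero_cancel, OF _ lim])
    have "cmod (cm_cinner (E y ?f) ?g - cm_cinner (E x ?f) ?g) \<le> sqrt \<bar>mass h y - mass h x\<bar> * cm_cnorm ?g"
      if y: "y \<in> {0..2*pi}" for y
    proof -
      have "(cm_cnorm (\<lambda>t. E y ?f t - E x ?f t))\<^sup>2 = \<bar>mass h y - mass h x\<bar>"
      proof (cases "x \<le> y")
        case True
        from mass_increment[OF h x y True] mass_mono[OF h True] show ?thesis by simp
      next
        case False
        then have le: "y \<le> x" by simp
        have "cm_cnorm (\<lambda>t. E y ?f t - E x ?f t) = cm_cnorm (\<lambda>t. E x ?f t - E y ?f t)"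
          using cm_cnorm_cmult[OF CM_complex_diff[OF E_CM[OF x f] E_CM[OF y f]], of "-1"] by simp
        with mass_increment[OF h y x le] mass_mono[OF h le] show ?thesis by simp
      qed
      then have n: "cm_cnorm (\<lambda>t. E y ?f t - E x ?f t) = sqrt \<bar>mass h y - mass h x\<bar>"
        by (metis cm_cnorm_nonneg real_sqrt_unique)
      have "cm_cinner (E y ?f) ?g - cm_cinner (E x ?f) ?g = cm_cinner (\<lambda>t. E y ?f t - E x ?f t) ?g"
        by (intro cm_cinner_diff_left[symmetric] E_CM x y f g)
      then show ?thesis
        using cm_cinner_Cauchy_Schwarz[OF CM_complex_diff[OF E_CM[OF y f] E_CM[OF x f]] g] by (simp only: n)
    qed
    then have "cmod (cm_cinner (E y ?f) ?g - cm_cinner (E x ?f) ?g) \<le> norm (sqrt \<bar>mass h y - mass h x\<bar> * cm_cnorm ?g)"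
      if "y \<in> {0..2*pi}" for y using that by (simp only: real_norm_def abs_mult real_sqrt_abs2 abs_ge_zero real_sqrt_ge_zero cm_cnorm_nonneg abs_of_nonneg)
    then show "\<forall>\<^sub>F y in at x within {0..2*pi}. cmod (cm_cinner (E y ?f) ?g - cm_cinner (E x ?f) ?g)
        \<le> norm (sqrt \<bar>mass h y - mass h x\<bar> * cm_cnorm ?g)"
      unfolding eventually_at_filter
      by (intro always_eventually allI impI)
  qed
qed

end

end

section \<open>Wiener's lemma and Fourier uniqueness\<close>

lemma cis_eq_1_imp: "cis u = 1 \<Longrightarrow> \<exists>k::int. u = 2 * pi * of_int k"
proof -
  assume "cis u = 1"
  then have "cos u = 1" by (simp add: complex_eq_iff)
  then obtain k :: int where "u = of_int k * 2 * pi" unfolding cos_one_2pi_int by (elim exE)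
  then show ?thesis by (intro exI[of _ k]) simp
qed

text \<open>The normalised geometric sum of the characters \<open>e\<^sup>i\<^sup>n\<^sup>u\<close>;
  as \<open>N\<close> grows it tends to the indicator of the multiples of \<open>2 * pi\<close>. For
  \<open>N = 0\<close> its value is 0.\<close>

definition dirichlet_mean :: "nat \<Rightarrow> real \<Rightarrow> complex" where
  "dirichlet_mean N u = (\<Sum>n<N. cis (real n * u)) / of_nat N"

lemma dirichlet_mean_le: "cmod (dirichlet_mean N u) \<le> 1"
proof -
  have "cmod (\<Sum>n<N. cis (real n * u)) \<le> (\<Sum>n<N. cmod (cis (real n * u)))" by (rule norm_sum)
  then show ?thesis by (cases "N = 0") (simp_all add: dirichlet_mean_def norm_divide divide_le_eq)
qed

lemma dirichlet_mean_1:
  assumes "cis u = 1" "N > 0"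
  shows "dirichlet_mean N u = 1"
proof -
  have "cis (real n * u) = 1" for n using Complex.DeMoivre[of u n] assms(1) by simp
  then show ?thesis using assms(2) by (simp add: dirichlet_mean_def)
qed

lemma dirichlet_mean_tendsto_0:
  assumes "cis u \<noteq> 1"
  shows "(\<lambda>N. dirichlet_mean N u) \<longlonglongrightarrow> 0"
proof -
  define C where "C = 2 / cmod (cis u - 1)"
  have le: "cmod (dirichlet_mean N u) \<le> C * inverse (real N)" for N
  proof -
    have "(\<Sum>n<N. cis (real n * u)) = (\<Sum>n<N. cis u ^ n)" by (simp add: Complex.DeMoivre)
    also have "\<dots> = (cis u ^ N - 1) / (cis u - 1)" using assms by (rule geometric_sum)
    finally have "cmod (\<Sum>n<N. cis (real n * u)) = cmod (cis u ^ N - 1) / cmod (cis u - 1)" by (simp add: norm_divide)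
    also have "\<dots> \<le> C"
      unfolding C_def using norm_triangle_ineq4[of "cis u ^ N" 1]
      by (intro divide_right_mono) (simp_all add: norm_power)
    finally have "cmod (\<Sum>n<N. cis (real n * u)) \<le> C" .
    then have "cmod (\<Sum>n<N. cis (real n * u)) * inverse (real N) \<le> C * inverse (real N)" by (rule mult_right_mono) simp
    then show ?thesis unfolding dirichlet_mean_def norm_divide by (simp only: norm_of_nat divide_inverse)
  qed
  have lim: "(\<lambda>N. C * inverse (real N)) \<longlonglongrightarrow> 0"
    by (rule tendsto_mult_right_zero[OF lim_inverse_n])
  show ?thesis by (rule Lim_null_comparison[OF always_eventually[OF allI[OF le]] lim])
qed

lemma sum_cis_diff:
  "(\<Sum>n<N. \<Sum>m<N. cis ((real n - real m) * u)) = (\<Sum>n<N. cis (real n * u)) * cnj (\<Sum>n<N. cis (real n * u))"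
  by (simp add: cnj_sum cis_cnj sum_product cis_mult left_diff_distrib)

lemma (in finite_borel_measure) cis_integrable: "integrable M (\<lambda>x. cis (c * x))"
proof (rule integrable_const_bound[of _ 1])
  show "(\<lambda>x. cis (c * x)) \<in> borel_measurable M"
    by (subst measurable_cong_sets[OF M_is_borel refl]) (rule cis_measurable)
qed simp

text \<open>
  Wiener's lemma, in the two-parameter form that the decorrelation estimate needs.  The double
  mean of squared Fourier coefficients is the iterated integral of \<open>|D\<^sub>N(x - y)|\<^sup>2\<close>, which is
  treated by dominated convergence in each variable separately.
\<close>

lemma (in finite_borel_measure) Wiener_double_mean:
  fixes c :: "nat \<Rightarrow> nat \<Rightarrow> real"
  assumes c: "\<And>n m. complex_of_real (c n m) = (\<integral>x. cis ((real n - real m) * x) \<partial>M)"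
    and atomless: "\<And>x. measure M {x} = 0"
  shows "(\<lambda>N. (\<Sum>n<N. \<Sum>m<N. (c n m)\<^sup>2) / (real N)\<^sup>2) \<longlonglongrightarrow> 0"
proof -
  \<comment> \<open>The squared modulus, kept as a complex product so that it remains a double sum
    of \<open>cis\<close>.\<close>
  define K where "K N u = dirichlet_mean N u * cnj (dirichlet_mean N u)" for N u
  have K1: "cmod (K N u) \<le> 1" for N u
    unfolding K_def norm_mult complex_mod_cnj using dirichlet_mean_le[of N u] by (intro mult_le_one) auto
  have Ksum: "K N u = (\<Sum>n<N. \<Sum>m<N. cis ((real n - real m) * u)) / of_nat N ^ 2" for N u
    unfolding K_def dirichlet_mean_def sum_cis_diff complex_cnj_divide complex_cnj_of_nat times_divide_times_eq power2_eq_square ..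
  define H where "H N x = (\<integral>y. K N (x - y) \<partial>M)" for N x
  have meas: "(\<lambda>y. K N (x - y)) \<in> borel_measurable borel" for N x
  proof -
    have "(\<lambda>y. \<Sum>n<N. \<Sum>m<N. cis ((real n - real m) * (x - y))) \<in> borel_measurable borel"
      by (intro borel_measurable_continuous_onI continuous_on_sum continuous_on_mult continuous_on_cis
          continuous_on_diff continuous_on_const continuous_on_id)
    then show ?thesis unfolding Ksum by (intro borel_measurable_divide borel_measurable_const)
  qed
  have measM: "(\<lambda>y. K N (x - y)) \<in> borel_measurable M" for N x
    by (subst measurable_cong_sets[OF M_is_borel refl]) (rule meas)
  have H_lim: "(\<lambda>N. H N x) \<longlonglongrightarrow> 0" for x
  proof -
    have "(\<lambda>N. \<integral>y. K N (x - y) \<partial>M) \<longlonglongrightarrow> (\<integral>y. 0 \<partial>M)"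
    proof (rule integral_dominated_convergence[where w="\<lambda>_. 1"])
      show "(\<lambda>y. K N (x - y)) \<in> borel_measurable M" for N by (rule measM)
      show "AE y in M. cmod (K N (x - y)) \<le> 1" for N using K1 by simp
      have null: "{y} \<in> null_sets M" for y
        using atomless[of y] by (intro null_setsI) (simp_all add: emeasure_eq_measure M_is_borel)
      \<comment> \<open>For fixed \<open>x\<close>, the kernel fails to vanish in the limit only on
        a countable set of \<open>y\<close>, which is null because there are no atoms.\<close>
      have "(\<Union>k\<in>(UNIV :: int set). {x - 2 * pi * of_int k}) \<in> null_sets M"
        by (rule null_sets_UN') (simp_all add: null)
      then have "AE y in M. cis (x - y) \<noteq> 1"
      proof (rule AE_I')
        show "{y \<in> space M. \<not> cis (x - y) \<noteq> 1} \<subseteq> (\<Union>k\<in>(UNIV :: int set). {x - 2 * pi * of_int k})"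
        proof
          fix y assume "y \<in> {y \<in> space M. \<not> cis (x - y) \<noteq> 1}"
          then have "cis (x - y) = 1" by simp
          from cis_eq_1_imp[OF this] obtain k :: int where "x - y = 2 * pi * of_int k" by (elim exE)
          then have "y = x - 2 * pi * of_int k" by simp
          then show "y \<in> (\<Union>k\<in>(UNIV :: int set). {x - 2 * pi * of_int k})" by (intro UN_I[of k]) simp_all
        qed
      qed
      then show "AE y in M. (\<lambda>N. K N (x - y)) \<longlonglongrightarrow> 0"
      proof eventually_elim
        case (elim y)
        from tendsto_mult[OF dirichlet_mean_tendsto_0[OF elim] tendsto_cnj[OF dirichlet_mean_tendsto_0[OF elim]]]
        show ?case by (simp add: K_def)
      qed
    qed simp_all
    then show ?thesis by (simp add: H_def)
  qed
  have cc: "(\<integral>y. cis ((real n - real m) * (x - y)) \<partial>M) = cis ((real n - real m) * x) * complex_of_real (c n m)" for n m x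
  proof -
    have "(\<integral>y. cis ((real n - real m) * (x - y)) \<partial>M) = (\<integral>y. cis ((real n - real m) * x) * cnj (cis ((real n - real m) * y)) \<partial>M)"
      by (simp add: cis_cnj cis_mult right_diff_distrib)
    also have "\<dots> = cis ((real n - real m) * x) * cnj (\<integral>y. cis ((real n - real m) * y) \<partial>M)"
      by simp
    finally show ?thesis by (simp add: c[symmetric])
  qed
  have ci: "integrable M (\<lambda>y. cis ((real n - real m) * (x - y)))" for n m x
  proof -
    have "integrable M (\<lambda>y. cis ((real n - real m) * x) * cis (- (real n - real m) * y))"
      by (intro integrable_mult_right cis_integrable)
    then show ?thesis by (simp add: cis_mult right_diff_distrib algebra_simps)
  qed
  have H_sum: "H N x = (\<Sum>n<N. \<Sum>m<N. cis ((real n - real m) * x) * complex_of_real (c n m)) / of_nat N ^ 2" for N x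
    unfolding H_def Ksum
    by (simp add: Bochner_Integration.integral_sum integrable_sum ci cc)
  have Hm: "H N \<in> borel_measurable M" for N
  proof -
    have "(\<lambda>x. \<Sum>n<N. \<Sum>m<N. cis ((real n - real m) * x) * complex_of_real (c n m)) \<in> borel_measurable borel"
      by (intro borel_measurable_continuous_onI continuous_on_sum continuous_on_mult continuous_on_cis
          continuous_on_diff continuous_on_const continuous_on_id)
    then have "H N \<in> borel_measurable borel"
      unfolding H_sum[abs_def] by (intro borel_measurable_divide borel_measurable_const)
    then show ?thesis by (subst measurable_cong_sets[OF M_is_borel refl])
  qed
  have "(\<lambda>N. \<integral>x. H N x \<partial>M) \<longlonglongrightarrow> (\<integral>x. 0 \<partial>M)"
  proof (rule integral_dominated_convergence[where w="\<lambda>_. measure M (space M)"])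
    show "H N \<in> borel_measurable M" for N by (rule Hm)
    show "AE x in M. (\<lambda>N. H N x) \<longlonglongrightarrow> 0" using H_lim by simp
    have "cmod (H N x) \<le> measure M (space M)" for N x
    proof -
      have "cmod (H N x) \<le> (\<integral>y. cmod (K N (x - y)) \<partial>M)" unfolding H_def by (rule integral_norm_bound)
      also have "\<dots> \<le> (\<integral>y. 1 \<partial>M)"
        using measM K1 by (intro integral_mono integrable_const_bound[of _ 1]) auto
      finally show ?thesis by simp
    qed
    then show "AE x in M. cmod (H N x) \<le> measure M (space M)" for N by simp
  qed simp_all
  then have lim: "(\<lambda>N. \<integral>x. H N x \<partial>M) \<longlonglongrightarrow> 0" by simp
  \<comment> \<open>The integration over \<open>y\<close> has produced one factor
    \<open>c n m\<close>; the integration over \<open>x\<close> produces the second, hence the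
    square.\<close>
  have "(\<integral>x. H N x \<partial>M) = complex_of_real ((\<Sum>n<N. \<Sum>m<N. (c n m)\<^sup>2) / (real N)\<^sup>2)" for N
    unfolding H_sum
    by (simp add: Bochner_Integration.integral_sum integrable_sum cis_integrable c[symmetric] power2_eq_square)
  then have "(\<lambda>N. complex_of_real ((\<Sum>n<N. \<Sum>m<N. (c n m)\<^sup>2) / (real N)\<^sup>2)) \<longlonglongrightarrow> complex_of_real 0"
    using lim by simp
  then show ?thesis unfolding tendsto_of_real_iff .
qed

text \<open>Cauchy-Schwarz against the constant 1 over the \<open>N * N\<close> pairs: the estimate
  of the exponentials is linear in the covariance, not quadratic.\<close>

lemma double_mean_abs_tendsto:
  fixes c :: "nat \<Rightarrow> nat \<Rightarrow> real"
  assumes "(\<lambda>N. (\<Sum>n<N. \<Sum>m<N. (c n m)\<^sup>2) / (real N)\<^sup>2) \<longlonglongrightarrow> 0"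
  shows "(\<lambda>N. (\<Sum>n<N. \<Sum>m<N. \<bar>c n m\<bar>) / (real N)\<^sup>2) \<longlonglongrightarrow> 0"
proof (rule Lim_null_comparison[OF always_eventually])
  from tendsto_real_sqrt[OF assms]
  show "(\<lambda>N. sqrt ((\<Sum>n<N. \<Sum>m<N. (c n m)\<^sup>2) / (real N)\<^sup>2)) \<longlonglongrightarrow> 0" by simp
  show "\<forall>N. norm ((\<Sum>n<N. \<Sum>m<N. \<bar>c n m\<bar>) / (real N)\<^sup>2) \<le> sqrt ((\<Sum>n<N. \<Sum>m<N. (c n m)\<^sup>2) / (real N)\<^sup>2)"
  proof
    fix N :: nat
    define A where "A = {..<N} \<times> {..<N}"
    have s: "(\<Sum>n<N. \<Sum>m<N. f n m) = (\<Sum>(n, m)\<in>A. f n m)" for f :: "nat \<Rightarrow> nat \<Rightarrow> real"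
      unfolding A_def by (rule sum.cartesian_product)
    have "(\<Sum>p\<in>A. 1 * \<bar>c (fst p) (snd p)\<bar>)\<^sup>2 \<le> (\<Sum>p\<in>A. 1\<^sup>2) * (\<Sum>p\<in>A. \<bar>c (fst p) (snd p)\<bar>\<^sup>2)"
      by (rule Cauchy_Schwarz_ineq_sum)
    then have "(\<Sum>n<N. \<Sum>m<N. \<bar>c n m\<bar>)\<^sup>2 \<le> (real N)\<^sup>2 * (\<Sum>n<N. \<Sum>m<N. (c n m)\<^sup>2)"
      unfolding s by (simp add: case_prod_unfold A_def card_cartesian_product power2_eq_square)
    then have "((\<Sum>n<N. \<Sum>m<N. \<bar>c n m\<bar>) / (real N)\<^sup>2)\<^sup>2 \<le> (\<Sum>n<N. \<Sum>m<N. (c n m)\<^sup>2) / (real N)\<^sup>2"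
      by (cases "N = 0") (simp_all add: power_divide divide_le_eq field_simps power2_eq_square)
    then have "\<bar>(\<Sum>n<N. \<Sum>m<N. \<bar>c n m\<bar>) / (real N)\<^sup>2\<bar> \<le> sqrt ((\<Sum>n<N. \<Sum>m<N. (c n m)\<^sup>2) / (real N)\<^sup>2)"
      by (intro real_le_rsqrt) (simp only: power2_abs)
    then show "norm ((\<Sum>n<N. \<Sum>m<N. \<bar>c n m\<bar>) / (real N)\<^sup>2) \<le> sqrt ((\<Sum>n<N. \<Sum>m<N. (c n m)\<^sup>2) / (real N)\<^sup>2)" by simp
  qed
qed

text \<open>Isometry cancels the common power of \<open>R\<close>; negative differences of exponents
  follow by conjugation, since the inner product is real.\<close>

lemma (in spectral_resolution) inner_funpow_spectral:
  assumes h: "h \<in> CM"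
  shows "complex_of_real (cm_inner ((R ^^ n) h) ((R ^^ m) h)) = (\<integral>x. cis ((real n - real m) * x) \<partial>spectral_measure h)"
proof -
  have le: "complex_of_real (cm_inner ((R ^^ n) h) ((R ^^ m) h)) = (\<integral>x. cis ((real n - real m) * x) \<partial>spectral_measure h)"
    if "m \<le> n" for n m
  proof -
    have "(R ^^ n) h = (R ^^ m) ((R ^^ (n - m)) h)" using funpow_add[of m "n - m" R] that by (simp add: fun_eq_iff)
    then have "cm_inner ((R ^^ n) h) ((R ^^ m) h) = cm_inner ((R ^^ (n - m)) h) h"
      by (simp only: unitary_CM_funpow_inner[OF R unitary_CM_funpow[OF R h] h])
    then show ?thesis using spectral_measure_moment[OF h, of "n - m"] that by (simp add: of_nat_diff)
  qed
  show ?thesis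
  proof (cases "m \<le> n")
    case False
    then have "n \<le> m" by simp
    have "complex_of_real (cm_inner ((R ^^ n) h) ((R ^^ m) h)) = cnj (complex_of_real (cm_inner ((R ^^ m) h) ((R ^^ n) h)))"
      by (simp add: cm_inner_commute)
    also have "\<dots> = (\<integral>x. cnj (cis ((real m - real n) * x)) \<partial>spectral_measure h)"
      unfolding le[OF \<open>n \<le> m\<close>] by simp
    finally show ?thesis by (simp add: cis_cnj algebra_simps)
  qed (rule le)
qed

text \<open>Fourier uniqueness for the signed law of \<open>W\<close> under the density
  \<open>u\<close>. The parameter \<open>a = 0\<close> shows that both parts of \<open>u\<close>
  have the same mass; after normalisation they give \<open>W\<close> two laws with equal
  characteristic functions, and Levy's theorem identifies these.\<close>

lemma fourier_zero_real:
  fixes u W :: "'a \<Rightarrow> real"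
  assumes u: "integrable M u" and W: "W \<in> borel_measurable M"
    and z: "\<And>a. (\<integral>x. complex_of_real (u x) * iexp (a * W x) \<partial>M) = 0"
    and A: "A \<in> sets borel"
  shows "(\<integral>x. u x * indicator A (W x) \<partial>M) = 0"
proof -
  define up where "up x = max 0 (u x)" for x
  define un where "un x = max 0 (- u x)" for x
  have um: "u \<in> borel_measurable M" using u by simp
  have upi: "integrable M up" and uni: "integrable M un"
    unfolding up_def[abs_def] un_def[abs_def] using u by simp_all
  have u_eq: "u x = up x - un x" for x by (simp add: up_def un_def max_def)
  have nn: "0 \<le> up x" "0 \<le> un x" for x by (simp_all add: up_def un_def)
  have indb: "(\<lambda>x. indicator A (W x) :: real) \<in> borel_measurable M"
    using measurable_compose[OF W borel_measurable_indicator[OF A]] .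
  have upI: "integrable M (\<lambda>x. up x * indicator A (W x))"
    by (rule Bochner_Integration.integrable_bound[OF upi]) (use indb upi in \<open>auto simp: indicator_def\<close>)
  have unI: "integrable M (\<lambda>x. un x * indicator A (W x))"
    by (rule Bochner_Integration.integrable_bound[OF uni]) (use indb uni in \<open>auto simp: indicator_def\<close>)
  have em: "(\<lambda>x. iexp (a * W x)) \<in> borel_measurable M" for a
  proof -
    have "(\<lambda>y. cis (a * y)) \<in> borel_measurable borel" by (rule cis_measurable)
    from measurable_compose[OF W this] show ?thesis by (simp add: cis_conv_exp)
  qed
  have ei: "integrable M (\<lambda>x. complex_of_real (v x) * iexp (a * W x))" if "integrable M v" for v a
  proof (rule Bochner_Integration.integrable_bound[OF that])
    show "(\<lambda>x. complex_of_real (v x) * iexp (a * W x)) \<in> borel_measurable M"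
      using em[of a] that by (intro borel_measurable_times borel_measurable_of_real) simp_all
    show "AE x in M. norm (complex_of_real (v x) * iexp (a * W x)) \<le> norm (v x)" by (simp add: norm_mult)
  qed
  have eq: "(\<integral>x. complex_of_real (up x) * iexp (a * W x) \<partial>M) = (\<integral>x. complex_of_real (un x) * iexp (a * W x) \<partial>M)" for a
  proof -
    have "(\<integral>x. complex_of_real (u x) * iexp (a * W x) \<partial>M)
        = (\<integral>x. complex_of_real (up x) * iexp (a * W x) - complex_of_real (un x) * iexp (a * W x) \<partial>M)"
      unfolding u_eq of_real_diff left_diff_distrib ..
    then show ?thesis using z[of a] ei[OF upi, of a] ei[OF uni, of a] by simp
  qed
  \<comment> \<open>The common mass of the two parts. If it is 0, then \<open>u\<close> vanishes
    a.e.; otherwise it serves as the normalising factor.\<close>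
  define \<kappa> where "\<kappa> = (\<integral>x. up x \<partial>M)"
  have \<kappa>2: "(\<integral>x. un x \<partial>M) = \<kappa>" using eq[of 0] by (simp add: \<kappa>_def)
  show ?thesis
  proof (cases "\<kappa> = 0")
    case True
    have "AE x in M. up x = 0" using integral_nonneg_eq_0_iff_AE[OF upi] nn True by (simp add: \<kappa>_def)
    moreover have "AE x in M. un x = 0" using integral_nonneg_eq_0_iff_AE[OF uni] nn True \<kappa>2 by simp
    ultimately have "AE x in M. u x * indicator A (W x) = 0" by eventually_elim (simp add: u_eq)
    then show ?thesis by (rule integral_eq_zero_AE)
  next
    case False
    have "0 \<le> \<kappa>" unfolding \<kappa>_def using nn by (intro integral_nonneg_AE) simp
    with False have \<kappa>: "0 < \<kappa>" by simp
    define N where "N v = distr (density M (\<lambda>x. ennreal (v x / \<kappa>))) borel W" for v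
    have rd: "real_distribution (N v)"
      and ch: "char (N v) a = (\<integral>x. complex_of_real (v x) * iexp (a * W x) \<partial>M) / \<kappa>"
      and ind: "(\<integral>y. indicator A y \<partial>N v) = (\<integral>x. v x * indicator A (W x) \<partial>M) / \<kappa>"
      if v: "integrable M v" "\<And>x. 0 \<le> v x" "(\<integral>x. v x \<partial>M) = \<kappa>" for v a
    proof -
      have vm: "(\<lambda>x. v x / \<kappa>) \<in> borel_measurable M" using v(1) by simp
      have vn: "AE x in M. 0 \<le> v x / \<kappa>" using v(2) \<kappa> by simp
      have "emeasure (density M (\<lambda>x. ennreal (v x / \<kappa>))) (space M) = (\<integral>\<^sup>+x. ennreal (v x / \<kappa>) \<partial>M)"
        using vm by (subst emeasure_density) (auto intro!: nn_integral_cong)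
      also have "\<dots> = ennreal (\<integral>x. v x / \<kappa> \<partial>M)"
        by (rule nn_integral_eq_integral[OF _ vn]) (use v(1) in simp)
      also have "\<dots> = 1" using v(3) \<kappa> by simp
      finally have p: "prob_space (density M (\<lambda>x. ennreal (v x / \<kappa>)))" by (intro prob_spaceI) simp
      have Wd: "W \<in> borel_measurable (density M (\<lambda>x. ennreal (v x / \<kappa>)))" using W by simp
      show "real_distribution (N v)"
        unfolding N_def by (rule prob_space.real_distribution_distr[OF p Wd])
      have "char (N v) a = (\<integral>x. iexp (a * W x) \<partial>density M (\<lambda>x. ennreal (v x / \<kappa>)))"
        unfolding char_def N_def by (rule integral_distr[OF Wd]) simp
      also have "\<dots> = (\<integral>x. (v x / \<kappa>) *\<^sub>R iexp (a * W x) \<partial>M)"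
        by (rule integral_density[OF em vm vn])
      also have "(\<lambda>x. (v x / \<kappa>) *\<^sub>R iexp (a * W x)) = (\<lambda>x. (complex_of_real (v x) * iexp (a * W x)) / \<kappa>)"
        by (simp add: scaleR_conv_of_real)
      also have "(\<integral>x. (complex_of_real (v x) * iexp (a * W x)) / \<kappa> \<partial>M) = (\<integral>x. complex_of_real (v x) * iexp (a * W x) \<partial>M) / \<kappa>"
        by (rule integral_divide_zero)
      finally show "char (N v) a = (\<integral>x. complex_of_real (v x) * iexp (a * W x) \<partial>M) / \<kappa>" .
      have "(\<integral>y. indicator A y \<partial>N v) = (\<integral>x. (indicator A (W x) :: real) \<partial>density M (\<lambda>x. ennreal (v x / \<kappa>)))"
        unfolding N_def by (rule integral_distr[OF Wd borel_measurable_indicator[OF A]])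
      also have "\<dots> = (\<integral>x. (v x / \<kappa>) *\<^sub>R (indicator A (W x) :: real) \<partial>M)"
        by (rule integral_density[OF indb vm vn])
      also have "\<dots> = (\<integral>x. v x * indicator A (W x) \<partial>M) / \<kappa>"
        unfolding integral_divide_zero[symmetric] by simp
      finally show "(\<integral>y. indicator A y \<partial>N v) = (\<integral>x. v x * indicator A (W x) \<partial>M) / \<kappa>" .
    qed
    note P = upi nn(1) \<kappa>_def[symmetric] and Q = uni nn(2) \<kappa>2
    have "N up = N un"
      by (rule Levy_uniqueness[OF rd[OF P] rd[OF Q]]) (rule ext, simp only: ch[OF P] ch[OF Q] eq)
    then have "(\<integral>x. up x * indicator A (W x) \<partial>M) = (\<integral>x. un x * indicator A (W x) \<partial>M)"
      using ind[OF P] ind[OF Q] \<kappa> by simp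
    moreover have "(\<integral>x. u x * indicator A (W x) \<partial>M) = (\<integral>x. up x * indicator A (W x) - un x * indicator A (W x) \<partial>M)"
      unfolding u_eq left_diff_distrib ..
    ultimately show ?thesis using upI unI by simp
  qed
qed

text \<open>The hypothesis is stable under conjugation, which replaces \<open>a\<close> by
  \<open>- a\<close>, and under multiplication by constants; so it holds for the real part of
  \<open>g\<close> and, through \<open>- \<i> * g\<close>, for the imaginary part.\<close>

lemma fourier_zero:
  fixes g :: "'a \<Rightarrow> complex" and W :: "'a \<Rightarrow> real"
  assumes g: "integrable M g" and W: "W \<in> borel_measurable M"
    and z: "\<And>a. (\<integral>x. g x * iexp (a * W x) \<partial>M) = 0"
    and A: "A \<in> sets borel"
  shows "(\<integral>x. g x * indicator A (W x) \<partial>M) = 0"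
proof -
  have em: "(\<lambda>x. iexp (a * W x)) \<in> borel_measurable M" for a
  proof -
    have "(\<lambda>y. cis (a * y)) \<in> borel_measurable borel" by (rule cis_measurable)
    from measurable_compose[OF W this] show ?thesis by (simp add: cis_conv_exp)
  qed
  have ei: "integrable M (\<lambda>x. v x * iexp (a * W x))" if "integrable M v" for v a
  proof (rule Bochner_Integration.integrable_bound[OF that])
    show "(\<lambda>x. v x * iexp (a * W x)) \<in> borel_measurable M"
      using em[of a] that by (intro borel_measurable_times) simp_all
    show "AE x in M. norm (v x * iexp (a * W x)) \<le> norm (v x)" by (simp add: norm_mult)
  qed
  have re: "(\<integral>x. complex_of_real (Re (v x)) * iexp (a * W x) \<partial>M) = 0"
    if v: "integrable M v" and vz: "\<And>a. (\<integral>x. v x * iexp (a * W x) \<partial>M) = 0" for v a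
  proof -
    have vc: "integrable M (\<lambda>x. cnj (v x))" using v by simp
    have "(\<integral>x. cnj (v x) * iexp (a * W x) \<partial>M) = (\<integral>x. cnj (v x * iexp (- a * W x)) \<partial>M)"
      by (simp add: exp_cnj)
    also have "\<dots> = cnj (\<integral>x. v x * iexp (- a * W x) \<partial>M)" by (rule Bochner_Integration.integral_cnj)
    finally have zc: "(\<integral>x. cnj (v x) * iexp (a * W x) \<partial>M) = 0" by (simp only: vz complex_cnj_zero)
    have "complex_of_real (Re (v x)) * iexp (a * W x) = (1 / 2) * (v x * iexp (a * W x) + cnj (v x) * iexp (a * W x))" for x
      by (simp add: complex_add_cnj distrib_right[symmetric])
    then have "(\<integral>x. complex_of_real (Re (v x)) * iexp (a * W x) \<partial>M) = (1 / 2) * (\<integral>x. v x * iexp (a * W x) + cnj (v x) * iexp (a * W x) \<partial>M)"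
      by (simp only: integral_mult_right_zero)
    also have "(\<integral>x. v x * iexp (a * W x) + cnj (v x) * iexp (a * W x) \<partial>M) = 0"
      using Bochner_Integration.integral_add[OF ei[OF v, of a] ei[OF vc, of a]] by (simp only: vz zc add_0)
    finally show ?thesis by simp
  qed
  have ig: "integrable M (\<lambda>x. - \<i> * g x)" using g by simp
  have "(\<integral>x. (- \<i> * g x) * iexp (a * W x) \<partial>M) = 0" for a
    unfolding mult.assoc[of "- \<i>"] integral_mult_right_zero z by simp
  from re[OF ig this] have im: "(\<integral>x. complex_of_real (Im (g x)) * iexp (a * W x) \<partial>M) = 0" for a
    by simp
  have 1: "(\<integral>x. Re (g x) * indicator A (W x) \<partial>M) = 0"
    by (rule fourier_zero_real[OF integrable_Re[OF g] W re[OF g z] A])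
  have 2: "(\<integral>x. Im (g x) * indicator A (W x) \<partial>M) = 0"
    by (rule fourier_zero_real[OF integrable_Im[OF g] W im A])
  have indb: "(\<lambda>x. indicator A (W x) :: complex) \<in> borel_measurable M"
    using measurable_compose[OF W borel_measurable_indicator[OF A]] .
  have gi: "integrable M (\<lambda>x. g x * indicator A (W x))"
    by (rule Bochner_Integration.integrable_bound[OF g]) (use indb g in \<open>auto simp: indicator_def\<close>)
  have "Re (g x * indicator A (W x)) = Re (g x) * indicator A (W x)"
    "Im (g x * indicator A (W x)) = Im (g x) * indicator A (W x)" for x
    by (cases "W x \<in> A"; simp)+
  note eqs = this
  have "Re (\<integral>x. g x * indicator A (W x) \<partial>M) = 0"
    using 1 integral_Re[OF gi] by (simp only: eqs)
  moreover have "Im (\<integral>x. g x * indicator A (W x) \<partial>M) = 0"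
    using 2 integral_Im[OF gi] by (simp only: eqs)
  ultimately show ?thesis by (simp add: complex_eq_iff)
qed

section \<open>Decorrelation implies weak mixing\<close>

context wiener_space
begin

lemma space_mu: "space \<mu> = C0_paths"
proof -
  have "space \<mu> = space path_space" by (rule sets_eq_imp_space_eq[OF sets_mu])
  then show ?thesis by (simp add: path_space_def space_restrict_space space_PiM)
qed

lemma wdelta_cong_AE:
  assumes X: "wdelta h X" and Y: "Y \<in> borel_measurable \<mu>" and eq: "AE w in \<mu>. X w = Y w"
  shows "wdelta h Y"
proof -
  have sY: "sq_int \<mu> Y" by (rule sq_int_cong_AE[OF wdelta_sq_int[OF X] Y eq])
  have Xm: "X \<in> borel_measurable \<mu>" using wdelta_sq_int[OF X] by (simp add: sq_int_def)
  have "L2_norm \<mu> (\<lambda>w. X w - Y w) = L2_norm \<mu> (\<lambda>w. 0)"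
    using eq Xm Y by (intro L2_norm_cong_AE) auto
  then have z: "L2_norm \<mu> (\<lambda>w. X w - Y w) = 0" by simp
  have "cm_norm (\<lambda>t. h t - h t) = 0" by (simp add: cm_norm_def)
  with z show ?thesis
    by (intro wdelta_limit[OF X wdelta_CM[OF X] sY]) simp_all
qed

lemma wdelta_coordinate: "\<exists>h. wdelta h (\<lambda>w. w t)"
proof (cases "t \<in> {0..1}")
  case True
  have "wdelta (step_primitive [(1, 0, t)]) (step_integral [(1, 0, t)])"
    using True by (intro wdelta_step) (simp add: step_valid_def)
  moreover have "AE w in \<mu>. step_integral [(1, 0, t)] w = w t"
    by (rule AE_I2) (simp add: space_mu C0_paths_def step_integral_def)
  ultimately show ?thesis using wdelta_cong_AE[OF _ coordinate_measurable] by blast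
next
  case False
  have "AE w in \<mu>. 0 = w t"
    by (rule AE_I2) (use False in \<open>simp add: space_mu C0_paths_def\<close>)
  then show ?thesis using wdelta_cong_AE[OF wdelta_zero coordinate_measurable] by blast
qed

definition cylinder :: "real set \<Rightarrow> (real \<Rightarrow> real set) \<Rightarrow> (real \<Rightarrow> real) \<Rightarrow> real" where
  "cylinder J A w = (\<Prod>t\<in>J. indicator (A t) (w t))"

lemma cylinder_measurable:
  assumes "\<And>t. t \<in> J \<Longrightarrow> A t \<in> sets borel"
  shows "cylinder J A \<in> borel_measurable \<mu>"
  unfolding cylinder_def[abs_def]
  by (intro borel_measurable_prod measurable_compose[OF coordinate_measurable borel_measurable_indicator] assms)

lemma cylinder_le_1: "\<bar>cylinder J A w\<bar> \<le> 1"
  unfolding cylinder_def abs_prod by (intro prod_le_1) (auto simp: indicator_def)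

lemma integrable_cylinder:
  fixes f :: "(real \<Rightarrow> real) \<Rightarrow> 'b::{banach, second_countable_topology, real_normed_field}"
  assumes f: "integrable \<mu> f" and A: "\<And>t. t \<in> J \<Longrightarrow> A t \<in> sets borel"
  shows "integrable \<mu> (\<lambda>w. f w * of_real (cylinder J A w))"
proof (rule Bochner_Integration.integrable_bound[OF f])
  show "(\<lambda>w. f w * of_real (cylinder J A w)) \<in> borel_measurable \<mu>"
    using f cylinder_measurable[of J A] A by (intro borel_measurable_times borel_measurable_of_real) auto
  show "AE w in \<mu>. norm (f w * of_real (cylinder J A w)) \<le> norm (f w)"
    using cylinder_le_1 by (simp add: norm_mult mult_left_le)
qed

text \<open>Coordinates are added one at a time, Fourier uniqueness exchanging
  \<open>iexp (a * w t)\<close> for the indicator of \<open>A t\<close>. The factor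
  \<open>iexp (X w)\<close> has to stay in the statement: the induction hypothesis is applied to
  \<open>X w + a * w t\<close>, which is again a Wiener integral.\<close>

lemma integral_cylinder_zero:
  fixes f :: "(real \<Rightarrow> real) \<Rightarrow> complex"
  assumes f: "integrable \<mu> f" and z: "\<And>h X. wdelta h X \<Longrightarrow> (\<integral>w. f w * iexp (X w) \<partial>\<mu>) = 0"
    and J: "finite J" "\<And>t. t \<in> J \<Longrightarrow> A t \<in> sets borel" and X: "wdelta h X"
  shows "(\<integral>w. f w * of_real (cylinder J A w) * iexp (X w) \<partial>\<mu>) = 0"
  using J X
proof (induction J arbitrary: h X rule: finite_induct)
  case empty
  then show ?case by (simp add: cylinder_def z)
next
  case (insert t J)
  define g where "g w = f w * of_real (cylinder J A w) * iexp (X w)" for w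
  have Xm: "X \<in> borel_measurable \<mu>" using wdelta_sq_int[OF insert.prems(2)] by (simp add: sq_int_def)
  have em: "(\<lambda>w. iexp (X w)) \<in> borel_measurable \<mu>"
    using measurable_compose[OF Xm cis_measurable[of 1]] by (simp add: cis_conv_exp)
  have fc: "integrable \<mu> (\<lambda>w. f w * of_real (cylinder J A w))"
    using insert.prems(1) by (intro integrable_cylinder f) auto
  have gi: "integrable \<mu> g"
    unfolding g_def[abs_def]
  proof (rule Bochner_Integration.integrable_bound[OF fc])
    show "(\<lambda>w. f w * of_real (cylinder J A w) * iexp (X w)) \<in> borel_measurable \<mu>"
      by (rule borel_measurable_times[OF borel_measurable_integrable[OF fc] em])
    show "AE w in \<mu>. norm (f w * of_real (cylinder J A w) * iexp (X w)) \<le> norm (f w * of_real (cylinder J A w))"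
      by (simp add: norm_mult)
  qed
  obtain k where k: "wdelta k (\<lambda>w. w t)" using wdelta_coordinate by blast
  have "(\<integral>w. g w * iexp (a * w t) \<partial>\<mu>) = 0" for a
  proof -
    have "wdelta (\<lambda>s. h s + a * k s) (\<lambda>w. X w + a * w t)"
      by (intro wdelta_add wdelta_cmult insert.prems(2) k)
    from insert.IH[OF _ this] insert.prems(1)
    have "(\<integral>w. f w * of_real (cylinder J A w) * iexp (X w + a * w t) \<partial>\<mu>) = 0" by simp
    moreover have "f w * of_real (cylinder J A w) * iexp (X w + a * w t) = g w * iexp (a * w t)" for w
      by (simp add: g_def exp_add[symmetric] distrib_left mult.assoc)
    ultimately show ?thesis by simp
  qed
  from fourier_zero[OF gi coordinate_measurable this, of "A t"] insert.prems(1)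
  have "(\<integral>w. g w * indicator (A t) (w t) \<partial>\<mu>) = 0" by simp
  moreover have "f w * of_real (cylinder (insert t J) A w) * iexp (X w) = g w * indicator (A t) (w t)" for w
    using insert.hyps by (cases "w t \<in> A t") (simp_all add: g_def cylinder_def)
  ultimately show ?case by simp
qed

text \<open>The two parts of \<open>v\<close> are densities of finite measures that agree on
  cylinder sets; these determine the measure, and equal measures have a.e. equal densities.\<close>

lemma AE_zero_if_cylinder_zero:
  fixes v :: "(real \<Rightarrow> real) \<Rightarrow> real"
  assumes v: "integrable \<mu> v"
    and z: "\<And>J A. finite J \<Longrightarrow> (\<And>t. t \<in> J \<Longrightarrow> A t \<in> sets borel) \<Longrightarrow> (\<integral>w. v w * cylinder J A w \<partial>\<mu>) = 0"
  shows "AE w in \<mu>. v w = 0"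
proof -
  define \<Omega> where "\<Omega> = (\<Pi>\<^sub>M t\<in>(UNIV :: real set). (borel :: real measure))"
  define up where "up w = max 0 (v w)" for w
  define un where "un w = max 0 (- v w)" for w
  have upi: "integrable \<mu> up" and uni: "integrable \<mu> un"
    unfolding up_def[abs_def] un_def[abs_def] using v by simp_all
  have v_eq: "v w = up w - un w" for w by (simp add: up_def un_def max_def)
  have nn: "0 \<le> up w" "0 \<le> un w" for w by (simp_all add: up_def un_def)
  have setsm: "sets \<mu> = sets (restrict_space \<Omega> C0_paths)" unfolding \<Omega>_def using sets_mu by (simp add: path_space_def)
  have spO: "space \<Omega> = UNIV" by (simp add: \<Omega>_def space_PiM)
  have id: "(\<lambda>w. w) \<in> measurable \<mu> \<Omega>"
  proof -
    have "(\<lambda>w. w) \<in> measurable (restrict_space \<Omega> C0_paths) \<Omega>" by (intro measurable_restrict_space1 measurable_ident_sets refl)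
    then show ?thesis using measurable_cong_sets[OF setsm refl] by blast
  qed
  \<comment> \<open>The measures are moved to the full product space, where agreement on cylinders
    can be exploited; the measurable sets of \<mu> are the traces on
    \<open>C0_paths\<close>.\<close>
  define N where "N f = distr (density \<mu> (\<lambda>w. ennreal (f w))) \<Omega> (\<lambda>w. w)" for f
  have idd: "(\<lambda>w. w) \<in> measurable (density \<mu> (\<lambda>w. ennreal (f w))) \<Omega>" for f using id by simp
  have N: "emeasure (N f) B = emeasure (density \<mu> (\<lambda>w. ennreal (f w))) (B \<inter> C0_paths)" if "B \<in> sets \<Omega>" for f B
    unfolding N_def using that by (subst emeasure_distr[OF idd]) (simp_all add: space_mu)
  have "N up = N un"
  proof (rule measure_eqI_PiM_infinite)
    show "sets (N up) = sets (\<Pi>\<^sub>M t\<in>(UNIV :: real set). borel)" "sets (N un) = sets (\<Pi>\<^sub>M t\<in>(UNIV :: real set). borel)"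
      by (simp_all add: N_def \<Omega>_def)
    show "finite_measure (N up)"
    proof
      have "emeasure (N up) (space (N up)) = emeasure (density \<mu> (\<lambda>w. ennreal (up w))) C0_paths"
        using N[of UNIV up] spO by (simp add: N_def) (metis sets.top spO)
      also have "\<dots> = (\<integral>\<^sup>+w. ennreal (up w) \<partial>\<mu>)"
        using upi sets.top[of \<mu>] by (subst emeasure_density) (auto intro!: nn_integral_cong simp: space_mu)
      also have "\<dots> = ennreal (\<integral>w. up w \<partial>\<mu>)" using upi nn by (intro nn_integral_eq_integral) auto
      finally show "emeasure (N up) (space (N up)) \<noteq> \<infinity>" by simp
    qed
    fix A :: "real \<Rightarrow> real set" and J :: "real set"
    assume J: "finite J" "\<And>i. i \<in> J \<Longrightarrow> A i \<in> sets borel"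
    define B where "B = prod_emb UNIV (\<lambda>_. borel :: real measure) J (Pi\<^sub>E J A)"
    have Bs: "B \<in> sets \<Omega>" unfolding B_def \<Omega>_def using J by (intro sets_PiM_I) auto
    have BC: "B \<inter> C0_paths \<in> sets \<mu>"
      using Bs unfolding setsm sets_restrict_space by (auto simp: Int_commute)
    have ind: "indicator B w = cylinder J A w" for w
    proof -
      have "w \<in> B \<longleftrightarrow> (\<forall>t\<in>J. w t \<in> A t)"
        by (auto simp: B_def prod_emb_iff PiE_iff extensional_def)
      then show ?thesis
        using J(1) by (cases "w \<in> B") (auto simp: cylinder_def indicator_def)
    qed
    have e: "emeasure (N f) B = ennreal (\<integral>w. f w * cylinder J A w \<partial>\<mu>)"
      if f: "integrable \<mu> f" and fn: "\<And>w. 0 \<le> f w" for f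
    proof -
      have "emeasure (N f) B = (\<integral>\<^sup>+w. ennreal (f w) * indicator (B \<inter> C0_paths) w \<partial>\<mu>)"
        unfolding N[OF Bs] using f BC by (intro emeasure_density) auto
      also have "\<dots> = (\<integral>\<^sup>+w. ennreal (f w * cylinder J A w) \<partial>\<mu>)"
      proof (rule nn_integral_cong)
        fix w assume "w \<in> space \<mu>"
        then have "indicator (B \<inter> C0_paths) w = (indicator B w :: ennreal)" by (simp add: space_mu indicator_def)
        moreover have "ennreal (f w) * indicator B w = ennreal (f w * indicator B w)" by (simp add: indicator_def)
        ultimately show "ennreal (f w) * indicator (B \<inter> C0_paths) w = ennreal (f w * cylinder J A w)" by (simp only: ind)
      qed
      also have "\<dots> = ennreal (\<integral>w. f w * cylinder J A w \<partial>\<mu>)"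
      proof (rule nn_integral_eq_integral)
        show "integrable \<mu> (\<lambda>w. f w * cylinder J A w)" using integrable_cylinder[OF f J(2)] by simp
        show "AE w in \<mu>. 0 \<le> f w * cylinder J A w" using fn by (simp add: ind[symmetric] indicator_def)
      qed
      finally show ?thesis .
    qed
    have "(\<integral>w. v w * cylinder J A w \<partial>\<mu>) = (\<integral>w. up w * cylinder J A w - un w * cylinder J A w \<partial>\<mu>)"
      unfolding v_eq left_diff_distrib ..
    also have "\<dots> = (\<integral>w. up w * cylinder J A w \<partial>\<mu>) - (\<integral>w. un w * cylinder J A w \<partial>\<mu>)"
      using integrable_cylinder[OF upi J(2)] integrable_cylinder[OF uni J(2)] by (intro Bochner_Integration.integral_diff) simp_all
    finally have "(\<integral>w. up w * cylinder J A w \<partial>\<mu>) = (\<integral>w. un w * cylinder J A w \<partial>\<mu>)" using z[OF J] by simp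
    then have "emeasure (N up) B = emeasure (N un) B" by (simp only: e[OF upi nn(1)] e[OF uni nn(2)])
    then show "emeasure (N up) (prod_emb UNIV (\<lambda>_. borel) J (Pi\<^sub>E J A)) = emeasure (N un) (prod_emb UNIV (\<lambda>_. borel) J (Pi\<^sub>E J A))"
      by (simp only: B_def)
  qed
  have "density \<mu> (\<lambda>w. ennreal (up w)) = density \<mu> (\<lambda>w. ennreal (un w))"
  proof (rule measure_eqI)
    fix S assume "S \<in> sets (density \<mu> (\<lambda>w. ennreal (up w)))"
    then have "S \<in> sets (restrict_space \<Omega> C0_paths)" using setsm by simp
    then obtain B where B: "B \<in> sets \<Omega>" "S = C0_paths \<inter> B" unfolding sets_restrict_space by (elim imageE)
    then have S: "S = B \<inter> C0_paths" by blast
    show "emeasure (density \<mu> (\<lambda>w. ennreal (up w))) S = emeasure (density \<mu> (\<lambda>w. ennreal (un w))) S"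
      unfolding S N[OF B(1), symmetric] \<open>N up = N un\<close> ..
  qed simp
  then have "AE w in \<mu>. ennreal (up w) = ennreal (un w)"
    using upi uni by (subst (asm) density_unique_iff) auto
  then show ?thesis
  proof eventually_elim
    case (elim w)
    then have "up w = un w" using nn by simp
    then show ?case by (simp add: v_eq)
  qed
qed

text \<open>With the zero Wiener integral as \<open>X\<close>, the cylinder statement loses its
  exponential factor; real and imaginary parts are then separated.\<close>

lemma AE_zero_if_wdelta_exp_zero:
  fixes f :: "(real \<Rightarrow> real) \<Rightarrow> complex"
  assumes f: "integrable \<mu> f" and z: "\<And>h X. wdelta h X \<Longrightarrow> (\<integral>w. f w * iexp (X w) \<partial>\<mu>) = 0"
  shows "AE w in \<mu>. f w = 0"
proof -
  have c: "(\<integral>w. f w * of_real (cylinder J A w) \<partial>\<mu>) = 0"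
    if "finite J" "\<And>t. t \<in> J \<Longrightarrow> A t \<in> sets borel" for J A
    using integral_cylinder_zero[OF f z that wdelta_zero] by simp
  have "AE w in \<mu>. Re (f w) = 0"
  proof (rule AE_zero_if_cylinder_zero)
    show "integrable \<mu> (\<lambda>w. Re (f w))" using f by simp
    fix J and A :: "real \<Rightarrow> real set" assume J: "finite J" "\<And>t. t \<in> J \<Longrightarrow> A t \<in> sets borel"
    have "(\<integral>w. Re (f w * of_real (cylinder J A w)) \<partial>\<mu>) = 0"
      using integral_Re[OF integrable_cylinder[OF f J(2)]] c[OF J] by simp
    then show "(\<integral>w. Re (f w) * cylinder J A w \<partial>\<mu>) = 0" by simp
  qed
  moreover have "AE w in \<mu>. Im (f w) = 0"
  proof (rule AE_zero_if_cylinder_zero)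
    show "integrable \<mu> (\<lambda>w. Im (f w))" using f by simp
    fix J and A :: "real \<Rightarrow> real set" assume J: "finite J" "\<And>t. t \<in> J \<Longrightarrow> A t \<in> sets borel"
    have "(\<integral>w. Im (f w * of_real (cylinder J A w)) \<partial>\<mu>) = 0"
      using integral_Im[OF integrable_cylinder[OF f J(2)]] c[OF J] by simp
    then show "(\<integral>w. Im (f w) * cylinder J A w \<partial>\<mu>) = 0" by simp
  qed
  ultimately show ?thesis by eventually_elim (simp add: complex_eq_iff)
qed

end

lemma measure_preserving_funpow:
  assumes T: "measure_preserving_map M T"
  shows "measure_preserving_map M (T ^^ n)"
proof (induction n)
  case 0
  have "distr M M (\<lambda>x. x) = M" by (rule distr_id)
  then show ?case by (simp add: measure_preserving_map_def id_def)
next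
  case (Suc n)
  then have Tn: "T ^^ n \<in> measurable M M" "distr M M (T ^^ n) = M" by (simp_all add: measure_preserving_map_def)
  have T1: "T \<in> measurable M M" "distr M M T = M" using T by (simp_all add: measure_preserving_map_def)
  have "distr (distr M M (T ^^ n)) M T = distr M M (T \<circ> T ^^ n)" by (rule distr_distr[OF T1(1) Tn(1)])
  then have "distr M M (T \<circ> T ^^ n) = M" using Tn(2) T1(2) by simp
  then show ?case using measurable_comp[OF Tn(1) T1(1)] by (simp add: measure_preserving_map_def comp_def)
qed

text \<open>Makes the covariance of exponentials linear in the covariance of the Gaussian variables,
  since the latter are bounded.\<close>

lemma abs_exp_minus_one_le: "\<bar>exp x - 1\<bar> \<le> \<bar>x\<bar> * exp \<bar>x\<bar>" for x :: real
proof (cases "0 \<le> x")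
  case True
  have "1 - x \<le> exp (- x)" using exp_ge_add_one_self[of "- x"] by simp
  then have "(1 - x) * exp x \<le> exp (- x) * exp x" by (rule mult_right_mono) simp
  moreover have "exp (- x) * exp x = 1" by (simp add: exp_minus)
  ultimately have "exp x - 1 \<le> x * exp x" by (simp add: left_diff_distrib)
  then show ?thesis using True by simp
next
  case False
  then have "\<bar>exp x - 1\<bar> = 1 - exp x" by simp
  also have "\<dots> \<le> \<bar>x\<bar> * 1" using exp_ge_add_one_self[of x] False by linarith
  also have "\<dots> \<le> \<bar>x\<bar> * exp \<bar>x\<bar>" by (intro mult_left_mono) auto
  finally show ?thesis .
qed

section \<open>Eigenfunctions of the rotation\<close>

context wiener_rotation
begin

text \<open>The difference of two translates is the Wiener integral of
  \<open>R\<^sup>n h - R\<^sup>m h\<close>, whose squared norm is twice that of \<open>h\<close>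
  minus twice the inner product; the Gaussian characteristic function then factors as
  stated.\<close>

lemma exp_covariance:
  assumes X: "wdelta h X"
  defines "\<kappa> \<equiv> exp (- ((cm_norm h)\<^sup>2) / 2)"
  shows "(\<integral>w. (iexp (X ((T ^^ n) w)) - complex_of_real \<kappa>) * cnj (iexp (X ((T ^^ m) w)) - complex_of_real \<kappa>) \<partial>\<mu>)
      = complex_of_real (\<kappa>\<^sup>2 * (exp (cm_inner ((R ^^ n) h) ((R ^^ m) h)) - 1))"
proof -
  note h = wdelta_CM[OF X]
  define e where "e n w = iexp (X ((T ^^ n) w))" for n w
  have W: "wdelta ((R ^^ n) h) (\<lambda>w. X ((T ^^ n) w))" for n by (rule wdelta_compose_T_funpow[OF X])
  note Rn = wdelta_CM[OF W]
  have Wm: "(\<lambda>w. X ((T ^^ n) w)) \<in> borel_measurable \<mu>" for n using wdelta_sq_int[OF W] by (simp add: sq_int_def)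
  have em: "e n \<in> borel_measurable \<mu>" for n
    using measurable_compose[OF Wm cis_measurable[of 1]] by (simp add: e_def[abs_def] cis_conv_exp)
  have bi: "integrable \<mu> g" if "g \<in> borel_measurable \<mu>" "\<And>w. cmod (g w) \<le> 1" for g
    by (rule integrable_const_bound[of _ 1]) (use that in auto)
  have ei: "integrable \<mu> (e n)" for n by (rule bi[OF em]) (simp add: e_def)
  have ci: "integrable \<mu> (\<lambda>w. cnj (e m w))" for m using ei by simp
  have eei: "integrable \<mu> (\<lambda>w. e n w * cnj (e m w))"
  proof (rule bi)
    show "(\<lambda>w. e n w * cnj (e m w)) \<in> borel_measurable \<mu>"
      using borel_measurable_integrable[OF ci[of m]] em[of n] by (intro borel_measurable_times)
  qed (simp add: norm_mult e_def)
  have eint: "(\<integral>w. e n w \<partial>\<mu>) = complex_of_real \<kappa>" for n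
    using wdelta_char[OF W[of n]] by (simp add: e_def \<kappa>_def unitary_CM_funpow_norm[OF R h])
  have "(\<integral>w. e n w * cnj (e m w) \<partial>\<mu>) = (\<integral>w. iexp (X ((T ^^ n) w) - X ((T ^^ m) w)) \<partial>\<mu>)"
    by (intro Bochner_Integration.integral_cong refl)
      (simp add: e_def exp_cnj exp_add[symmetric] right_diff_distrib)
  also have "\<dots> = exp (- ((cm_norm (\<lambda>t. (R ^^ n) h t - (R ^^ m) h t))\<^sup>2) / 2)"
    by (rule wdelta_char[OF wdelta_diff[OF W W]])
  also have "(cm_norm (\<lambda>t. (R ^^ n) h t - (R ^^ m) h t))\<^sup>2 = 2 * (cm_norm h)\<^sup>2 - 2 * cm_inner ((R ^^ n) h) ((R ^^ m) h)"
  proof -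
    have "cm_inner ((R ^^ k) h) ((R ^^ k) h) = cm_inner h h" for k by (rule unitary_CM_funpow_inner[OF R h h])
    then show ?thesis
      unfolding cm_norm_sq
      by (simp add: cm_inner_diff_left[OF Rn Rn CM_diff[OF Rn Rn]] cm_inner_diff_right[OF Rn Rn Rn]
          cm_inner_commute[of "(R ^^ m) h" "(R ^^ n) h"])
  qed
  also have "exp (- (2 * (cm_norm h)\<^sup>2 - 2 * cm_inner ((R ^^ n) h) ((R ^^ m) h)) / 2)
      = \<kappa>\<^sup>2 * exp (cm_inner ((R ^^ n) h) ((R ^^ m) h))"
    by (simp add: \<kappa>_def power2_eq_square exp_add[symmetric] field_simps)
  finally have ee: "(\<integral>w. e n w * cnj (e m w) \<partial>\<mu>) = complex_of_real (\<kappa>\<^sup>2 * exp (cm_inner ((R ^^ n) h) ((R ^^ m) h)))" .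
  have "(\<integral>w. (e n w - complex_of_real \<kappa>) * cnj (e m w - complex_of_real \<kappa>) \<partial>\<mu>)
      = (\<integral>w. e n w * cnj (e m w) - complex_of_real \<kappa> * e n w - complex_of_real \<kappa> * cnj (e m w) + complex_of_real (\<kappa>\<^sup>2) \<partial>\<mu>)"
    by (intro Bochner_Integration.integral_cong refl) (simp add: algebra_simps power2_eq_square)
  also have "\<dots> = complex_of_real (\<kappa>\<^sup>2 * exp (cm_inner ((R ^^ n) h) ((R ^^ m) h))) - complex_of_real \<kappa> * complex_of_real \<kappa>
      - complex_of_real \<kappa> * complex_of_real \<kappa> + complex_of_real (\<kappa>\<^sup>2)"
    using ei ci eei by (simp add: ee eint prob_space)
  also have "\<dots> = complex_of_real (\<kappa>\<^sup>2 * (exp (cm_inner ((R ^^ n) h) ((R ^^ m) h)) - 1))"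
    by (simp add: power2_eq_square algebra_simps)
  finally show ?thesis by (simp only: e_def)
qed

lemma cm_inner_funpow_le: "h \<in> CM \<Longrightarrow> \<bar>cm_inner ((R ^^ n) h) ((R ^^ m) h)\<bar> \<le> (cm_norm h)\<^sup>2"
  using cm_Cauchy_Schwarz[OF unitary_CM_funpow[OF R] unitary_CM_funpow[OF R], of h h n m]
  by (simp add: unitary_CM_funpow_norm[OF R] power2_eq_square)

text \<open>
  An eigenfunction \<open>f\<close> with mean zero has \<open>\<integral> f \<cdot> \<Sum>\<^sub>n\<^sub><\<^sub>N c\<^sup>n (e\<^sub>n - \<kappa>) = N \<integral> f \<cdot> e\<^sub>0\<close>, where \<open>e\<^sub>n\<close> is the
  \<open>n\<close>-th translate of \<open>exp (i \<delta>h)\<close> and \<open>\<kappa>\<close> is its mean, while the norm of the sum is \<open>o(N)\<close>.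
\<close>

lemma eigenfunction_orthogonal:
  fixes f :: "(real \<Rightarrow> real) \<Rightarrow> complex"
  assumes fm: "f \<in> borel_measurable \<mu>" and f2: "integrable \<mu> (\<lambda>w. (cmod (f w))\<^sup>2)"
    and f0: "(\<integral>w. f w \<partial>\<mu>) = 0" and c: "cmod c = 1" and eig: "AE w in \<mu>. f (T w) = c * f w"
    and X: "wdelta h X"
    and mix: "(\<lambda>N. (\<Sum>n<N. \<Sum>m<N. \<bar>cm_inner ((R ^^ n) h) ((R ^^ m) h)\<bar>) / (real N)\<^sup>2) \<longlonglongrightarrow> 0"
  shows "(\<integral>w. f w * iexp (X w) \<partial>\<mu>) = 0"
proof -
  note h = wdelta_CM[OF X]
  define \<kappa> where "\<kappa> = exp (- ((cm_norm h)\<^sup>2) / 2)"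
  define e where "e n w = iexp (X ((T ^^ n) w))" for n w
  define b where "b = (\<integral>w. f w * iexp (X w) \<partial>\<mu>)"
  have sF: "sq_int \<mu> (\<lambda>w. cmod (f w))" using fm f2 by (simp add: sq_int_def)
  have fi: "integrable \<mu> f"
    using L1_le_L2(2)[OF sF] fm by (simp add: integrable_norm_iff)
  have W: "wdelta ((R ^^ n) h) (\<lambda>w. X ((T ^^ n) w))" for n by (rule wdelta_compose_T_funpow[OF X])
  have Wm: "(\<lambda>w. X ((T ^^ n) w)) \<in> borel_measurable \<mu>" for n using wdelta_sq_int[OF W] by (simp add: sq_int_def)
  have em: "e n \<in> borel_measurable \<mu>" for n
    using measurable_compose[OF Wm cis_measurable[of 1]] by (simp add: e_def[abs_def] cis_conv_exp)
  have Tn: "measure_preserving_map \<mu> (T ^^ n)" for n by (rule measure_preserving_funpow[OF T])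
  have eign: "AE w in \<mu>. f ((T ^^ n) w) = c ^ n * f w" for n
  proof (induction n)
    case (Suc n)
    from measure_preserving_AE[OF T Suc] eig show ?case
      by eventually_elim (simp add: funpow_swap1)
  qed simp
  have fei: "integrable \<mu> (\<lambda>w. f w * e n w)" for n
  proof (rule Bochner_Integration.integrable_bound[OF fi])
    show "(\<lambda>w. f w * e n w) \<in> borel_measurable \<mu>" by (intro borel_measurable_times fm em)
    show "AE w in \<mu>. norm (f w * e n w) \<le> norm (f w)" by (simp add: norm_mult e_def)
  qed
  \<comment> \<open>Invariance of \<mu> under \<open>T ^^ n\<close>, with the eigenvalue equation
    applied to \<open>f\<close> and the translation absorbed into \<open>e n\<close>.\<close>
  have trans: "c ^ n * (\<integral>w. f w * e n w \<partial>\<mu>) = b" for n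
  proof -
    have m0: "(\<lambda>w. f w * e 0 w) \<in> borel_measurable \<mu>" by (intro borel_measurable_times fm em)
    have "b = (\<integral>w. f w * e 0 w \<partial>\<mu>)" by (simp add: b_def e_def)
    also have "\<dots> = (\<integral>w. f ((T ^^ n) w) * e 0 ((T ^^ n) w) \<partial>\<mu>)"
      by (rule measure_preserving_integral(2)[OF Tn m0, symmetric])
    also have "\<dots> = (\<integral>w. c ^ n * (f w * e n w) \<partial>\<mu>)"
    proof (rule integral_cong_AE)
      show "(\<lambda>w. f ((T ^^ n) w) * e 0 ((T ^^ n) w)) \<in> borel_measurable \<mu>"
        by (rule measure_preserving_integral(1)[OF Tn m0])
      show "(\<lambda>w. c ^ n * (f w * e n w)) \<in> borel_measurable \<mu>" by (intro borel_measurable_times borel_measurable_const fm em)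
      show "AE w in \<mu>. f ((T ^^ n) w) * e 0 ((T ^^ n) w) = c ^ n * (f w * e n w)"
        using eign[of n] by eventually_elim (simp add: e_def)
    qed
    also have "\<dots> = c ^ n * (\<integral>w. f w * e n w \<partial>\<mu>)" by (rule integral_mult_right_zero)
    finally show ?thesis by simp
  qed
  define G where "G N w = (\<Sum>n<N. c ^ n * (e n w - complex_of_real \<kappa>))" for N w
  have Gm: "G N \<in> borel_measurable \<mu>" for N
    unfolding G_def[abs_def] by (intro borel_measurable_sum borel_measurable_times borel_measurable_diff borel_measurable_const em)
  have fG: "(\<integral>w. f w * G N w \<partial>\<mu>) = of_nat N * b" for N
  proof -
    have "(\<integral>w. f w * G N w \<partial>\<mu>) = (\<integral>w. (\<Sum>n<N. c ^ n * (f w * e n w) - c ^ n * complex_of_real \<kappa> * f w) \<partial>\<mu>)"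
      by (intro Bochner_Integration.integral_cong refl) (simp add: G_def sum_distrib_left algebra_simps)
    also have "\<dots> = (\<Sum>n<N. c ^ n * (\<integral>w. f w * e n w \<partial>\<mu>) - c ^ n * complex_of_real \<kappa> * (\<integral>w. f w \<partial>\<mu>))"
      using fei fi by simp
    also have "\<dots> = of_nat N * b" by (simp add: trans f0)
    finally show ?thesis .
  qed
  have Gb: "cmod (G N w) \<le> real N * (1 + \<bar>\<kappa>\<bar>)" for N w
  proof -
    have "cmod (G N w) \<le> (\<Sum>n<N. cmod (c ^ n * (e n w - complex_of_real \<kappa>)))" unfolding G_def by (rule norm_sum)
    also have "\<dots> \<le> (\<Sum>n<N. 1 + \<bar>\<kappa>\<bar>)"
    proof (rule sum_mono)
      fix n
      have "cmod (c ^ n * (e n w - complex_of_real \<kappa>)) = cmod (e n w - complex_of_real \<kappa>)" by (simp add: norm_mult norm_power c)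
      also have "\<dots> \<le> cmod (e n w) + cmod (complex_of_real \<kappa>)" by (rule norm_triangle_ineq4)
      finally show "cmod (c ^ n * (e n w - complex_of_real \<kappa>)) \<le> 1 + \<bar>\<kappa>\<bar>" by (simp add: e_def)
    qed
    finally show ?thesis by simp
  qed
  have sG: "sq_int \<mu> (\<lambda>w. cmod (G N w))" for N
    unfolding sq_int_def
  proof
    show m: "(\<lambda>w. cmod (G N w)) \<in> borel_measurable \<mu>" using Gm by simp
    show "integrable \<mu> (\<lambda>w. (cmod (G N w))\<^sup>2)"
    proof (rule integrable_const_bound[of _ "(real N * (1 + \<bar>\<kappa>\<bar>))\<^sup>2"])
      show "AE w in \<mu>. norm ((cmod (G N w))\<^sup>2) \<le> (real N * (1 + \<bar>\<kappa>\<bar>))\<^sup>2"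
        using power_mono[OF Gb] by simp
    qed (use m in simp)
  qed
  \<comment> \<open>Bounds \<open>exp \<bar>r\<bar>\<close> for all covariances \<open>r\<close> of
    the orbit, which are at most the squared norm of \<open>h\<close>.\<close>
  define C where "C = exp ((cm_norm h)\<^sup>2)"
  define S where "S N = (\<Sum>n<N. \<Sum>m<N. \<bar>cm_inner ((R ^^ n) h) ((R ^^ m) h)\<bar>)" for N
  have G2: "(L2_norm \<mu> (\<lambda>w. cmod (G N w)))\<^sup>2 \<le> C * S N" for N
  proof -
    let ?E = "\<lambda>n w. e n w - complex_of_real \<kappa>"
    have EEi: "integrable \<mu> (\<lambda>w. ?E n w * cnj (?E m w))" for n m
    proof (rule integrable_const_bound[of _ "(1 + \<bar>\<kappa>\<bar>) * (1 + \<bar>\<kappa>\<bar>)"])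
      have "cmod (?E n w) \<le> 1 + \<bar>\<kappa>\<bar>" for n w
        using norm_triangle_ineq4[of "e n w" "complex_of_real \<kappa>"] by (simp add: e_def)
      then show "AE w in \<mu>. norm (?E n w * cnj (?E m w)) \<le> (1 + \<bar>\<kappa>\<bar>) * (1 + \<bar>\<kappa>\<bar>)"
        unfolding norm_mult complex_mod_cnj by (intro AE_I2 mult_mono) auto
      have "cnj \<in> borel_measurable borel"
        by (intro borel_measurable_continuous_onI continuous_on_cnj continuous_on_id)
      then have "(\<lambda>w. cnj (?E m w)) \<in> borel_measurable \<mu>"
        using em[of m] by (intro measurable_compose[of "?E m" \<mu> borel cnj] borel_measurable_diff borel_measurable_const)
      then show "(\<lambda>w. ?E n w * cnj (?E m w)) \<in> borel_measurable \<mu>"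
        using em[of n] by (intro borel_measurable_times borel_measurable_diff borel_measurable_const)
    qed
    have "complex_of_real (\<integral>w. (cmod (G N w))\<^sup>2 \<partial>\<mu>) = (\<integral>w. G N w * cnj (G N w) \<partial>\<mu>)"
      unfolding integral_complex_of_real[symmetric] by (simp only: complex_norm_square)
    also have "\<dots> = (\<integral>w. (\<Sum>n<N. \<Sum>m<N. c ^ n * cnj (c ^ m) * (?E n w * cnj (?E m w))) \<partial>\<mu>)"
      by (intro Bochner_Integration.integral_cong refl)
        (simp only: G_def cnj_sum sum_product complex_cnj_mult mult_ac)
    also have "\<dots> = (\<Sum>n<N. \<Sum>m<N. c ^ n * cnj (c ^ m) * (\<integral>w. ?E n w * cnj (?E m w) \<partial>\<mu>))"
      using EEi by (simp del: complex_cnj_diff complex_cnj_power)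
    finally have "\<bar>\<integral>w. (cmod (G N w))\<^sup>2 \<partial>\<mu>\<bar> = cmod (\<Sum>n<N. \<Sum>m<N. c ^ n * cnj (c ^ m) * (\<integral>w. ?E n w * cnj (?E m w) \<partial>\<mu>))"
      by (metis norm_of_real)
    also have "\<dots> \<le> (\<Sum>n<N. \<Sum>m<N. cmod (c ^ n * cnj (c ^ m) * (\<integral>w. ?E n w * cnj (?E m w) \<partial>\<mu>)))"
      by (intro order_trans[OF norm_sum] sum_mono norm_sum)
    also have "\<dots> \<le> (\<Sum>n<N. \<Sum>m<N. C * \<bar>cm_inner ((R ^^ n) h) ((R ^^ m) h)\<bar>)"
    proof (intro sum_mono)
      fix n m
      define r where "r = cm_inner ((R ^^ n) h) ((R ^^ m) h)"
      have "cmod (c ^ n * cnj (c ^ m) * (\<integral>w. ?E n w * cnj (?E m w) \<partial>\<mu>)) = \<bar>\<kappa>\<^sup>2 * (exp r - 1)\<bar>"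
        using exp_covariance[OF X, of n m]
        by (simp only: e_def \<kappa>_def r_def norm_mult norm_power c complex_mod_cnj power_one mult_1 norm_of_real)
      also have "\<dots> \<le> 1 * (\<bar>r\<bar> * exp \<bar>r\<bar>)"
      proof -
        have "\<kappa>\<^sup>2 \<le> 1" unfolding \<kappa>_def by (intro power_le_one) auto
        then show ?thesis unfolding abs_mult by (intro mult_mono abs_exp_minus_one_le) auto
      qed
      also have "\<dots> \<le> C * \<bar>r\<bar>"
        using mult_left_mono[of "exp \<bar>r\<bar>" C "\<bar>r\<bar>"] cm_inner_funpow_le[OF h, of n m]
        by (simp add: C_def r_def mult.commute)
      finally show "cmod (c ^ n * cnj (c ^ m) * (\<integral>w. ?E n w * cnj (?E m w) \<partial>\<mu>)) \<le> C * \<bar>cm_inner ((R ^^ n) h) ((R ^^ m) h)\<bar>"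
        by (simp only: r_def)
    qed
    also have "\<dots> = C * S N" by (simp add: S_def sum_distrib_left)
    finally show ?thesis by (simp add: L2_norm_sq)
  qed
  define F where "F = L2_norm \<mu> (\<lambda>w. cmod (f w))"
  \<comment> \<open>Cauchy-Schwarz for \<open>f\<close> and \<open>G N\<close>: the left side grows
    like \<open>N\<close>, the norm of \<open>G N\<close> only like the root of \<open>S N\<close>,
    which is \<open>o(N)\<close>.\<close>
  have main: "(cmod b)\<^sup>2 \<le> F\<^sup>2 * C * (S N / (real N)\<^sup>2)" if N: "0 < N" for N
  proof -
    have "cmod (of_nat N * b) \<le> (\<integral>w. cmod (f w * G N w) \<partial>\<mu>)"
      unfolding fG[symmetric] by (rule integral_norm_bound)
    also have "\<dots> = (\<integral>w. cmod (f w) * cmod (G N w) \<partial>\<mu>)" by (simp add: norm_mult)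
    also have "\<dots> \<le> F * L2_norm \<mu> (\<lambda>w. cmod (G N w))"
      using L2_Cauchy_Schwarz[OF sF sG[of N]] unfolding F_def by linarith
    finally have "real N * cmod b \<le> F * L2_norm \<mu> (\<lambda>w. cmod (G N w))" by (simp add: norm_mult)
    then have "(real N * cmod b)\<^sup>2 \<le> (F * L2_norm \<mu> (\<lambda>w. cmod (G N w)))\<^sup>2" by (intro power_mono) auto
    also have "\<dots> \<le> F\<^sup>2 * (C * S N)" unfolding power_mult_distrib by (intro mult_left_mono G2) auto
    finally have "(real N)\<^sup>2 * (cmod b)\<^sup>2 \<le> F\<^sup>2 * C * S N" by (simp add: power_mult_distrib mult.assoc)
    then show ?thesis using N by (simp add: field_simps)
  qed
  have "(\<lambda>N. F\<^sup>2 * C * (S N / (real N)\<^sup>2)) \<longlonglongrightarrow> 0"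
    using mix unfolding S_def by (rule tendsto_mult_right_zero)
  then have "(cmod b)\<^sup>2 \<le> 0"
    by (rule LIMSEQ_le_const) (use main in \<open>auto intro!: exI[of _ 1]\<close>)
  then show ?thesis by (simp add: b_def)
qed

text \<open>Invariance of the norm gives an eigenvalue of modulus 1 unless \<open>f\<close>
  vanishes. Subtracting the mean leaves an eigenfunction of mean zero, orthogonal to all
  exponentials and therefore zero.\<close>

lemma weak_mixing_if_decorrelated:
  assumes mix: "\<And>h. h \<in> CM \<Longrightarrow>
    (\<lambda>N. (\<Sum>n<N. \<Sum>m<N. \<bar>cm_inner ((R ^^ n) h) ((R ^^ m) h)\<bar>) / (real N)\<^sup>2) \<longlonglongrightarrow> 0"
  shows "weak_mixing_map \<mu> T"
  unfolding weak_mixing_map_def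
proof (intro allI impI, elim conjE)
  fix f :: "(real \<Rightarrow> real) \<Rightarrow> complex" and c
  assume fm: "f \<in> borel_measurable \<mu>" and f2: "integrable \<mu> (\<lambda>w. (cmod (f w))\<^sup>2)"
    and eig: "AE w in \<mu>. f (T w) = c * f w"
  have sF: "sq_int \<mu> (\<lambda>w. cmod (f w))" using fm f2 by (simp add: sq_int_def)
  have fi: "integrable \<mu> f"
    using L1_le_L2(2)[OF sF] fm by (simp add: integrable_norm_iff)
  have f2m: "(\<lambda>w. (cmod (f w))\<^sup>2) \<in> borel_measurable \<mu>" using f2 by simp
  define q where "q = (\<integral>w. (cmod (f w))\<^sup>2 \<partial>\<mu>)"
  have "q = (\<integral>w. (cmod (f (T w)))\<^sup>2 \<partial>\<mu>)"
    unfolding q_def by (rule measure_preserving_integral(2)[OF T f2m, symmetric])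
  also have "\<dots> = (\<integral>w. (cmod c)\<^sup>2 * (cmod (f w))\<^sup>2 \<partial>\<mu>)"
  proof (rule integral_cong_AE)
    show "(\<lambda>w. (cmod (f (T w)))\<^sup>2) \<in> borel_measurable \<mu>" by (rule measure_preserving_integral(1)[OF T f2m])
    show "AE w in \<mu>. (cmod (f (T w)))\<^sup>2 = (cmod c)\<^sup>2 * (cmod (f w))\<^sup>2"
      using eig by eventually_elim (simp add: norm_mult power_mult_distrib)
  qed (use f2m in simp)
  finally have q: "q = (cmod c)\<^sup>2 * q" by (simp add: q_def)
  show "\<exists>d. AE w in \<mu>. f w = d"
  proof (cases "q = 0")
    case True
    then have "AE w in \<mu>. (cmod (f w))\<^sup>2 = 0"
      using integral_nonneg_eq_0_iff_AE[OF f2] by (simp add: q_def)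
    then show ?thesis by (intro exI[of _ 0]) simp
  next
    case False
    then have "(cmod c)\<^sup>2 = 1" using q by simp
    then have c: "cmod c = 1" by (simp add: power2_eq_1_iff) (metis norm_ge_zero not_one_le_zero neg_0_le_iff_le order_trans zero_le_one)
    define m where "m = (\<integral>w. f w \<partial>\<mu>)"
    have "m = (\<integral>w. f (T w) \<partial>\<mu>)" unfolding m_def by (rule measure_preserving_integral(2)[OF T fm, symmetric])
    also have "\<dots> = (\<integral>w. c * f w \<partial>\<mu>)"
      by (rule integral_cong_AE[OF measure_preserving_integral(1)[OF T fm] _ eig]) (use fm in simp)
    \<comment> \<open>Covers both cases, \<open>c = 1\<close> and mean zero: in either, subtracting
      \<open>m\<close> respects the eigenvalue equation.\<close>
    finally have m: "m = c * m" by (simp add: m_def)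
    define g where "g w = f w - m" for w
    have gm: "g \<in> borel_measurable \<mu>" unfolding g_def[abs_def] using fm by simp
    have g2: "integrable \<mu> (\<lambda>w. (cmod (g w))\<^sup>2)"
    proof -
      have "integrable \<mu> (\<lambda>w. 2 * (cmod (f w))\<^sup>2 + 2 * (cmod m)\<^sup>2)" using f2 by simp
      then show ?thesis
      proof (rule Bochner_Integration.integrable_bound)
        show "(\<lambda>w. (cmod (g w))\<^sup>2) \<in> borel_measurable \<mu>" using gm by simp
        have "(cmod (g w))\<^sup>2 \<le> 2 * (cmod (f w))\<^sup>2 + 2 * (cmod m)\<^sup>2" for w
        proof -
          have "cmod (g w) \<le> cmod (f w) + cmod m" unfolding g_def by (rule norm_triangle_ineq4)
          then have "(cmod (g w))\<^sup>2 \<le> (cmod (f w) + cmod m)\<^sup>2" by (rule power_mono) simp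
          also have "\<dots> \<le> 2 * (cmod (f w))\<^sup>2 + 2 * (cmod m)\<^sup>2"
            using sum_squares_bound[of "cmod (f w)" "cmod m"] by (simp add: power2_sum)
          finally show ?thesis .
        qed
        then show "AE w in \<mu>. norm ((cmod (g w))\<^sup>2) \<le> norm (2 * (cmod (f w))\<^sup>2 + 2 * (cmod m)\<^sup>2)" by simp
      qed
    qed
    have gi: "integrable \<mu> g" unfolding g_def[abs_def] using fi by simp
    have g0: "(\<integral>w. g w \<partial>\<mu>) = 0" using fi by (simp add: g_def m_def prob_space)
    have ge: "AE w in \<mu>. g (T w) = c * g w"
      using eig
    proof eventually_elim
      case (elim w)
      have "g (T w) = c * f w - c * m" by (simp only: g_def elim m[symmetric])
      then show ?case by (simp add: g_def right_diff_distrib)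
    qed
    have "AE w in \<mu>. g w = 0"
      by (rule AE_zero_if_wdelta_exp_zero[OF gi])
        (rule eigenfunction_orthogonal[OF gm g2 g0 c ge _ mix[OF wdelta_CM]])
    then show ?thesis by (intro exI[of _ m]) (simp add: g_def)
  qed
qed

text \<open>An invariant function may fail to be square-integrable; \<open>arctan\<close> is bounded
  and injective, so it produces an eigenfunction for the eigenvalue 1 from which \<open>F\<close> is
  recovered.\<close>

lemma ergodic_if_weak_mixing:
  assumes wm: "weak_mixing_map \<mu> T"
  shows "ergodic_map \<mu> T"
  unfolding ergodic_map_def
proof (intro allI impI, elim conjE)
  fix F :: "(real \<Rightarrow> real) \<Rightarrow> real"
  assume Fm: "F \<in> borel_measurable \<mu>" and inv: "AE w in \<mu>. F (T w) = F w"
  define f where "f w = complex_of_real (arctan (F w))" for w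
  have am: "(\<lambda>w. arctan (F w)) \<in> borel_measurable \<mu>"
    using Fm by (rule measurable_compose) (intro borel_measurable_continuous_onI continuous_intros)
  then have fm: "f \<in> borel_measurable \<mu>" unfolding f_def[abs_def] by simp
  have "integrable \<mu> (\<lambda>w. (cmod (f w))\<^sup>2)"
  proof (rule integrable_const_bound[of _ "(pi / 2)\<^sup>2"])
    have "\<bar>arctan (F w)\<bar> \<le> pi / 2" for w
      using arctan_bounded[of "F w"] by linarith
    then show "AE w in \<mu>. norm ((cmod (f w))\<^sup>2) \<le> (pi / 2)\<^sup>2"
      by (intro AE_I2) (simp add: f_def abs_le_square_iff[symmetric])
  qed (use fm in simp)
  moreover have "AE w in \<mu>. f (T w) = 1 * f w" using inv by eventually_elim (simp add: f_def)
  ultimately obtain d where d: "AE w in \<mu>. f w = d"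
    using wm fm unfolding weak_mixing_map_def by blast
  have "AE w in \<mu>. F w = tan (Re d)"
    using d
  proof eventually_elim
    case (elim w)
    then have "Re d = arctan (F w)" by (auto simp: f_def)
    then show ?case by (simp add: tan_arctan)
  qed
  then show "\<exists>c. AE w in \<mu>. F w = c" by blast
qed

end

section \<open>Atoms destroy ergodicity\<close>

lemma L2_norm_eq_0_AE:
  assumes f: "sq_int M f" and z: "L2_norm M f = 0"
  shows "AE x in M. f x = 0"
proof -
  have "(\<integral>x. (f x)\<^sup>2 \<partial>M) = 0" using z L2_norm_sq[of M f] by simp
  then have "AE x in M. (f x)\<^sup>2 = 0"
    using f integral_nonneg_eq_0_iff_AE[of M "\<lambda>x. (f x)\<^sup>2"] by (simp add: sq_int_def)
  then show ?thesis by simp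
qed

section \<open>Mean-square limits of Gaussian variables\<close>

context wiener_space
begin

text \<open>Norms and characteristic functions are continuous in mean square, so centred Gaussian
  laws survive the limit. The limit is described by its law rather than by an element of
  \<open>CM\<close>.\<close>

lemma wdelta_limit_char:
  assumes X: "\<And>n. wdelta (h n) (X n)" and Y: "sq_int \<mu> Y"
    and lim: "(\<lambda>n. L2_norm \<mu> (\<lambda>w. X n w - Y w)) \<longlonglongrightarrow> 0"
  shows "(\<integral>w. iexp (t * Y w) \<partial>\<mu>) = exp (- (t\<^sup>2 * (L2_norm \<mu> Y)\<^sup>2) / 2)"
proof -
  note sX = wdelta_sq_int[OF X]
  have nX: "(\<lambda>n. L2_norm \<mu> (X n)) \<longlonglongrightarrow> L2_norm \<mu> Y"
    by (rule Lim_transform_bound[THEN LIM_zero_cancel, OF _ lim]) (auto intro!: always_eventually L2_norm_diff_le sX Y)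
  have ch: "(\<integral>w. iexp (t * X n w) \<partial>\<mu>) = complex_of_real (exp (- (t\<^sup>2 * (L2_norm \<mu> (X n))\<^sup>2) / 2))" for n
    using wdelta_char[OF wdelta_cmult[OF X[of n], of t]]
    unfolding wdelta_norm[OF wdelta_cmult[OF X[of n], of t], symmetric] L2_norm_cmult
    by (simp only: power_mult_distrib power2_abs)
  have "(\<lambda>n. complex_of_real (exp (- (t\<^sup>2 * (L2_norm \<mu> (X n))\<^sup>2) / 2)))
      \<longlonglongrightarrow> complex_of_real (exp (- (t\<^sup>2 * (L2_norm \<mu> Y)\<^sup>2) / 2))"
    by (intro tendsto_intros nX) simp
  moreover have "(\<lambda>n. \<integral>w. iexp (t * X n w) \<partial>\<mu>) \<longlonglongrightarrow> (\<integral>w. iexp (t * Y w) \<partial>\<mu>)"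
  proof (rule Lim_transform_bound[THEN LIM_zero_cancel])
    have "L2_norm \<mu> (\<lambda>w. t * X n w - t * Y w) = \<bar>t\<bar> * L2_norm \<mu> (\<lambda>w. X n w - Y w)" for n
      using L2_norm_cmult[of \<mu> t "\<lambda>w. X n w - Y w"] by (simp add: right_diff_distrib)
    then show "(\<lambda>n. L2_norm \<mu> (\<lambda>w. t * X n w - t * Y w)) \<longlonglongrightarrow> 0"
      using tendsto_mult_right_zero[OF lim, of "\<bar>t\<bar>"] by simp
    show "\<forall>\<^sub>F n in sequentially. cmod ((\<integral>w. iexp (t * X n w) \<partial>\<mu>) - (\<integral>w. iexp (t * Y w) \<partial>\<mu>))
        \<le> norm (L2_norm \<mu> (\<lambda>w. t * X n w - t * Y w))"
      using iexp_integral_diff_le[OF sq_int_cmult[OF sX] sq_int_cmult[OF Y]]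
      by (intro always_eventually allI) simp
  qed
  ultimately show ?thesis unfolding ch by (rule LIMSEQ_unique[rotated])
qed

text \<open>After rescaling the law is standard normal by Levy's theorem. Its density is positive
  everywhere, so an almost sure bound on the variable would bound almost every real number.\<close>

lemma gaussian_unbounded:
  assumes Y: "sq_int \<mu> Y" and ch: "\<And>t. (\<integral>w. iexp (t * Y w) \<partial>\<mu>) = exp (- (t\<^sup>2 * (L2_norm \<mu> Y)\<^sup>2) / 2)"
    and s: "L2_norm \<mu> Y > 0"
  shows "\<not> (AE w in \<mu>. (Y w)\<^sup>2 \<le> C)"
proof
  assume bd: "AE w in \<mu>. (Y w)\<^sup>2 \<le> C"
  define s where "s = L2_norm \<mu> Y"
  have s0: "s > 0" using s by (simp add: s_def)
  have Ym: "Y \<in> borel_measurable \<mu>" using Y by (simp add: sq_int_def)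
  have Zm: "(\<lambda>w. Y w / s) \<in> borel_measurable \<mu>" using Ym by (intro borel_measurable_divide borel_measurable_const)
  define N where "N = distr \<mu> borel (\<lambda>w. Y w / s)"
  have N: "real_distribution N" unfolding N_def by (rule real_distribution_distr[OF Zm])
  have "char N t = complex_of_real (exp (- (t\<^sup>2) / 2))" for t
  proof -
    have "(\<lambda>y. iexp (t * y)) \<in> borel_measurable borel"
      using cis_measurable[of t] by (simp add: cis_conv_exp)
    from integral_distr[OF Zm this]
    have "char N t = (\<integral>w. iexp (t * (Y w / s)) \<partial>\<mu>)" by (simp add: char_def N_def)
    also have "\<dots> = (\<integral>w. iexp (t / s * Y w) \<partial>\<mu>)" by simp
    also have "\<dots> = complex_of_real (exp (- ((t / s)\<^sup>2 * s\<^sup>2) / 2))" unfolding s_def by (rule ch)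
    also have "(t / s)\<^sup>2 * s\<^sup>2 = t\<^sup>2" using s0 by (simp add: power_divide)
    finally show ?thesis .
  qed
  then have "char N = char std_normal_distribution" unfolding char_std_normal_distribution by (intro ext)
  then have Nd: "N = std_normal_distribution" by (rule Levy_uniqueness[OF N real_dist_normal_dist])
  have "AE w in \<mu>. (Y w / s)\<^sup>2 \<le> C / s\<^sup>2"
    using bd by eventually_elim (simp add: power_divide divide_right_mono)
  then have "AE y in N. y\<^sup>2 \<le> C / s\<^sup>2"
    unfolding N_def by (subst AE_distr_iff[OF Zm]) simp_all
  then have "AE y in lborel. 0 < ennreal (std_normal_density y) \<longrightarrow> y\<^sup>2 \<le> C / s\<^sup>2"
    unfolding Nd by (subst (asm) AE_density) simp_all
  then have ae: "AE y in lborel. y\<^sup>2 \<le> C / s\<^sup>2"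
    by (simp add: normal_density_pos)
  \<comment> \<open>Above \<open>a\<close> one has \<open>y \<ge> 1\<close> and
    \<open>y > C / s\<^sup>2\<close>, so the square exceeds the bound on an interval of length
    1.\<close>
  define a where "a = \<bar>C / s\<^sup>2\<bar> + 1"
  have "AE y in lborel. y \<notin> {a<..<a + 1}"
    using ae
  proof eventually_elim
    case (elim y)
    show ?case
    proof
      assume "y \<in> {a<..<a + 1}"
      then have "a < y" by simp
      then have y: "1 \<le> y" "\<bar>C / s\<^sup>2\<bar> < y" unfolding a_def by linarith+
      have "y * 1 \<le> y * y" using y(1) by (intro mult_left_mono) auto
      then have "y \<le> y\<^sup>2" by (simp add: power2_eq_square)
      then show False using elim y(2) by linarith
    qed
  qed
  then have "{a<..<a + 1} \<in> null_sets lborel" by (subst AE_iff_null_sets) simp_all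
  then show False by (simp add: null_sets_def)
qed

end

section \<open>Twisted orbit means and their limits\<close>

context wiener_rotation
begin

lemma orbit_sum_norm:
  fixes a :: "nat \<Rightarrow> real"
  assumes X: "wdelta h X"
  shows "(L2_norm \<mu> (\<lambda>w. \<Sum>n<K. a n * X ((T ^^ n) w)))\<^sup>2
    = (\<Sum>n<K. \<Sum>m<K. a n * a m * cm_inner ((R ^^ n) h) ((R ^^ m) h))"
proof -
  have W: "wdelta ((R ^^ n) h) (\<lambda>w. X ((T ^^ n) w))" for n by (rule wdelta_compose_T_funpow[OF X])
  have "(L2_norm \<mu> (\<lambda>w. \<Sum>n<K. a n * X ((T ^^ n) w)))\<^sup>2
      = (\<integral>w. (\<Sum>n<K. \<Sum>m<K. a n * a m * (X ((T ^^ n) w) * X ((T ^^ m) w))) \<partial>\<mu>)"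
    unfolding L2_norm_sq by (intro Bochner_Integration.integral_cong refl) (simp add: power2_eq_square sum_product mult_ac)
  also have "\<dots> = (\<Sum>n<K. \<Sum>m<K. a n * a m * (\<integral>w. X ((T ^^ n) w) * X ((T ^^ m) w) \<partial>\<mu>))"
    using sq_int_prod_integrable[OF wdelta_sq_int[OF W] wdelta_sq_int[OF W]] by simp
  also have "\<dots> = (\<Sum>n<K. \<Sum>m<K. a n * a m * cm_inner ((R ^^ n) h) ((R ^^ m) h))"
    by (simp only: wdelta_inner[OF W W])
  finally show ?thesis .
qed

text \<open>Sending the \<open>n\<close>-th translate of \<open>X\<close> to
  \<open>cis (n x)\<close> is an isometry into the square-integrable functions of \<sigma>. The
  translates are real, so the squared norm of a complex combination is the sum of those of its real
  and imaginary parts.\<close>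

lemma spectral_isometry:
  fixes z :: "nat \<Rightarrow> complex"
  assumes X: "wdelta h X" and \<sigma>: "finite_borel_measure \<sigma>"
    and c: "\<And>n m. complex_of_real (cm_inner ((R ^^ n) h) ((R ^^ m) h)) = (\<integral>x. cis ((real n - real m) * x) \<partial>\<sigma>)"
  shows "(L2_norm \<mu> (\<lambda>w. \<Sum>n<K. Re (z n) * X ((T ^^ n) w)))\<^sup>2 + (L2_norm \<mu> (\<lambda>w. \<Sum>n<K. Im (z n) * X ((T ^^ n) w)))\<^sup>2
    = (\<integral>x. (cmod (\<Sum>n<K. z n * cis (real n * x)))\<^sup>2 \<partial>\<sigma>)"
proof -
  interpret \<sigma>: finite_borel_measure \<sigma> by (rule \<sigma>)
  let ?c = "\<lambda>n m. cm_inner ((R ^^ n) h) ((R ^^ m) h)"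
  have "complex_of_real (\<integral>x. (cmod (\<Sum>n<K. z n * cis (real n * x)))\<^sup>2 \<partial>\<sigma>)
      = (\<integral>x. (\<Sum>n<K. z n * cis (real n * x)) * cnj (\<Sum>n<K. z n * cis (real n * x)) \<partial>\<sigma>)"
    unfolding integral_complex_of_real[symmetric] by (simp only: complex_norm_square)
  also have "\<dots> = (\<integral>x. (\<Sum>n<K. \<Sum>m<K. z n * cnj (z m) * cis ((real n - real m) * x)) \<partial>\<sigma>)"
  proof (intro Bochner_Integration.integral_cong refl)
    fix x
    have "z n * cis (real n * x) * cnj (z m * cis (real m * x)) = z n * cnj (z m) * cis ((real n - real m) * x)" for n m
    proof -
      have "cis ((real n - real m) * x) = cis (real n * x) * cnj (cis (real m * x))"
        by (simp add: cis_cnj cis_mult left_diff_distrib)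
      then show ?thesis by (simp only: complex_cnj_mult mult_ac)
    qed
    then show "(\<Sum>n<K. z n * cis (real n * x)) * cnj (\<Sum>n<K. z n * cis (real n * x))
        = (\<Sum>n<K. \<Sum>m<K. z n * cnj (z m) * cis ((real n - real m) * x))"
      by (simp only: cnj_sum sum_product)
  qed
  also have "\<dots> = (\<Sum>n<K. \<Sum>m<K. z n * cnj (z m) * complex_of_real (?c n m))"
    unfolding c by (simp add: \<sigma>.cis_integrable)
  finally have "(\<integral>x. (cmod (\<Sum>n<K. z n * cis (real n * x)))\<^sup>2 \<partial>\<sigma>) = Re (\<Sum>n<K. \<Sum>m<K. z n * cnj (z m) * complex_of_real (?c n m))"
    by (metis Re_complex_of_real)
  \<comment> \<open>The covariances are real, so only the real part of
    \<open>z n * cnj (z m)\<close> survives.\<close>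
  also have "\<dots> = (\<Sum>n<K. \<Sum>m<K. Re (z n) * Re (z m) * ?c n m) + (\<Sum>n<K. \<Sum>m<K. Im (z n) * Im (z m) * ?c n m)"
    by (simp add: sum.distrib[symmetric] distrib_right)
  finally show ?thesis unfolding orbit_sum_norm[OF X] by simp
qed

text \<open>Composition with \<open>T\<close> is an isometry, so an asymptotic relation between two
  sequences becomes an exact one between their limits.\<close>

lemma L2_limits_T_eq:
  assumes U: "\<And>N. sq_int \<mu> (U N)" "sq_int \<mu> u" "(\<lambda>N. L2_norm \<mu> (\<lambda>w. U N w - u w)) \<longlonglongrightarrow> 0"
    and V: "\<And>N. sq_int \<mu> (V N)" "sq_int \<mu> v" "(\<lambda>N. L2_norm \<mu> (\<lambda>w. V N w - v w)) \<longlonglongrightarrow> 0"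
    and UV: "(\<lambda>N. L2_norm \<mu> (\<lambda>w. U N (T w) - V N w)) \<longlonglongrightarrow> 0"
  shows "AE w in \<mu>. u (T w) = v w"
proof -
  note sUT = measure_preserving_L2(1)[OF T U(1)] and suT = measure_preserving_L2(1)[OF T U(2)]
  have "L2_norm \<mu> (\<lambda>w. u (T w) - v w)
      \<le> L2_norm \<mu> (\<lambda>w. U N w - u w) + (L2_norm \<mu> (\<lambda>w. U N (T w) - V N w) + L2_norm \<mu> (\<lambda>w. V N w - v w))" for N
  proof -
    have "L2_norm \<mu> (\<lambda>w. u (T w) - v w) \<le> L2_norm \<mu> (\<lambda>w. u (T w) - U N (T w)) + L2_norm \<mu> (\<lambda>w. U N (T w) - v w)"
      by (rule L2_norm_triangle[OF suT sUT V(2)])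
    also have "L2_norm \<mu> (\<lambda>w. u (T w) - U N (T w)) = L2_norm \<mu> (\<lambda>w. U N w - u w)"
      using measure_preserving_L2(2)[OF T sq_int_diff[OF U(2) U(1)]] L2_norm_minus_commute[of \<mu> u "U N"] by simp
    also have "L2_norm \<mu> (\<lambda>w. U N (T w) - v w) \<le> L2_norm \<mu> (\<lambda>w. U N (T w) - V N w) + L2_norm \<mu> (\<lambda>w. V N w - v w)"
      by (rule L2_norm_triangle[OF sUT V(1) V(2)])
    finally show ?thesis by simp
  qed
  moreover have "(\<lambda>N. L2_norm \<mu> (\<lambda>w. U N w - u w) + (L2_norm \<mu> (\<lambda>w. U N (T w) - V N w) + L2_norm \<mu> (\<lambda>w. V N w - v w))) \<longlonglongrightarrow> 0"
    using tendsto_add[OF U(3) tendsto_add[OF UV V(3)]] by simp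
  ultimately have "L2_norm \<mu> (\<lambda>w. u (T w) - v w) \<le> 0"
    by (intro LIMSEQ_le_const[of _ 0]) auto
  then have "L2_norm \<mu> (\<lambda>w. u (T w) - v w) = 0" using L2_norm_nonneg[of \<mu> "\<lambda>w. u (T w) - v w"] by linarith
  from L2_norm_eq_0_AE[OF sq_int_diff[OF suT V(2)] this] show ?thesis by simp
qed

text \<open>The real part of \<open>e\<^sup>-\<^sup>i\<^sup>\<phi>\<close> times the mean of
  \<open>e\<^sup>-\<^sup>i\<^sup>n\<^sup>\<theta> X \<circ> T\<^sup>n\<close>. The phases 0 and
  \<open>pi / 2\<close> give its real and imaginary parts, and applying \<open>T\<close> acts on the
  phase.\<close>

definition orbit_mean :: "((real \<Rightarrow> real) \<Rightarrow> real) \<Rightarrow> real \<Rightarrow> real \<Rightarrow> nat \<Rightarrow> (real \<Rightarrow> real) \<Rightarrow> real" where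
  "orbit_mean X \<theta> \<phi> N w = (\<Sum>n<N. cos (real n * \<theta> + \<phi>) / real N * X ((T ^^ n) w))"

lemma wdelta_orbit_mean:
  assumes X: "wdelta h X"
  shows "wdelta (\<lambda>t. \<Sum>n<N. cos (real n * \<theta> + \<phi>) / real N * (R ^^ n) h t) (orbit_mean X \<theta> \<phi> N)"
  unfolding orbit_mean_def[abs_def] by (intro wdelta_sum wdelta_cmult wdelta_compose_T_funpow X)

text \<open>Applying \<open>T\<close> shifts the index, which the phase
  \<open>\<phi> - \<theta>\<close> compensates; the difference telescopes to two end terms of size
  \<open>1 / N\<close>.\<close>

lemma orbit_mean_shift:
  assumes X: "wdelta h X"
  shows "(\<lambda>N. L2_norm \<mu> (\<lambda>w. orbit_mean X \<theta> \<phi> N (T w) - orbit_mean X \<theta> (\<phi> - \<theta>) N w)) \<longlonglongrightarrow> 0"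
proof (rule Lim_null_comparison[OF always_eventually])
  show "(\<lambda>N. 2 * cm_norm h * inverse (real N)) \<longlonglongrightarrow> 0" by (rule tendsto_mult_right_zero[OF lim_inverse_n])
  have W: "wdelta ((R ^^ n) h) (\<lambda>w. X ((T ^^ n) w))" for n by (rule wdelta_compose_T_funpow[OF X])
  have nW: "L2_norm \<mu> (\<lambda>w. X ((T ^^ n) w)) = cm_norm h" for n
    using wdelta_norm[OF W] by (simp add: unitary_CM_funpow_norm[OF R wdelta_CM[OF X]])
  show "\<forall>N. norm (L2_norm \<mu> (\<lambda>w. orbit_mean X \<theta> \<phi> N (T w) - orbit_mean X \<theta> (\<phi> - \<theta>) N w)) \<le> 2 * cm_norm h * inverse (real N)"
  proof
    fix N
    define g where "g w n = cos (real n * \<theta> + (\<phi> - \<theta>)) / real N * X ((T ^^ n) w)" for w n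
    have "orbit_mean X \<theta> \<phi> N (T w) - orbit_mean X \<theta> (\<phi> - \<theta>) N w = g w N - g w 0" for w
    proof -
      have "orbit_mean X \<theta> \<phi> N (T w) = (\<Sum>n<N. g w (Suc n))"
        unfolding orbit_mean_def g_def
      proof (intro sum.cong refl)
        fix n
        have "real (Suc n) * \<theta> + (\<phi> - \<theta>) = real n * \<theta> + \<phi>" by (simp add: algebra_simps)
        moreover have "(T ^^ Suc n) w = (T ^^ n) (T w)" by (simp add: funpow_swap1)
        ultimately show "cos (real n * \<theta> + \<phi>) / real N * X ((T ^^ n) (T w))
            = cos (real (Suc n) * \<theta> + (\<phi> - \<theta>)) / real N * X ((T ^^ Suc n) w)" by (simp only:)
      qed
      moreover have "orbit_mean X \<theta> (\<phi> - \<theta>) N w = (\<Sum>n<N. g w n)" by (simp add: orbit_mean_def g_def)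
      ultimately have "orbit_mean X \<theta> \<phi> N (T w) - orbit_mean X \<theta> (\<phi> - \<theta>) N w = (\<Sum>n<N. g w (Suc n) - g w n)"
        by (simp only: sum_subtractf)
      then show ?thesis by (simp only: sum_lessThan_telescope)
    qed
    then have "L2_norm \<mu> (\<lambda>w. orbit_mean X \<theta> \<phi> N (T w) - orbit_mean X \<theta> (\<phi> - \<theta>) N w) = L2_norm \<mu> (\<lambda>w. g w N - g w 0)"
      by (simp only:)
    also have "\<dots> = L2_norm \<mu> (\<lambda>w. g w N + (-1) * g w 0)" by simp
    also have "\<dots> \<le> L2_norm \<mu> (\<lambda>w. g w N) + L2_norm \<mu> (\<lambda>w. (-1) * g w 0)"
      unfolding g_def by (intro L2_norm_add sq_int_cmult wdelta_sq_int[OF W])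
    also have "\<dots> = \<bar>cos (real N * \<theta> + (\<phi> - \<theta>)) / real N\<bar> * cm_norm h + \<bar>cos (real 0 * \<theta> + (\<phi> - \<theta>)) / real N\<bar> * cm_norm h"
      unfolding g_def L2_norm_cmult nW by simp
    also have "\<dots> \<le> inverse (real N) * cm_norm h + inverse (real N) * cm_norm h"
    proof -
      have "\<bar>cos u / real N\<bar> \<le> inverse (real N)" for u
        using abs_cos_le_one[of u] mult_right_mono[of "\<bar>cos u\<bar>" 1 "inverse (real N)"] by (simp add: abs_mult divide_inverse)
      then show ?thesis by (intro add_mono mult_right_mono cm_norm_nonneg)
    qed
    finally show "norm (L2_norm \<mu> (\<lambda>w. orbit_mean X \<theta> \<phi> N (T w) - orbit_mean X \<theta> (\<phi> - \<theta>) N w)) \<le> 2 * cm_norm h * inverse (real N)"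
      by simp
  qed
qed

text \<open>On the support, \<open>x - \<theta>\<close> is a multiple of \<open>2 * pi\<close> only
  for \<open>x = \<theta>\<close>. So the bounded means tend a.e. to the indicator of the point, and
  dominated convergence applies.\<close>

lemma dirichlet_mean_limit:
  assumes \<sigma>: "finite_borel_measure \<sigma>" and supp: "AE x in \<sigma>. 0 < x \<and> x \<le> 2 * pi" and \<theta>: "0 < \<theta>" "\<theta> \<le> 2 * pi"
  shows "(\<lambda>N. \<integral>x. (cmod (dirichlet_mean N (x - \<theta>) - (if x = \<theta> then 1 else 0)))\<^sup>2 \<partial>\<sigma>) \<longlonglongrightarrow> 0"
    "(\<lambda>N. \<integral>x. (cmod (dirichlet_mean N (x - \<theta>)))\<^sup>2 \<partial>\<sigma>) \<longlonglongrightarrow> measure \<sigma> {\<theta>}"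
    "integrable \<sigma> (\<lambda>x. (cmod (dirichlet_mean N (x - \<theta>) - (if x = \<theta> then 1 else 0)))\<^sup>2)"
    "(\<lambda>x. dirichlet_mean N (x - \<theta>)) \<in> borel_measurable \<sigma>"
proof -
  interpret \<sigma>: finite_borel_measure \<sigma> by (rule \<sigma>)
  have "(\<lambda>x. \<Sum>n<N. cis (real n * (x - \<theta>))) \<in> borel_measurable borel" for N
    by (intro borel_measurable_continuous_onI continuous_on_sum continuous_on_mult continuous_on_cis
          continuous_on_diff continuous_on_const continuous_on_id)
  then have Db: "(\<lambda>x. dirichlet_mean N (x - \<theta>)) \<in> borel_measurable borel" for N
    unfolding dirichlet_mean_def by (intro borel_measurable_divide borel_measurable_const)
  then show Dm: "(\<lambda>x. dirichlet_mean N (x - \<theta>)) \<in> borel_measurable \<sigma>" for N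
    by (subst measurable_cong_sets[OF \<sigma>.M_is_borel refl])
  define g :: "real \<Rightarrow> complex" where "g x = (if x = \<theta> then 1 else 0)" for x
  have "g \<in> borel_measurable borel" unfolding g_def[abs_def] by simp
  then have gm: "g \<in> borel_measurable \<sigma>" by (subst measurable_cong_sets[OF \<sigma>.M_is_borel refl])
  have g1: "cmod (g x) \<le> 1" for x by (simp add: g_def)
  \<comment> \<open>Both functions have modulus at most 1, so their difference has modulus at most
    2.\<close>
  have b4: "(cmod (dirichlet_mean N (x - \<theta>) - g x))\<^sup>2 \<le> 4" for N x
  proof -
    have "cmod (dirichlet_mean N (x - \<theta>) - g x) \<le> 2"
      using norm_triangle_ineq4[of "dirichlet_mean N (x - \<theta>)" "g x"] dirichlet_mean_le[of N "x - \<theta>"] g1[of x] by linarith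
    then show ?thesis using power_mono[of "cmod (dirichlet_mean N (x - \<theta>) - g x)" 2 2] by simp
  qed
  have dm: "(\<lambda>x. (cmod (dirichlet_mean N (x - \<theta>) - g x))\<^sup>2) \<in> borel_measurable \<sigma>" for N
    using borel_measurable_diff[OF Dm[of N] gm] by simp
  show "integrable \<sigma> (\<lambda>x. (cmod (dirichlet_mean N (x - \<theta>) - (if x = \<theta> then 1 else 0)))\<^sup>2)"
    unfolding g_def[symmetric] by (rule \<sigma>.integrable_const_bound[OF _ dm, where B=4]) (use b4 in simp)
  have lim: "AE x in \<sigma>. (\<lambda>N. dirichlet_mean N (x - \<theta>)) \<longlonglongrightarrow> g x"
    using supp
  proof eventually_elim
    case (elim x)
    show ?case
    proof (cases "x = \<theta>")
      case True
      have "dirichlet_mean N (x - \<theta>) = g x" if "N > 0" for N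
        using dirichlet_mean_1[of "x - \<theta>" N] that True by (simp add: g_def)
      then show ?thesis
        by (intro tendsto_eventually eventually_sequentiallyI[of 1]) simp
    next
      case False
      have "cis (x - \<theta>) \<noteq> 1"
      proof
        assume "cis (x - \<theta>) = 1"
        from cis_eq_1_imp[OF this] obtain k :: int where k: "x - \<theta> = 2 * pi * of_int k" by (elim exE)
        \<comment> \<open>Both points lie in the half-open interval from 0 to \<open>2 * pi\<close>,
          so their difference is strictly less than one period in modulus.\<close>
        have "2 * pi * of_int k < 2 * pi * 1" "2 * pi * (-1) < 2 * pi * of_int k" using k elim \<theta> by linarith+
        then have "(of_int k :: real) < 1" "(-1 :: real) < of_int k"
          unfolding mult_less_cancel_left_pos[OF mult_pos_pos[OF zero_less_numeral pi_gt_zero]] by simp_all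
        then have "k = 0" by linarith
        then show False using k False by simp
      qed
      from dirichlet_mean_tendsto_0[OF this] show ?thesis using False by (simp add: g_def)
    qed
  qed
  have "(\<lambda>N. \<integral>x. (cmod (dirichlet_mean N (x - \<theta>) - g x))\<^sup>2 \<partial>\<sigma>) \<longlonglongrightarrow> (\<integral>x. 0 \<partial>\<sigma>)"
  proof (rule integral_dominated_convergence[where w="\<lambda>_. 4"])
    show "AE x in \<sigma>. (\<lambda>N. (cmod (dirichlet_mean N (x - \<theta>) - g x))\<^sup>2) \<longlonglongrightarrow> 0"
      using lim
    proof eventually_elim
      case (elim x)
      from tendsto_power[OF tendsto_norm[OF tendsto_diff[OF elim tendsto_const[of "g x"]]], of 2] show ?case by simp
    qed
  qed (use b4 in \<open>simp_all add: dm\<close>)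
  then show "(\<lambda>N. \<integral>x. (cmod (dirichlet_mean N (x - \<theta>) - (if x = \<theta> then 1 else 0)))\<^sup>2 \<partial>\<sigma>) \<longlonglongrightarrow> 0"
    by (simp add: g_def)
  have "(\<lambda>N. \<integral>x. (cmod (dirichlet_mean N (x - \<theta>)))\<^sup>2 \<partial>\<sigma>) \<longlonglongrightarrow> (\<integral>x. (cmod (g x))\<^sup>2 \<partial>\<sigma>)"
  proof (rule integral_dominated_convergence[where w="\<lambda>_. 1"])
    show "AE x in \<sigma>. (\<lambda>N. (cmod (dirichlet_mean N (x - \<theta>)))\<^sup>2) \<longlonglongrightarrow> (cmod (g x))\<^sup>2"
      using lim by eventually_elim (intro tendsto_power tendsto_norm)
    show "AE x in \<sigma>. norm ((cmod (dirichlet_mean N (x - \<theta>)))\<^sup>2) \<le> 1" for N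
      using dirichlet_mean_le by (intro AE_I2) (simp add: power_le_one)
    show "(\<lambda>x. (cmod (g x))\<^sup>2) \<in> borel_measurable \<sigma>" using gm by simp
    show "(\<lambda>x. (cmod (dirichlet_mean N (x - \<theta>)))\<^sup>2) \<in> borel_measurable \<sigma>" for N
      using Dm by simp
  qed simp
  moreover have "(\<integral>x. (cmod (g x))\<^sup>2 \<partial>\<sigma>) = (\<integral>x. indicator {\<theta>} x \<partial>\<sigma>)"
    by (intro Bochner_Integration.integral_cong refl) (simp add: g_def)
  moreover have "(\<integral>x. indicator {\<theta>} x \<partial>\<sigma>) = measure \<sigma> {\<theta>}"
    using \<sigma>.M_is_borel sets_eq_imp_space_eq[OF \<sigma>.M_is_borel] by simp
  ultimately show "(\<lambda>N. \<integral>x. (cmod (dirichlet_mean N (x - \<theta>)))\<^sup>2 \<partial>\<sigma>) \<longlonglongrightarrow> measure \<sigma> {\<theta>}" by simp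
qed

lemma not_ergodic_if_atom:
  assumes h: "h \<in> CM" and \<sigma>: "finite_borel_measure \<sigma>"
    and c: "\<And>n m. complex_of_real (cm_inner ((R ^^ n) h) ((R ^^ m) h)) = (\<integral>x. cis ((real n - real m) * x) \<partial>\<sigma>)"
    and supp: "AE x in \<sigma>. 0 < x \<and> x \<le> 2 * pi" and atom: "measure \<sigma> {\<theta>} \<noteq> 0"
  shows "\<not> ergodic_map \<mu> T"
proof
  assume erg: "ergodic_map \<mu> T"
  interpret \<sigma>: finite_borel_measure \<sigma> by (rule \<sigma>)
  have \<theta>: "0 < \<theta> \<and> \<theta> \<le> 2 * pi"
  proof (rule ccontr)
    assume n: "\<not> (0 < \<theta> \<and> \<theta> \<le> 2 * pi)"
    from supp have "AE x in \<sigma>. x \<notin> {\<theta>}" by eventually_elim (use n in auto)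
    then have "{\<theta>} \<in> null_sets \<sigma>" by (subst AE_iff_null_sets) (simp_all add: \<sigma>.M_is_borel)
    then show False using atom by (simp add: null_sets_def measure_def)
  qed
  note dl = dirichlet_mean_limit[OF \<sigma> supp conjunct1[OF \<theta>] conjunct2[OF \<theta>]]
  obtain X where X: "wdelta h X" by (rule wdelta_exists[OF h])
  define S where "S \<phi> = orbit_mean X \<theta> \<phi>" for \<phi>
  define A where "A = S 0"
  define B where "B = S (pi / 2)"
  \<comment> \<open>The mean with an arbitrary phase is a fixed combination of the two basic means,
    so convergence of \<open>A\<close> and \<open>B\<close> settles all phases.\<close>
  have S_eq: "S \<phi> N w = cos \<phi> * A N w + sin \<phi> * B N w" for \<phi> N w
  proof -
    have sh: "cos (x + pi / 2) = - sin x" for x :: real by (simp add: cos_add)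
    have e1: "cos (real n * \<theta> + \<phi>) / real N * X ((T ^^ n) w)
        = cos \<phi> * (cos (real n * \<theta> + 0) / real N * X ((T ^^ n) w)) + sin \<phi> * (cos (real n * \<theta> + pi / 2) / real N * X ((T ^^ n) w))" for n
      by (simp only: sh add_0_right)
        (simp only: cos_add divide_inverse algebra_simps mult_minus_left mult_minus_right add_uminus_conv_diff)
    show ?thesis unfolding S_def A_def B_def orbit_mean_def sum_distrib_left sum.distrib[symmetric]
      by (intro sum.cong refl e1)
  qed
  define k where "k \<phi> N t = (\<Sum>n<N. cos (real n * \<theta> + \<phi>) / real N * (R ^^ n) h t)" for \<phi> N t
  have WS: "wdelta (k \<phi> N) (S \<phi> N)" for \<phi> N unfolding S_def k_def[abs_def] by (rule wdelta_orbit_mean[OF X])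
  have kA: "wdelta (k 0 N) (A N)" and kB: "wdelta (k (pi / 2) N) (B N)" for N unfolding A_def B_def by (rule WS)+
  note sA = wdelta_sq_int[OF kA] and sB = wdelta_sq_int[OF kB]
  \<comment> \<open>Padding with zeros lets means of different lengths be written over one index
    range and subtracted.\<close>
  define z where "z N n = (if n < N then cis (- (real n * \<theta>)) / of_nat N else 0)" for N n
  have z_sum: "(\<Sum>n<K. f n * z N n) = (\<Sum>n<N. f n * (cis (- (real n * \<theta>)) / of_nat N))" if "N \<le> K" for f :: "nat \<Rightarrow> complex" and N K
    unfolding z_def using that by (intro sum.mono_neutral_cong_right) auto
  have A_z: "A N w = (\<Sum>n<K. Re (z N n) * X ((T ^^ n) w))" if "N \<le> K" for N K w
    unfolding A_def S_def orbit_mean_def z_def using that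
    by (intro sum.mono_neutral_cong_left) (auto simp: Re_divide_of_nat)
  have B_z: "B N w = (\<Sum>n<K. Im (z N n) * X ((T ^^ n) w))" if "N \<le> K" for N K w
    unfolding B_def S_def orbit_mean_def z_def using that
    by (intro sum.mono_neutral_cong_left) (auto simp: Im_divide_of_nat cos_add)
  have z_dir: "(\<Sum>n<K. z N n * cis (real n * x)) = dirichlet_mean N (x - \<theta>)" if "N \<le> K" for N K x
  proof -
    have "(\<Sum>n<K. z N n * cis (real n * x)) = (\<Sum>n<N. cis (real n * x) * (cis (- (real n * \<theta>)) / of_nat N))"
      using z_sum[OF that, of "\<lambda>n. cis (real n * x)"] by (simp only: mult.commute)
    also have "\<dots> = dirichlet_mean N (x - \<theta>)"
      unfolding dirichlet_mean_def sum_divide_distrib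
      by (intro sum.cong refl) (simp add: cis_mult right_diff_distrib)
    finally show ?thesis .
  qed
  have norms: "(L2_norm \<mu> (A N))\<^sup>2 + (L2_norm \<mu> (B N))\<^sup>2 = (\<integral>x. (cmod (dirichlet_mean N (x - \<theta>)))\<^sup>2 \<partial>\<sigma>)" for N
    using spectral_isometry[OF X \<sigma> c, where K=N and z="z N"]
    by (simp only: A_z[OF order_refl, symmetric] B_z[OF order_refl, symmetric] z_dir[OF order_refl])
  \<comment> \<open>The squared distance of the Dirichlet mean from its limit; comparing two means
    with this limit yields the Cauchy property.\<close>
  define \<delta> where "\<delta> N = (\<integral>x. (cmod (dirichlet_mean N (x - \<theta>) - (if x = \<theta> then 1 else 0)))\<^sup>2 \<partial>\<sigma>)" for N
  have \<delta>: "\<delta> \<longlonglongrightarrow> 0" using dl(1) by (simp only: \<delta>_def[abs_def])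
  have diffs: "(L2_norm \<mu> (\<lambda>w. A N w - A M w))\<^sup>2 + (L2_norm \<mu> (\<lambda>w. B N w - B M w))\<^sup>2 \<le> 2 * \<delta> N + 2 * \<delta> M" for N M
  proof -
    define K where "K = max N M"
    have K: "N \<le> K" "M \<le> K" by (simp_all add: K_def)
    have a: "A N w - A M w = (\<Sum>n<K. Re (z N n - z M n) * X ((T ^^ n) w))" for w
      by (simp add: A_z[OF K(1)] A_z[OF K(2)] sum_subtractf left_diff_distrib)
    have b: "B N w - B M w = (\<Sum>n<K. Im (z N n - z M n) * X ((T ^^ n) w))" for w
      by (simp add: B_z[OF K(1)] B_z[OF K(2)] sum_subtractf left_diff_distrib)
    have d: "(\<Sum>n<K. (z N n - z M n) * cis (real n * x)) = dirichlet_mean N (x - \<theta>) - dirichlet_mean M (x - \<theta>)" for x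
      by (simp add: z_dir[OF K(1), symmetric] z_dir[OF K(2), symmetric] sum_subtractf left_diff_distrib)
    have "(L2_norm \<mu> (\<lambda>w. A N w - A M w))\<^sup>2 + (L2_norm \<mu> (\<lambda>w. B N w - B M w))\<^sup>2
        = (\<integral>x. (cmod (dirichlet_mean N (x - \<theta>) - dirichlet_mean M (x - \<theta>)))\<^sup>2 \<partial>\<sigma>)"
      using spectral_isometry[OF X \<sigma> c, where K=K and z="\<lambda>n. z N n - z M n"] by (simp only: a b d)
    also have "\<dots> \<le> (\<integral>x. 2 * (cmod (dirichlet_mean N (x - \<theta>) - (if x = \<theta> then 1 else 0)))\<^sup>2
        + 2 * (cmod (dirichlet_mean M (x - \<theta>) - (if x = \<theta> then 1 else 0)))\<^sup>2 \<partial>\<sigma>)"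
    proof (rule integral_mono)
      show ir: "integrable \<sigma> (\<lambda>x. 2 * (cmod (dirichlet_mean N (x - \<theta>) - (if x = \<theta> then 1 else 0)))\<^sup>2
        + 2 * (cmod (dirichlet_mean M (x - \<theta>) - (if x = \<theta> then 1 else 0)))\<^sup>2)"
        by (intro Bochner_Integration.integrable_add integrable_mult_right dl(3))
      have le: "(cmod (p - q))\<^sup>2 \<le> 2 * (cmod (p - r))\<^sup>2 + 2 * (cmod (q - r))\<^sup>2" for p q r :: complex
      proof -
        have "cmod (p - q) \<le> cmod (p - r) + cmod (q - r)" using norm_triangle_ineq4[of "p - r" "q - r"] by simp
        then have "(cmod (p - q))\<^sup>2 \<le> (cmod (p - r) + cmod (q - r))\<^sup>2" by (rule power_mono) simp
        also have "\<dots> \<le> 2 * (cmod (p - r))\<^sup>2 + 2 * (cmod (q - r))\<^sup>2"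
          using zero_le_power2[of "cmod (p - r) - cmod (q - r)"] by (simp only: power2_diff power2_sum)
        finally show ?thesis .
      qed
      show "(cmod (dirichlet_mean N (x - \<theta>) - dirichlet_mean M (x - \<theta>)))\<^sup>2
        \<le> 2 * (cmod (dirichlet_mean N (x - \<theta>) - (if x = \<theta> then 1 else 0)))\<^sup>2
        + 2 * (cmod (dirichlet_mean M (x - \<theta>) - (if x = \<theta> then 1 else 0)))\<^sup>2" for x by (rule le)
      show "integrable \<sigma> (\<lambda>x. (cmod (dirichlet_mean N (x - \<theta>) - dirichlet_mean M (x - \<theta>)))\<^sup>2)"
      proof (rule Bochner_Integration.integrable_bound[OF ir])
        show "(\<lambda>x. (cmod (dirichlet_mean N (x - \<theta>) - dirichlet_mean M (x - \<theta>)))\<^sup>2) \<in> borel_measurable \<sigma>"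
          using borel_measurable_diff[OF dl(4)[of N] dl(4)[of M]] by simp
        show "AE x in \<sigma>. norm ((cmod (dirichlet_mean N (x - \<theta>) - dirichlet_mean M (x - \<theta>)))\<^sup>2)
            \<le> norm (2 * (cmod (dirichlet_mean N (x - \<theta>) - (if x = \<theta> then 1 else 0)))\<^sup>2
              + 2 * (cmod (dirichlet_mean M (x - \<theta>) - (if x = \<theta> then 1 else 0)))\<^sup>2)"
        proof (rule AE_I2)
          fix x
          have a: "norm (a\<^sup>2) \<le> norm b" if "a\<^sup>2 \<le> b" for a b :: real using that zero_le_power2[of a] by simp
          show "norm ((cmod (dirichlet_mean N (x - \<theta>) - dirichlet_mean M (x - \<theta>)))\<^sup>2)
            \<le> norm (2 * (cmod (dirichlet_mean N (x - \<theta>) - (if x = \<theta> then 1 else 0)))\<^sup>2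
              + 2 * (cmod (dirichlet_mean M (x - \<theta>) - (if x = \<theta> then 1 else 0)))\<^sup>2)" by (rule a[OF le])
        qed
      qed
    qed
    also have "\<dots> = 2 * \<delta> N + 2 * \<delta> M"
      unfolding \<delta>_def by (subst Bochner_Integration.integral_add) (simp_all only: integrable_mult_right dl(3) integral_mult_right_zero)
    finally show ?thesis .
  qed
  have Cauchy: "L2_Cauchy \<mu> U"
    if U: "\<And>N M. (L2_norm \<mu> (\<lambda>w. U N w - U M w))\<^sup>2 \<le> 2 * \<delta> N + 2 * \<delta> M" for U :: "nat \<Rightarrow> (real \<Rightarrow> real) \<Rightarrow> real"
    unfolding L2_Cauchy_def
  proof (intro allI impI)
    fix \<epsilon> :: real assume e: "0 < \<epsilon>"
    then have "0 < \<epsilon>\<^sup>2 / 4" by simp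
    from order_tendstoD(2)[OF \<delta> this] obtain K where K: "\<forall>n\<ge>K. \<delta> n < \<epsilon>\<^sup>2 / 4"
      unfolding eventually_sequentially by (elim exE)
    show "\<exists>K. \<forall>m\<ge>K. \<forall>n\<ge>K. L2_norm \<mu> (\<lambda>x. U m x - U n x) < \<epsilon>"
    proof (intro exI[of _ K] allI impI)
      fix m n assume m: "K \<le> m" and n: "K \<le> n"
      have "(L2_norm \<mu> (\<lambda>x. U m x - U n x))\<^sup>2 < \<epsilon>\<^sup>2"
        using U[of m n] K[rule_format, OF m] K[rule_format, OF n] by linarith
      then show "L2_norm \<mu> (\<lambda>x. U m x - U n x) < \<epsilon>" by (rule power_less_imp_less_base) (use e in simp)
    qed
  qed
  have dA: "(L2_norm \<mu> (\<lambda>w. A N w - A M w))\<^sup>2 \<le> 2 * \<delta> N + 2 * \<delta> M" for N M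
    using diffs[of N M] zero_le_power2[of "L2_norm \<mu> (\<lambda>w. B N w - B M w)"] by linarith
  have dB: "(L2_norm \<mu> (\<lambda>w. B N w - B M w))\<^sup>2 \<le> 2 * \<delta> N + 2 * \<delta> M" for N M
    using diffs[of N M] zero_le_power2[of "L2_norm \<mu> (\<lambda>w. A N w - A M w)"] by linarith
  obtain P where P: "sq_int \<mu> P" "(\<lambda>N. L2_norm \<mu> (\<lambda>w. A N w - P w)) \<longlonglongrightarrow> 0"
    by (rule L2_complete[OF sA Cauchy[OF dA]])
  obtain Q where Q: "sq_int \<mu> Q" "(\<lambda>N. L2_norm \<mu> (\<lambda>w. B N w - Q w)) \<longlonglongrightarrow> 0"
    by (rule L2_complete[OF sB Cauchy[OF dB]])
  define Z where "Z \<phi> w = cos \<phi> * P w + sin \<phi> * Q w" for \<phi> w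
  have sZ: "sq_int \<mu> (Z \<phi>)" for \<phi> unfolding Z_def[abs_def] by (intro sq_int_add sq_int_cmult P(1) Q(1))
  have sS: "sq_int \<mu> (S \<phi> N)" for \<phi> N by (rule wdelta_sq_int[OF WS])
  have SZ: "(\<lambda>N. L2_norm \<mu> (\<lambda>w. S \<phi> N w - Z \<phi> w)) \<longlonglongrightarrow> 0" for \<phi>
  proof (rule Lim_null_comparison[OF always_eventually])
    show "(\<lambda>N. \<bar>cos \<phi>\<bar> * L2_norm \<mu> (\<lambda>w. A N w - P w) + \<bar>sin \<phi>\<bar> * L2_norm \<mu> (\<lambda>w. B N w - Q w)) \<longlonglongrightarrow> 0"
      using tendsto_add[OF tendsto_mult_right_zero[OF P(2), of "\<bar>cos \<phi>\<bar>"] tendsto_mult_right_zero[OF Q(2), of "\<bar>sin \<phi>\<bar>"]] by simp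
    show "\<forall>N. norm (L2_norm \<mu> (\<lambda>w. S \<phi> N w - Z \<phi> w))
        \<le> \<bar>cos \<phi>\<bar> * L2_norm \<mu> (\<lambda>w. A N w - P w) + \<bar>sin \<phi>\<bar> * L2_norm \<mu> (\<lambda>w. B N w - Q w)"
    proof
      fix N
      have "(\<lambda>w. S \<phi> N w - Z \<phi> w) = (\<lambda>w. cos \<phi> * (A N w - P w) + sin \<phi> * (B N w - Q w))"
        by (simp add: S_eq Z_def algebra_simps)
      then show "norm (L2_norm \<mu> (\<lambda>w. S \<phi> N w - Z \<phi> w))
        \<le> \<bar>cos \<phi>\<bar> * L2_norm \<mu> (\<lambda>w. A N w - P w) + \<bar>sin \<phi>\<bar> * L2_norm \<mu> (\<lambda>w. B N w - Q w)"
        using L2_norm_add[OF sq_int_cmult[OF sq_int_diff[OF sA P(1)]] sq_int_cmult[OF sq_int_diff[OF sB Q(1)]], of "cos \<phi>" N "sin \<phi>" N]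
        by (simp add: L2_norm_cmult)
    qed
  qed
  \<comment> \<open>In the limit \<open>T\<close> turns the phase by exactly
    \<open>\<theta>\<close>, that is, it rotates the pair \<open>P\<close>,
    \<open>Q\<close>.\<close>
  have rot: "AE w in \<mu>. Z \<phi> (T w) = Z (\<phi> - \<theta>) w" for \<phi>
    by (rule L2_limits_T_eq[OF sS sZ SZ sS sZ SZ]) (unfold S_def, rule orbit_mean_shift[OF X])
  have PZ: "Z 0 = P" and QZ: "Z (pi / 2) = Q" by (simp_all add: Z_def fun_eq_iff)
  define F where "F w = (P w)\<^sup>2 + (Q w)\<^sup>2" for w
  have id2: "(c * p - s * q)\<^sup>2 + (s * p + c * q)\<^sup>2 = (c\<^sup>2 + s\<^sup>2) * (p\<^sup>2 + q\<^sup>2)" for c s p q :: real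
    by (simp add: power2_eq_square algebra_simps)
  have inv: "AE w in \<mu>. F (T w) = F w"
    using rot[of 0] rot[of "pi / 2"]
  proof eventually_elim
    case (elim w)
    then have p: "P (T w) = cos \<theta> * P w - sin \<theta> * Q w" and q: "Q (T w) = sin \<theta> * P w + cos \<theta> * Q w"
      unfolding PZ QZ by (simp_all add: Z_def cos_diff sin_diff)
    have "F (T w) = ((cos \<theta>)\<^sup>2 + (sin \<theta>)\<^sup>2) * F w"
      unfolding F_def p q by (rule id2)
    then show ?case by simp
  qed
  have Fm: "F \<in> borel_measurable \<mu>"
    unfolding F_def[abs_def] using P(1) Q(1) by (intro borel_measurable_add borel_measurable_power) (simp_all add: sq_int_def)
  obtain C where C: "AE w in \<mu>. F w = C"
    using erg[unfolded ergodic_map_def, rule_format, OF conjI[OF Fm inv]] by (rule exE)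
  have bP: "AE w in \<mu>. (P w)\<^sup>2 \<le> C" using C by eventually_elim (auto simp: F_def)
  have bQ: "AE w in \<mu>. (Q w)\<^sup>2 \<le> C" using C by eventually_elim (auto simp: F_def)
  \<comment> \<open>Ergodicity has bounded \<open>P\<close> and \<open>Q\<close> almost surely by a
    constant; as limits of Gaussian variables they can only be degenerate.\<close>
  have zero: "L2_norm \<mu> Y = 0"
    if k: "\<And>N. wdelta (k N) (U N)" and Y: "sq_int \<mu> Y" and lim: "(\<lambda>N. L2_norm \<mu> (\<lambda>w. U N w - Y w)) \<longlonglongrightarrow> 0"
      and b: "AE w in \<mu>. (Y w)\<^sup>2 \<le> C" for k U Y
  proof (rule ccontr)
    assume "L2_norm \<mu> Y \<noteq> 0"
    then have "L2_norm \<mu> Y > 0" using L2_norm_nonneg[of \<mu> Y] by linarith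
    from gaussian_unbounded[OF Y wdelta_limit_char[OF k Y lim] this] b show False by (rule notE)
  qed
  have "(\<lambda>N. (L2_norm \<mu> (A N))\<^sup>2 + (L2_norm \<mu> (B N))\<^sup>2) \<longlonglongrightarrow> (L2_norm \<mu> P)\<^sup>2 + (L2_norm \<mu> Q)\<^sup>2"
  proof (intro tendsto_add tendsto_power)
    show "(\<lambda>N. L2_norm \<mu> (A N)) \<longlonglongrightarrow> L2_norm \<mu> P"
      by (rule Lim_transform_bound[THEN LIM_zero_cancel, OF _ P(2)]) (auto intro!: always_eventually L2_norm_diff_le sA P(1))
    show "(\<lambda>N. L2_norm \<mu> (B N)) \<longlonglongrightarrow> L2_norm \<mu> Q"
      by (rule Lim_transform_bound[THEN LIM_zero_cancel, OF _ Q(2)]) (auto intro!: always_eventually L2_norm_diff_le sB Q(1))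
  qed
  then have "(\<lambda>N. (L2_norm \<mu> (A N))\<^sup>2 + (L2_norm \<mu> (B N))\<^sup>2) \<longlonglongrightarrow> 0"
    using zero[OF kA P bP] zero[OF kB Q bQ] by simp
  \<comment> \<open>The same sum of squared norms tends to the mass of the atom by the spectral
    isometry, and to 0 because \<open>P\<close> and \<open>Q\<close> vanish.\<close>
  then have "measure \<sigma> {\<theta>} = 0" unfolding norms by (rule LIMSEQ_unique[OF dl(2)])
  then show False using atom by simp
qed

end

theorem theorem2:
  fixes \<mu> :: "(real \<Rightarrow> real) measure"
    and R :: "(real \<Rightarrow> real) \<Rightarrow> (real \<Rightarrow> real)"
    and E :: "real \<Rightarrow> (real \<Rightarrow> complex) \<Rightarrow> (real \<Rightarrow> complex)"
    and e :: "nat \<Rightarrow> real \<Rightarrow> real"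
    and T :: "(real \<Rightarrow> real) \<Rightarrow> (real \<Rightarrow> real)"
  assumes "wiener_measure \<mu>"
    and "unitary_CM R"
    and "resolution_of_identity R E"
    and "orthonormal_basis_CM e"
    and "measure_preserving_map \<mu> T"
    and "is_wiener_series \<mu> R e T"
  shows "(ergodic_map \<mu> T \<longleftrightarrow>
            (\<forall>h\<in>CM. \<forall>k\<in>CM. continuous_on {0..2*pi}
               (\<lambda>\<theta>. cm_cinner (E \<theta> (\<lambda>t. complex_of_real (h t))) (\<lambda>t. complex_of_real (k t)))))
         \<and> (ergodic_map \<mu> T \<longrightarrow> weak_mixing_map \<mu> T)"
proof -
  from assms(6)[unfolded is_wiener_series_def] obtain D where D: "(\<forall>i. is_delta \<mu> (R (e i)) (D i)) \<and>
    (AE w in \<mu>. uniform_limit {0..1} (\<lambda>n t. \<Sum>i<n. D i w * e i t) (T w) sequentially)" by (rule exE)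
  interpret prob_space \<mu> using assms(1) by (simp add: wiener_measure_def)
  interpret wiener_rotation \<mu> R e T D
    by unfold_locales (use assms D in simp_all)
  interpret spectral_resolution R E
    by unfold_locales (fact assms(2) assms(3))+
  let ?cont = "\<forall>h\<in>CM. \<forall>k\<in>CM. continuous_on {0..2*pi}
      (\<lambda>\<theta>. cm_cinner (E \<theta> (\<lambda>t. complex_of_real (h t))) (\<lambda>t. complex_of_real (k t)))"
  \<comment> \<open>All claims turn on the absence of atoms, which is equivalent to continuity,
    follows from ergodicity and implies weak mixing; weak mixing in turn implies ergodicity.\<close>
  let ?atomless = "\<forall>h\<in>CM. \<forall>\<theta>. measure (spectral_measure h) {\<theta>} = 0"
  have mix: "weak_mixing_map \<mu> T" if a: ?atomless
  proof (rule weak_mixing_if_decorrelated)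
    fix h assume h: "h \<in> CM"
    interpret S: finite_borel_measure "spectral_measure h" by (rule spectral_measure_finite[OF h])
    show "(\<lambda>N. (\<Sum>n<N. \<Sum>m<N. \<bar>cm_inner ((R ^^ n) h) ((R ^^ m) h)\<bar>) / (real N)\<^sup>2) \<longlonglongrightarrow> 0"
      by (rule double_mean_abs_tendsto[OF S.Wiener_double_mean[OF inner_funpow_spectral[OF h] a[rule_format, OF h]]])
  qed
  have erg_atomless: ?atomless if "ergodic_map \<mu> T"
  proof (intro ballI allI, rule ccontr)
    fix h \<theta> assume h: "h \<in> CM" and "measure (spectral_measure h) {\<theta>} \<noteq> 0"
    from not_ergodic_if_atom[OF h spectral_measure_finite[OF h] inner_funpow_spectral[OF h] spectral_measure_AE[OF h] this(2)]
      that show False by (rule notE)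
  qed
  have atomless_cont: ?cont if a: ?atomless
    by (intro ballI continuous_if_atomless a[rule_format])
  have cont_atomless: ?atomless if c: ?cont
    using c by (intro ballI allI) (rule atomless_if_continuous, simp_all)
  show ?thesis
  proof (intro conjI iffI impI)
    show ?cont if "ergodic_map \<mu> T" using that by (intro atomless_cont erg_atomless)
    show "ergodic_map \<mu> T" if ?cont using that by (intro ergodic_if_weak_mixing mix cont_atomless)
    show "weak_mixing_map \<mu> T" if "ergodic_map \<mu> T" using that by (intro mix erg_atomless)
  qed
qed

end
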